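(* Let ${\sf Z}\subset \mathbb{C}$ and ${\sf W}\subset \mathbb{C}_{\rm rh}:=\{z\in\mathbb{C}\colon \operatorname{Re} z>0\}$ be distributions of points, both of finite upper density and both asymptotically separated by angles from the imaginary axis $i\mathbb{R}$. Then the following three statements are equivalent: I. For every function $g\in I^1_*({\sf W})$ there exists a function $f\in I^1_*({\sf Z})$ such that $$|f(iy)|\le |g(iy)|\quad\text{for all } y\in\mathbb{R}.$$ II. There exist $f\in I^1_*({\sf Z})$ and $g\in I^1_*({\sf W})$ with $\mathsf{Zero}_g\cap \mathbb{C}_{\rm rh}={\sf W}$ (equality of distributions of points, i.e. counting multiplicities) such that $|f(iy)|\le |g(iy)|$ for all $y\in\mathbb{R}$. III. There exists a real number $C\ge 0$ such that $$l_{\sf Z}(r,R)\le l_{\sf W}(r,R)+C\quad\text{for all } 0<r<R<+\infty .$$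
   Context: Distributions of points. A distribution of points ${\sf Z}=\{{\sf z}_j\}$ is an at most countable indexed family of points ${\sf z}_j\in\mathbb{C}$ (repetitions allowed, i.e. a multiset). Its counting function is $n_{\sf Z}(z)=\#\{j\colon {\sf z}_j=z\}$ for $z\in\mathbb{C}$. Two distributions are equal if their counting functions coincide; ${\sf Z}\subset{\sf Z}'$ means $n_{\sf Z}\le n_{{\sf Z}'}$ pointwise. For a set $S\subset\mathbb{C}$, ${\sf Z}\subset S$ means that all points ${\sf z}_j$ lie in $S$, and ${\sf Z}\cap S$ is the distribution of those points of ${\sf Z}$ (with multiplicity) that lie in $S$. Finite upper density. ${\sf Z}$ is of finite upper density if $\limsup_{r\to+\infty}\frac{1}{r}\,\#\{j\colon |{\sf z}_j|\le r\}<+\infty$. Asymptotic separation. ${\sf Z}=\{{\sf z}_j\}$ is asymptotically separated by angles from $i\mathbb{R}$ if $\liminf_{j\to\infty}\frac{|\operatorname{Re}{\sf z}_j|}{|{\sf z}_j|}>0$ (equivalently, $\limsup_{j\to\infty}\frac{|\operatorname{Im}{\sf z}_j|}{|{\sf z}_j|}<1$). Geometrically: there is a pair of nonempty open vertical angles containing $i\mathbb{R}\setminus\{0\}$ such that all points ${\sf z}_j$, except for finitely many indices $j$, lie outside this pair of angles. (A finite distribution satisfies this trivially.) Logarithmic characteristics. Let $\mathbb{C}_{\rm lh}:=-\mathbb{C}_{\rm rh}=\{z\colon\operatorname{Re}z<0\}$. For $0<r\le+\infty$ put $$l^{\rm rh}_{\sf Z}(r):=\sum_{0<|{\sf z}_k|\le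 r,\ {\sf z}_k\in\mathbb{C}_{\rm rh}}\operatorname{Re}\frac1{{\sf z}_k},\qquad l^{\rm lh}_{\sf Z}(r):=\sum_{0<|{\sf z}_k|\le r,\ {\sf z}_k\in\mathbb{C}_{\rm lh}}\Bigl(-\operatorname{Re}\frac1{{\sf z}_k}\Bigr),$$ and for $0<r<R<+\infty$ put $l^{\rm rh}_{\sf Z}(r,R):=l^{\rm rh}_{\sf Z}(R)-l^{\rm rh}_{\sf Z}(r)$, $l^{\rm lh}_{\sf Z}(r,R):=l^{\rm lh}_{\sf Z}(R)-l^{\rm lh}_{\sf Z}(r)$, and $$l_{\sf Z}(r,R):=\max\{l^{\rm lh}_{\sf Z}(r,R),\,l^{\rm rh}_{\sf Z}(r,R)\},$$ with $l_{\varnothing}(r,R)\equiv0$. Entire functions of exponential type. A nonzero entire function $f$ (that is, $f\not\equiv0$) is of exponential type if $\limsup_{z\to\infty}\frac{\ln|f(z)|}{|z|}<+\infty$. For an entire function $f\not\equiv0$, $\mathsf{Zero}_f$ denotes the distribution of all its zeros, with $n_{\mathsf{Zero}_f}(z)$ equal to the multiplicity of the zero of $f$ at $z$. Such an $f$ vanishes on ${\sf Z}$, written $f({\sf Z})=0$, if ${\sf Z}\subset\mathsf{Zero}_f$ (with multiplicities). Finally, $I^1_*({\sf Z})$ denotes the set of all entire functions $f\not\equiv0$ of exponential type with $f({\sf Z})=0$. *)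

theory Defs
  imports "HOL-Complex_Analysis.Complex_Analysis"
begin

(* An at most countable indexed family of points, possibly finite or empty, with repetitions
   allowed: the points are point Z j for j in index_set Z; values outside index_set Z are
   irrelevant. *)
record distribution =
  index_set :: "nat set"
  point :: "nat \<Rightarrow> complex"

definition ext_card :: "'a set \<Rightarrow> enat" where
  "ext_card A = (if finite A then enat (card A) else \<infinity>)"

definition count_dist :: "distribution \<Rightarrow> complex \<Rightarrow> enat" where
  "count_dist Z z = ext_card {j \<in> index_set Z. point Z j = z}"

definition points_in :: "distribution \<Rightarrow> complex set \<Rightarrow> bool" where
  "points_in Z S \<longleftrightarrow> (\<forall>j \<in> index_set Z. point Z j \<in> S)"

(* Zero sets are represented by their counting functions; this is the counting function of the
   part of a distribution that lies in S. *)
definition restrict_count :: "(complex \<Rightarrow> enat) \<Rightarrow> complex set \<Rightarrow> complex \<Rightarrow> enat" where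
  "restrict_count n S z = (if z \<in> S then n z else 0)"

definition right_half_plane :: "complex set" where
  "right_half_plane = {z. Re z > 0}"

definition left_half_plane :: "complex set" where
  "left_half_plane = {z. Re z < 0}"

definition finite_upper_density :: "distribution \<Rightarrow> bool" where
  "finite_upper_density Z \<longleftrightarrow>
     Limsup at_top (\<lambda>r::real.
       ereal (1 / r) * ereal_of_enat (ext_card {j \<in> index_set Z. norm (point Z j) \<le> r})) < \<infinity>"

(* The filter is j tending to infinity within the index set. For a finite index set it is bot, so
   the lower limit is \<infinity>. A point at 0 contributes the quotient 0 / 0 = 0; for finite upper
   density there are only finitely many of these, so they do not affect the lower limit. *)
definition asymp_separated_imag :: "distribution \<Rightarrow> bool" where
  "asymp_separated_imag Z \<longleftrightarrow>
     Liminf (inf sequentially (principal (index_set Z)))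
       (\<lambda>j. ereal (\<bar>Re (point Z j)\<bar> / norm (point Z j))) > 0"

(* For a distribution of finite upper density the index sets of these sums are finite. *)
definition l_rh :: "distribution \<Rightarrow> real \<Rightarrow> real" where
  "l_rh Z r =
     (\<Sum>k | k \<in> index_set Z \<and> 0 < norm (point Z k) \<and> norm (point Z k) \<le> r
            \<and> point Z k \<in> right_half_plane. Re (1 / point Z k))"

definition l_lh :: "distribution \<Rightarrow> real \<Rightarrow> real" where
  "l_lh Z r =
     (\<Sum>k | k \<in> index_set Z \<and> 0 < norm (point Z k) \<and> norm (point Z k) \<le> r
            \<and> point Z k \<in> left_half_plane. - Re (1 / point Z k))"

definition l_char :: "distribution \<Rightarrow> real \<Rightarrow> real \<Rightarrow> real" where
  "l_char Z r R = max (l_lh Z R - l_lh Z r) (l_rh Z R - l_rh Z r)"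

(* The case distinction gives ln 0 = -\<infinity>, whereas ln (0::real) = 0. *)
definition exponential_type :: "(complex \<Rightarrow> complex) \<Rightarrow> bool" where
  "exponential_type f \<longleftrightarrow>
     Limsup at_infinity
       (\<lambda>z. if f z = 0 then - \<infinity> else ereal (ln (norm (f z)) / norm z)) < \<infinity>"

(* Meant for entire f that do not vanish identically. *)
definition zero_count :: "(complex \<Rightarrow> complex) \<Rightarrow> complex \<Rightarrow> enat" where
  "zero_count f z = (if f z = 0 then enat (nat (zorder f z)) else 0)"

definition I1 :: "distribution \<Rightarrow> (complex \<Rightarrow> complex) set" where
  "I1 Z = {f. f holomorphic_on UNIV \<and> (\<exists>z. f z \<noteq> 0) \<and> exponential_type f
              \<and> (\<forall>z. count_dist Z z \<le> zero_count f z)}"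

end

(*
  Comparison (II implies III): if |f| <= |g| on the imaginary axis, divide f and g by half-disc Blaschke
  products over their zeros in the right half-plane. The quotient is bounded by exp(O(Re z)) on half-discs of
  suitable ("good") radius; evaluated at a good point x of the positive axis, where the Blaschke factors are
  comparable with exp(-x Re(1/z_j)), this bounds the logarithmic sum over the zeros of f by that of g.

  Construction (III implies I): applied to g and to its mirror image, the comparison shows that in both half-planes
  the zeros of g dominate W, hence Z, in the sense of logarithmic sums. A greedy choice gives a subfamily A of the
  zeros of g whose logarithmic sums agree with those of Z up to O(1). The balayage of A minus that of Z onto the
  axis has a density which is bounded below - this uses the separation of Z from the axis - so a large multiple
  of Lebesgue measure can be added, and the sum discretized into unit masses i s_k. The product over Z and the
  points i s_k, divided by the product over A, is exp(linear) up to a power of |z| beyond the axis, and the power is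
  removed by deleting finitely many of the s_k. Replacing the factor of g that vanishes on A by this product gives f.
*)
theory Submission
  imports Defs "HOL-Real_Asymp.Real_Asymp"
begin

text \<open>The two families enter asymmetrically, and this shapes the construction. A pole a
  contributes to the density at i s at least Re a / (|a| + |s|)^2, because |a - i s| <= |a| + |s|,
  however close a is to the axis. The points b of Z carry the opposite sign, so |b - i s| must be
  bounded below by a multiple of |b| + |s|; this is separation. All points are translated by 1 away
  from the axis. The line on which f and g are compared becomes Re w = -1, while the new zeros i s_k
  sit on Re w = 0 and keep distance 1 from it; without this distance the deletion of some of them
  would gain nothing near the others. The phase of the density is only known to grow at most like
  |s|^(5/4), too fast for the Poisson integral of its discretization error to be used directly.
  Hence the third derivative of the logarithm is compared, where the kernel is 1 / (z + i s)^3.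
  Discretization costs its total variation, O((Re z)^-3); three integrations turn this into a linear
  function plus O(ln |z|), which is the origin of the stray power of |z|.\<close>

abbreviation (input) axis :: "real \<Rightarrow> complex" where "axis y \<equiv> \<i> * of_real y"

abbreviation (input) cnj_fam :: "(nat \<Rightarrow> complex) \<Rightarrow> nat \<Rightarrow> complex" where "cnj_fam a \<equiv> \<lambda>n. cnj (a n)"

section \<open>Orders of vanishing and entire quotients\<close>

text \<open>Order at least m, encoded as divisibility by a power in the ring of entire functions.
  This form is additive under products by pure algebra, passes to smaller m, and makes sense for f =
  0 as well.\<close>

definition vanishes :: "(complex \<Rightarrow> complex) \<Rightarrow> complex \<Rightarrow> nat \<Rightarrow> bool" where
  "vanishes f z m \<longleftrightarrow> (\<exists>q. q holomorphic_on UNIV \<and> (\<forall>w. f w = (w - z) ^ m * q w))"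

text \<open>\<open>zor_poly\<close> gives the factorization only near z. Away from z the cofactor is
  \<open>f w / (w - z) ^ m\<close>; the two agree on the overlap, so gluing yields an entire
  cofactor.\<close>

lemma entire_factor_at:
  assumes f: "f holomorphic_on UNIV" and nz: "f w0 \<noteq> 0"
  obtains m q where "q holomorphic_on UNIV" "q z \<noteq> 0" "\<And>w. f w = (w - z) ^ m * q w"
proof (cases "f z = 0")
  case False
  then show ?thesis using that[of f 0] f by auto
next
  case True
  have "\<exists>w\<in>UNIV. f w \<noteq> 0" using nz by auto
  then obtain r where r: "zorder f z > 0" "r > 0" "zor_poly f z holomorphic_on cball z r"
    "\<And>w. w \<in> cball z r \<Longrightarrow> f w = zor_poly f z w * (w - z) ^ nat (zorder f z) \<and> zor_poly f z w \<noteq> 0"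
    using zorder_exist_zero[of f UNIV z] f True connected_UNIV[where 'a=complex] by (auto simp: subset_UNIV)
  define m where "m = nat (zorder f z)"
  define q where "q w = (if w = z then zor_poly f z z else f w / (w - z) ^ m)" for w
  have qg: "q w = zor_poly f z w" if "w \<in> cball z r" for w
    using r(4)[OF that] by (auto simp: q_def m_def)
  have h1: "q holomorphic_on ball z r"
    using r(3) by (subst holomorphic_cong[OF refl qg]) (auto intro: holomorphic_on_subset)
  have h2: "q holomorphic_on UNIV - {z}"
  proof (subst holomorphic_cong[OF refl])
    show "(\<lambda>w. f w / (w - z) ^ m) holomorphic_on UNIV - {z}"
      by (intro holomorphic_intros holomorphic_on_subset[OF f]) auto
  qed (auto simp: q_def)
  have "q holomorphic_on ball z r \<union> (UNIV - {z})"
    using h1 h2 by (intro holomorphic_on_Un) auto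
  also have "ball z r \<union> (UNIV - {z}) = UNIV" using r by auto
  finally have "q holomorphic_on UNIV" .
  moreover have "q z \<noteq> 0" using r(4)[of z] r(2) by (auto simp: q_def)
  moreover have "f w = (w - z) ^ m * q w" for w
    using r(1) r(2) qg[of z] r(4)[of z] True by (cases "w = z") (auto simp: q_def m_def)
  ultimately show ?thesis using that by blast
qed

lemma zero_count_factor:
  assumes q: "q holomorphic_on UNIV" "q z \<noteq> 0" "\<And>w. f w = (w - z) ^ m * q w"
  shows "zero_count f z = enat m"
proof (cases "m = 0")
  case True
  then show ?thesis using q by (simp add: zero_count_def zero_enat_def)
next
  case False
  have "zorder f z = int m"
    by (rule zorder_eqI[of UNIV _ q]) (use q in \<open>auto simp: mult.commute\<close>)
  then show ?thesis using q False by (simp add: zero_count_def)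
qed

lemma vanishes_iff:
  assumes f: "f holomorphic_on UNIV" and nz: "f w0 \<noteq> 0"
  shows "vanishes f z m \<longleftrightarrow> enat m \<le> zero_count f z"
proof
  assume "vanishes f z m"
  then obtain q where q: "q holomorphic_on UNIV" "\<And>w. f w = (w - z) ^ m * q w"
    by (auto simp: vanishes_def)
  have "q w0 \<noteq> 0" using nz q by auto
  from entire_factor_at[OF q(1) this, of z] obtain k r where
    r: "r holomorphic_on UNIV" "r z \<noteq> 0" "\<And>w. q w = (w - z) ^ k * r w" by blast
  have "zero_count f z = enat (m + k)"
    by (rule zero_count_factor[OF r(1,2)]) (simp add: q r power_add)
  then show "enat m \<le> zero_count f z" by simp
next
  assume *: "enat m \<le> zero_count f z"
  from entire_factor_at[OF f nz, of z] obtain k r where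
    r: "r holomorphic_on UNIV" "r z \<noteq> 0" "\<And>w. f w = (w - z) ^ k * r w" by blast
  have "zero_count f z = enat k" by (rule zero_count_factor[OF r])
  with * have "m \<le> k" by simp
  then have "f w = (w - z) ^ m * ((w - z) ^ (k - m) * r w)" for w
    by (simp add: r(3) mult.assoc[symmetric] power_add[symmetric])
  moreover have "(\<lambda>w. (w - z) ^ (k - m) * r w) holomorphic_on UNIV"
    by (intro holomorphic_intros r)
  ultimately show "vanishes f z m" unfolding vanishes_def by (intro exI conjI allI)
qed

lemma vanishes_mono:
  assumes "vanishes f z m" "k \<le> m"
  shows "vanishes f z k"
proof -
  obtain q where q: "q holomorphic_on UNIV" "\<And>w. f w = (w - z) ^ m * q w"
    using assms by (auto simp: vanishes_def)
  have "f w = (w - z) ^ k * ((w - z) ^ (m - k) * q w)" for w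
    using assms(2) by (simp add: q(2) mult.assoc[symmetric] power_add[symmetric])
  moreover have "(\<lambda>w. (w - z) ^ (m - k) * q w) holomorphic_on UNIV"
    by (intro holomorphic_intros q)
  ultimately show ?thesis unfolding vanishes_def by (intro exI conjI allI)
qed

lemma vanishes_mult:
  assumes "vanishes f z m" "vanishes g z k"
  shows "vanishes (\<lambda>w. f w * g w) z (m + k)"
proof -
  obtain p q where "p holomorphic_on UNIV" "\<And>w. f w = (w - z) ^ m * p w"
     "q holomorphic_on UNIV" "\<And>w. g w = (w - z) ^ k * q w"
    using assms unfolding vanishes_def by blast
  then show ?thesis unfolding vanishes_def
    by (intro exI[of _ "\<lambda>w. p w * q w"]) (auto intro!: holomorphic_intros simp: power_add)
qed

lemma vanishes_0: "f holomorphic_on UNIV \<Longrightarrow> vanishes f z 0"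
  by (auto simp: vanishes_def)

lemma vanishes_1_iff:
  assumes "f holomorphic_on UNIV"
  shows "vanishes f z 1 \<longleftrightarrow> f z = 0"
proof
  assume "f z = 0"
  show "vanishes f z 1"
  proof (cases "\<exists>w0. f w0 \<noteq> 0")
    case True
    then obtain w0 where w0: "f w0 \<noteq> 0" by auto
    from entire_factor_at[OF assms this, of z] obtain k r where
      r: "r holomorphic_on UNIV" "r z \<noteq> 0" "\<And>w. f w = (w - z) ^ k * r w" by blast
    with \<open>f z = 0\<close> have "k \<noteq> 0" by (cases k) auto
    then show ?thesis using zero_count_factor[OF r] vanishes_iff[OF assms w0] by simp
  next
    case False
    then show ?thesis by (auto simp: vanishes_def intro!: exI[of _ "\<lambda>_. 0"])
  qed
qed (auto simp: vanishes_def)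

text \<open>At each point the orders allow the common power of w - z to be cancelled, so the
  quotient has a finite limit there and all its singularities are removable.\<close>

lemma entire_divide:
  assumes g: "g holomorphic_on UNIV" and P: "P holomorphic_on UNIV" and nz: "P w0 \<noteq> 0"
    and le: "\<And>z m. vanishes P z m \<Longrightarrow> vanishes g z m"
  obtains q where "q holomorphic_on UNIV" "\<And>z. g z = P z * q z"
proof -
  define h where "h = (\<lambda>w. g w / P w)"
  have an: "remove_sings h analytic_on {z}" for z
  proof -
    from entire_factor_at[OF P nz, of z] obtain m p where
      p: "p holomorphic_on UNIV" "p z \<noteq> 0" "\<And>w. P w = (w - z) ^ m * p w" by blast
    have "vanishes P z m" unfolding vanishes_def using p by auto
    from le[OF this] obtain r where r: "r holomorphic_on UNIV" "\<And>w. g w = (w - z) ^ m * r w"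
      unfolding vanishes_def by auto
    have "continuous (at z) p"
      using holomorphic_on_imp_continuous_on[OF p(1)] continuous_on_eq_continuous_at by blast
    then obtain e where e: "e > 0" "\<And>w. dist w z < e \<Longrightarrow> p w \<noteq> 0"
      using continuous_at_avoid[of z p 0] p(2) by (metis dist_commute)
    have hw: "h w = r w / p w" if "w \<in> ball z e - {z}" for w
      using that e(2)[of w] by (auto simp: h_def p r dist_commute)
    have hol: "(\<lambda>w. r w / p w) holomorphic_on ball z e"
      using e by (intro holomorphic_intros holomorphic_on_subset[OF r(1)] holomorphic_on_subset[OF p(1)])
        (auto simp: dist_commute)
    have "h holomorphic_on ball z e - {z}"
      by (subst holomorphic_cong[OF refl hw]) (auto intro: holomorphic_on_subset[OF hol])
    then have "h analytic_on ball z e - {z}"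
      by (simp add: analytic_on_open open_delete)
    then have iso: "isolated_singularity_at h z"
      using e unfolding isolated_singularity_at_def by auto
    have "isCont (\<lambda>w. r w / p w) z"
      using hol e by (metis centre_in_ball continuous_on_eq_continuous_at holomorphic_on_imp_continuous_on open_ball)
    then have "(\<lambda>w. r w / p w) \<midarrow>z\<rightarrow> r z / p z" by (simp add: isCont_def)
    then have "h \<midarrow>z\<rightarrow> r z / p z"
      by (rule Lim_transform_within_open[where s = "ball z e"]) (use e hw in auto)
    then show ?thesis using iso remove_sings_analytic_at by blast
  qed
  then have hol: "remove_sings h holomorphic_on UNIV"
    by (meson analytic_imp_holomorphic analytic_on_analytic_at)
  moreover have "g z = P z * remove_sings h z" for z
  proof (cases "P z = 0")
    case True
    then have "vanishes P z 1" using P vanishes_1_iff by simp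
    from le[OF this] have "g z = 0" using g vanishes_1_iff by simp
    then show ?thesis using True by simp
  next
    case False
    have "open {w. P w \<noteq> 0}"
      using P by (intro open_Collect_neq) (auto simp: holomorphic_on_imp_continuous_on)
    moreover have "h holomorphic_on {w. P w \<noteq> 0}" unfolding h_def
      by (intro holomorphic_intros holomorphic_on_subset[OF P] holomorphic_on_subset[OF g]) auto
    ultimately have "h analytic_on {z}" using False analytic_at by blast
    then have "remove_sings h z = h z" by simp
    then show ?thesis using False by (simp add: h_def)
  qed
  ultimately show ?thesis using that by blast
qed

lemma vanishes_prod_iff:
  assumes "finite F"
  shows "vanishes (\<lambda>w. \<Prod>n\<in>F. w - a n) z m \<longleftrightarrow> m \<le> card {n\<in>F. a n = z}"
proof -
  let ?P = "\<lambda>w. \<Prod>n\<in>F. w - a n" and ?A = "{n\<in>F. a n = z}"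
  have eq: "?P w = (w - z) ^ card ?A * (\<Prod>n\<in>F - ?A. w - a n)" for w
  proof -
    have "?P w = (\<Prod>n\<in>?A. w - a n) * (\<Prod>n\<in>F - ?A. w - a n)"
      using assms by (metis (no_types, lifting) mem_Collect_eq mult.commute prod.subset_diff subsetI)
    also have "(\<Prod>n\<in>?A. w - a n) = (\<Prod>n\<in>?A. w - z)" by (rule prod.cong) auto
    finally show ?thesis by simp
  qed
  have nz: "(\<Prod>n\<in>F - ?A. z - a n) \<noteq> 0" using assms by auto
  have zc: "zero_count ?P z = enat (card ?A)"
    by (rule zero_count_factor[OF _ nz eq]) (intro holomorphic_intros)
  have "infinite (UNIV :: complex set)" using infinite_UNIV_char_0 by blast
  then obtain w0 where "w0 \<notin> a ` F" using assms
    by (metis UNIV_I finite_imageI finite_subset subsetI)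
  then have "?P w0 \<noteq> 0" using assms by auto
  then show ?thesis by (subst vanishes_iff[of _ w0]) (auto intro!: holomorphic_intros simp: zc)
qed

lemma entire_divide_finite:
  assumes f: "f holomorphic_on UNIV" and F: "finite F"
    and le: "\<And>z. vanishes f z (card {n\<in>F. a n = z})"
  obtains q where "q holomorphic_on UNIV" "\<And>z. f z = (\<Prod>n\<in>F. z - a n) * q z"
proof -
  have "infinite (UNIV :: complex set)" using infinite_UNIV_char_0 by blast
  then obtain w0 where "w0 \<notin> a ` F" using F
    by (metis UNIV_I finite_imageI finite_subset subsetI)
  then have w0: "(\<Prod>n\<in>F. w0 - a n) \<noteq> 0" using F by auto
  show ?thesis
  proof (rule entire_divide[of f "\<lambda>z. \<Prod>n\<in>F. z - a n" w0])
    show "(\<lambda>z. \<Prod>n\<in>F. z - a n) holomorphic_on UNIV" by (intro holomorphic_intros)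
    show "f holomorphic_on UNIV" "(\<Prod>n\<in>F. w0 - a n) \<noteq> 0" by fact+
    show "vanishes f z m" if "vanishes (\<lambda>z. \<Prod>n\<in>F. z - a n) z m" for z m
      using that vanishes_prod_iff[OF F] le vanishes_mono by blast
  qed (use that in blast)
qed

text \<open>A zero of the cofactor would raise the order of f by one beyond the multiplicity already
  divided out. Zero-freeness in discs and half-discs is obtained in this way once the zeros there
  have been removed.\<close>

lemma quotient_nonzero:
  assumes F: "finite F" and q: "q holomorphic_on UNIV" "\<And>w. f w = (\<Prod>n\<in>F. w - a n) * q w"
    and ex: "\<not> vanishes f z (Suc (card {n\<in>F. a n = z}))"
  shows "q z \<noteq> 0"
proof
  assume "q z = 0"
  then have "vanishes q z 1" using vanishes_1_iff q by simp
  moreover have "vanishes (\<lambda>w. \<Prod>n\<in>F. w - a n) z (card {n\<in>F. a n = z})"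
    using vanishes_prod_iff[OF F] by simp
  ultimately have "vanishes (\<lambda>w. (\<Prod>n\<in>F. w - a n) * q w) z (card {n\<in>F. a n = z} + 1)"
    by (intro vanishes_mult)
  moreover have "(\<lambda>w. (\<Prod>n\<in>F. w - a n) * q w) = f" using q by auto
  ultimately show False using ex by simp
qed

text \<open>The zeros of a nonzero entire function are countable, so the pairs of a zero and a copy
  number below its multiplicity can be numbered by naturals; the first component is then the
  family.\<close>

lemma zero_family_exists:
  assumes f: "f holomorphic_on UNIV" and nz: "f w0 \<noteq> 0"
  obtains I :: "nat set" and a where "\<And>n. n \<in> I \<Longrightarrow> a n \<in> S"
    "\<And>z. z \<in> S \<Longrightarrow> finite {n\<in>I. a n = z} \<and> zero_count f z = enat (card {n\<in>I. a n = z})"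
proof -
  define X where "X = {(z,i::nat). z \<in> S \<and> f z = 0 \<and> enat i < zero_count f z}"
  have "countable {z. f z = 0}"
  proof (cases "\<exists>z. f z = 0")
    case True
    then have "\<not> f constant_on UNIV" using nz unfolding constant_on_def by (metis UNIV_I)
    then show ?thesis using holomorphic_countable_zeros[of f UNIV] f connected_UNIV[where 'a=complex] by auto
  qed simp
  then have "countable ({z. f z = 0} \<times> (UNIV::nat set))" by auto
  then have X: "countable X" by (rule countable_subset[rotated]) (auto simp: X_def)
  define e where "e = to_nat_on X"
  have inj: "inj_on e X" unfolding e_def using X by (rule inj_on_to_nat_on)
  define a where "a n = fst (from_nat_into X n)" for n
  have ae: "a (e x) = fst x" if "x \<in> X" for x
    using that X by (simp add: a_def e_def)
  show ?thesis
  proof (rule that[of "e ` X" a])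
    show "a n \<in> S" if "n \<in> e ` X" for n using that ae by (auto simp: X_def)
    fix z assume z: "z \<in> S"
    from entire_factor_at[OF f nz, of z] obtain k r where
      r: "r holomorphic_on UNIV" "r z \<noteq> 0" "\<And>w. f w = (w - z) ^ k * r w" by blast
    have k: "zero_count f z = enat k" by (rule zero_count_factor[OF r])
    have fz: "f z = 0" if "k > 0" using r(3)[of z] that by auto
    have "{n \<in> e ` X. a n = z} = e ` (Pair z ` {..<k})"
    proof -
      have "{x\<in>X. fst x = z} = Pair z ` {..<k}"
        using z k fz by (auto simp: X_def)
      moreover have "{n \<in> e ` X. a n = z} = e ` {x\<in>X. fst x = z}" using ae by auto
      ultimately show ?thesis by simp
    qed
    moreover have "card (e ` (Pair z ` {..<k})) = k"
    proof -
      have "Pair z ` {..<k} \<subseteq> X" using z k fz by (auto simp: X_def)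
      then have "inj_on e (Pair z ` {..<k})" using inj inj_on_subset by blast
      then show ?thesis by (simp add: card_image inj_on_def)
    qed
    ultimately show "finite {n \<in> e ` X. a n = z} \<and> zero_count f z = enat (card {n \<in> e ` X. a n = z})"
      using k by simp
  qed
qed

section \<open>Exponential type as a bound in the whole plane\<close>

lemma exponential_type_bound:
  assumes f: "f holomorphic_on UNIV" and "exponential_type f"
  obtains K where "K \<ge> 0" "\<And>z. norm (f z) \<le> exp (K * (1 + norm z))"
proof -
  obtain L where L: "Limsup at_infinity
       (\<lambda>z. if f z = 0 then - \<infinity> else ereal (ln (norm (f z)) / norm z)) < ereal L"
    using assms(2) unfolding exponential_type_def by (meson ereal_dense2)
  have "\<forall>\<^sub>F z in at_infinity. (if f z = 0 then - \<infinity> else ereal (ln (norm (f z)) / norm z)) < ereal L"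
    using Limsup_lessD[OF L] by simp
  then obtain b where b: "\<And>z. b \<le> norm z \<Longrightarrow> (if f z = 0 then - \<infinity> else ereal (ln (norm (f z)) / norm z)) < ereal L"
    unfolding eventually_at_infinity by auto
  have "compact (f ` cball 0 (max b 1))"
    using f by (intro compact_continuous_image) (auto intro: holomorphic_on_imp_continuous_on holomorphic_on_subset)
  then obtain M where M: "M > 0" "\<And>z. norm z \<le> max b 1 \<Longrightarrow> norm (f z) \<le> M"
    by (metis bounded_pos compact_imp_bounded imageI mem_cball_0)
  define K where "K = max \<bar>L\<bar> (\<bar>ln M\<bar>)"
  show ?thesis
  proof (rule that[of K])
    show "K \<ge> 0" by (simp add: K_def)
    fix z
    show "norm (f z) \<le> exp (K * (1 + norm z))"
    proof (cases "norm z \<le> max b 1")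
      case True
      have "norm (f z) \<le> exp (ln M)" using M True by simp
      also have "\<dots> \<le> exp (K * (1 + norm z))"
      proof -
        have "ln M \<le> K * 1" by (simp add: K_def)
        also have "\<dots> \<le> K * (1 + norm z)" by (intro mult_left_mono) (auto simp: K_def)
        finally show ?thesis by simp
      qed
      finally show ?thesis .
    next
      case False
      then have z: "norm z > b" "norm z > 1" by auto
      show ?thesis
      proof (cases "f z = 0")
        case False
        have "ln (norm (f z)) / norm z < L" using b[of z] z False by (auto split: if_splits)
        then have "ln (norm (f z)) < L * norm z" using z
          by (subst (asm) pos_divide_less_eq) auto
        also have "\<dots> \<le> K * norm z" by (intro mult_right_mono) (auto simp: K_def)
        also have "\<dots> \<le> K * (1 + norm z)" by (intro mult_left_mono) (auto simp: K_def)
        finally have "exp (ln (norm (f z))) \<le> exp (K * (1 + norm z))" by simp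
        then show ?thesis using False by simp
      qed simp
    qed
  qed
qed

lemma exponential_typeI:
  assumes "\<And>z. norm (f z) \<le> exp (K * (1 + norm z))" and "K \<ge> 0"
  shows "exponential_type f"
proof -
  have "\<forall>\<^sub>F z in at_infinity. (if f z = 0 then - \<infinity> else ereal (ln (norm (f z)) / norm z)) \<le> ereal (2 * K)"
    unfolding eventually_at_infinity
  proof (intro exI[of _ 1] allI impI)
    fix z :: complex assume z: "1 \<le> norm z"
    show "(if f z = 0 then - \<infinity> else ereal (ln (norm (f z)) / norm z)) \<le> ereal (2 * K)"
    proof (cases "f z = 0")
      case False
      then have "ln (norm (f z)) \<le> K * (1 + norm z)" using assms(1)[of z]
        by (metis ln_exp ln_le_cancel_iff exp_gt_zero zero_less_norm_iff)
      also have "\<dots> \<le> K * (2 * norm z)" using z assms by (intro mult_left_mono) auto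
      finally have "ln (norm (f z)) / norm z \<le> 2 * K" using z by (subst pos_divide_le_eq) auto
      then show ?thesis using False by simp
    qed simp
  qed
  then have "Limsup at_infinity (\<lambda>z. if f z = 0 then - \<infinity> else ereal (ln (norm (f z)) / norm z)) \<le> ereal (2 * K)"
    by (rule Limsup_bounded)
  then show ?thesis unfolding exponential_type_def using le_less_trans less_ereal.simps(4) by blast
qed

section \<open>Families of finite density and logarithmic sums\<close>

definition near :: "nat set \<Rightarrow> (nat \<Rightarrow> complex) \<Rightarrow> real \<Rightarrow> nat set" where
  "near I a t = {n\<in>I. norm (a n) \<le> t}"

text \<open>The bound by \<open>1 + t\<close> rather than t admits finitely many points at or near 0
  and keeps one constant valid down to t = 0.\<close>

definition fin_dens :: "nat set \<Rightarrow> (nat \<Rightarrow> complex) \<Rightarrow> bool" where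
  "fin_dens I a \<longleftrightarrow> (\<exists>K\<ge>0. \<forall>t\<ge>0. finite (near I a t) \<and> real (card (near I a t)) \<le> K * (1 + t))"

text \<open>The positive part lets a sum over a whole family count only its points in the open right
  half-plane; the other half-plane is reached by negating or reflecting the points. The point 0
  contributes 0, since \<open>1 / 0 = 0\<close>.\<close>

definition pos_recip :: "complex \<Rightarrow> real" where
  "pos_recip z = max 0 (Re (1 / z))"

definition lsum :: "nat set \<Rightarrow> (nat \<Rightarrow> complex) \<Rightarrow> real \<Rightarrow> real" where
  "lsum I a t = (\<Sum>n\<in>near I a t. pos_recip (a n))"

lemma Re_inverse_complex: "Re (1 / z) = Re z / (norm z)\<^sup>2"
  by (cases "z = 0") (auto simp: Re_divide cmod_power2)

lemma pos_recip_bounds: "0 \<le> pos_recip z" "pos_recip z \<le> 1 / norm z"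
  using abs_Re_le_cmod[of "1 / z"] by (auto simp: pos_recip_def norm_divide)

lemma pos_recip_eq_0: "Re z \<le> 0 \<Longrightarrow> pos_recip z = 0"
  using divide_nonpos_nonneg[of "Re z" "(norm z)\<^sup>2"] unfolding pos_recip_def Re_inverse_complex by simp

lemma pos_recip_pos: "Re z \<ge> 0 \<Longrightarrow> pos_recip z = Re (1 / z)"
  by (simp add: pos_recip_def Re_inverse_complex)

lemma pos_recip_diff: "\<bar>pos_recip z - pos_recip w\<bar> \<le> norm (1 / z - 1 / w)"
proof -
  have "\<bar>pos_recip z - pos_recip w\<bar> \<le> \<bar>Re (1 / z - 1 / w)\<bar>"
    by (auto simp: pos_recip_def max_def)
  also have "\<dots> \<le> norm (1 / z - 1 / w)" by (rule abs_Re_le_cmod)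
  finally show ?thesis .
qed

lemma near_mono: "t \<le> u \<Longrightarrow> near I a t \<subseteq> near I a u"
  by (auto simp: near_def)

lemma fin_densE:
  assumes "fin_dens I a"
  obtains K where "K \<ge> 1" "\<And>t. finite (near I a t)" "\<And>t. t \<ge> 0 \<Longrightarrow> real (card (near I a t)) \<le> K * (1 + t)"
proof -
  obtain K where K: "K \<ge> 0" "\<And>t. t \<ge> 0 \<Longrightarrow> finite (near I a t) \<and> real (card (near I a t)) \<le> K * (1 + t)"
    using assms unfolding fin_dens_def by auto
  show ?thesis
  proof (rule that[of "max K 1"])
    show "finite (near I a t)" for t
      using K(2)[of "max t 0"] near_mono[of t "max t 0" I a] by (meson finite_subset max.cobounded1 max.cobounded2)
    show "real (card (near I a t)) \<le> max K 1 * (1 + t)" if "t \<ge> 0" for t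
    proof -
      have "K * (1 + t) \<le> max K 1 * (1 + t)" using that by (intro mult_right_mono) auto
      then show ?thesis using K(2)[OF that] by linarith
    qed
  qed auto
qed

lemma fin_dens_near_finite: "fin_dens I a \<Longrightarrow> finite (near I a t)"
  by (metis fin_densE)

text \<open>Covers subfamilies, translations and modulus-preserving changes at once: a disc for the
  new family corresponds to a disc of radius larger by at most |c| for the old one.\<close>

lemma fin_dens_comparison:
  assumes "fin_dens I a" "\<And>n. n \<in> J \<Longrightarrow> n \<in> I \<and> norm (a n) \<le> norm (b n) + c"
  shows "fin_dens J b"
proof -
  from fin_densE[OF assms(1)] obtain K where K: "K \<ge> 1" "\<And>t. finite (near I a t)"
    "\<And>t. t \<ge> 0 \<Longrightarrow> real (card (near I a t)) \<le> K * (1 + t)" by metis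
  show ?thesis unfolding fin_dens_def
  proof (intro exI[of _ "K * (1 + \<bar>c\<bar>)"] conjI allI impI)
    show "K * (1 + \<bar>c\<bar>) \<ge> 0" using K by simp
    fix t :: real assume t: "t \<ge> 0"
    have sub: "near J b t \<subseteq> near I a (t + \<bar>c\<bar>)"
      using assms(2) by (force simp: near_def)
    show "finite (near J b t)" using sub K(2) finite_subset by blast
    have "real (card (near J b t)) \<le> real (card (near I a (t + \<bar>c\<bar>)))"
      using card_mono[OF K(2) sub] by simp
    also have "\<dots> \<le> K * (1 + (t + \<bar>c\<bar>))" using K(3) t by simp
    also have "\<dots> \<le> K * ((1 + \<bar>c\<bar>) * (1 + t))"
      using K t by (intro mult_left_mono) (auto simp: algebra_simps)
    finally show "real (card (near J b t)) \<le> K * (1 + \<bar>c\<bar>) * (1 + t)" by (simp add: mult.assoc)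
  qed
qed

lemma fin_dens_subset: "fin_dens I a \<Longrightarrow> J \<subseteq> I \<Longrightarrow> fin_dens J a"
  by (rule fin_dens_comparison[where c = 0]) auto

lemma fin_dens_shift: "fin_dens I a \<Longrightarrow> fin_dens I (\<lambda>n. a n + d)"
  by (rule fin_dens_comparison[where c = "norm d"])
    (auto simp: norm_diff_triangle_ineq, metis add_diff_cancel norm_triangle_ineq4)

lemma fin_dens_norm: "fin_dens I a \<Longrightarrow> (\<And>n. n \<in> I \<Longrightarrow> norm (b n) = norm (a n)) \<Longrightarrow> fin_dens I b"
  by (rule fin_dens_comparison[where c = 0]) auto

lemma finite_upper_density_imp_fin_dens:
  assumes "finite_upper_density Z"
  shows "fin_dens (index_set Z) (point Z)"
proof -
  let ?A = "\<lambda>r. {j \<in> index_set Z. norm (point Z j) \<le> r}"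
  have A: "?A r = near (index_set Z) (point Z) r" for r by (auto simp: near_def)
  obtain L where L: "Limsup at_top (\<lambda>r::real. ereal (1 / r) * ereal_of_enat (ext_card (?A r))) < ereal L"
    using assms unfolding finite_upper_density_def by (meson ereal_dense2)
  have "\<forall>\<^sub>F r in at_top. ereal (1 / r) * ereal_of_enat (ext_card (?A r)) < ereal L"
    by (rule Limsup_lessD[OF L])
  then obtain b where b: "\<And>r. b \<le> r \<Longrightarrow> ereal (1 / r) * ereal_of_enat (ext_card (?A r)) < ereal L"
    unfolding eventually_at_top_linorder by auto
  have *: "finite (?A r) \<and> real (card (?A r)) \<le> L * r" if "r \<ge> max b 1" for r
  proof -
    have r: "r > 0" "b \<le> r" using that by auto
    have fin: "finite (?A r)"
    proof (rule ccontr)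
      assume "infinite (?A r)"
      then have "ereal (1 / r) * ereal_of_enat (ext_card (?A r)) = \<infinity>" using r
        by (simp add: ext_card_def)
      then show False using b[OF r(2)] by simp
    qed
    then have "1 / r * real (card (?A r)) < L" using b[OF r(2)] by (simp add: ext_card_def)
    then show ?thesis using fin r by (simp add: field_simps)
  qed
  define K where "K = \<bar>L\<bar> * max b 1"
  show ?thesis unfolding fin_dens_def
  proof (intro exI[of _ K] conjI allI impI)
    show "K \<ge> 0" by (simp add: K_def)
    fix t :: real assume t: "t \<ge> 0"
    \<comment> \<open>The upper limit gives a bound only beyond some b; this radius exceeds both t
      and the threshold and is still O(1 + t).\<close>
    define r where "r = max b 1 * (1 + t)"
    have r: "r \<ge> max b 1" "r \<ge> t"
    proof -
      have "max b 1 * 1 \<le> max b 1 * (1 + t)" using t by (intro mult_left_mono) auto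
      then show "r \<ge> max b 1" by (simp add: r_def)
      have "1 * (1 + t) \<le> max b 1 * (1 + t)" using t by (intro mult_right_mono) auto
      then show "r \<ge> t" by (simp add: r_def)
    qed
    have sub: "near (index_set Z) (point Z) t \<subseteq> ?A r" using r by (auto simp: near_def)
    show "finite (near (index_set Z) (point Z) t)" using sub *[OF r(1)] finite_subset by blast
    have "real (card (near (index_set Z) (point Z) t)) \<le> real (card (?A r))"
      using card_mono[OF _ sub] *[OF r(1)] by simp
    also have "\<dots> \<le> L * r" using *[OF r(1)] by simp
    also have "\<dots> \<le> \<bar>L\<bar> * r" using r by (intro mult_right_mono) auto
    finally show "real (card (near (index_set Z) (point Z) t)) \<le> K * (1 + t)"
      by (simp add: K_def r_def mult.assoc)
  qed
qed

text \<open>The place of a point when the family is listed by increasing modulus, ties being broken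
  by the index, counted from 0. It replaces a rearrangement, so that the family keeps its index set
  throughout.\<close>

definition rank :: "nat set \<Rightarrow> (nat \<Rightarrow> complex) \<Rightarrow> nat \<Rightarrow> nat" where
  "rank I a j = card {i\<in>I. norm (a i) < norm (a j) \<or> (norm (a i) = norm (a j) \<and> i < j)}"

lemma rank_less:
  assumes fin: "\<And>t. finite (near I a t)" and i: "i \<in> I"
    and less: "norm (a i) < norm (a j) \<or> (norm (a i) = norm (a j) \<and> i < j)"
  shows "rank I a i < rank I a j"
  unfolding rank_def
proof (rule psubset_card_mono)
  let ?S = "\<lambda>j. {i\<in>I. norm (a i) < norm (a j) \<or> (norm (a i) = norm (a j) \<and> i < j)}"
  show "finite (?S j)"
    by (rule finite_subset[OF _ fin[of "norm (a j)"]]) (auto simp: near_def)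
  have "i \<in> ?S j" "i \<notin> ?S i" using i less by auto
  moreover have "?S i \<subseteq> ?S j" using less by auto
  ultimately show "?S i \<subset> ?S j" by blast
qed

lemma rank_inj:
  assumes fin: "\<And>t. finite (near I a t)"
  shows "inj_on (rank I a) I"
proof (rule inj_onI, rule ccontr)
  fix i j assume ij: "i \<in> I" "j \<in> I" "rank I a i = rank I a j" "i \<noteq> j"
  then consider "norm (a i) < norm (a j) \<or> (norm (a i) = norm (a j) \<and> i < j)"
    | "norm (a j) < norm (a i) \<or> (norm (a j) = norm (a i) \<and> j < i)" by linarith
  then show False using rank_less[of I a, OF fin] ij by cases (metis less_irrefl)+
qed

lemma rank_less_norm:
  assumes fin: "\<And>t. finite (near I a t)" and "j \<in> I" "rank I a i < rank I a j"
  shows "norm (a i) \<le> norm (a j)"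
  using rank_less[of I a j i, OF fin] assms by force

lemma rank_bound:
  assumes fin: "\<And>t. finite (near I a t)" and j: "j \<in> I"
  shows "rank I a j + 1 \<le> card (near I a (norm (a j)))"
proof -
  have "rank I a j < card (near I a (norm (a j)))"
    unfolding rank_def
    by (rule psubset_card_mono[OF fin]) (use j in \<open>force simp: near_def\<close>)
  then show ?thesis by simp
qed

text \<open>Ranks are injective, so the sum over the family is part of a sum of nonnegative terms
  over an initial segment of the naturals.\<close>

lemma sum_rank_le:
  fixes f :: "nat \<Rightarrow> real"
  assumes fin: "\<And>t. finite (near I a t)" and F: "finite F" "F \<subseteq> I"
    and f: "\<And>n. f n \<ge> 0" and B: "\<And>N. (\<Sum>m<N. f m) \<le> B"
  shows "(\<Sum>j\<in>F. f (rank I a j)) \<le> B"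
proof -
  have inj: "inj_on (rank I a) F" using rank_inj[OF fin] F(2) by (rule inj_on_subset)
  have "(\<Sum>j\<in>F. f (rank I a j)) = (\<Sum>m\<in>rank I a ` F. f m)"
    using inj by (simp add: sum.reindex)
  also have "\<dots> \<le> (\<Sum>m<Suc (Max (insert 0 (rank I a ` F))). f m)"
    by (intro sum_mono2) (use F f in \<open>auto simp: less_Suc_eq_le\<close>)
  also have "\<dots> \<le> B" by (rule B)
  finally show ?thesis .
qed

text \<open>Inverts the density bound: at least rank + 1 points lie in the closed disc through the
  given one, so the modulus grows at least linearly with the rank. The lower bound c absorbs the
  additive 1.\<close>

lemma fin_dens_rank:
  assumes "fin_dens I a" and c: "c > 0" "\<And>n. n \<in> I \<Longrightarrow> norm (a n) \<ge> c"
  obtains K where "K \<ge> 1" "\<And>n. n \<in> I \<Longrightarrow> real (rank I a n) + 1 \<le> K * norm (a n)"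
proof -
  from fin_densE[OF assms(1)] obtain K where K: "K \<ge> 1" "\<And>t. finite (near I a t)"
    "\<And>t. t \<ge> 0 \<Longrightarrow> real (card (near I a t)) \<le> K * (1 + t)" by metis
  show ?thesis
  proof (rule that[of "K * (1 / c + 1)"])
    have "1 * 1 \<le> K * (1 / c + 1)" using K c by (intro mult_mono) auto
    then show "K * (1 / c + 1) \<ge> 1" by simp
    fix n assume n: "n \<in> I"
    have "real (rank I a n + 1) \<le> real (card (near I a (norm (a n))))"
      using rank_bound[OF K(2) n] by linarith
    also have "\<dots> \<le> K * (1 + norm (a n))" using K(3) by simp
    also have "\<dots> \<le> K * ((1 / c + 1) * norm (a n))"
      using K c n by (intro mult_left_mono) (auto simp: field_simps)
    finally show "real (rank I a n) + 1 \<le> K * (1 / c + 1) * norm (a n)" by (simp add: mult.assoc)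
  qed
qed

lemma fin_dens_summable:
  assumes fd: "fin_dens I a" and c: "c > 0" "\<And>n. n \<in> I \<Longrightarrow> norm (a n) \<ge> c" and p: "p > 1"
  shows "summable (\<lambda>n. if n \<in> I then norm (a n) powr (-p) else 0)"
proof -
  obtain K where K: "K \<ge> 1" "\<And>n. n \<in> I \<Longrightarrow> real (rank I a n) + 1 \<le> K * norm (a n)"
    using fin_dens_rank[OF fd c] by metis
  have "summable (\<lambda>n. real n powr (-p))" using p by (subst summable_real_powr_iff) auto
  then have "summable (\<lambda>n. real (Suc n) powr (-p))" by (subst summable_Suc_iff)
  then have s: "summable (\<lambda>n. K powr p * (1 + real n) powr (-p))" by (intro summable_mult) simp
  define B where "B = (\<Sum>n. K powr p * (1 + real n) powr (-p))"
  show ?thesis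
  proof (rule summableI_nonneg_bounded[where x = B])
    fix N
    have "(\<Sum>n<N. if n \<in> I then norm (a n) powr (-p) else 0) = (\<Sum>n\<in>{..<N} \<inter> I. norm (a n) powr (-p))"
      by (simp add: sum.inter_restrict)
    also have "\<dots> \<le> (\<Sum>n\<in>{..<N} \<inter> I. K powr p * (1 + real (rank I a n)) powr (-p))"
    proof (rule sum_mono)
      fix n assume "n \<in> {..<N} \<inter> I"
      then have n: "real (rank I a n) + 1 \<le> K * norm (a n)" and pos: "norm (a n) > 0"
        using K c by (auto, metis c(2) le_less_trans less_le_trans linorder_not_le norm_le_zero_iff norm_zero)
      have "(K * norm (a n)) powr (-p) \<le> (1 + real (rank I a n)) powr (-p)"
        using n p by (intro powr_mono2') auto
      then have "K powr p * (K powr (-p) * norm (a n) powr (-p)) \<le> K powr p * (1 + real (rank I a n)) powr (-p)"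
        using K by (intro mult_left_mono) (auto simp: powr_mult)
      moreover have "K powr p * K powr (-p) = 1" using K by (simp add: powr_minus)
      ultimately show "norm (a n) powr (-p) \<le> K powr p * (1 + real (rank I a n)) powr (-p)"
        by (simp add: mult.assoc[symmetric])
    qed
    also have "\<dots> \<le> B"
    proof (rule sum_rank_le[where f = "\<lambda>m. K powr p * (1 + real m) powr (-p)"])
      show "(\<Sum>m<N. K powr p * (1 + real m) powr - p) \<le> B" for N
        unfolding B_def using s by (intro sum_le_suminf) auto
    qed (use fd fin_dens_near_finite in auto)
    finally show "(\<Sum>n<N. if n \<in> I then norm (a n) powr (-p) else 0) \<le> B" .
  qed auto
qed

text \<open>In the order of ranks the sum is dominated by the sum of s / ((m / K)^2 + s^2) over m >=
  1, and hence by the integral of s / ((t / K)^2 + s^2) over t > 0, which is K pi / 2 for every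
  s.\<close>

lemma fin_dens_poisson_sum:
  assumes fd: "fin_dens I a" and c: "c > 0" "\<And>n. n \<in> I \<Longrightarrow> norm (a n) \<ge> c"
  obtains C where "C \<ge> 0" "\<And>F s. finite F \<Longrightarrow> F \<subseteq> I \<Longrightarrow> s > 0 \<Longrightarrow>
      (\<Sum>n\<in>F. s / ((norm (a n))\<^sup>2 + s\<^sup>2)) \<le> C"
proof -
  obtain K where K: "K \<ge> 1" "\<And>n. n \<in> I \<Longrightarrow> real (rank I a n) + 1 \<le> K * norm (a n)"
    using fin_dens_rank[OF fd c] by metis
  show ?thesis
  proof (rule that[of "K * (pi / 2)"])
    show "K * (pi / 2) \<ge> 0" using K by simp
    fix F and s :: real assume F: "finite F" "F \<subseteq> I" and s: "s > 0"
    define f where "f m = s / (((real m + 1) / K)\<^sup>2 + s\<^sup>2)" for m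
    have "(\<Sum>n\<in>F. s / ((norm (a n))\<^sup>2 + s\<^sup>2)) \<le> (\<Sum>n\<in>F. f (rank I a n))"
    proof (rule sum_mono)
      fix n assume "n \<in> F"
      then have "(real (rank I a n) + 1) / K \<le> norm (a n)" using K F by (auto simp: field_simps)
      then have "((real (rank I a n) + 1) / K)\<^sup>2 \<le> (norm (a n))\<^sup>2" using K by (intro power_mono) auto
      moreover have "((real (rank I a n) + 1) / K)\<^sup>2 + s\<^sup>2 > 0" using s by (intro add_nonneg_pos) auto
      ultimately show "s / ((norm (a n))\<^sup>2 + s\<^sup>2) \<le> f (rank I a n)"
        using s unfolding f_def by (intro divide_left_mono mult_pos_pos) (auto intro: add_nonneg_pos)
    qed
    also have "\<dots> \<le> K * (pi / 2)"
    proof (rule sum_rank_le)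
      show "f n \<ge> 0" for n using s by (simp add: f_def)
      fix N
      \<comment> \<open>The antiderivative of s / ((t / K)^2 + s^2) at t = m. As the integrand
        decreases, the increment over [m, m + 1] bounds \<open>f m\<close>, which is the value at
        the right end.\<close>
      define A where "A m = K * arctan (real m / (K * s))" for m
      have step: "f m \<le> A (Suc m) - A m" for m
      proof -
        define u v where "u = real m / (K * s)" and "v = real (Suc m) / (K * s)"
        have uv: "0 \<le> u" "u < v" "v - u = 1 / (K * s)"
          using K s by (auto simp: u_def v_def field_simps)
        have "\<exists>z>u. z < v \<and> arctan v - arctan u = (v - u) * inverse (1 + z\<^sup>2)"
          by (rule MVT2) (use uv in \<open>auto intro!: DERIV_arctan\<close>)
        then obtain z where z: "u < z" "z < v" "arctan v - arctan u = (v - u) * inverse (1 + z\<^sup>2)" by auto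
        have "z\<^sup>2 \<le> v\<^sup>2" using z uv by (intro power_mono) auto
        then have "inverse (1 + v\<^sup>2) \<le> inverse (1 + z\<^sup>2)"
          by (intro le_imp_inverse_le) (auto intro: add_pos_nonneg)
        then have "(v - u) * inverse (1 + v\<^sup>2) \<le> arctan v - arctan u"
          unfolding z(3) using uv(2) by (intro mult_left_mono) auto
        then have "K * ((v - u) * inverse (1 + v\<^sup>2)) \<le> A (Suc m) - A m"
          using K unfolding A_def u_def v_def by (auto simp: right_diff_distrib[symmetric] intro!: mult_left_mono)
        moreover have "K * ((v - u) * inverse (1 + v\<^sup>2)) = f m"
        proof -
          have v: "v = ((real m + 1) / K) / s" by (simp add: v_def field_simps)
          have "K * ((v - u) * inverse (1 + v\<^sup>2)) = inverse (s * (1 + v\<^sup>2))"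
            unfolding uv(3) using K(1) s by (simp add: divide_inverse)
          also have "s * (1 + v\<^sup>2) = (((real m + 1) / K)\<^sup>2 + s\<^sup>2) / s"
            unfolding v power_divide[where b = s] using s by (simp add: distrib_left add.commute) (simp add: power2_eq_square add_divide_distrib)
          finally show ?thesis by (simp add: f_def)
        qed
        ultimately show ?thesis by simp
      qed
      have "(\<Sum>m<N. f m) \<le> (\<Sum>m<N. A (Suc m) - A m)" by (intro sum_mono step)
      also have "\<dots> = A N - A 0" by (rule sum_lessThan_telescope)
      also have "\<dots> \<le> K * (pi / 2)" using K arctan_ubound[of "real N / (K * s)"]
        by (simp add: A_def)
      finally show "(\<Sum>m<N. f m) \<le> K * (pi / 2)" .
    qed (use fd fin_dens_near_finite F in auto)
    finally show "(\<Sum>n\<in>F. s / ((norm (a n))\<^sup>2 + s\<^sup>2)) \<le> K * (pi / 2)" .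
  qed
qed

text \<open>The Poisson sum at s = T: for |a| >= T the term 1 / |a|^2 is at most 2 / (|a|^2 +
  T^2).\<close>

lemma fin_dens_tail_sum:
  assumes fd: "fin_dens I a" and c: "c > 0" "\<And>n. n \<in> I \<Longrightarrow> norm (a n) \<ge> c"
  obtains C where "C \<ge> 0" "\<And>F T. finite F \<Longrightarrow> F \<subseteq> I \<Longrightarrow> T > 0 \<Longrightarrow> (\<And>n. n \<in> F \<Longrightarrow> norm (a n) \<ge> T) \<Longrightarrow>
      (\<Sum>n\<in>F. 1 / (norm (a n))\<^sup>2) \<le> C / T"
proof -
  obtain C where C: "C \<ge> 0" "\<And>F s. finite F \<Longrightarrow> F \<subseteq> I \<Longrightarrow> s > 0 \<Longrightarrow>
      (\<Sum>n\<in>F. s / ((norm (a n))\<^sup>2 + s\<^sup>2)) \<le> C" using fin_dens_poisson_sum[OF fd c] by metis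
  show ?thesis
  proof (rule that[of "2 * C"])
    show "2 * C \<ge> 0" using C by simp
    fix F and T :: real assume F: "finite F" "F \<subseteq> I" and T: "T > 0" "\<And>n. n \<in> F \<Longrightarrow> norm (a n) \<ge> T"
    have "(\<Sum>n\<in>F. 1 / (norm (a n))\<^sup>2) \<le> (\<Sum>n\<in>F. (2 / T) * (T / ((norm (a n))\<^sup>2 + T\<^sup>2)))"
    proof (rule sum_mono)
      fix n assume "n \<in> F"
      then have "T\<^sup>2 \<le> (norm (a n))\<^sup>2" using T by (intro power_mono) auto
      moreover have "T\<^sup>2 > 0" using T by simp
      ultimately have "2 / (2 * (norm (a n))\<^sup>2) \<le> 2 / ((norm (a n))\<^sup>2 + T\<^sup>2)"
        by (intro divide_left_mono mult_pos_pos) linarith+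
      then show "1 / (norm (a n))\<^sup>2 \<le> (2 / T) * (T / ((norm (a n))\<^sup>2 + T\<^sup>2))"
        using T by simp
    qed
    also have "\<dots> \<le> (2 / T) * C"
      unfolding sum_distrib_left[symmetric] using C(2)[OF F T(1)] T by (intro mult_left_mono) auto
    finally show "(\<Sum>n\<in>F. 1 / (norm (a n))\<^sup>2) \<le> 2 * C / T" by simp
  qed
qed

text \<open>Abel summation by induction on the number of points. The set where t is largest is
  peeled off: if m is the value of v there, then v = m + (v - m), where the first part gives m times
  a full partial sum and the second lives on the remaining points, still decreases in t and is
  bounded by q - m. Points with equal t stay together, so no order among them has to be
  chosen.\<close>

lemma abel_sum_lower_bound:
  fixes t c v :: "'i \<Rightarrow> real"
  assumes "finite F" and C: "C \<ge> 0"
    and part: "\<And>T. (\<Sum>j\<in>{j\<in>F. t j \<le> T}. c j) \<ge> -C"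
    and v: "\<And>j. j \<in> F \<Longrightarrow> 0 \<le> v j \<and> v j \<le> q" "\<And>i j. i \<in> F \<Longrightarrow> j \<in> F \<Longrightarrow> t i \<le> t j \<Longrightarrow> v j \<le> v i"
    and q: "q \<ge> 0"
  shows "(\<Sum>j\<in>F. c j * v j) \<ge> - C * q"
  using assms
proof (induction "card F" arbitrary: F v q rule: less_induct)
  case less
  show ?case
  proof (cases "F = {}")
    case True
    then show ?thesis using less.prems by simp
  next
    case False
    define T where "T = Max (t ` F)"
    have "T \<in> t ` F" unfolding T_def using False less.prems(1) by (intro Max_in) auto
    then obtain j0 where j0: "j0 \<in> F" "t j0 = T" by auto
    have tT: "t j \<le> T" if "j \<in> F" for j unfolding T_def using that less.prems(1) by auto
    define m where "m = v j0"
    have m: "0 \<le> m" "m \<le> q" using less.prems(4)[OF j0(1)] by (auto simp: m_def)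
    have vm: "m \<le> v j" if "j \<in> F" for j unfolding m_def using less.prems(5)[OF that j0(1)] tT[OF that] j0 by auto
    define G where "G = {j\<in>F. t j < T}"
    have G: "finite G" "G \<subset> F" using less.prems(1) j0 by (auto simp: G_def)
    have eqm: "v j = m" if "j \<in> F - G" for j
    proof -
      have "t j = T" using that tT[of j] by (auto simp: G_def)
      then show ?thesis using vm[of j] less.prems(5)[OF j0(1), of j] j0 that by (auto simp: m_def)
    qed
    \<comment> \<open>Partial sums over G are partial sums over F: the threshold is lowered to the
      largest value of t attained on G up to U, which lies strictly below T.\<close>
    have partG: "(\<Sum>j\<in>{j\<in>G. t j \<le> U}. c j) \<ge> -C" for U
    proof (cases "{j\<in>G. t j \<le> U} = {}")
      case True
      show ?thesis unfolding True using less.prems(2) by simp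
    next
      case ne: False
      define U' where "U' = Max (t ` {j\<in>G. t j \<le> U})"
      have "U' \<in> t ` {j\<in>G. t j \<le> U}" unfolding U'_def using ne G(1) by (intro Max_in) auto
      then have "U' \<le> U" "U' < T" by (auto simp: G_def)
      moreover have "t j \<le> U'" if "j \<in> G" "t j \<le> U" for j unfolding U'_def using that G(1) by auto
      ultimately have "{j\<in>G. t j \<le> U} = {j\<in>F. t j \<le> U'}" by (force simp: G_def)
      then show ?thesis using less.prems(3)[of U'] by simp
    qed
    have IH: "(\<Sum>j\<in>G. c j * (v j - m)) \<ge> - C * (q - m)"
    proof (rule less.hyps[OF psubset_card_mono[OF less.prems(1) G(2)] G(1) less.prems(2) partG])
      show "0 \<le> v j - m \<and> v j - m \<le> q - m" if "j \<in> G" for j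
        using that vm[of j] less.prems(4)[of j] by (auto simp: G_def)
      show "v j - m \<le> v i - m" if "i \<in> G" "j \<in> G" "t i \<le> t j" for i j
        using that less.prems(5)[of i j] by (auto simp: G_def)
      show "0 \<le> q - m" using m by simp
    qed
    have "(\<Sum>j\<in>F. c j * v j) = m * (\<Sum>j\<in>F. c j) + (\<Sum>j\<in>F. c j * (v j - m))"
      by (simp add: sum_distrib_left sum.distrib[symmetric] algebra_simps)
    also have "(\<Sum>j\<in>F. c j * (v j - m)) = (\<Sum>j\<in>G. c j * (v j - m))"
      using less.prems(1) G(2) eqm by (intro sum.mono_neutral_right) auto
    finally have eq: "(\<Sum>j\<in>F. c j * v j) = m * (\<Sum>j\<in>F. c j) + (\<Sum>j\<in>G. c j * (v j - m))" .
    have "{j\<in>F. t j \<le> T} = F" using tT by auto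
    then have "(\<Sum>j\<in>F. c j) \<ge> -C" using less.prems(3)[of T] by simp
    then have "m * (\<Sum>j\<in>F. c j) \<ge> m * (-C)" using m by (intro mult_left_mono)
    then show ?thesis using eq IH by (simp add: algebra_simps)
  qed
qed

text \<open>Running through the points in the order of their ranks, a point is taken if the amount
  \<open>L\<close> prescribed so far exceeds the amount already taken.\<close>

function take_point :: "nat set \<Rightarrow> (nat \<Rightarrow> complex) \<Rightarrow> (real \<Rightarrow> real) \<Rightarrow> nat \<Rightarrow> bool" where
  "take_point I a L j \<longleftrightarrow>
     L (norm (a j)) - (\<Sum>i\<in>{i\<in>I. rank I a i < rank I a j}. if take_point I a L i then pos_recip (a i) else 0) > 0"
  by auto
termination by (relation "Wellfounded.measure (\<lambda>(I, a, L, j). rank I a j)") auto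

declare take_point.simps [simp del]

lemma lsum_nonneg_mono:
  assumes "\<And>t. finite (near I a t)" "s \<le> t"
  shows "0 \<le> lsum I a s" "lsum I a s \<le> lsum I a t"
  using assms near_mono[OF assms(2), of I a] unfolding lsum_def
  by (auto intro!: sum_nonneg sum_mono2 simp: pos_recip_bounds)

text \<open>One point carries at most 1, so the amount taken exceeds the prescribed one by at most
  1, as seen at the last point taken up to t. For the other direction consider the last point
  skipped up to t: nothing was missing there, and after it the family was taken completely, so that
  \<open>le\<close> bounds the deficit by C.\<close>

lemma greedy_subfamily:
  assumes finI: "\<And>t. finite (near I a t)" and finJ: "\<And>t. finite (near J b t)"
    and a1: "\<And>n. n \<in> I \<Longrightarrow> norm (a n) \<ge> 1" and b1: "\<And>n. n \<in> J \<Longrightarrow> norm (b n) \<ge> 1"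
    and C: "C \<ge> 0"
    and le: "\<And>r R. 0 < r \<Longrightarrow> r < R \<Longrightarrow> lsum J b R - lsum J b r \<le> lsum I a R - lsum I a r + C"
  obtains I' where "I' \<subseteq> I" "\<And>t. \<bar>lsum J b t - lsum I' a t\<bar> \<le> C + 1"
proof -
  define L where "L = lsum J b"
  define tk where "tk = take_point I a L"
  define I' where "I' = {j\<in>I. tk j}"
  let ?r = "rank I a" and ?\<alpha> = "\<lambda>n. pos_recip (a n)"
  have Lmono: "s \<le> t \<Longrightarrow> L s \<le> L t" and L0: "L t \<ge> 0" for s t
    using lsum_nonneg_mono[OF finJ] unfolding L_def by auto
  have \<alpha>1: "?\<alpha> n \<le> 1" if "n \<in> I" for n
    using pos_recip_bounds(2)[of "a n"] a1[OF that] by (smt (verit) divide_le_eq_1)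
  have fr: "finite {i\<in>I. ?r i < ?r j}" if "j \<in> I" for j
    by (rule finite_subset[OF _ finI[of "norm (a j)"]])
      (use rank_less_norm[OF finI that] in \<open>auto simp: near_def\<close>)
  have tk_iff: "tk j \<longleftrightarrow> L (norm (a j)) - (\<Sum>i\<in>{i\<in>I'. ?r i < ?r j}. ?\<alpha> i) > 0" if "j \<in> I" for j
  proof -
    have "(\<Sum>i\<in>{i\<in>I. ?r i < ?r j}. if tk i then ?\<alpha> i else 0) = (\<Sum>i\<in>{i\<in>I. ?r i < ?r j} \<inter> {i. tk i}. ?\<alpha> i)"
      using fr[OF that] by (simp add: sum.inter_restrict)
    also have "{i\<in>I. ?r i < ?r j} \<inter> {i. tk i} = {i\<in>I'. ?r i < ?r j}" by (auto simp: I'_def)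
    finally show ?thesis unfolding tk_def by (subst take_point.simps) simp
  qed
  have I': "I' \<subseteq> I" by (auto simp: I'_def)
  have finI': "finite (near I' a t)" for t
    by (rule finite_subset[OF _ finI[of t]]) (use I' in \<open>auto simp: near_def\<close>)
  have inj: "inj_on ?r I" by (rule rank_inj[OF finI])
  \<comment> \<open>All moduli are at least 1, so both sums vanish at radius 1/2. It serves as the
    lower end in \<open>le\<close>, which requires r > 0.\<close>
  have small: "lsum J b (1/2) = 0" "lsum I a (1/2) = 0" "\<And>t. t \<le> 1/2 \<Longrightarrow> lsum J b t = 0"
    using a1 b1 by (auto simp: lsum_def near_def intro!: sum.neutral) fastforce+
  have lower: "L t - lsum I' a t \<ge> -1" for t
  proof (cases "near I' a t = {}")
    case True
    then show ?thesis using L0[of t] by (simp add: lsum_def)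
  next
    case False
    define M where "M = Max (?r ` near I' a t)"
    have "M \<in> ?r ` near I' a t" unfolding M_def using False finI' by (intro Max_in) auto
    then obtain j where j: "j \<in> near I' a t" "?r j = M" by auto
    have jI: "j \<in> I" "j \<in> I'" "norm (a j) \<le> t" using j I' by (auto simp: near_def)
    have max: "?r i \<le> ?r j" if "i \<in> near I' a t" for i
      unfolding j(2) M_def using that finI' by auto
    have "near I' a t = insert j {i\<in>I'. ?r i < ?r j}"
    proof (intro equalityI subsetI)
      fix i assume i: "i \<in> near I' a t"
      then have "i \<in> I" "i \<in> I'" using I' by (auto simp: near_def)
      then show "i \<in> insert j {i\<in>I'. ?r i < ?r j}"
        using max[OF i] inj jI by (auto simp: le_less inj_on_def)
    next
      fix i assume "i \<in> insert j {i\<in>I'. ?r i < ?r j}"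
      then show "i \<in> near I' a t"
        using j rank_less_norm[OF finI jI(1), of i] jI by (fastforce simp: near_def)
    qed
    moreover have "finite {i\<in>I'. ?r i < ?r j}"
      by (rule finite_subset[OF _ fr[OF jI(1)]]) (use I' in auto)
    ultimately have "lsum I' a t = ?\<alpha> j + (\<Sum>i\<in>{i\<in>I'. ?r i < ?r j}. ?\<alpha> i)"
      by (simp add: lsum_def)
    moreover have "L (norm (a j)) - (\<Sum>i\<in>{i\<in>I'. ?r i < ?r j}. ?\<alpha> i) > 0"
      using tk_iff[OF jI(1)] jI(2) by (simp add: I'_def)
    ultimately show ?thesis using \<alpha>1[OF jI(1)] Lmono[OF jI(3)] by linarith
  qed
  have upper: "L t - lsum I' a t \<le> C" for t
  proof (cases "near (I - I') a t = {}")
    case True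
    then have "near I' a t = near I a t" using I' by (auto simp: near_def)
    then have "lsum I' a t = lsum I a t" by (simp add: lsum_def)
    moreover have "L t - lsum I a t \<le> C"
    proof (cases "t \<le> 1/2")
      case True
      then show ?thesis using small(3)[OF True] lsum_nonneg_mono(1)[OF finI order.refl, of t] C by (simp add: L_def)
    next
      case False
      then show ?thesis using le[of "1/2" t] small by (simp add: L_def)
    qed
    ultimately show ?thesis by simp
  next
    case False
    have finS: "finite (near (I - I') a t)"
      by (rule finite_subset[OF _ finI[of t]]) (auto simp: near_def)
    define M where "M = Max (?r ` near (I - I') a t)"
    have "M \<in> ?r ` near (I - I') a t" unfolding M_def using False finS by (intro Max_in) auto
    then obtain j where j: "j \<in> near (I - I') a t" "?r j = M" by auto
    have jI: "j \<in> I" "j \<notin> I'" "norm (a j) \<le> t" using j by (auto simp: near_def)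
    have max: "?r i \<le> ?r j" if "i \<in> near (I - I') a t" for i
      unfolding j(2) M_def using that finS by auto
    let ?lo = "{i\<in>I'. ?r i < ?r j}" and ?hi = "{i\<in>near I a t. ?r j < ?r i}" and ?low = "{i\<in>near I a t. ?r i \<le> ?r j}"
    have flo: "finite ?lo" by (rule finite_subset[OF _ fr[OF jI(1)]]) (use I' in auto)
    have fhi: "finite ?hi" "finite ?low" using finI by auto
    have "near I' a t = ?lo \<union> ?hi"
    proof (intro equalityI subsetI)
      fix i assume i: "i \<in> near I' a t"
      then have "i \<in> I" "i \<in> I'" "i \<in> near I a t" using I' by (auto simp: near_def)
      moreover have "?r i \<noteq> ?r j" using \<open>i \<in> I'\<close> \<open>i \<in> I\<close> jI inj by (auto simp: inj_on_def)
      ultimately show "i \<in> ?lo \<union> ?hi" by auto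
    next
      fix i assume "i \<in> ?lo \<union> ?hi"
      then show "i \<in> near I' a t"
      proof
        assume "i \<in> ?lo"
        then show ?thesis using rank_less_norm[OF finI jI(1), of i] jI by (fastforce simp: near_def)
      next
        assume i: "i \<in> ?hi"
        then have "i \<in> I'" using max[of i] by (force simp: near_def)
        then show ?thesis using i by (auto simp: near_def)
      qed
    qed
    then have "lsum I' a t = sum ?\<alpha> (?lo \<union> ?hi)"
      unfolding lsum_def by (rule arg_cong[where f = "sum ?\<alpha>"])
    then have "lsum I' a t = (\<Sum>i\<in>?lo. ?\<alpha> i) + (\<Sum>i\<in>?hi. ?\<alpha> i)"
      using sum.union_disjoint[of ?lo ?hi ?\<alpha>] flo fhi(1) by fastforce
    moreover have "lsum I a t = (\<Sum>i\<in>?low. ?\<alpha> i) + (\<Sum>i\<in>?hi. ?\<alpha> i)"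
    proof -
      have "near I a t = ?low \<union> ?hi" by auto
      then have "lsum I a t = sum ?\<alpha> (?low \<union> ?hi)"
        unfolding lsum_def by (rule arg_cong[where f = "sum ?\<alpha>"])
      then show ?thesis using sum.union_disjoint[of ?low ?hi ?\<alpha>] fhi by fastforce
    qed
    moreover have "(\<Sum>i\<in>?low. ?\<alpha> i) \<le> lsum I a (norm (a j))"
      unfolding lsum_def
    proof (rule sum_mono2[OF finI])
      show "?low \<subseteq> near I a (norm (a j))"
      proof
        fix i assume i: "i \<in> ?low"
        then have "i \<in> I" "i = j \<or> ?r i < ?r j" using inj jI by (auto simp: near_def le_less inj_on_def)
        then show "i \<in> near I a (norm (a j))"
          using rank_less_norm[OF finI jI(1), of i] by (auto simp: near_def)
      qed
    qed (auto simp: pos_recip_bounds)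
    moreover have "L (norm (a j)) - (\<Sum>i\<in>?lo. ?\<alpha> i) \<le> 0"
      using tk_iff[OF jI(1)] jI by (auto simp: I'_def)
    moreover have "L t - L (norm (a j)) \<le> lsum I a t - lsum I a (norm (a j)) + C"
    proof (cases "norm (a j) = t")
      case False
      moreover have "norm (a j) > 0" using a1[OF jI(1)] by linarith
      ultimately show ?thesis using le[of "norm (a j)" t] jI(3) by (simp add: L_def)
    qed (use C in auto)
    ultimately show ?thesis by linarith
  qed
  show ?thesis
  proof (rule that[OF I'])
    show "\<bar>lsum J b t - lsum I' a t\<bar> \<le> C + 1" for t
      using lower[of t] upper[of t] C unfolding L_def by linarith
  qed
qed

text \<open>For points of large modulus 1 / (a + d) - 1 / a is O(|a|^-2), which is summable.
  Truncation at radius t may treat a point and its translate differently, but then the modulus is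
  within |d| of t; there are O(1 + t) such points, each contributing O(1 / (1 + t)).\<close>

lemma lsum_shift:
  assumes fd: "fin_dens I a"
  obtains C where "C \<ge> 0" "\<And>t. \<bar>lsum I (\<lambda>n. a n + d) t - lsum I a t\<bar> \<le> C"
proof -
  from fin_densE[OF fd] obtain K where K: "K \<ge> 1" "\<And>t. finite (near I a t)"
    "\<And>t. t \<ge> 0 \<Longrightarrow> real (card (near I a t)) \<le> K * (1 + t)" by metis
  define b where "b = (\<lambda>n. a n + d)"
  have finb: "finite (near I b t)" for t
    unfolding b_def by (rule fin_dens_near_finite[OF fin_dens_shift[OF fd]])
  define R where "R = max 1 (2 * norm d)"
  have R: "R \<ge> 1" "R \<ge> 2 * norm d" by (auto simp: R_def)
  define I1 where "I1 = I - near I a R"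
  have I1: "fin_dens I1 a" by (rule fin_dens_subset[OF fd]) (auto simp: I1_def)
  have aR: "norm (a n) \<ge> R" if "n \<in> I1" for n using that by (auto simp: I1_def near_def)
  obtain C2 where C2: "C2 \<ge> 0" "\<And>F T. finite F \<Longrightarrow> F \<subseteq> I1 \<Longrightarrow> T > 0 \<Longrightarrow> (\<And>n. n \<in> F \<Longrightarrow> norm (a n) \<ge> T) \<Longrightarrow>
      (\<Sum>n\<in>F. 1 / (norm (a n))\<^sup>2) \<le> C2 / T"
    by (rule fin_dens_tail_sum[OF I1, of R]) (use aR R in auto)
  define C1 where "C1 = (\<Sum>n\<in>near I a R. pos_recip (a n) + pos_recip (b n))"
  define u where "u t n = (if n \<in> near I b t then pos_recip (b n) else 0) - (if n \<in> near I a t then pos_recip (a n) else 0)" for t n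
  have bn: "norm (b n) \<ge> norm (a n) / 2" "norm (b n) \<le> norm (a n) + norm d" "norm (b n) \<ge> norm (a n) - norm d" if "n \<in> I1" for n
  proof -
    show 1: "norm (b n) \<ge> norm (a n) - norm d" unfolding b_def by (metis diff_minus_eq_add norm_minus_cancel norm_triangle_ineq2)
    show "norm (b n) \<ge> norm (a n) / 2" using 1 aR[OF that] R by linarith
    show "norm (b n) \<le> norm (a n) + norm d" unfolding b_def by (rule norm_triangle_ineq)
  qed
  have main: "\<bar>lsum I b t - lsum I a t\<bar> \<le> C1 + 2 * norm d * C2 / R + 3 * K + 8 * K" for t
  proof -
    define X where "X = near I a t \<union> near I b t"
    have X: "finite X" "X \<subseteq> I" using K(2) finb by (auto simp: X_def near_def)
    have "lsum I b t = (\<Sum>n\<in>X. if n \<in> near I b t then pos_recip (b n) else 0)"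
      unfolding lsum_def using X by (subst sum.inter_restrict[symmetric]) (auto simp: X_def intro!: sum.cong)
    moreover have "lsum I a t = (\<Sum>n\<in>X. if n \<in> near I a t then pos_recip (a n) else 0)"
      unfolding lsum_def using X by (subst sum.inter_restrict[symmetric]) (auto simp: X_def intro!: sum.cong)
    ultimately have "\<bar>lsum I b t - lsum I a t\<bar> = \<bar>\<Sum>n\<in>X. u t n\<bar>"
      by (simp add: u_def sum_subtractf)
    also have "\<dots> \<le> (\<Sum>n\<in>X. \<bar>u t n\<bar>)" by (rule sum_abs)
    also have "\<dots> = (\<Sum>n\<in>X \<inter> near I a R. \<bar>u t n\<bar>) + (\<Sum>n\<in>X \<inter> I1. \<bar>u t n\<bar>)"
      using X by (subst sum.union_disjoint[symmetric]) (auto simp: I1_def intro!: sum.cong)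
    also have "(\<Sum>n\<in>X \<inter> near I a R. \<bar>u t n\<bar>) \<le> (\<Sum>n\<in>near I a R. \<bar>u t n\<bar>)"
      using K(2) by (intro sum_mono2) auto
    also have "(\<Sum>n\<in>near I a R. \<bar>u t n\<bar>) \<le> C1" unfolding C1_def
    proof (rule sum_mono)
      fix n
      show "\<bar>u t n\<bar> \<le> pos_recip (a n) + pos_recip (b n)"
        using pos_recip_bounds(1)[of "a n"] pos_recip_bounds(1)[of "b n"] unfolding u_def abs_le_iff by auto
    qed
    \<comment> \<open>The three summands dominate the three cases: both points inside radius t, only
      the original, only the translate. The last two cases force t >= 1 and t >= 0 respectively,
      which the Boolean factors record.\<close>
    also have "(\<Sum>n\<in>X \<inter> I1. \<bar>u t n\<bar>) \<le>
        (\<Sum>n\<in>X \<inter> I1. (2 * norm d * (1 / (norm (a n))\<^sup>2)) +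
           (if n \<in> near I a t then 3 / (1 + t) * of_bool (t \<ge> 1) else 0) +
           (if n \<in> near I a (t + norm d) then 8 / (1 + t + norm d) * of_bool (t \<ge> 0) else 0))"
    proof (rule sum_mono)
      fix n assume n: "n \<in> X \<inter> I1"
      have an: "norm (a n) \<ge> R" "norm (a n) \<ge> 1" "norm (a n) \<ge> 2 * norm d" using aR[of n] n R by auto
      have nI: "n \<in> I" using n X by auto
      note b = bn[of n]
      have p1: "0 \<le> 2 * norm d * (1 / (norm (a n))\<^sup>2)" by simp
      have p2: "0 \<le> (if n \<in> near I a t then 3 / (1 + t) * of_bool (t \<ge> 1) else 0)" by simp
      have p3: "0 \<le> (if n \<in> near I a (t + norm d) then 8 / (1 + t + norm d) * of_bool (t \<ge> 0) else 0)" by simp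
      consider (both) "n \<in> near I a t" "n \<in> near I b t" | (onlya) "n \<in> near I a t" "n \<notin> near I b t"
        | (onlyb) "n \<notin> near I a t" "n \<in> near I b t" using n by (auto simp: X_def)
      then show "\<bar>u t n\<bar> \<le> (2 * norm d * (1 / (norm (a n))\<^sup>2)) +
           (if n \<in> near I a t then 3 / (1 + t) * of_bool (t \<ge> 1) else 0) +
           (if n \<in> near I a (t + norm d) then 8 / (1 + t + norm d) * of_bool (t \<ge> 0) else 0)"
      proof cases
        case both
        then have "\<bar>u t n\<bar> \<le> norm (1 / b n - 1 / a n)" by (simp add: u_def pos_recip_diff)
        also have "1 / b n - 1 / a n = - d / (a n * b n)"
        proof -
          have "a n \<noteq> 0" "b n \<noteq> 0" using an b n by auto
          then show ?thesis by (simp add: divide_simps) (simp add: b_def)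
        qed
        also have "norm \<dots> = norm d / (norm (a n) * norm (b n))" by (simp add: norm_divide norm_mult)
        also have "\<dots> \<le> norm d / (norm (a n) * (norm (a n) / 2))"
          using an b n by (intro divide_left_mono mult_left_mono mult_pos_pos) auto
        also have "\<dots> = 2 * norm d * (1 / (norm (a n))\<^sup>2)" by (simp add: power2_eq_square)
        finally show ?thesis using p2 p3 by linarith
      next
        case onlya
        then have t: "norm (a n) \<le> t" "norm (b n) > t" using nI by (auto simp: near_def)
        have "\<bar>u t n\<bar> = pos_recip (a n)" using onlya by (simp add: u_def pos_recip_bounds)
        also have "\<dots> \<le> 1 / norm (a n)" by (rule pos_recip_bounds)
        also have "\<dots> \<le> 3 / (1 + t)"
        proof -
          have "1 + t \<le> 3 * norm (a n)" using t b n an by auto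
          then have "3 / (3 * norm (a n)) \<le> 3 / (1 + t)" using an t by (intro divide_left_mono mult_pos_pos) linarith+
          then show ?thesis by simp
        qed
        also have "\<dots> = (if n \<in> near I a t then 3 / (1 + t) * of_bool (t \<ge> 1) else 0)"
          using onlya t an by simp
        finally show ?thesis using p1 p3 by linarith
      next
        case onlyb
        then have t: "norm (a n) > t" "norm (b n) \<le> t" using nI by (auto simp: near_def)
        have t2: "t \<ge> norm (a n) / 2" "t \<ge> norm (a n) - norm d" "t \<ge> 1/2" "t \<ge> norm d" using t b n an by auto
        have "\<bar>u t n\<bar> = pos_recip (b n)" using onlyb by (simp add: u_def pos_recip_bounds)
        also have "\<dots> \<le> 1 / norm (b n)" by (rule pos_recip_bounds)
        also have "\<dots> \<le> 8 / (1 + t + norm d)"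
        proof -
          have "norm (b n) > 0" using b n an by auto
          moreover have "1 + t + norm d \<le> 8 * norm (b n)" using t b n an by auto
          ultimately have "8 / (8 * norm (b n)) \<le> 8 / (1 + t + norm d)"
            using t2 norm_ge_zero[of d] by (intro divide_left_mono mult_pos_pos) linarith+
          then show ?thesis by simp
        qed
        also have "\<dots> = (if n \<in> near I a (t + norm d) then 8 / (1 + t + norm d) * of_bool (t \<ge> 0) else 0)"
          using t2 nI t b n by (auto simp: near_def)
        finally show ?thesis using p1 p2 by linarith
      qed
    qed
    also have "\<dots> = 2 * norm d * (\<Sum>n\<in>X \<inter> I1. 1 / (norm (a n))\<^sup>2)
       + (\<Sum>n\<in>X \<inter> I1. if n \<in> near I a t then 3 / (1 + t) * of_bool (t \<ge> 1) else 0)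
       + (\<Sum>n\<in>X \<inter> I1. if n \<in> near I a (t + norm d) then 8 / (1 + t + norm d) * of_bool (t \<ge> 0) else 0)"
      by (simp only: sum.distrib sum_distrib_left)
    also have "2 * norm d * (\<Sum>n\<in>X \<inter> I1. 1 / (norm (a n))\<^sup>2) \<le> 2 * norm d * (C2 / R)"
      using X R aR by (intro mult_left_mono C2(2)) auto
    also have "(\<Sum>n\<in>X \<inter> I1. if n \<in> near I a t then 3 / (1 + t) * of_bool (t \<ge> 1) else 0) \<le> 3 * K"
    proof (cases "t \<ge> 1")
      case True
      have "(\<Sum>n\<in>X \<inter> I1. if n \<in> near I a t then 3 / (1 + t) * of_bool (t \<ge> 1) else 0)
        = (\<Sum>n\<in>X \<inter> I1. if n \<in> near I a t then 3 / (1 + t) else 0)" using True by (intro sum.cong) auto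
      also have "\<dots> = (\<Sum>n\<in>(X \<inter> I1) \<inter> near I a t. 3 / (1 + t))" using X by (intro sum.inter_restrict[symmetric]) auto
      also have "\<dots> = card ((X \<inter> I1) \<inter> near I a t) * (3 / (1 + t))" by simp
      also have "\<dots> \<le> card (near I a t) * (3 / (1 + t))"
        using True by (intro mult_right_mono of_nat_mono card_mono K(2)) auto
      also have "\<dots> \<le> K * (1 + t) * (3 / (1 + t))" using True by (intro mult_right_mono K(3)) auto
      also have "\<dots> = 3 * K" using True by simp
      finally show ?thesis .
    next
      case False
      then have "(\<Sum>n\<in>X \<inter> I1. if n \<in> near I a t then 3 / (1 + t) * of_bool (t \<ge> 1) else 0) = 0"
        by (intro sum.neutral) auto
      then show ?thesis using K by simp
    qed
    also have "(\<Sum>n\<in>X \<inter> I1. if n \<in> near I a (t + norm d) then 8 / (1 + t + norm d) * of_bool (t \<ge> 0) else 0) \<le> 8 * K"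
    proof (cases "t \<ge> 0")
      case True
      have pos: "1 + t + norm d > 0" using True by (simp add: add_pos_nonneg)
      have "(\<Sum>n\<in>X \<inter> I1. if n \<in> near I a (t + norm d) then 8 / (1 + t + norm d) * of_bool (t \<ge> 0) else 0)
        = (\<Sum>n\<in>X \<inter> I1. if n \<in> near I a (t + norm d) then 8 / (1 + t + norm d) else 0)" using True by (intro sum.cong) auto
      also have "\<dots> = (\<Sum>n\<in>(X \<inter> I1) \<inter> near I a (t + norm d). 8 / (1 + t + norm d))" using X by (intro sum.inter_restrict[symmetric]) auto
      also have "\<dots> = card ((X \<inter> I1) \<inter> near I a (t + norm d)) * (8 / (1 + t + norm d))" by simp
      also have "\<dots> \<le> card (near I a (t + norm d)) * (8 / (1 + t + norm d))"
        using pos by (intro mult_right_mono of_nat_mono card_mono K(2)) auto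
      also have "\<dots> \<le> K * (1 + (t + norm d)) * (8 / (1 + t + norm d))" using True pos by (intro mult_right_mono K(3)) auto
      also have "\<dots> = 8 * K" using pos by (simp add: field_simps)
      finally show ?thesis .
    next
      case False
      then have "(\<Sum>n\<in>X \<inter> I1. if n \<in> near I a (t + norm d) then 8 / (1 + t + norm d) * of_bool (t \<ge> 0) else 0) = 0"
        by (intro sum.neutral) auto
      then show ?thesis using K by simp
    qed
    finally show ?thesis by (simp add: algebra_simps)
  qed
  show ?thesis
  proof (rule that)
    show "\<bar>lsum I (\<lambda>n. a n + d) t - lsum I a t\<bar> \<le> \<bar>C1 + 2 * norm d * C2 / R + 3 * K + 8 * K\<bar>" for t
      using main[of t] unfolding b_def by linarith
  qed simp
qed

section \<open>Canonical products of genus one and their logarithms\<close>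

definition fam :: "nat set \<Rightarrow> (nat \<Rightarrow> complex) \<Rightarrow> bool" where
  "fam I a \<longleftrightarrow> (\<forall>n\<in>I. a n \<noteq> 0) \<and> summable (\<lambda>n. if n \<in> I then 1 / (norm (a n))\<^sup>2 else 0)"

text \<open>Factors outside I are set to 1, so that every product runs over all naturals whatever
  the index set.\<close>

definition pfac :: "nat set \<Rightarrow> (nat \<Rightarrow> complex) \<Rightarrow> nat \<Rightarrow> complex \<Rightarrow> complex" where
  "pfac I a n z = (if n \<in> I then (1 - z / a n) * exp (z / a n) else 1)"

definition PP :: "nat set \<Rightarrow> (nat \<Rightarrow> complex) \<Rightarrow> complex \<Rightarrow> complex" where
  "PP I a z = (\<Prod>n. pfac I a n z)"

lemma fam_subset: "fam I a \<Longrightarrow> J \<subseteq> I \<Longrightarrow> fam J a"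
  unfolding fam_def by (auto elim!: summable_comparison_test'[where N = 0])

lemma fam_of_powr:
  assumes c: "c > 0" "\<And>n. n \<in> I \<Longrightarrow> norm (a n) \<ge> c" and p: "p \<le> 2"
    and s: "summable (\<lambda>n. if n \<in> I then norm (a n) powr (-p) else 0)"
  shows "fam I a"
  unfolding fam_def
proof (intro conjI ballI)
  show "a n \<noteq> 0" if "n \<in> I" for n using c(2)[OF that] c(1) by auto
  show "summable (\<lambda>n. if n \<in> I then 1 / (norm (a n))\<^sup>2 else 0)"
  proof (rule summable_comparison_test'[where N = 0])
    show "summable (\<lambda>n. c powr (p - 2) * (if n \<in> I then norm (a n) powr (-p) else 0))"
      by (rule summable_mult[OF s])
    fix n
    show "norm (if n \<in> I then 1 / (norm (a n))\<^sup>2 else 0) \<le> c powr (p - 2) * (if n \<in> I then norm (a n) powr (-p) else 0)"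
    proof (cases "n \<in> I")
      case True
      have pos: "norm (a n) > 0" using c(2)[OF True] c(1) by linarith
      have "1 / (norm (a n))\<^sup>2 = norm (a n) powr (p - 2) * norm (a n) powr (-p)"
      proof -
        have "norm (a n) powr (p - 2) * norm (a n) powr (-p) = norm (a n) powr (- 2)"
          unfolding powr_add[symmetric] by simp
        also have "\<dots> = 1 / (norm (a n))\<^sup>2" using pos by (simp add: powr_minus_divide powr_numeral)
        finally show ?thesis by simp
      qed
      also have "\<dots> \<le> c powr (p - 2) * norm (a n) powr (-p)"
        using c(2)[OF True] c(1) p by (intro mult_right_mono powr_mono2') auto
      finally show ?thesis using True by simp
    qed simp
  qed
qed

lemma fam_of_fin_dens:
  assumes "fin_dens I a" and c: "c > 0" "\<And>n. n \<in> I \<Longrightarrow> norm (a n) \<ge> c"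
  shows "fam I a"
  by (rule fam_of_powr[OF c, where p = 2]) (use fin_dens_summable[OF assms, where p = 2] in auto)

lemma fam_ev_large:
  assumes "fam I a"
  shows "\<forall>\<^sub>F n in sequentially. n \<in> I \<longrightarrow> norm (a n) \<ge> R"
proof -
  define r where "r = max R 1"
  have "(\<lambda>n. if n \<in> I then 1 / (norm (a n))\<^sup>2 else 0) \<longlonglongrightarrow> 0"
    using assms unfolding fam_def by (auto intro: summable_LIMSEQ_zero)
  then have "\<forall>\<^sub>F n in sequentially. (if n \<in> I then 1 / (norm (a n))\<^sup>2 else 0) < 1 / r\<^sup>2"
    by (rule order_tendstoD) (simp add: r_def)
  then show ?thesis
  proof eventually_elim
    case (elim n)
    show ?case
    proof
      assume n: "n \<in> I"
      then have "1 / (norm (a n))\<^sup>2 < 1 / r\<^sup>2" "norm (a n) > 0" using elim assms by (auto simp: fam_def)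
      then have "r\<^sup>2 < (norm (a n))\<^sup>2" by (simp add: r_def field_simps)
      then show "norm (a n) \<ge> R" by (smt (verit) power_mono r_def norm_ge_zero max.cobounded1 max.cobounded2)
    qed
  qed
qed

lemma fam_finite:
  assumes "fam I a"
  shows "finite (near I a t)"
proof -
  obtain N where "\<And>n. n \<ge> N \<Longrightarrow> n \<in> I \<Longrightarrow> norm (a n) \<ge> t + 1"
    using fam_ev_large[OF assms, of "t + 1"] unfolding eventually_sequentially by auto
  then have "near I a t \<subseteq> {..<N}" by (force simp: near_def not_le[symmetric])
  then show ?thesis using finite_subset by blast
qed

lemma fam_finite_fibre: "fam I a \<Longrightarrow> finite {n\<in>I. a n = z}"
  by (rule finite_subset[OF _ fam_finite[of I a "norm z"]]) (auto simp: near_def)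

lemma pfac_holomorphic:
  assumes "fam I a"
  shows "pfac I a n holomorphic_on A"
  using assms by (cases "n \<in> I") (auto simp: pfac_def[abs_def] fam_def intro!: holomorphic_intros)

lemma pfac_bound:
  assumes "n \<in> I \<Longrightarrow> 2 * norm z \<le> norm (a n)"
  shows "norm (pfac I a n z - 1) \<le> 3 * (norm z)\<^sup>2 * (if n \<in> I then 1 / (norm (a n))\<^sup>2 else 0)"
proof (cases "n \<in> I \<and> a n \<noteq> 0")
  case True
  then have "norm (z / a n) \<le> 1 / 2" using assms by (auto simp: norm_divide divide_simps)
  from weierstrass_factor_bound[OF this, of 1] True show ?thesis
    by (simp add: weierstrass_factor_def pfac_def norm_divide power_divide numeral_2_eq_2)
qed (auto simp: pfac_def)

lemma pfac_abs_convergent: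
  assumes "fam I a"
  shows "abs_convergent_prod (\<lambda>n. pfac I a n z)"
  unfolding abs_convergent_prod_conv_summable
proof (rule summable_comparison_test_ev)
  show "\<forall>\<^sub>F n in sequentially. norm (norm (pfac I a n z - 1)) \<le>
      3 * (norm z)\<^sup>2 * (if n \<in> I then 1 / (norm (a n))\<^sup>2 else 0)"
    using fam_ev_large[OF assms, of "2 * norm z"]
  proof eventually_elim
    case (elim n)
    then show ?case using pfac_bound[of n I z a] by simp
  qed
  show "summable (\<lambda>n. 3 * (norm z)\<^sup>2 * (if n \<in> I then 1 / (norm (a n))\<^sup>2 else 0))"
    using assms unfolding fam_def by (intro summable_mult) auto
qed

lemma PP_has_prod: "fam I a \<Longrightarrow> (\<lambda>n. pfac I a n z) has_prod PP I a z"
  unfolding PP_def by (intro convergent_prod_has_prod abs_convergent_prod_imp_convergent_prod pfac_abs_convergent)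

lemma PP_LIMSEQ:
  assumes "fam I a"
  shows "(\<lambda>N. \<Prod>n<N. pfac I a n z) \<longlonglongrightarrow> PP I a z"
proof -
  have "(\<lambda>N. \<Prod>n\<le>N. pfac I a n z) \<longlonglongrightarrow> PP I a z"
    unfolding PP_def by (intro convergent_prod_LIMSEQ abs_convergent_prod_imp_convergent_prod pfac_abs_convergent assms)
  then have "(\<lambda>N. \<Prod>n<Suc N. pfac I a n z) \<longlonglongrightarrow> PP I a z" by (simp add: lessThan_Suc_atMost)
  then show ?thesis by (subst (asm) filterlim_sequentially_Suc)
qed

lemma PP_eq_0_iff:
  assumes "fam I a"
  shows "PP I a z = 0 \<longleftrightarrow> (\<exists>n\<in>I. a n = z)"
proof -
  have "pfac I a n z = 0 \<longleftrightarrow> n \<in> I \<and> a n = z" for n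
    using assms by (auto simp: pfac_def fam_def divide_simps)
  then show ?thesis using has_prod_eq_0_iff[OF PP_has_prod[OF assms], of z] by (auto simp: image_iff)
qed

lemma PP_uniform_limit:
  assumes "fam I a"
  shows "uniform_limit (cball 0 R) (\<lambda>N z. \<Prod>n<N. pfac I a n z) (PP I a) sequentially"
proof -
  have "uniformly_convergent_on (cball 0 R) (\<lambda>N z. \<Prod>n<N. pfac I a n z)"
  proof (rule uniformly_convergent_on_prod')
    show "continuous_on (cball 0 R) (pfac I a n)" for n
      by (intro holomorphic_on_imp_continuous_on pfac_holomorphic assms)
    show "uniformly_convergent_on (cball 0 R) (\<lambda>N z. \<Sum>n<N. norm (pfac I a n z - 1))"
    proof (rule Weierstrass_m_test'_ev)
      show "\<forall>\<^sub>F n in sequentially. \<forall>z\<in>cball 0 R. norm (norm (pfac I a n z - 1)) \<le>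
         3 * R\<^sup>2 * (if n \<in> I then 1 / (norm (a n))\<^sup>2 else 0)"
        using fam_ev_large[OF assms, of "2 * R"]
      proof eventually_elim
        case (elim n)
        show ?case
        proof
          fix z :: complex assume z: "z \<in> cball 0 R"
          have "norm (pfac I a n z - 1) \<le> 3 * (norm z)\<^sup>2 * (if n \<in> I then 1 / (norm (a n))\<^sup>2 else 0)"
            using elim z by (intro pfac_bound) auto
          also have "\<dots> \<le> 3 * R\<^sup>2 * (if n \<in> I then 1 / (norm (a n))\<^sup>2 else 0)"
            using z by (intro mult_right_mono mult_left_mono power_mono) auto
          finally show "norm (norm (pfac I a n z - 1)) \<le> \<dots>" by simp
        qed
      qed
      show "summable (\<lambda>n. 3 * R\<^sup>2 * (if n \<in> I then 1 / (norm (a n))\<^sup>2 else 0))"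
        using assms unfolding fam_def by (intro summable_mult) auto
    qed
  qed auto
  then obtain g where g: "uniform_limit (cball 0 R) (\<lambda>N z. \<Prod>n<N. pfac I a n z) g sequentially"
    by (auto simp: uniformly_convergent_on_def)
  have "g z = PP I a z" if "z \<in> cball 0 R" for z
    using tendsto_uniform_limitI[OF g that] PP_LIMSEQ[OF assms, of z] LIMSEQ_unique by blast
  then show ?thesis using g by (subst uniform_limit_cong'[where g = "\<lambda>N z. \<Prod>n<N. pfac I a n z" and i = g]) auto
qed

lemma PP_holomorphic:
  assumes "fam I a"
  shows "PP I a holomorphic_on UNIV"
proof (rule holomorphic_uniform_sequence)
  show "(\<lambda>z. \<Prod>n<N. pfac I a n z) holomorphic_on UNIV" for N
    by (intro holomorphic_intros pfac_holomorphic assms)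
  fix z :: complex
  have "uniform_limit (cball z 1) (\<lambda>N z. \<Prod>n<N. pfac I a n z) (PP I a) sequentially"
    by (rule uniform_limit_on_subset[OF PP_uniform_limit[OF assms, of "norm z + 1"]])
      (simp add: cball_subset_cball_iff)
  then show "\<exists>d>0. cball z d \<subseteq> UNIV \<and> uniform_limit (cball z d) (\<lambda>N z. \<Prod>n<N. pfac I a n z) (PP I a) sequentially"
    by (intro exI[of _ 1]) auto
qed auto

lemma PP_split:
  assumes "fam I a" "finite F" "F \<subseteq> I"
  shows "PP I a z = (\<Prod>n\<in>F. (1 - z / a n) * exp (z / a n)) * PP (I - F) a z"
proof (rule LIMSEQ_unique[OF PP_LIMSEQ[OF assms(1)]])
  have "fam (I - F) a" using assms(1) by (rule fam_subset) auto
  then have "(\<lambda>N. (\<Prod>n\<in>F. (1 - z / a n) * exp (z / a n)) * (\<Prod>n<N. pfac (I - F) a n z))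
      \<longlonglongrightarrow> (\<Prod>n\<in>F. (1 - z / a n) * exp (z / a n)) * PP (I - F) a z"
    by (intro tendsto_intros PP_LIMSEQ)
  moreover have "\<forall>\<^sub>F N in sequentially. (\<Prod>n\<in>F. (1 - z / a n) * exp (z / a n)) * (\<Prod>n<N. pfac (I - F) a n z) = (\<Prod>n<N. pfac I a n z)"
    unfolding eventually_sequentially
  proof (intro exI[of _ "Suc (Max (insert 0 F))"] allI impI)
    fix N assume N: "Suc (Max (insert 0 F)) \<le> N"
    have "n < N" if "n \<in> F" for n
    proof -
      have "n \<le> Max (insert 0 F)" using that assms(2) by auto
      then show ?thesis using N by linarith
    qed
    then have sub: "F \<subseteq> {..<N}" by auto
    have "(\<Prod>n<N. pfac I a n z) = (\<Prod>n\<in>{..<N} - F. pfac I a n z) * (\<Prod>n\<in>F. pfac I a n z)"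
      by (rule prod.subset_diff[OF sub]) simp
    also have "(\<Prod>n\<in>F. pfac I a n z) = (\<Prod>n\<in>F. (1 - z / a n) * exp (z / a n))"
      using assms(3) by (intro prod.cong) (auto simp: pfac_def)
    also have "(\<Prod>n\<in>{..<N} - F. pfac I a n z) = (\<Prod>n\<in>{..<N} - F. pfac (I - F) a n z)"
      by (intro prod.cong) (auto simp: pfac_def)
    also have "\<dots> = (\<Prod>n<N. pfac (I - F) a n z)"
      by (rule prod.mono_neutral_left) (auto simp: pfac_def)
    finally show "(\<Prod>n\<in>F. (1 - z / a n) * exp (z / a n)) * (\<Prod>n<N. pfac (I - F) a n z) = (\<Prod>n<N. pfac I a n z)"
      by (simp add: mult.commute)
  qed
  ultimately show "(\<lambda>N. \<Prod>n<N. pfac I a n z) \<longlonglongrightarrow> (\<Prod>n\<in>F. (1 - z / a n) * exp (z / a n)) * PP (I - F) a z"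
    by (rule Lim_transform_eventually)
qed

lemma PP_nonzero_somewhere:
  assumes "fam I a"
  shows "PP I a 0 \<noteq> 0"
  using PP_eq_0_iff[OF assms] assms by (auto simp: fam_def)

text \<open>Finitely many points equal z; splitting off their factors leaves a product that does not
  vanish at z.\<close>

lemma PP_zero_count:
  assumes "fam I a"
  shows "zero_count (PP I a) z = enat (card {n\<in>I. a n = z})"
proof -
  define F where "F = {n\<in>I. a n = z}"
  have F: "finite F" "F \<subseteq> I" using fam_finite_fibre[OF assms] by (auto simp: F_def)
  have famF: "fam (I - F) a" using assms by (rule fam_subset) auto
  define q where "q w = (\<Prod>n\<in>F. - 1 / a n * exp (w / a n)) * PP (I - F) a w" for w
  have anz: "a n \<noteq> 0" if "n \<in> F" for n using that F assms by (auto simp: fam_def)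
  show ?thesis unfolding F_def[symmetric]
  proof (rule zero_count_factor)
    show "q holomorphic_on UNIV" unfolding q_def
      by (intro holomorphic_intros PP_holomorphic[OF famF]) (use anz in auto)
    show "q z \<noteq> 0" unfolding q_def using F(1) anz PP_eq_0_iff[OF famF] by (auto simp: F_def)
    fix w
    have "(\<Prod>n\<in>F. (1 - w / a n) * exp (w / a n)) = (\<Prod>n\<in>F. (w - z) * (- 1 / a n * exp (w / a n)))"
      by (intro prod.cong) (use anz in \<open>auto simp: F_def field_simps\<close>)
    also have "\<dots> = (w - z) ^ card F * (\<Prod>n\<in>F. - 1 / a n * exp (w / a n))"
      by (simp only: prod.distrib prod_constant)
    finally show "PP I a w = (w - z) ^ card F * q w"
      unfolding PP_split[OF assms F] q_def by (simp only: mult.assoc)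
  qed
qed

text \<open>A logarithm of the factor at the reflected point - z. With this sign
  \<open>1 + z / a\<close> avoids the cut of \<open>Ln\<close> whenever Re z > 0 and Re a >= 0, so
  that \<open>LL\<close> is a holomorphic logarithm of \<open>PP I a (- z)\<close> in the right
  half-plane.\<close>

definition LLt :: "nat set \<Rightarrow> (nat \<Rightarrow> complex) \<Rightarrow> nat \<Rightarrow> complex \<Rightarrow> complex" where
  "LLt I a n z = (if n \<in> I then Ln (1 + z / a n) - z / a n else 0)"

definition LL :: "nat set \<Rightarrow> (nat \<Rightarrow> complex) \<Rightarrow> complex \<Rightarrow> complex" where
  "LL I a z = (\<Sum>n. LLt I a n z)"

text \<open>\<open>LL1\<close>, \<open>LL2\<close> and \<open>LL3\<close> are the termwise first,
  second and third derivatives of \<open>LL\<close>. The genus-one subtraction survives in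
  \<open>LL1\<close> and is gone from \<open>LL2\<close> on; \<open>LL3\<close> is the quantity that
  the discretization controls.\<close>

definition LL1 :: "nat set \<Rightarrow> (nat \<Rightarrow> complex) \<Rightarrow> complex \<Rightarrow> complex" where
  "LL1 I a z = (\<Sum>n. if n \<in> I then 1 / (z + a n) - 1 / a n else 0)"

definition LL2 :: "nat set \<Rightarrow> (nat \<Rightarrow> complex) \<Rightarrow> complex \<Rightarrow> complex" where
  "LL2 I a z = (\<Sum>n. if n \<in> I then - 1 / (z + a n)^2 else 0)"

definition LL3 :: "nat set \<Rightarrow> (nat \<Rightarrow> complex) \<Rightarrow> complex \<Rightarrow> complex" where
  "LL3 I a z = (\<Sum>n. if n \<in> I then 2 / (z + a n)^3 else 0)"

lemma norm_Ln_minus_le: "norm u \<le> 1 / 2 \<Longrightarrow> norm (Ln (1 + u) - u) \<le> 2 * (norm u)\<^sup>2" for u :: complex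
proof -
  assume u: "norm u \<le> 1 / 2"
  then have "norm (Ln (1 + u) - u) \<le> (norm u)\<^sup>2 / (1 - norm u)" by (intro Ln_approx_linear) auto
  also have "\<dots> \<le> (norm u)\<^sup>2 / (1 / 2)" using u by (intro divide_left_mono) auto
  finally show ?thesis by simp
qed

lemma LLt_bound:
  assumes "n \<in> I \<Longrightarrow> 2 * norm z \<le> norm (a n)"
  shows "norm (LLt I a n z) \<le> 2 * (norm z)\<^sup>2 * (if n \<in> I then 1 / (norm (a n))\<^sup>2 else 0)"
proof (cases "n \<in> I \<and> a n \<noteq> 0")
  case True
  then have "norm (z / a n) \<le> 1 / 2" using assms by (auto simp: norm_divide divide_simps)
  from norm_Ln_minus_le[OF this] True show ?thesis
    by (simp add: LLt_def norm_divide power_divide)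
qed (auto simp: LLt_def)

text \<open>Domination of the terms by a multiple of 1 / |a n|^2 for large |a n| gives locally
  uniform convergence, and for holomorphic functions this carries over to the derivatives. Applied
  three times, along \<open>LL\<close>, \<open>LL1\<close> and \<open>LL2\<close>.\<close>

lemma series_deriv:
  fixes t t' :: "nat \<Rightarrow> complex \<Rightarrow> complex"
  assumes fam: "fam I a" and S: "open S" and der: "\<And>n x. x \<in> S \<Longrightarrow> (t n has_field_derivative t' n x) (at x)"
    and bound: "\<And>n z R. norm z \<le> R \<Longrightarrow> 2 * R \<le> norm (a n) \<Longrightarrow> n \<in> I \<Longrightarrow> norm (t n z) \<le> B R * (1 / (norm (a n))\<^sup>2)"
    and zero: "\<And>n z. n \<notin> I \<Longrightarrow> t n z = 0"
    and x: "x \<in> S"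
  shows "summable (\<lambda>n. t n x)" "summable (\<lambda>n. t' n x)"
    "((\<lambda>z. \<Sum>n. t n z) has_field_derivative (\<Sum>n. t' n x)) (at x)"
proof -
  have "\<exists>g g'. \<forall>x\<in>S. ((\<lambda>n. t n x) sums g x) \<and> ((\<lambda>n. t' n x) sums g' x) \<and> (g has_field_derivative g' x) (at x)"
  proof (rule series_and_derivative_comparison_local[OF S der])
    fix x assume "x \<in> S"
    define R where "R = norm x + 1"
    have "\<forall>\<^sub>F n in sequentially. \<forall>y\<in>ball x 1 \<inter> S. norm (t n y) \<le> B R * (if n \<in> I then 1 / (norm (a n))\<^sup>2 else 0)"
      using fam_ev_large[OF fam, of "2 * R"]
    proof eventually_elim
      case (elim n)
      show ?case
      proof
        fix y assume "y \<in> ball x 1 \<inter> S"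
        then have "norm y \<le> R" using norm_triangle_ineq2[of y x] by (auto simp: R_def dist_norm norm_minus_commute)
        then show "norm (t n y) \<le> B R * (if n \<in> I then 1 / (norm (a n))\<^sup>2 else 0)"
          using elim bound[of y R n] zero[of n y] by auto
      qed
    qed
    moreover have "summable (\<lambda>n. B R * (if n \<in> I then 1 / (norm (a n))\<^sup>2 else 0))"
      using fam unfolding fam_def by (intro summable_mult) auto
    ultimately show "\<exists>d h. 0 < d \<and> summable h \<and> (\<forall>\<^sub>F n in sequentially. \<forall>y\<in>ball x d \<inter> S. norm (t n y) \<le> h n)"
      by (intro exI[of _ 1] exI[of _ "\<lambda>n. B R * (if n \<in> I then 1 / (norm (a n))\<^sup>2 else 0)"]) auto
  qed
  then obtain g g' where g: "\<And>x. x \<in> S \<Longrightarrow> ((\<lambda>n. t n x) sums g x) \<and> ((\<lambda>n. t' n x) sums g' x) \<and> (g has_field_derivative g' x) (at x)"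
    by blast
  show "summable (\<lambda>n. t n x)" "summable (\<lambda>n. t' n x)" using g[OF x] by (auto simp: sums_iff)
  have "(g has_field_derivative g' x) (at x)" using g[OF x] by auto
  then have "((\<lambda>z. \<Sum>n. t n z) has_field_derivative g' x) (at x)"
    by (rule DERIV_cong_ev[OF refl _ refl, THEN iffD1, rotated])
      (use g S x in \<open>auto simp: eventually_nhds sums_iff intro!: exI[of _ S]\<close>)
  then show "((\<lambda>z. \<Sum>n. t n z) has_field_derivative (\<Sum>n. t' n x)) (at x)"
    using g[OF x] by (simp add: sums_iff)
qed

lemma half_plane_nonneg_Reals:
  assumes "a \<noteq> 0" "Re a \<ge> \<delta>" "\<delta> \<ge> 0" "Re z > - \<delta>"
  shows "1 + z / a \<notin> \<real>\<^sub>\<le>\<^sub>0" "z + a \<noteq> 0"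
proof -
  show nz: "z + a \<noteq> 0" using assms by (auto simp: complex_eq_iff)
  show "1 + z / a \<notin> \<real>\<^sub>\<le>\<^sub>0"
  proof
    assume "1 + z / a \<in> \<real>\<^sub>\<le>\<^sub>0"
    then obtain t where t: "1 + z / a = of_real t" "t \<le> 0" by (auto elim!: nonpos_Reals_cases)
    then have "z = of_real (t - 1) * a" using assms(1) by (simp add: field_simps)
    then have "Re z = (t - 1) * Re a" by simp
    also have "\<dots> \<le> (-1) * Re a" using t assms by (intro mult_right_mono) auto
    finally show False using assms by simp
  qed
qed

lemma norm_add_ge_half:
  assumes "norm z \<le> R" "2 * R \<le> norm (w :: complex)"
  shows "norm (z + w) \<ge> norm w / 2"
proof -
  have "norm w - norm z \<le> norm (z + w)" by (metis add.commute norm_diff_ineq)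
  then show ?thesis using assms by linarith
qed

context
  fixes I :: "nat set" and a :: "nat \<Rightarrow> complex" and \<delta> :: real
  assumes fam: "fam I a" and \<delta>: "\<delta> \<ge> 0" and Re: "\<And>n. n \<in> I \<Longrightarrow> Re (a n) \<ge> \<delta>"
begin

lemma LL_aux_nz:
  assumes "n \<in> I" "Re z > - \<delta>"
  shows "a n \<noteq> 0" "1 + z / a n \<notin> \<real>\<^sub>\<le>\<^sub>0" "z + a n \<noteq> 0"
  using half_plane_nonneg_Reals[of "a n" \<delta> z] fam Re \<delta> assms by (auto simp: fam_def)

lemma open_right_plane: "open {z. Re z > - \<delta>}"
  by (rule open_halfspace_Re_gt)

text \<open>With \<delta> = 1, for families of real parts at least 1, the imaginary axis is interior
  to the domain; \<delta> = 0 admits families that lie on the axis.\<close>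

lemma LL_deriv:
  assumes z: "Re z > - \<delta>"
  shows "summable (\<lambda>n. LLt I a n z)" "summable (\<lambda>n. if n \<in> I then 1 / (z + a n) - 1 / a n else 0)"
    "(LL I a has_field_derivative LL1 I a z) (at z)"
proof -
  have der: "(LLt I a n has_field_derivative (if n \<in> I then 1 / (x + a n) - 1 / a n else 0)) (at x)"
    if x: "x \<in> {z. Re z > - \<delta>}" for n x
  proof (cases "n \<in> I")
    case True
    note nz = LL_aux_nz[OF True, of x]
    have an: "a n \<noteq> 0" "x + a n \<noteq> 0" using nz(1,3) x by simp_all
    have 1: "((\<lambda>z. 1 + z / a n) has_field_derivative 1 / a n) (at x)"
      using an by (auto intro!: derivative_eq_intros)
    have 2: "(Ln has_field_derivative inverse (1 + x / a n)) (at (1 + x / a n))"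
      using nz x by (intro has_field_derivative_Ln) auto
    have 3: "((\<lambda>z. z / a n) has_field_derivative 1 / a n) (at x)"
      using an by (auto intro!: derivative_eq_intros)
    have "1 + x / a n = (x + a n) / a n" using an by (simp add: add_divide_distrib)
    with an have "inverse (1 + x / a n) * (1 / a n) = 1 / (x + a n)" by simp
    then have "((\<lambda>z. Ln (1 + z / a n) - z / a n) has_field_derivative (1 / (x + a n) - 1 / a n)) (at x)"
      using DERIV_diff[OF DERIV_chain2[OF 2 1] 3] by simp
    then show ?thesis using True by (simp add: LLt_def[abs_def])
  qed (simp add: LLt_def[abs_def])
  have bd: "norm (LLt I a n z) \<le> 2 * R\<^sup>2 * (1 / (norm (a n))\<^sup>2)"
    if "norm z \<le> R" "2 * R \<le> norm (a n)" "n \<in> I" for n z R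
  proof -
    have "norm (LLt I a n z) \<le> 2 * (norm z)\<^sup>2 * (1 / (norm (a n))\<^sup>2)" using LLt_bound[of n I z a] that by auto
    also have "\<dots> \<le> 2 * R\<^sup>2 * (1 / (norm (a n))\<^sup>2)"
      using that by (intro mult_right_mono mult_left_mono power_mono) auto
    finally show ?thesis .
  qed
  have z': "z \<in> {z. Re z > - \<delta>}" using z by simp
  note sd = series_deriv[where t = "LLt I a" and t' = "\<lambda>n x. if n \<in> I then 1 / (x + a n) - 1 / a n else 0"
      and B = "\<lambda>R. 2 * R\<^sup>2", OF fam open_right_plane der bd _ z']
  show "summable (\<lambda>n. LLt I a n z)" by (rule sd(1)) (auto simp: LLt_def)
  show "summable (\<lambda>n. if n \<in> I then 1 / (z + a n) - 1 / a n else 0)" by (rule sd(2)) (auto simp: LLt_def)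
  show "(LL I a has_field_derivative LL1 I a z) (at z)"
    unfolding LL_def[abs_def] LL1_def by (rule sd(3)) (auto simp: LLt_def)
qed

lemma LL1_deriv:
  assumes z: "Re z > - \<delta>"
  shows "summable (\<lambda>n. if n \<in> I then - 1 / (z + a n)^2 else 0)"
    "(LL1 I a has_field_derivative LL2 I a z) (at z)"
proof -
  define t where "t = (\<lambda>n x. if n \<in> I then 1 / (x + a n) - 1 / a n else 0)"
  have der: "(t n has_field_derivative (if n \<in> I then - 1 / (x + a n)^2 else 0)) (at x)"
    if x: "x \<in> {z. Re z > - \<delta>}" for n x
  proof (cases "n \<in> I")
    case True
    note nz = LL_aux_nz[OF True, of x]
    have "((\<lambda>z. 1 / (z + a n) - 1 / a n) has_field_derivative (- 1 / (x + a n)^2)) (at x)"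
      using nz x by (auto intro!: derivative_eq_intros simp: power2_eq_square)
    then show ?thesis using True by (simp add: t_def)
  qed (simp add: t_def)
  have bd: "norm (t n z) \<le> (2 * R) * (1 / (norm (a n))\<^sup>2)"
    if "norm z \<le> R" "2 * R \<le> norm (a n)" "n \<in> I" for n z R
  proof -
    have an: "a n \<noteq> 0" using that fam by (auto simp: fam_def)
    have ge: "norm (z + a n) \<ge> norm (a n) / 2" by (rule norm_add_ge_half[OF that(1,2)])
    moreover have "norm (a n) > 0" using an by simp
    ultimately have "norm (z + a n) > 0" by linarith
    then have nz: "z + a n \<noteq> 0" by auto
    have "t n z = - z / ((z + a n) * a n)" using that an nz by (simp add: t_def divide_simps)
    then have "norm (t n z) = norm z / (norm (z + a n) * norm (a n))" by (simp add: norm_divide norm_mult)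
    also have "\<dots> \<le> R / (norm (a n) / 2 * norm (a n))"
      using that ge an by (intro frac_le mult_right_mono mult_pos_pos) (auto intro: order_trans[OF norm_ge_zero])
    finally show ?thesis by (simp add: power2_eq_square mult.commute)
  qed
  have z': "z \<in> {z. Re z > - \<delta>}" using z by simp
  note sd = series_deriv[where t = t and t' = "\<lambda>n x. if n \<in> I then - 1 / (x + a n)^2 else 0"
      and B = "\<lambda>R. 2 * R", OF fam open_right_plane der bd _ z']
  show "summable (\<lambda>n. if n \<in> I then - 1 / (z + a n)^2 else 0)" by (rule sd(2)) (auto simp: t_def)
  have "LL1 I a = (\<lambda>z. \<Sum>n. t n z)" by (auto simp: LL1_def t_def)
  then show "(LL1 I a has_field_derivative LL2 I a z) (at z)"
    unfolding LL2_def using sd(3) by (auto simp: t_def)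
qed

lemma LL2_deriv:
  assumes z: "Re z > - \<delta>"
  shows "summable (\<lambda>n. if n \<in> I then 2 / (z + a n)^3 else 0)"
    "(LL2 I a has_field_derivative LL3 I a z) (at z)"
proof -
  define t where "t = (\<lambda>n x. if n \<in> I then - 1 / (x + a n)^2 else 0)"
  have der: "(t n has_field_derivative (if n \<in> I then 2 / (x + a n)^3 else 0)) (at x)"
    if x: "x \<in> {z. Re z > - \<delta>}" for n x
  proof (cases "n \<in> I")
    case True
    note nz = LL_aux_nz[OF True, of x]
    have "((\<lambda>z. - 1 / (z + a n)^2) has_field_derivative (2 / (x + a n)^3)) (at x)"
    proof -
      have "2 * (x + a n) / ((x + a n)\<^sup>2)\<^sup>2 = 2 / (x + a n)^3"
      proof -
        have "2 * y / (y\<^sup>2)\<^sup>2 = 2 / y^3" if "y \<noteq> 0" for y :: complex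
          using that by (simp add: power2_eq_square power3_eq_cube)
        then show ?thesis using nz x by blast
      qed
      moreover have "- ((- (2 * x) - 2 * a n) / D) = (2 * x + 2 * a n) / D" for D
        unfolding minus_divide_left by simp
      ultimately show ?thesis using nz x
        by (auto intro!: derivative_eq_intros simp: power2_eq_square)
    qed
    then show ?thesis using True by (simp add: t_def)
  qed (simp add: t_def)
  have bd: "norm (t n z) \<le> 4 * (1 / (norm (a n))\<^sup>2)"
    if "norm z \<le> R" "2 * R \<le> norm (a n)" "n \<in> I" for n z R
  proof -
    have an: "a n \<noteq> 0" using that fam by (auto simp: fam_def)
    have ge: "norm (z + a n) \<ge> norm (a n) / 2" by (rule norm_add_ge_half[OF that(1,2)])
    have "norm (t n z) = 1 / (norm (z + a n))\<^sup>2" using that by (simp add: t_def norm_divide norm_power)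
    also have "\<dots> \<le> 1 / (norm (a n) / 2)\<^sup>2"
    proof (intro divide_left_mono power_mono ge mult_pos_pos zero_less_power)
      have "norm (a n) > 0" using an by simp
      then show "0 < norm (z + a n)" "0 < norm (a n) / 2" using ge by linarith+
    qed auto
    finally show ?thesis by (simp add: power_divide)
  qed
  have z': "z \<in> {z. Re z > - \<delta>}" using z by simp
  note sd = series_deriv[where t = t and t' = "\<lambda>n x. if n \<in> I then 2 / (x + a n)^3 else 0"
      and B = "\<lambda>R. 4", OF fam open_right_plane der bd _ z']
  show "summable (\<lambda>n. if n \<in> I then 2 / (z + a n)^3 else 0)" by (rule sd(2)) (auto simp: t_def)
  have "LL2 I a = (\<lambda>z. \<Sum>n. t n z)" by (auto simp: LL2_def t_def)
  then show "(LL2 I a has_field_derivative LL3 I a z) (at z)"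
    unfolding LL3_def using sd(3) by (auto simp: t_def)
qed

lemma exp_LL:
  assumes z: "Re z > - \<delta>"
  shows "exp (LL I a z) = PP I a (- z)"
proof (rule LIMSEQ_unique)
  have "(\<lambda>N. \<Sum>n<N. LLt I a n z) \<longlonglongrightarrow> LL I a z"
    unfolding LL_def using LL_deriv(1)[OF z] by (rule summable_LIMSEQ)
  then show "(\<lambda>N. exp (\<Sum>n<N. LLt I a n z)) \<longlonglongrightarrow> exp (LL I a z)" by (intro tendsto_intros)
  have "exp (LLt I a n z) = pfac I a n (- z)" for n
  proof (cases "n \<in> I")
    case True
    then have "1 + z / a n \<noteq> 0" using LL_aux_nz[OF True z] by auto
    then show ?thesis using True by (simp add: LLt_def pfac_def exp_diff exp_minus field_simps)
  qed (simp add: LLt_def pfac_def)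
  then show "(\<lambda>N. exp (\<Sum>n<N. LLt I a n z)) \<longlonglongrightarrow> PP I a (- z)"
    using PP_LIMSEQ[OF fam, of "- z"] by (simp add: exp_sum)
qed

end

section \<open>Zero densities and the minimum modulus\<close>

lemma continuous_x_ln_abs: "continuous_on A (\<lambda>x::real. x * ln \<bar>x\<bar>)"
proof (intro continuous_at_imp_continuous_on ballI)
  fix x :: real
  show "isCont (\<lambda>x. x * ln \<bar>x\<bar>) x"
  proof (cases "x = 0")
    case True
    have "((\<lambda>x::real. x * ln \<bar>x\<bar>) \<longlongrightarrow> 0) (at 0)" by real_asymp
    then show ?thesis using True by (simp add: isCont_def)
  qed (auto intro!: continuous_intros)
qed

lemma abs_x_ln_abs_le:
  assumes "\<bar>x\<bar> \<le> (2::real)"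
  shows "\<bar>x * ln \<bar>x\<bar>\<bar> \<le> 2"
proof -
  consider "x = 0" | "0 < \<bar>x\<bar>" "\<bar>x\<bar> \<le> 1" | "\<bar>x\<bar> > 1" by linarith
  then show ?thesis
  proof cases
    case 2
    have "ln (1 / \<bar>x\<bar>) \<le> 1 / \<bar>x\<bar> - 1" using 2 by (intro ln_le_minus_one) auto
    then have "- ln \<bar>x\<bar> \<le> 1 / \<bar>x\<bar> - 1" using 2 by (simp add: ln_div)
    then have "\<bar>x\<bar> * (- ln \<bar>x\<bar>) \<le> \<bar>x\<bar> * (1 / \<bar>x\<bar> - 1)" by (rule mult_left_mono) simp
    also have "\<dots> \<le> 1" using 2 by (simp add: field_simps)
    finally have "\<bar>x\<bar> * (- ln \<bar>x\<bar>) \<le> 1" .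
    moreover have "ln \<bar>x\<bar> \<le> 0" using 2 by simp
    ultimately show ?thesis by (simp add: abs_mult)
  next
    case 3
    have "0 \<le> ln \<bar>x\<bar>" using 3 by simp
    have "ln \<bar>x\<bar> \<le> 1" using ln_le_minus_one[of "\<bar>x\<bar>"] 3 assms by linarith
    with \<open>0 \<le> ln \<bar>x\<bar>\<close>    have "\<bar>x\<bar> * ln \<bar>x\<bar> \<le> 2 * 1" using assms by (intro mult_mono) auto
    then show ?thesis using \<open>0 \<le> ln \<bar>x\<bar>\<close> by (simp add: abs_mult)
  qed auto
qed

text \<open>The antiderivative (u - t) ln |u - t| - u extends continuously over u = t, so the
  logarithmic singularity costs a bounded amount, uniformly in its position.\<close>

lemma integral_ln_dist:
  fixes t :: real
  obtains S where "((\<lambda>u. ln \<bar>u - t\<bar>) has_integral S) {1..2}" "S \<ge> -8"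
proof -
  define \<Phi> where "\<Phi> u = (u - t) * ln \<bar>u - t\<bar> - u" for u
  have cont: "continuous_on {1..2} \<Phi>"
  proof -
    have "continuous_on {1..2} (\<lambda>u. (u - t) * ln \<bar>u - t\<bar>)"
      using continuous_on_compose2[OF continuous_x_ln_abs[of UNIV], of "{1..2}" "\<lambda>u. u - t"]
      by (simp add: continuous_on_diff)
    then show ?thesis unfolding \<Phi>_def by (intro continuous_on_diff continuous_on_id)
  qed
  have der: "(\<Phi> has_vector_derivative ln \<bar>u - t\<bar>) (at u)" if "u \<in> {1<..<2} - {t}" for u
  proof -
    have "((\<lambda>u. ln \<bar>u - t\<bar>) has_real_derivative 1 / (u - t)) (at u)"
    proof (cases "u > t")
      case True
      have "((\<lambda>u. ln (u - t)) has_real_derivative 1 / (u - t)) (at u)"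
        using True by (auto intro!: derivative_eq_intros)
      then show ?thesis
        by (rule DERIV_cong_ev[OF refl _ refl, THEN iffD1, rotated])
          (use True in \<open>auto simp: eventually_nhds intro!: exI[of _ "{t<..}"]\<close>)
    next
      case False
      then have "u < t" using that by auto
      have "((\<lambda>u. ln (t - u)) has_real_derivative 1 / (u - t)) (at u)"
        using \<open>u < t\<close> by (auto intro!: derivative_eq_intros simp: field_simps)
      then show ?thesis
        by (rule DERIV_cong_ev[OF refl _ refl, THEN iffD1, rotated])
          (use \<open>u < t\<close> in \<open>auto simp: eventually_nhds intro!: exI[of _ "{..<t}"]\<close>)
    qed
    from this have "(\<Phi> has_real_derivative 1 * ln \<bar>u - t\<bar> + 1 / (u - t) * (u - t) - 1) (at u)"
      unfolding \<Phi>_def by (intro DERIV_diff DERIV_mult) (auto intro!: derivative_eq_intros)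
    then show ?thesis using that by (simp add: has_real_derivative_iff_has_vector_derivative)
  qed
  have int: "((\<lambda>u. ln \<bar>u - t\<bar>) has_integral (\<Phi> 2 - \<Phi> 1)) {1..2}"
    by (rule fundamental_theorem_of_calculus_interior_strong[where S = "{t}"]) (use cont der in auto)
  show ?thesis
  proof (cases "0 \<le> t \<and> t \<le> 3")
    case True
    have "\<bar>(2 - t) * ln \<bar>2 - t\<bar>\<bar> \<le> 2" "\<bar>(1 - t) * ln \<bar>1 - t\<bar>\<bar> \<le> 2"
      using True by (auto intro!: abs_x_ln_abs_le)
    then have "\<Phi> 2 - \<Phi> 1 \<ge> -8" by (simp add: \<Phi>_def)
    then show ?thesis using int that by blast
  next
    \<comment> \<open>Here |u - t| >= 1 on the whole interval, so the integrand is
      nonnegative.\<close>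
    case False
    have "0 \<le> \<Phi> 2 - \<Phi> 1"
      by (rule has_integral_nonneg[OF int]) (use False in auto)
    then show ?thesis using int that[of "\<Phi> 2 - \<Phi> 1"] by simp
  qed
qed

text \<open>A mean value argument: the average of the sum over [1, 2] is at least -8 per point, so
  the sum cannot stay below this bound minus 1 everywhere off the finite set of the t j.\<close>

lemma good_radius_unit:
  fixes t :: "'i \<Rightarrow> real"
  assumes F: "finite F"
  obtains u where "1 \<le> u" "u \<le> 2" "\<And>j. j \<in> F \<Longrightarrow> u \<noteq> t j"
    "(\<Sum>j\<in>F. ln \<bar>u - t j\<bar>) \<ge> - 8 * real (card F) - 1"
proof -
  have "\<exists>S. \<forall>j. ((\<lambda>u. ln \<bar>u - t j\<bar>) has_integral S j) {1..2} \<and> S j \<ge> -8"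
    by (intro choice allI) (metis integral_ln_dist)
  then obtain S where S: "\<And>j. ((\<lambda>u. ln \<bar>u - t j\<bar>) has_integral S j) {1..2}" "\<And>j. S j \<ge> -8" by blast
  define g where "g u = (\<Sum>j\<in>F. ln \<bar>u - t j\<bar>)" for u
  have int: "(g has_integral (\<Sum>j\<in>F. S j)) {1..2}"
    unfolding g_def using F S by (intro has_integral_sum) auto
  define k where "k = - 8 * real (card F)"
  have k: "(\<Sum>j\<in>F. S j) \<ge> k"
    using sum_mono[of F "\<lambda>_. -8" S] S by (simp add: k_def)
  note obt = that
  show ?thesis
  proof (rule ccontr)
    assume contra: "\<not> thesis"
    have less: "g u < k - 1" if "u \<in> {1..2}" "u \<notin> t ` F" for u
    proof (rule ccontr)
      assume "\<not> g u < k - 1"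
      then have "g u \<ge> k - 1" by simp
      then show False using obt[of u] that contra unfolding g_def k_def by auto
    qed
    \<comment> \<open>At u = t j a summand is \<open>ln 0 = 0\<close>, a default value that says
      nothing about nearby radii. On this finite set g is overwritten, which leaves the integral
      unchanged.\<close>
    define g' where "g' u = (if u \<in> t ` F then k - 1 else g u)" for u
    have "(g' has_integral (\<Sum>j\<in>F. S j)) {1..2}"
      by (rule has_integral_spike_finite[OF _ _ int, of "t ` F"]) (use F in \<open>auto simp: g'_def\<close>)
    moreover have "((\<lambda>u::real. k - 1) has_integral (k - 1) * (2 - 1)) {1..2}"
      using has_integral_const_real[of "k - 1" 1 2] by simp
    ultimately have "(\<Sum>j\<in>F. S j) \<le> (k - 1) * (2 - 1)"
      by (rule has_integral_le) (use less in \<open>force simp: g'_def\<close>)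
    then show False using k by simp
  qed
qed

text \<open>The previous choice scaled by R. The factor 10 makes every logarithm nonnegative in the
  applications, where 0 <= t j <= 9 R and r <= 2 R, so that terms may be added or dropped; 18 covers
  8 plus the crude bound ln 10 <= 9.\<close>

lemma good_radius:
  fixes t :: "'i \<Rightarrow> real"
  assumes F: "finite F" and R: "R > 0"
  obtains r where "R \<le> r" "r \<le> 2 * R" "\<And>j. j \<in> F \<Longrightarrow> r \<noteq> t j"
    "(\<Sum>j\<in>F. ln (10 * R / \<bar>r - t j\<bar>)) \<le> 18 * real (card F) + 1"
proof -
  obtain u where u: "1 \<le> u" "u \<le> 2" "\<And>j. j \<in> F \<Longrightarrow> u \<noteq> t j / R"
    "(\<Sum>j\<in>F. ln \<bar>u - t j / R\<bar>) \<ge> - 8 * real (card F) - 1"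
    using good_radius_unit[OF F, of "\<lambda>j. t j / R"] by blast
  have eq: "ln (10 * R / \<bar>R * u - t j\<bar>) = ln 10 - ln \<bar>u - t j / R\<bar>" if "j \<in> F" for j
  proof -
    have "R * u - t j = R * (u - t j / R)" using R by (simp add: field_simps)
    then have "10 * R / \<bar>R * u - t j\<bar> = 10 / \<bar>u - t j / R\<bar>" using R by (simp add: abs_mult)
    then show ?thesis using u(3)[OF that] by (simp add: ln_div)
  qed
  show ?thesis
  proof (rule that[of "R * u"])
    show "R \<le> R * u" "R * u \<le> 2 * R" using R u by auto
    show "R * u \<noteq> t j" if "j \<in> F" for j using u(3)[OF that] R by (auto simp: field_simps)
    have "ln 10 \<le> (9::real)" using ln_le_minus_one[of "10::real"] by simp
    then have "ln 10 * real (card F) \<le> 9 * real (card F)" by (rule mult_right_mono) simp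
    moreover have "(\<Sum>j\<in>F. ln (10 * R / \<bar>R * u - t j\<bar>)) = ln 10 * real (card F) - (\<Sum>j\<in>F. ln \<bar>u - t j / R\<bar>)"
      using eq by (simp add: sum_subtractf mult.commute)
    ultimately show "(\<Sum>j\<in>F. ln (10 * R / \<bar>R * u - t j\<bar>)) \<le> 18 * real (card F) + 1" using u(4) by linarith
  qed
qed

section \<open>Blaschke factors of discs, Jensen's inequality and lower bounds on circles\<close>

lemma norm_reflect_circle:
  assumes "norm z = \<rho>"
  shows "norm (of_real (\<rho>\<^sup>2) - cnj a * z) = \<rho> * norm (z - a)"
proof -
  have "of_real (\<rho>\<^sup>2) = z * cnj z" using complex_norm_square[of z] assms by simp
  then have "of_real (\<rho>\<^sup>2) - cnj a * z = z * cnj (z - a)" by (simp add: algebra_simps)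
  then show ?thesis using assms by (simp add: norm_mult del: complex_cnj_diff)
qed

lemma reflect_nonzero:
  assumes "norm a < \<rho>" "norm z \<le> \<rho>"
  shows "of_real (\<rho>\<^sup>2) - cnj a * z \<noteq> (0::complex)"
proof
  assume "of_real (\<rho>\<^sup>2) - cnj a * z = 0"
  then have "norm (complex_of_real (\<rho>\<^sup>2)) = norm (cnj a * z)" by simp
  then have "\<rho>\<^sup>2 = norm a * norm z" by (simp add: norm_mult del: of_real_power)
  also have "\<dots> \<le> norm a * \<rho>" using assms by (intro mult_left_mono) auto
  also have "\<dots> < \<rho> * \<rho>"
  proof (rule mult_strict_right_mono)
    show "0 < \<rho>" using assms(1) norm_ge_zero[of a] by linarith
  qed (rule assms)
  also have "\<dots> = \<rho>\<^sup>2" by (simp add: power2_eq_square)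
  finally show False by simp
qed

text \<open>Each factor z - a is traded for (\<rho>^2 - cnj a z) / \<rho>, which has the same
  modulus on the circle; the maximum principle carries the bound for g into the disc.\<close>

lemma blaschke_disc_bound:
  fixes a :: "'i \<Rightarrow> complex"
  assumes F: "finite F" and q: "q holomorphic_on UNIV" "\<And>z. g z = (\<Prod>n\<in>F. z - a n) * q z"
    and \<rho>: "\<rho> > 0"
    and M: "\<And>z. norm z = \<rho> \<Longrightarrow> norm (g z) \<le> M" and z: "norm z \<le> \<rho>"
  shows "norm (q z * (\<Prod>n\<in>F. (of_real (\<rho>\<^sup>2) - cnj (a n) * z) / of_real \<rho>)) \<le> M"
proof -
  let ?G = "\<lambda>z. q z * (\<Prod>n\<in>F. (of_real (\<rho>\<^sup>2) - cnj (a n) * z) / of_real \<rho>)"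
  have hol: "?G holomorphic_on UNIV" using \<rho> by (intro holomorphic_intros q) auto
  have "norm (?G w) \<le> M" if w: "norm w = \<rho>" for w
  proof -
    have "norm ((of_real (\<rho>\<^sup>2) - cnj (a n) * w) / of_real \<rho>) = norm (w - a n)" for n
      using norm_reflect_circle[OF w, of "a n"] \<rho> by (simp add: norm_divide)
    then have "norm (?G w) = norm (g w)"
      unfolding q(2) norm_mult prod_norm[symmetric] by (simp add: mult.commute)
    then show ?thesis using M[OF w] by simp
  qed
  moreover have "?G holomorphic_on interior (cball 0 \<rho>)" "continuous_on (closure (cball 0 \<rho>)) ?G"
    using hol by (auto intro: holomorphic_on_subset holomorphic_on_imp_continuous_on simp del: of_real_power)
  ultimately show ?thesis
    using maximum_modulus_frontier[of ?G "cball 0 \<rho>" M z] z \<rho> by (simp del: of_real_power)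
qed

text \<open>Jensen's inequality at the origin with the circle of radius 2 t: for a zero of modulus
  at most t the traded factor has modulus 2 t at 0, at least twice |a|.\<close>

lemma jensen_finite_count:
  fixes a :: "'i \<Rightarrow> complex"
  assumes g: "g holomorphic_on UNIV" "g 0 \<noteq> 0" and K: "\<And>z. norm (g z) \<le> exp (K * (1 + norm z))"
    and F: "finite F" "\<And>z. vanishes g z (card {n\<in>F. a n = z})" "\<And>n. n \<in> F \<Longrightarrow> norm (a n) \<le> t" and t: "t > 0"
  shows "real (card F) * ln 2 \<le> K * (1 + 2 * t) - ln (norm (g 0))"
proof -
  obtain q where q: "q holomorphic_on UNIV" "\<And>z. g z = (\<Prod>n\<in>F. z - a n) * q z"
    using entire_divide_finite[OF g(1) F(1,2)] by blast
  define \<rho> where "\<rho> = 2 * t"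
  have \<rho>: "\<rho> > 0" using t by (simp add: \<rho>_def)
  have "norm (q 0 * (\<Prod>n\<in>F. (of_real (\<rho>\<^sup>2) - cnj (a n) * 0) / of_real \<rho>)) \<le> exp (K * (1 + \<rho>))"
    by (rule blaschke_disc_bound[OF F(1) q \<rho>]) (use K \<rho> in \<open>force+\<close>)
  then have 1: "norm (q 0) * \<rho> ^ card F \<le> exp (K * (1 + \<rho>))"
    using \<rho> by (simp add: norm_mult norm_power power2_eq_square)
  have "norm (g 0) = norm (q 0) * (\<Prod>n\<in>F. norm (a n))"
    unfolding q(2) by (simp add: norm_mult prod_norm[symmetric])
  also have "\<dots> \<le> norm (q 0) * t ^ card F"
  proof (intro mult_left_mono)
    have "(\<Prod>n\<in>F. norm (a n)) \<le> (\<Prod>n\<in>F. t)" using F by (intro prod_mono) auto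
    then show "(\<Prod>n\<in>F. norm (a n)) \<le> t ^ card F" by simp
  qed simp
  finally have "norm (g 0) * 2 ^ card F \<le> norm (q 0) * t ^ card F * 2 ^ card F" by simp
  also have "\<dots> = norm (q 0) * \<rho> ^ card F" by (simp add: \<rho>_def power_mult_distrib)
  also note 1
  finally have "ln (norm (g 0) * 2 ^ card F) \<le> ln (exp (K * (1 + \<rho>)))"
    using g(2) by (intro ln_mono) auto
  then show ?thesis using g(2) by (simp add: ln_mult ln_realpow \<rho>_def)
qed

lemma jensen_fin_dens_origin:
  assumes g: "g holomorphic_on UNIV" "g 0 \<noteq> 0" and K: "K \<ge> 0" "\<And>z. norm (g z) \<le> exp (K * (1 + norm z))"
    and a: "\<And>z. finite {n\<in>I. a n = z}" "\<And>z. vanishes g z (card {n\<in>I. a n = z})"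
  shows "fin_dens I a"
proof -
  define B where "B = (2 * K + \<bar>ln (norm (g 0))\<bar>) / ln 2"
  have fin: "finite (near I a t) \<and> real (card (near I a t)) \<le> B * (1 + t)" if t: "t > 0" for t
  proof -
    have *: "real (card F) \<le> B * (1 + t)" if F: "F \<subseteq> near I a t" "finite F" for F
    proof -
      have "vanishes g z (card {n\<in>F. a n = z})" for z
        by (rule vanishes_mono[OF a(2)[of z]], rule card_mono[OF a(1)]) (use F in \<open>auto simp: near_def\<close>)
      then have "real (card F) * ln 2 \<le> K * (1 + 2 * t) - ln (norm (g 0))"
        by (intro jensen_finite_count[OF g K(2) F(2)]) (use F t in \<open>auto simp: near_def\<close>)
      also have "\<dots> \<le> K * (2 * (1 + t)) + \<bar>ln (norm (g 0))\<bar> * 1"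
        using K t by (intro diff_le_eq[THEN iffD2]) (auto simp: algebra_simps)
      also have "\<dots> \<le> K * (2 * (1 + t)) + \<bar>ln (norm (g 0))\<bar> * (1 + t)"
        using t by (intro add_left_mono mult_left_mono) auto
      finally have "real (card F) * ln 2 \<le> (2 * K + \<bar>ln (norm (g 0))\<bar>) * (1 + t)" by (simp add: algebra_simps)
      then show ?thesis unfolding B_def by (simp add: pos_le_divide_eq)
    qed
    \<comment> \<open>A common bound for all finite subfamilies forces the points in this disc to be
      finite in number.\<close>
    have "finite (near I a t) \<and> card (near I a t) \<le> nat \<lfloor>B * (1 + t)\<rfloor>"
    proof (rule finite_if_finite_subsets_card_bdd)
      fix G assume "G \<subseteq> near I a t" "finite G"
      then show "card G \<le> nat \<lfloor>B * (1 + t)\<rfloor>" using * by (simp add: le_nat_floor)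
    qed
    then show ?thesis using * by blast
  qed
  show ?thesis unfolding fin_dens_def
  proof (intro exI[of _ "2 * B"] conjI allI impI)
    show "2 * B \<ge> 0" using K by (simp add: B_def)
    fix t :: real assume t: "t \<ge> 0"
    have sub: "near I a t \<subseteq> near I a (t + 1)" by (rule near_mono) simp
    have f: "finite (near I a (t + 1))" "real (card (near I a (t + 1))) \<le> B * (1 + (t + 1))"
      using fin[of "t + 1"] t by simp_all
    show "finite (near I a t)" using f sub finite_subset by blast
    have "real (card (near I a t)) \<le> B * (1 + (t + 1))" using card_mono[OF f(1) sub] f(2) by linarith
    also have "\<dots> \<le> B * (2 * (1 + t))" using K t by (intro mult_left_mono) (auto simp: B_def)
    finally show "real (card (near I a t)) \<le> 2 * B * (1 + t)" by (simp add: algebra_simps)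
  qed
qed

lemma vanishes_shift: "vanishes g (z + c) m \<Longrightarrow> vanishes (\<lambda>w. g (w + c)) z m"
  unfolding vanishes_def
proof (elim exE conjE)
  fix q assume q: "q holomorphic_on UNIV" "\<forall>w. g w = (w - (z + c)) ^ m * q w"
  show "\<exists>q. q holomorphic_on UNIV \<and> (\<forall>w. g (w + c) = (w - z) ^ m * q w)"
  proof (intro exI[of _ "\<lambda>w. q (w + c)"] conjI allI)
    show "(\<lambda>w. q (w + c)) holomorphic_on UNIV"
      by (rule holomorphic_on_compose_gen[of "\<lambda>w. w + c" UNIV q UNIV, unfolded o_def])
        (auto intro!: holomorphic_intros q)
  qed (simp add: q)
qed

lemma exp_bound_shift:
  assumes K: "K \<ge> 0" "\<And>z. norm (g z) \<le> exp (K * (1 + norm z))"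
  shows "norm (g (z + c)) \<le> exp ((K * (1 + norm c)) * (1 + norm z))"
proof -
  have "1 + norm (z + c) \<le> 1 + norm z + norm c" using norm_triangle_ineq[of z c] by simp
  also have "\<dots> \<le> (1 + norm c) * (1 + norm z)" by (simp add: algebra_simps)
  finally have "K * (1 + norm (z + c)) \<le> K * ((1 + norm c) * (1 + norm z))" using K(1) by (intro mult_left_mono)
  then have "exp (K * (1 + norm (z + c))) \<le> exp ((K * (1 + norm c)) * (1 + norm z))" by (simp add: mult.assoc)
  with K(2)[of "z + c"] show ?thesis by (rule order_trans)
qed

lemma entire_shift: "g holomorphic_on UNIV \<Longrightarrow> (\<lambda>w. g (w + c)) holomorphic_on UNIV"
  by (rule holomorphic_on_compose_gen[of "\<lambda>w. w + c" UNIV g UNIV, unfolded o_def])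
    (auto intro!: holomorphic_intros)

lemma jensen_fin_dens:
  assumes g: "g holomorphic_on UNIV" "g w0 \<noteq> 0" "exponential_type g"
    and a: "\<And>z. finite {n\<in>I. a n = z}" "\<And>z. vanishes g z (card {n\<in>I. a n = z})"
  shows "fin_dens I a"
proof -
  obtain K where K: "K \<ge> 0" "\<And>z. norm (g z) \<le> exp (K * (1 + norm z))"
    using exponential_type_bound[OF g(1,3)] by blast
  have eq: "{n\<in>I. a n - w0 = z} = {n\<in>I. a n = z + w0}" for z by (auto simp: algebra_simps)
  have "fin_dens I (\<lambda>n. a n - w0)"
  proof (rule jensen_fin_dens_origin[where g = "\<lambda>z. g (z + w0)" and K = "K * (1 + norm w0)"])
    show "vanishes (\<lambda>z. g (z + w0)) z (card {n \<in> I. a n - w0 = z})" for z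
      unfolding eq by (intro vanishes_shift a)
  qed (use g K a in \<open>auto simp: eq intro!: entire_shift exp_bound_shift\<close>)
  from fin_dens_shift[OF this, of w0] show ?thesis by simp
qed

text \<open>Harnack's inequality for the positive harmonic function ln (M / |q|), with the constant
  (1 + 1/2) / (1 - 1/2) = 3 at half the radius. It follows from the Schwarz lemma for a Cayley
  transform of its holomorphic completion.\<close>

lemma harnack_lower_bound:
  assumes q: "q holomorphic_on ball 0 \<rho>" "\<And>z. z \<in> ball 0 \<rho> \<Longrightarrow> q z \<noteq> 0"
    and M: "\<And>z. z \<in> ball 0 \<rho> \<Longrightarrow> norm (q z) < M" and \<rho>: "\<rho> > 0" and z: "norm z \<le> \<rho> / 2"
  shows "ln (M / norm (q z)) \<le> 3 * ln (M / norm (q 0))"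
proof -
  obtain L where L: "L holomorphic_on ball 0 \<rho>" "\<And>x. x \<in> ball 0 \<rho> \<Longrightarrow> exp (L x) = q x"
    using holomorphic_logarithm_exists[OF convex_ball open_ball q, of 0] \<rho> by (metis centre_in_ball)
  have M0: "M > 0" using M[of 0] \<rho> by (metis centre_in_ball le_less_trans norm_ge_zero)
  \<comment> \<open>Holomorphic with real part ln (M / |q|). The imaginary constant makes the value
    at 0 a positive number p, which the Cayley transform w sends to 0.\<close>
  define \<psi> where "\<psi> x = of_real (ln M) - L x + axis (Im (L 0))" for x
  have Re\<psi>: "Re (\<psi> x) = ln (M / norm (q x))" "Re (\<psi> x) > 0" if "x \<in> ball 0 \<rho>" for x
  proof -
    have "norm (q x) = exp (Re (L x))" using L(2)[OF that] by (metis norm_exp_eq_Re)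
    then show 1: "Re (\<psi> x) = ln (M / norm (q x))" using M0 by (simp add: \<psi>_def ln_div)
    have "norm (q x) > 0" using q(2)[OF that] by simp
    then have "M / norm (q x) > 1" using M[OF that] by simp
    then show "Re (\<psi> x) > 0" using 1 by simp
  qed
  define p where "p = Re (\<psi> 0)"
  have p0: "p > 0" using Re\<psi>[of 0] \<rho> by (simp add: p_def)
  have \<psi>0: "\<psi> 0 = of_real p" by (simp add: p_def complex_eq_iff \<psi>_def)
  define w where "w x = (\<psi> (of_real \<rho> * x) - of_real p) / (\<psi> (of_real \<rho> * x) + of_real p)" for x
  have in_ball: "of_real \<rho> * x \<in> ball 0 \<rho>" if "norm x < 1" for x :: complex
    using that \<rho> by (simp add: norm_mult)
  have nz: "\<psi> (of_real \<rho> * x) + of_real p \<noteq> 0" if "norm x < 1" for x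
  proof -
    have "Re (\<psi> (of_real \<rho> * x) + of_real p) > 0" using Re\<psi>(2)[OF in_ball[OF that]] p0 by simp
    then show ?thesis by (metis less_irrefl zero_complex.simps(1))
  qed
  define \<xi> where "\<xi> = z / of_real \<rho>"
  have \<xi>: "norm \<xi> \<le> 1 / 2" using z \<rho> by (simp add: \<xi>_def norm_divide field_simps)
  have "norm (w \<xi>) \<le> norm \<xi>"
  proof (rule Schwarz_Lemma(1))
    have "(\<lambda>x. L (of_real \<rho> * x)) holomorphic_on ball 0 1"
      by (rule holomorphic_on_compose_gen[of "\<lambda>x. of_real \<rho> * x" "ball 0 1" L "ball 0 \<rho>", unfolded o_def])
        (use in_ball L in \<open>auto intro!: holomorphic_intros\<close>)
    then show "w holomorphic_on ball 0 1" unfolding w_def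
      by (intro holomorphic_intros) (use nz in \<open>auto simp: \<psi>_def intro!: holomorphic_intros\<close>)
    show "w 0 = 0" by (simp add: w_def \<psi>0)
    show "norm (w x) < 1" if "norm x < 1" for x
    proof -
      let ?y = "\<psi> (of_real \<rho> * x)"
      have "Re ?y > 0" using Re\<psi>(2)[OF in_ball[OF that]] .
      then have "(Re ?y - p)\<^sup>2 < (Re ?y + p)\<^sup>2" using p0 by (simp add: power2_eq_square algebra_simps)
      then have "(norm (?y - of_real p))\<^sup>2 < (norm (?y + of_real p))\<^sup>2" by (simp add: cmod_power2)
      then have "norm (?y - of_real p) < norm (?y + of_real p)" by (meson norm_ge_zero power_less_imp_less_base)
      then show ?thesis unfolding w_def norm_divide by (simp add: divide_less_eq_1)
    qed
    show "norm \<xi> < 1" using \<xi> by linarith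
  qed
  then have w2: "norm (w \<xi>) \<le> 1 / 2" using \<xi> by linarith
  have \<xi>z: "of_real \<rho> * \<xi> = z" using \<rho> by (simp add: \<xi>_def)
  have "norm (\<psi> z - of_real p) \<le> 1 / 2 * norm (\<psi> z + of_real p)"
    using w2 nz[of \<xi>] \<xi> unfolding w_def \<xi>z norm_divide by (simp add: pos_divide_le_eq)
  also have "\<dots> \<le> 1 / 2 * (norm (\<psi> z) + p)" using norm_triangle_ineq[of "\<psi> z" "of_real p"] p0 by simp
  finally have "norm (\<psi> z) \<le> 3 * p" using norm_triangle_ineq2[of "\<psi> z" "of_real p"] p0 by simp
  then have "Re (\<psi> z) \<le> 3 * p" using complex_Re_le_cmod order_trans by blast
  moreover have "z \<in> ball 0 \<rho>" using z \<rho> by simp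
  ultimately show ?thesis using Re\<psi>(1)[of z] Re\<psi>(1)[of 0] \<rho> by (simp add: p_def)
qed

text \<open>After the zeros of modulus below 4 R are traded for Blaschke factors, what remains is
  zero-free and bounded in that disc, so Harnack bounds it below by exp (- C R) up to radius 2 R. A
  traded zero contributes at least |r - |a|| / (10 R); this loss is left explicit, to be averaged
  out by a good radius.\<close>

lemma minimum_modulus:
  assumes g: "g holomorphic_on UNIV" "g 0 \<noteq> 0" and K: "K \<ge> 0" "\<And>z. norm (g z) \<le> exp (K * (1 + norm z))"
    and a: "\<And>z. finite {n\<in>I. a n = z}" "\<And>z. zero_count g z = enat (card {n\<in>I. a n = z})"
  obtains C where "C \<ge> 0" "\<And>R r (z::complex). R \<ge> 1 \<Longrightarrow> R \<le> r \<Longrightarrow> r \<le> 2 * R \<Longrightarrow> norm z = r \<Longrightarrow>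
     (\<And>n. n \<in> near I a (4 * R) \<Longrightarrow> r \<noteq> norm (a n)) \<Longrightarrow>
     norm (g z) \<ge> exp (- C * R - (\<Sum>n\<in>near I a (4 * R). ln (10 * R / \<bar>r - norm (a n)\<bar>)))"
proof -
  have van: "vanishes g z m \<longleftrightarrow> m \<le> card {n\<in>I. a n = z}" for z m
    using vanishes_iff[OF g, of z m] a(2)[of z] by simp
  have fd: "fin_dens I a" by (rule jensen_fin_dens_origin[OF g K a(1)]) (simp add: van)
  note fin = fin_dens_near_finite[OF fd]
  define C where "C = 2 + 10 * K + 3 * \<bar>ln (norm (g 0))\<bar>"
  show ?thesis
  proof (rule that[of C])
    show "C \<ge> 0" using K by (simp add: C_def)
    fix R r and z :: complex assume R: "R \<ge> 1" "R \<le> r" "r \<le> 2 * R" and z: "norm z = r"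
      and ne: "\<And>n. n \<in> near I a (4 * R) \<Longrightarrow> r \<noteq> norm (a n)"
    define \<rho> where "\<rho> = 4 * R"
    have \<rho>: "\<rho> > 0" using R by (simp add: \<rho>_def)
    define F where "F = {n\<in>I. norm (a n) < \<rho>}"
    have FN: "F \<subseteq> near I a (4 * R)" by (auto simp: F_def near_def \<rho>_def)
    have F: "finite F" using FN fin finite_subset by blast
    obtain q where q: "q holomorphic_on UNIV" "\<And>z. g z = (\<Prod>n\<in>F. z - a n) * q z"
    proof (rule entire_divide_finite[OF g(1) F, where a = a])
      show "vanishes g z (card {n \<in> F. a n = z})" for z
        unfolding van by (rule card_mono[OF a(1)]) (auto simp: F_def)
    qed blast
    define G where "G z = q z * (\<Prod>n\<in>F. (of_real (\<rho>\<^sup>2) - cnj (a n) * z) / of_real \<rho>)" for z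
    define M where "M = exp (K * (1 + \<rho>))"
    have GM: "norm (G w) \<le> M" if "norm w \<le> \<rho>" for w
      unfolding G_def by (rule blaschke_disc_bound[OF F q \<rho> _ that]) (use K in \<open>auto simp: M_def\<close>)
    have Mpos: "M > 0" by (simp add: M_def)
    have Ghol: "G holomorphic_on ball 0 \<rho>"
      unfolding G_def using \<rho> by (intro holomorphic_intros holomorphic_on_subset[OF q(1)]) auto
    have q_nz: "q w \<noteq> 0" if "w \<in> ball 0 \<rho>" for w
    proof (rule quotient_nonzero[OF F q])
      have "{n\<in>F. a n = w} = {n\<in>I. a n = w}" using that by (auto simp: F_def)
      then show "\<not> vanishes g w (Suc (card {n \<in> F. a n = w}))" using van by simp
    qed
    have G_nz: "G w \<noteq> 0" if "w \<in> ball 0 \<rho>" for w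
      unfolding G_def using q_nz[OF that] F \<rho> reflect_nonzero[of _ \<rho> w] that by (auto simp: F_def)
    \<comment> \<open>The bound M is doubled because Harnack's inequality is stated for a strict
      upper bound.\<close>
    have har: "ln (2 * M / norm (G z)) \<le> 3 * ln (2 * M / norm (G 0))"
    proof (rule harnack_lower_bound[OF Ghol G_nz _ \<rho>])
      show "norm (G w) < 2 * M" if "w \<in> ball 0 \<rho>" for w
        using GM[of w] that Mpos by auto
      show "norm z \<le> \<rho> / 2" using z R by (simp add: \<rho>_def)
    qed
    have G0: "norm (G 0) \<ge> norm (g 0)"
    proof -
      have "norm (G 0) = norm (q 0) * (\<Prod>n\<in>F. \<rho>)"
        using \<rho> by (simp add: G_def norm_mult norm_power power2_eq_square)
      also have "\<dots> \<ge> norm (q 0) * (\<Prod>n\<in>F. norm (a n))"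
        using \<rho> by (intro mult_left_mono prod_mono) (auto simp: F_def)
      also have "norm (q 0) * (\<Prod>n\<in>F. norm (a n)) = norm (g 0)"
        unfolding q(2) by (simp add: norm_mult prod_norm[symmetric])
      finally show ?thesis .
    qed
    have zb: "z \<in> ball 0 \<rho>" using z R by (simp add: \<rho>_def)
    have Gz: "ln (norm (G z)) \<ge> - C * R"
    proof -
      define X where "X = K * (1 + \<rho>)"
      have h1: "ln (2 * M) - ln (norm (G z)) \<le> 3 * (ln (2 * M) - ln (norm (G 0)))"
        using har G_nz[OF zb] G_nz[of 0] \<rho> Mpos by (simp add: ln_div)
      have h2: "ln (norm (G 0)) \<ge> ln (norm (g 0))" using G0 g(2) by (intro ln_mono) auto
      have h3: "ln (2 * M) = ln 2 + X" by (simp add: M_def X_def ln_mult)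
      have h4: "ln 2 \<le> (1::real)" using ln_le_minus_one[of "2::real"] by simp
      have h5: "ln (norm (g 0)) \<ge> - \<bar>ln (norm (g 0))\<bar>" by simp
      have "ln (norm (G z)) \<ge> 3 * ln (norm (G 0)) - 2 * (ln 2 + X)" using h1 unfolding h3 by argo
      then have "ln (norm (G z)) \<ge> - 2 - 2 * X - 3 * \<bar>ln (norm (g 0))\<bar>" using h2 h4 h5 by argo
      then have "ln (norm (G z)) \<ge> - 2 - 2 * (K * (1 + \<rho>)) - 3 * \<bar>ln (norm (g 0))\<bar>" by (simp add: X_def)
      moreover have "K * (1 + \<rho>) \<le> K * (5 * R)" using K R by (intro mult_left_mono) (auto simp: \<rho>_def)
      moreover have "2 \<le> 2 * R" "3 * \<bar>ln (norm (g 0))\<bar> \<le> 3 * \<bar>ln (norm (g 0))\<bar> * R"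
        using R mult_left_mono[of 1 R "3 * \<bar>ln (norm (g 0))\<bar>"] by auto
      ultimately show ?thesis by (simp add: C_def algebra_simps)
    qed
    have gG: "norm (g z) = norm (G z) * (\<Prod>n\<in>F. \<rho> * norm (z - a n) / norm (of_real (\<rho>\<^sup>2) - cnj (a n) * z))"
    proof -
      have "norm (G z) * (\<Prod>n\<in>F. \<rho> * norm (z - a n) / norm (of_real (\<rho>\<^sup>2) - cnj (a n) * z))
         = norm (q z) * (\<Prod>n\<in>F. (norm (of_real (\<rho>\<^sup>2) - cnj (a n) * z) / \<rho>) * (\<rho> * norm (z - a n) / norm (of_real (\<rho>\<^sup>2) - cnj (a n) * z)))"
        unfolding G_def norm_mult prod_norm[symmetric] prod.distrib using \<rho> by (simp add: norm_divide)
      also have "(\<Prod>n\<in>F. (norm (of_real (\<rho>\<^sup>2) - cnj (a n) * z) / \<rho>) * (\<rho> * norm (z - a n) / norm (of_real (\<rho>\<^sup>2) - cnj (a n) * z)))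
         = (\<Prod>n\<in>F. norm (z - a n))"
      proof (rule prod.cong)
        fix n assume "n \<in> F"
        then have "of_real (\<rho>\<^sup>2) - cnj (a n) * z \<noteq> 0" using zb by (intro reflect_nonzero) (auto simp: F_def)
        then show "(norm (of_real (\<rho>\<^sup>2) - cnj (a n) * z) / \<rho>) * (\<rho> * norm (z - a n) / norm (of_real (\<rho>\<^sup>2) - cnj (a n) * z)) = norm (z - a n)"
          using \<rho> by simp
      qed simp
      finally show ?thesis unfolding q(2) norm_mult prod_norm[symmetric] by simp
    qed
    have fac: "\<rho> * norm (z - a n) / norm (of_real (\<rho>\<^sup>2) - cnj (a n) * z) \<ge> exp (- ln (10 * R / \<bar>r - norm (a n)\<bar>))"
      if n: "n \<in> F" for n
    proof -
      have nz: "of_real (\<rho>\<^sup>2) - cnj (a n) * z \<noteq> 0" using zb n by (intro reflect_nonzero) (auto simp: F_def)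
      have pos: "\<bar>r - norm (a n)\<bar> > 0" using ne[of n] n FN by auto
      have up: "norm (of_real (\<rho>\<^sup>2) - cnj (a n) * z) \<le> 2 * \<rho>\<^sup>2"
      proof -
        have "norm (of_real (\<rho>\<^sup>2) - cnj (a n) * z) \<le> \<rho>\<^sup>2 + norm (a n) * norm z"
          using norm_triangle_ineq4[of "of_real (\<rho>\<^sup>2)" "cnj (a n) * z"] by (simp add: norm_mult norm_power)
        also have "norm (a n) * norm z \<le> \<rho> * \<rho>" using n zb \<rho> by (intro mult_mono) (auto simp: F_def)
        finally show ?thesis by (simp add: power2_eq_square)
      qed
      have lo: "\<bar>r - norm (a n)\<bar> \<le> norm (z - a n)" using norm_triangle_ineq3[of z "a n"] z by simp
      have "exp (- ln (10 * R / \<bar>r - norm (a n)\<bar>)) = \<bar>r - norm (a n)\<bar> / (10 * R)"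
        using pos R by (simp add: exp_minus)
      also have "\<dots> \<le> \<bar>r - norm (a n)\<bar> / (8 * R)" using R pos by (intro divide_left_mono) auto
      also have "\<dots> = \<rho> * \<bar>r - norm (a n)\<bar> / (2 * \<rho>\<^sup>2)" using R by (simp add: \<rho>_def power2_eq_square)
      also have "\<dots> \<le> \<rho> * norm (z - a n) / norm (of_real (\<rho>\<^sup>2) - cnj (a n) * z)"
        using lo up nz \<rho> by (intro frac_le mult_left_mono mult_nonneg_nonneg) auto
      finally show ?thesis .
    qed
    have "exp (- C * R - (\<Sum>n\<in>near I a (4 * R). ln (10 * R / \<bar>r - norm (a n)\<bar>))) \<le>
        exp (- C * R - (\<Sum>n\<in>F. ln (10 * R / \<bar>r - norm (a n)\<bar>)))"
    proof -
      have "(\<Sum>n\<in>F. ln (10 * R / \<bar>r - norm (a n)\<bar>)) \<le> (\<Sum>n\<in>near I a (4 * R). ln (10 * R / \<bar>r - norm (a n)\<bar>))"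
      proof (rule sum_mono2[OF fin FN])
        fix n assume "n \<in> near I a (4 * R) - F"
        then have n: "n \<in> near I a (4 * R)" "norm (a n) \<le> 4 * R" by (auto simp: near_def)
        have "\<bar>r - norm (a n)\<bar> \<le> 10 * R" using n R norm_ge_zero[of "a n"] by linarith
        moreover have "\<bar>r - norm (a n)\<bar> > 0" using ne[OF n(1)] by auto
        ultimately show "0 \<le> ln (10 * R / \<bar>r - norm (a n)\<bar>)" by simp
      qed
      then show ?thesis by simp
    qed
    also have "\<dots> = exp (- C * R) * (\<Prod>n\<in>F. exp (- ln (10 * R / \<bar>r - norm (a n)\<bar>)))"
    proof -
      have "- C * R - (\<Sum>n\<in>F. ln (10 * R / \<bar>r - norm (a n)\<bar>)) = - C * R + (\<Sum>n\<in>F. - ln (10 * R / \<bar>r - norm (a n)\<bar>))"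
        by (simp add: sum_negf)
      then show ?thesis by (simp only: exp_add exp_sum[OF F])
    qed
    also have "\<dots> \<le> norm (G z) * (\<Prod>n\<in>F. \<rho> * norm (z - a n) / norm (of_real (\<rho>\<^sup>2) - cnj (a n) * z))"
    proof (rule mult_mono)
      have "exp (- C * R) \<le> exp (ln (norm (G z)))" using Gz by (simp only: exp_le_cancel_iff)
      also have "\<dots> = norm (G z)" using G_nz[OF zb] by (intro exp_ln) simp
      finally show "exp (- C * R) \<le> norm (G z)" .
      show "(\<Prod>n\<in>F. exp (- ln (10 * R / \<bar>r - norm (a n)\<bar>))) \<le> (\<Prod>n\<in>F. \<rho> * norm (z - a n) / norm (of_real (\<rho>\<^sup>2) - cnj (a n) * z))"
        by (rule prod_mono) (metis fac exp_ge_zero)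
      show "0 \<le> (\<Prod>n\<in>F. exp (- ln (10 * R / \<bar>r - norm (a n)\<bar>)))" by (rule prod_nonneg) simp
    qed simp
    finally show "norm (g z) \<ge> exp (- C * R - (\<Sum>n\<in>near I a (4 * R). ln (10 * R / \<bar>r - norm (a n)\<bar>)))"
      unfolding gG .
  qed
qed

section \<open>Comparison of logarithmic sums in the right half-plane\<close>

text \<open>Grouping by value: points outside the open right half-plane contribute 0, so only the
  multiplicities inside it matter.\<close>

lemma lsum_cong_count:
  assumes fin: "\<And>t. finite (near I a t)" "\<And>t. finite (near J b t)"
    and eq: "\<And>z. Re z > 0 \<Longrightarrow> card {n\<in>I. a n = z} = card {n\<in>J. b n = z}"
  shows "lsum I a t = lsum J b t"
proof -
  let ?X = "{z\<in>a ` near I a t \<union> b ` near J b t. Re z > 0}"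
  have *: "lsum I a t = (\<Sum>z\<in>?X. real (card {n\<in>I. a n = z}) * pos_recip z)"
    if fin: "\<And>t. finite (near I a t)" "finite X" and X: "{z\<in>a ` near I a t. Re z > 0} \<subseteq> X"
      and X2: "\<And>z. z \<in> X \<Longrightarrow> norm z \<le> t \<and> Re z > 0" and XX: "X = ?X"
    for I a X
  proof -
    have "lsum I a t = (\<Sum>n\<in>{n\<in>near I a t. Re (a n) > 0}. pos_recip (a n))"
      unfolding lsum_def using fin by (intro sum.mono_neutral_right) (auto simp: not_less pos_recip_eq_0)
    also have "\<dots> = (\<Sum>z\<in>X. \<Sum>n\<in>{n\<in>{n\<in>near I a t. Re (a n) > 0}. a n = z}. pos_recip (a n))"
      by (rule sum.group[symmetric]) (use fin X in auto)
    also have "\<dots> = (\<Sum>z\<in>X. real (card {n\<in>I. a n = z}) * pos_recip z)"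
    proof (rule sum.cong)
      fix z assume "z \<in> X"
      then have "{n\<in>{n\<in>near I a t. Re (a n) > 0}. a n = z} = {n\<in>I. a n = z}"
        using X2 by (auto simp: near_def)
      then show "(\<Sum>n\<in>{n\<in>{n\<in>near I a t. Re (a n) > 0}. a n = z}. pos_recip (a n)) = real (card {n\<in>I. a n = z}) * pos_recip z"
        by simp
    qed simp
    finally show ?thesis by (simp add: XX)
  qed
  have finX: "finite ?X" using fin by simp
  have "lsum I a t = (\<Sum>z\<in>?X. real (card {n\<in>I. a n = z}) * pos_recip z)"
    by (rule *[OF fin(1) finX]) (auto simp: near_def)
  also have "\<dots> = (\<Sum>z\<in>?X. real (card {n\<in>J. b n = z}) * pos_recip z)"
    using eq by (intro sum.cong) auto
  also have "\<dots> = lsum J b t"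
    by (rule *[OF fin(2) finX, symmetric]) (auto simp: near_def)
  finally show ?thesis .
qed

lemma lsum_diff_eq:
  assumes "\<And>t. finite (near I a t)" "r \<le> R"
  shows "lsum I a R - lsum I a r = (\<Sum>n\<in>near I a R - near I a r. pos_recip (a n))"
  unfolding lsum_def by (rule sum_diff[OF assms(1) near_mono[OF assms(2)], symmetric])

lemma lsum_diff_le:
  assumes fin: "\<And>t. finite (near I a t)" and r: "r > 0" "r \<le> R"
  shows "lsum I a R - lsum I a r \<le> real (card (near I a R)) / r"
proof -
  have "lsum I a R - lsum I a r \<le> (\<Sum>n\<in>near I a R - near I a r. 1 / r)"
    unfolding lsum_diff_eq[OF fin r(2)]
  proof (rule sum_mono)
    fix n assume "n \<in> near I a R - near I a r"
    then have "norm (a n) > r" by (auto simp: near_def)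
    then have "1 / norm (a n) \<le> 1 / r" using r by (intro divide_left_mono mult_pos_pos) auto
    then show "pos_recip (a n) \<le> 1 / r" using pos_recip_bounds(2)[of "a n"] by linarith
  qed
  also have "\<dots> = real (card (near I a R - near I a r)) / r" by simp
  also have "\<dots> \<le> real (card (near I a R)) / r"
    using r fin by (intro divide_right_mono of_nat_mono card_mono) auto
  finally show ?thesis .
qed

text \<open>If f had a lower order k < m at z, division by |s|^k along the axis would leave a
  nonzero limit for f and the limit 0 for g.\<close>

lemma vanishes_of_bound_on_axis:
  assumes f: "f holomorphic_on UNIV" "f w0 \<noteq> 0"
    and le: "\<And>y::real. norm (f (axis y)) \<le> norm (g (axis y))"
    and van: "vanishes g z m" and z: "Re z = 0"
  shows "vanishes f z m"
proof -
  obtain k p where p: "p holomorphic_on UNIV" "p z \<noteq> 0" "\<And>w. f w = (w - z) ^ k * p w"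
    using entire_factor_at[OF f, of z] by blast
  obtain q where q: "q holomorphic_on UNIV" "\<And>w. g w = (w - z) ^ m * q w"
    using van by (auto simp: vanishes_def)
  have vk: "vanishes f z k" using p unfolding vanishes_def by blast
  show ?thesis
  proof (cases "m \<le> k")
    case True
    then show ?thesis using vanishes_mono[OF vk] by blast
  next
    case False
    define c where "c s = z + axis s" for s :: real
    have c0: "((\<lambda>s. c s) \<longlongrightarrow> z) (at 0)" unfolding c_def by (auto intro!: tendsto_eq_intros)
    have cont: "isCont p z" "isCont q z"
      using holomorphic_on_imp_continuous_on[OF p(1)] holomorphic_on_imp_continuous_on[OF q(1)]
        continuous_on_eq_continuous_at by blast+
    have "((\<lambda>s. norm (p (c s))) \<longlongrightarrow> norm (p z)) (at 0)"
      by (intro tendsto_norm isCont_tendsto_compose[OF cont(1) c0])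
    moreover have "((\<lambda>s. \<bar>s\<bar> ^ (m - k) * norm (q (c s))) \<longlongrightarrow> \<bar>0\<bar> ^ (m - k) * norm (q z)) (at 0)"
      by (intro tendsto_intros isCont_tendsto_compose[OF cont(2) c0])
    moreover have "\<forall>\<^sub>F s in at 0. norm (p (c s)) \<le> \<bar>s\<bar> ^ (m - k) * norm (q (c s))"
      unfolding eventually_at
    proof (intro exI[of _ 1] conjI ballI impI)
      fix s :: real assume s: "s \<noteq> 0 \<and> dist s 0 < 1"
      have "c s = axis (Im z + s)" using z by (simp add: c_def complex_eq_iff)
      then have "norm (f (c s)) \<le> norm (g (c s))" using le by metis
      then have "\<bar>s\<bar> ^ k * norm (p (c s)) \<le> \<bar>s\<bar> ^ m * norm (q (c s))"
        by (simp add: p(3) q(2) norm_mult norm_power c_def)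
      also have "\<bar>s\<bar> ^ m = \<bar>s\<bar> ^ k * \<bar>s\<bar> ^ (m - k)" using False by (simp add: power_add[symmetric])
      finally show "norm (p (c s)) \<le> \<bar>s\<bar> ^ (m - k) * norm (q (c s))" using s by (simp add: mult.assoc)
    qed auto
    ultimately have "norm (p z) \<le> \<bar>0\<bar> ^ (m - k) * norm (q z)"
      by (intro tendsto_le[of "at (0::real)"]) auto
    then show ?thesis using p(2) False by (simp add: power_0_left)
  qed
qed

text \<open>\<open>(z - a) * hbl \<rho> a z\<close> is the Blaschke factor of the half disc of radius \<open>\<rho>\<close> with zero \<open>a\<close>: it has
  modulus 1 on the diameter and on the arc.\<close>

definition hbl :: "real \<Rightarrow> complex \<Rightarrow> complex \<Rightarrow> complex" where
  "hbl \<rho> a z = (of_real (\<rho>\<^sup>2) + a * z) / ((z + cnj a) * (of_real (\<rho>\<^sup>2) - cnj a * z))"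

lemma hbl_nonzero:
  assumes "Re a > 0" "norm a < \<rho>" "Re z \<ge> 0" "norm z \<le> \<rho>"
  shows "z + cnj a \<noteq> 0" "of_real (\<rho>\<^sup>2) - cnj a * z \<noteq> 0" "of_real (\<rho>\<^sup>2) + a * z \<noteq> 0" "hbl \<rho> a z \<noteq> 0"
proof -
  show 1: "z + cnj a \<noteq> 0" using assms by (auto simp: complex_eq_iff)
  show 2: "of_real (\<rho>\<^sup>2) - cnj a * z \<noteq> 0" by (rule reflect_nonzero) (use assms in auto)
  show 3: "of_real (\<rho>\<^sup>2) + a * z \<noteq> 0" using reflect_nonzero[of "- cnj a" \<rho> z] assms by simp
  show "hbl \<rho> a z \<noteq> 0" using 1 2 3 by (simp add: hbl_def del: of_real_power)
qed

lemma hbl_norm_axis: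
  assumes "Re a > 0" "norm a < \<rho>" "Re z = 0" "norm z \<le> \<rho>"
  shows "norm ((z - a) * hbl \<rho> a z) = 1"
proof -
  note nz = hbl_nonzero[OF assms(1,2) _ assms(4)]
  have zc: "cnj z = - z" using assms(3) by (simp add: complex_eq_iff)
  have "z + cnj a = - cnj (z - a)" using zc by simp
  then have 1: "norm (z + cnj a) = norm (z - a)" by (metis complex_mod_cnj norm_minus_cancel)
  have "of_real (\<rho>\<^sup>2) + a * z = cnj (of_real (\<rho>\<^sup>2) - cnj a * z)" using zc by simp
  then have 2: "norm (of_real (\<rho>\<^sup>2) + a * z) = norm (of_real (\<rho>\<^sup>2) - cnj a * z)" by (metis complex_mod_cnj)
  have "norm (z + cnj a) \<noteq> 0" "norm (of_real (\<rho>\<^sup>2) - cnj a * z) \<noteq> 0" using nz assms by (simp_all del: of_real_power)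
  then show ?thesis unfolding hbl_def norm_mult norm_divide 2 using 1 by simp
qed

lemma hbl_norm_arc:
  assumes "Re a > 0" "norm a < \<rho>" "Re z \<ge> 0" "norm z = \<rho>"
  shows "norm ((z - a) * hbl \<rho> a z) = 1"
proof -
  note nz = hbl_nonzero[OF assms(1,2,3) eq_refl[OF assms(4)]]
  have \<rho>: "\<rho> > 0" using assms by (metis le_less_trans norm_ge_zero)
  have 1: "norm (of_real (\<rho>\<^sup>2) - cnj a * z) = \<rho> * norm (z - a)" by (rule norm_reflect_circle[OF assms(4)])
  have 2: "norm (of_real (\<rho>\<^sup>2) + a * z) = \<rho> * norm (z + cnj a)"
    using norm_reflect_circle[OF assms(4), of "- cnj a"] by simp
  have "norm (z + cnj a) \<noteq> 0" "norm (z - a) \<noteq> 0" using nz 1 by (auto simp del: of_real_power)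
  then show ?thesis unfolding hbl_def norm_mult norm_divide 1 2 using \<rho> by simp
qed

lemma Re_half_disc_majorant:
  assumes "Re z \<ge> 0"
  shows "Re (of_real (\<rho>\<^sup>2) * z / (of_real (\<rho>\<^sup>2) + z\<^sup>2)) \<ge> 0"
proof -
  let ?w = "of_real (\<rho>\<^sup>2) + z\<^sup>2"
  have "Re (of_real (\<rho>\<^sup>2) * z / ?w) = Re (of_real (\<rho>\<^sup>2) * z * cnj ?w) / (norm ?w)\<^sup>2"
    by (metis Re_divide_of_real complex_div_cnj of_real_power)
  also have "Re (of_real (\<rho>\<^sup>2) * z * cnj ?w) = \<rho>\<^sup>2 * (\<rho>\<^sup>2 + (norm z)\<^sup>2) * Re z"
    unfolding cmod_power2 by (simp add: power2_eq_square algebra_simps)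
  finally show ?thesis using assms by simp
qed

text \<open>The majorant \<open>\<rho>\<^sup>2 z / (\<rho>\<^sup>2 + z\<^sup>2)\<close> has real part 0 on the diameter and \<open>\<rho> / (2 cos \<theta>)\<close> on the arc.\<close>

lemma half_disc_maximum:
  assumes \<rho>: "\<rho> > 0" and c: "c \<ge> 0"
    and hol: "G holomorphic_on {z. Re z > 0 \<and> norm z < \<rho>}"
    and cont: "continuous_on {z. Re z \<ge> 0 \<and> norm z \<le> \<rho>} G"
    and axis: "\<And>z. Re z = 0 \<Longrightarrow> norm z \<le> \<rho> \<Longrightarrow> norm (G z) \<le> 1"
    and arc: "\<And>z. Re z \<ge> 0 \<Longrightarrow> norm z = \<rho> \<Longrightarrow> norm (G z) \<le> exp (c * \<rho>)"
    and x: "0 < x" "x < \<rho>"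
  shows "norm (G (of_real x)) \<le> exp (2 * c * x)"
proof -
  define m where "m z = of_real (\<rho>\<^sup>2) * z / (of_real (\<rho>\<^sup>2) + z\<^sup>2)" for z :: complex
  define H where "H z = G z * exp (- of_real (2 * c) * m z)" for z
  let ?D = "{z. Re z \<ge> 0 \<and> norm z \<le> \<rho>}"
  have nexp: "norm (exp (- of_real (2 * c) * m z)) = exp (- 2 * c * Re (m z))" for z
    by (simp add: norm_exp_eq_Re)
  have nexp1: "norm (exp (- of_real (2 * c) * m z)) \<le> 1" if "Re z \<ge> 0" for z
    unfolding nexp using Re_half_disc_majorant[OF that, of \<rho>] c by (simp add: m_def)
  have fac: "of_real (\<rho>\<^sup>2) + z\<^sup>2 = (z - \<i> * of_real \<rho>) * (z + \<i> * of_real \<rho>)" for z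
    by (simp add: power2_eq_square algebra_simps)
  \<comment> \<open>The majorant has its poles at the corners i \<rho> and - i \<rho>, where H need
    not be continuous. Small discs around them are cut out; on their rims |H| <= |G|, and G is
    within \<epsilon> of a corner value of modulus at most 1.\<close>
  have Hx: "norm (H (of_real x)) \<le> 1 + \<epsilon>" if \<epsilon>: "\<epsilon> > 0" for \<epsilon>
  proof -
    have "\<exists>\<delta>>0. \<forall>z\<in>?D. dist z w < \<delta> \<longrightarrow> dist (G z) (G w) < \<epsilon>" if "w \<in> ?D" for w
      using cont that \<epsilon> unfolding continuous_on_iff by blast
    moreover have "\<i> * of_real \<rho> \<in> ?D" "- (\<i> * of_real \<rho>) \<in> ?D" using \<rho> by (auto simp: norm_mult)
    ultimately obtain \<delta>1 \<delta>2 where d: "\<delta>1 > 0" "\<And>z. z \<in> ?D \<Longrightarrow> dist z (\<i> * of_real \<rho>) < \<delta>1 \<Longrightarrow> dist (G z) (G (\<i> * of_real \<rho>)) < \<epsilon>"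
      "\<delta>2 > 0" "\<And>z. z \<in> ?D \<Longrightarrow> dist z (- (\<i> * of_real \<rho>)) < \<delta>2 \<Longrightarrow> dist (G z) (G (- (\<i> * of_real \<rho>))) < \<epsilon>"
      by meson
    define \<delta> where "\<delta> = min (min (\<delta>1 / 2) (\<delta>2 / 2)) (\<rho> / 2)"
    have \<delta>: "\<delta> > 0" "\<delta> < \<delta>1" "\<delta> < \<delta>2" "\<delta> < \<rho>" using d \<rho> by (auto simp: \<delta>_def min_def)
    define S where "S = {z \<in> ?D. \<delta> \<le> dist z (\<i> * of_real \<rho>) \<and> \<delta> \<le> dist z (- (\<i> * of_real \<rho>))}"
    have S_nz: "of_real (\<rho>\<^sup>2) + z\<^sup>2 \<noteq> 0" if "z \<in> S" for z
      using that \<delta> unfolding fac by (auto simp: S_def dist_norm)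
    have "closed S"
    proof -
      have "S = {z. 0 \<le> Re z} \<inter> {z. norm z \<le> \<rho>} \<inter> {z. \<delta> \<le> dist z (\<i> * of_real \<rho>)} \<inter> {z. \<delta> \<le> dist z (- (\<i> * of_real \<rho>))}"
        by (auto simp: S_def)
      also have "closed \<dots>"
        by (intro closed_Int closed_Collect_le continuous_intros)
      finally show ?thesis .
    qed
    have "bounded S" by (rule bounded_subset[of "cball 0 \<rho>"]) (auto simp: S_def)
    let ?O = "{z. 0 < Re z} \<inter> {z. norm z < \<rho>} \<inter> {z. \<delta> < dist z (\<i> * of_real \<rho>)} \<inter> {z. \<delta> < dist z (- (\<i> * of_real \<rho>))}"
    have "open ?O" by (intro open_Int open_Collect_less continuous_intros)
    then have O: "?O \<subseteq> interior S" by (intro interior_maximal) (auto simp: S_def)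
    \<comment> \<open>An interior point may be moved slightly to the left, or outwards along its
      ray, without leaving S; so it lies neither on the diameter nor on the arc.\<close>
    have Sint: "interior S \<subseteq> {z. Re z > 0 \<and> norm z < \<rho>}"
    proof
      fix z assume z: "z \<in> interior S"
      then obtain e where e: "e > 0" "ball z e \<subseteq> S" using mem_interior by blast
      have zS: "z \<in> S" using z interior_subset by blast
      have "z - of_real (e / 2) \<in> ball z e" using e(1) by (simp add: dist_norm)
      then have "z - of_real (e / 2) \<in> S" using e by blast
      then have r: "Re z > 0" using e(1) by (auto simp: S_def)
      then have "norm z > 0" by auto
      define w where "w = z + of_real (e / (2 * norm z)) * z"
      have "dist z w = norm (of_real (e / (2 * norm z)) * z)" by (simp add: w_def dist_norm)
      also have "\<dots> = e / 2" unfolding norm_mult norm_of_real using e(1) \<open>norm z > 0\<close> by simp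
      finally have "dist z w = e / 2" .
      then have "w \<in> S" using e by auto
      moreover have "norm w = norm z + e / 2"
      proof -
        have "w = of_real (1 + e / (2 * norm z)) * z" by (simp add: w_def algebra_simps)
        then have "norm w = (1 + e / (2 * norm z)) * norm z"
          using e \<open>norm z > 0\<close> by (simp only: norm_mult norm_of_real) simp
        then show ?thesis using \<open>norm z > 0\<close> by (simp add: algebra_simps)
      qed
      ultimately have "norm z < \<rho>" using e by (auto simp: S_def)
      then show "z \<in> {z. Re z > 0 \<and> norm z < \<rho>}" using r by simp
    qed
    have "norm (H (of_real x)) \<le> 1 + \<epsilon>"
    proof (rule maximum_modulus_frontier[where S = S and f = H])
      have "interior S \<subseteq> S" by (rule interior_subset)
      then show "H holomorphic_on interior S" unfolding H_def m_def
        by (intro holomorphic_intros holomorphic_on_subset[OF hol Sint]) (use S_nz in blast)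
      have "continuous_on S H" unfolding H_def m_def
        by (intro continuous_intros continuous_on_subset[OF cont]) (use S_nz in \<open>auto simp: S_def\<close>)
      then show "continuous_on (closure S) H" using \<open>closed S\<close> by simp
      show "bounded S" by fact
      have "dist (of_real x) (\<i> * of_real \<rho>) \<ge> \<rho>" "dist (of_real x) (- (\<i> * of_real \<rho>)) \<ge> \<rho>"
        using abs_Im_le_cmod[of "of_real x - \<i> * of_real \<rho>"] abs_Im_le_cmod[of "of_real x + \<i> * of_real \<rho>"] \<rho>
        by (auto simp: dist_norm)
      then show "of_real x \<in> S" using x \<delta> by (auto simp: S_def)
      fix z assume "z \<in> frontier S"
      then have zS: "z \<in> S" and "z \<notin> ?O" using O \<open>closed S\<close> by (auto simp: frontier_def)
      then have zD: "Re z \<ge> 0" "norm z \<le> \<rho>" by (auto simp: S_def)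
      consider "dist z (\<i> * of_real \<rho>) = \<delta>" | "dist z (- (\<i> * of_real \<rho>)) = \<delta>" | "Re z = 0" | "norm z = \<rho>" "Re z > 0"
        using \<open>z \<notin> ?O\<close> zS by (auto simp: S_def) linarith
      then show "norm (H z) \<le> 1 + \<epsilon>"
      proof cases
        case 1
        have "dist (G z) (G (\<i> * of_real \<rho>)) < \<epsilon>" using d(2)[of z] 1 \<delta> zD by simp
        then have "norm (G z) \<le> norm (G (\<i> * of_real \<rho>)) + \<epsilon>"
          using norm_triangle_ineq2[of "G z" "G (\<i> * of_real \<rho>)"] by (simp add: dist_norm)
        also have "norm (G (\<i> * of_real \<rho>)) \<le> 1" using \<rho> by (intro axis) (auto simp: norm_mult)
        finally show ?thesis unfolding H_def norm_mult
          using mult_mono[OF _ nexp1[OF zD(1)], of "norm (G z)" "1 + \<epsilon>"] \<epsilon> by auto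
      next
        case 2
        have "dist (G z) (G (- (\<i> * of_real \<rho>))) < \<epsilon>" using d(4)[of z] 2 \<delta> zD by simp
        then have "norm (G z) \<le> norm (G (- (\<i> * of_real \<rho>))) + \<epsilon>"
          using norm_triangle_ineq2[of "G z" "G (- (\<i> * of_real \<rho>))"] by (simp add: dist_norm)
        also have "norm (G (- (\<i> * of_real \<rho>))) \<le> 1" using \<rho> by (intro axis) (auto simp: norm_mult)
        finally show ?thesis unfolding H_def norm_mult
          using mult_mono[OF _ nexp1[OF zD(1)], of "norm (G z)" "1 + \<epsilon>"] \<epsilon> by auto
      next
        case 3
        then have "norm (G z) \<le> 1" using axis zD by blast
        then show ?thesis unfolding H_def norm_mult
          using mult_mono[OF _ nexp1[OF zD(1)], of "norm (G z)" 1] \<epsilon> by auto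
      next
        case 4
        \<comment> \<open>On the arc \<rho>^2 = z cnj z, which turns the majorant into the real
          number \<rho>^2 / (2 Re z) >= \<rho> / 2.\<close>
        have "of_real (\<rho>\<^sup>2) + z\<^sup>2 = z * (cnj z + z)"
          using complex_norm_square[of z] 4 by (simp add: power2_eq_square algebra_simps)
        also have "cnj z + z = of_real (2 * Re z)" by (simp add: complex_eq_iff)
        finally have "m z = of_real (\<rho>\<^sup>2 / (2 * Re z))"
          using 4 \<rho> by (auto simp: m_def)
        then have "Re (m z) = \<rho>\<^sup>2 / (2 * Re z)" by simp
        also have "\<dots> \<ge> \<rho>\<^sup>2 / (2 * \<rho>)"
          using 4 \<rho> complex_Re_le_cmod[of z] by (intro divide_left_mono) auto
        finally have "Re (m z) \<ge> \<rho> / 2" using \<rho> by (simp add: power2_eq_square)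
        then have "2 * c * Re (m z) \<ge> c * \<rho>" using mult_left_mono[of "\<rho> / 2" "Re (m z)" "2 * c"] c by simp
        then have "norm (exp (- of_real (2 * c) * m z)) \<le> exp (- (c * \<rho>))" unfolding nexp by simp
        then have "norm (H z) \<le> exp (c * \<rho>) * exp (- (c * \<rho>))"
          unfolding H_def norm_mult using arc[of z] 4 by (intro mult_mono) auto
        then show ?thesis using \<epsilon> by (simp add: exp_minus)
      qed
    qed
    then show ?thesis .
  qed
  have "norm (H (of_real x)) \<le> 1" by (rule field_le_epsilon) (use Hx in auto)
  then have "norm (G (of_real x)) * exp (- 2 * c * Re (m (of_real x))) \<le> 1"
    unfolding H_def norm_mult nexp .
  then have "norm (G (of_real x)) \<le> exp (2 * c * Re (m (of_real x)))"
    by (simp add: exp_minus field_simps)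
  \<comment> \<open>At a point x of the positive axis the majorant is at most x: the bound on the
    arc costs an amount linear in x and independent of \<rho>.\<close>
  also have "m (of_real x) = of_real (\<rho>\<^sup>2 * x / (\<rho>\<^sup>2 + x\<^sup>2))" by (simp add: m_def)
  also have "exp (2 * c * Re (of_real (\<rho>\<^sup>2 * x / (\<rho>\<^sup>2 + x\<^sup>2)))) \<le> exp (2 * c * x)"
  proof -
    have "\<rho>\<^sup>2 * x / (\<rho>\<^sup>2 + x\<^sup>2) \<le> x" using x \<rho> by (simp add: field_simps add_pos_pos)
    then have "2 * c * (\<rho>\<^sup>2 * x / (\<rho>\<^sup>2 + x\<^sup>2)) \<le> 2 * c * x" using c by (intro mult_left_mono) auto
    then show ?thesis by (simp only: Re_complex_of_real exp_le_cancel_iff)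
  qed
  finally show ?thesis .
qed

section \<open>Quotients over half-disc Blaschke products and their evaluation on the positive
  axis\<close>

lemma ln_norm_one_plus:
  assumes "norm v \<le> 1 / 2"
  shows "\<bar>ln (norm (1 + v)) - Re v\<bar> \<le> 2 * (norm v)\<^sup>2" "\<bar>ln (norm (1 + v))\<bar> \<le> 2 * norm v"
proof -
  have "1 + v \<noteq> 0"
  proof
    assume "1 + v = 0"
    then have "v = - 1" by (simp add: add_eq_0_iff)
    then show False using assms by simp
  qed
  then have "Re (Ln (1 + v) - v) = ln (norm (1 + v)) - Re v" by simp
  then have "\<bar>ln (norm (1 + v)) - Re v\<bar> \<le> norm (Ln (1 + v) - v)" by (metis abs_Re_le_cmod)
  also have "\<dots> \<le> 2 * (norm v)\<^sup>2" by (rule norm_Ln_minus_le[OF assms])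
  finally show 1: "\<bar>ln (norm (1 + v)) - Re v\<bar> \<le> 2 * (norm v)\<^sup>2" .
  have "2 * (norm v)\<^sup>2 \<le> norm v"
    using mult_right_mono[OF assms norm_ge_zero[of v]] by (simp add: power2_eq_square)
  then show "\<bar>ln (norm (1 + v))\<bar> \<le> 2 * norm v" using 1 abs_Re_le_cmod[of v] by linarith
qed

lemma card_Plus_fibre:
  assumes "finite A" "finite B"
  shows "card {n\<in>A <+> B. case_sum a b n = z} = card {n\<in>A. a n = z} + card {n\<in>B. b n = z}"
proof -
  have "{n\<in>A <+> B. case_sum a b n = z} = {n\<in>A. a n = z} <+> {n\<in>B. b n = z}" by auto
  then show ?thesis using assms by (simp add: card_Plus)
qed

lemma prod_Plus_fibre:
  fixes z :: complex
  assumes "finite A" "finite B"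
  shows "(\<Prod>n\<in>A <+> B. z - case_sum a b n) = (\<Prod>n\<in>A. z - a n) * (\<Prod>n\<in>B. z - b n)"
  using assms by (simp add: prod.Plus comp_def)

text \<open>The zeros of f in A and those of g in U are replaced by Blaschke factors of the
  half-disc, and the zeros of g on the diameter cancel against zeros of f that the inequality forces
  there. The quotient G is then holomorphic, bounded by 1 on the diameter and by exp (c \<rho>) on
  the arc.\<close>

lemma half_disc_comparison:
  fixes p :: "'i \<Rightarrow> complex"
  assumes f: "f holomorphic_on UNIV" "f w0 \<noteq> 0" and g: "g holomorphic_on UNIV" "g w1 \<noteq> 0"
    and le: "\<And>y::real. norm (f (axis y)) \<le> norm (g (axis y))"
    and A: "finite A" "\<And>n. n \<in> A \<Longrightarrow> Re (p n) > 0 \<and> norm (p n) < \<rho>"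
      "\<And>z. Re z > 0 \<Longrightarrow> vanishes f z (card {n\<in>A. p n = z})"
    and a: "\<And>t. finite (near I a t)" "\<And>z. zero_count g z = enat (card {n\<in>I. a n = z})"
    and \<rho>: "\<rho> > 0" and nz: "\<And>z. norm z = \<rho> \<Longrightarrow> g z \<noteq> 0"
    and c: "c \<ge> 0" and arc: "\<And>z. norm z = \<rho> \<Longrightarrow> norm (f z) \<le> exp (c * \<rho>) * norm (g z)"
    and x: "0 < x" "x < \<rho>"
  defines "U \<equiv> {n\<in>I. Re (a n) > 0 \<and> norm (a n) < \<rho>}"
  shows "norm (f (of_real x)) * (\<Prod>n\<in>U. norm ((of_real x - a n) * hbl \<rho> (a n) (of_real x)))
     \<le> norm (g (of_real x)) * (\<Prod>n\<in>A. norm ((of_real x - p n) * hbl \<rho> (p n) (of_real x))) * exp (2 * c * x)"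
proof -
  let ?D = "{z. Re z \<ge> 0 \<and> norm z \<le> \<rho>}"
  define Q where "Q = {n\<in>I. Re (a n) = 0 \<and> norm (a n) < \<rho>}"
  have UQ: "finite U" "finite Q"
    by (rule finite_subset[OF _ a(1)[of \<rho>]]; auto simp: U_def Q_def near_def)+
  have UP: "Re (a n) > 0" "norm (a n) < \<rho>" if "n \<in> U" for n using that by (auto simp: U_def)
  have van: "vanishes g z m \<longleftrightarrow> m \<le> card {n\<in>I. a n = z}" for z m
    using vanishes_iff[OF g, of z m] a(2)[of z] by simp
  have finfib: "finite {n\<in>I. a n = z}" for z
    by (rule finite_subset[OF _ a(1)[of "norm z"]]) (auto simp: near_def)
  obtain g2 where g2: "g2 holomorphic_on UNIV" "\<And>z. g z = (\<Prod>n\<in>U \<union> Q. z - a n) * g2 z"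
  proof (rule entire_divide_finite[OF g(1), of "U \<union> Q" a])
    show "finite (U \<union> Q)" using UQ by simp
    show "vanishes g z (card {n \<in> U \<union> Q. a n = z})" for z
      unfolding van by (rule card_mono[OF finfib]) (auto simp: U_def Q_def)
  qed blast
  have disj: "U \<inter> Q = {}" by (auto simp: U_def Q_def)
  have gUQ: "g z = (\<Prod>n\<in>U. z - a n) * (\<Prod>n\<in>Q. z - a n) * g2 z" for z
    unfolding g2(2) by (simp add: prod.union_disjoint[OF UQ disj])
  have g2nz: "g2 z \<noteq> 0" if z: "z \<in> ?D" for z
  proof (cases "norm z = \<rho>")
    case True
    then show ?thesis using nz[of z] g2(2)[of z] by auto
  next
    case False
    show ?thesis
    proof (rule quotient_nonzero[OF _ g2])
      show "finite (U \<union> Q)" using UQ by simp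
      have "{n\<in>U \<union> Q. a n = z} = {n\<in>I. a n = z}" using z False by (auto simp: U_def Q_def)
      then show "\<not> vanishes g z (Suc (card {n \<in> U \<union> Q. a n = z}))" using van by simp
    qed
  qed
  \<comment> \<open>The points of A and of Q have different index types, hence the disjoint
    sum.\<close>
  obtain f2 where f2: "f2 holomorphic_on UNIV" "\<And>z. f z = (\<Prod>n\<in>A <+> Q. z - case_sum p a n) * f2 z"
  proof (rule entire_divide_finite[OF f(1), of "A <+> Q" "case_sum p a"])
    show "finite (A <+> Q)" using UQ A by simp
    fix z
    show "vanishes f z (card {n \<in> A <+> Q. case_sum p a n = z})"
      unfolding card_Plus_fibre[OF A(1) UQ(2)]
    proof (cases "Re z = 0")
      case True
      then have "{n\<in>A. p n = z} = {}" using A(2) by force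
      moreover have "vanishes f z (card {n\<in>Q. a n = z})"
      proof (rule vanishes_of_bound_on_axis[OF f le _ True])
        show "vanishes g z (card {n \<in> Q. a n = z})"
          unfolding van by (rule card_mono[OF finfib]) (auto simp: Q_def)
      qed
      ultimately show "vanishes f z (card {n\<in>A. p n = z} + card {n\<in>Q. a n = z})"
        by (simp only: card.empty add_0_left add_0_right)
    next
      case False
      then have "{n\<in>Q. a n = z} = {}" by (auto simp: Q_def)
      moreover have "vanishes f z (card {n\<in>A. p n = z})"
      proof (cases "Re z > 0")
        case neg: False
        then have "{n\<in>A. p n = z} = {}" using A(2) by force
        then show ?thesis using vanishes_0[OF f(1), of z] by (simp only: card.empty)
      qed (use A(3) in auto)
      ultimately show "vanishes f z (card {n\<in>A. p n = z} + card {n\<in>Q. a n = z})"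
        by (simp only: card.empty add_0_left add_0_right)
    qed
  qed blast
  have fAQ: "f z = (\<Prod>n\<in>A. z - p n) * (\<Prod>n\<in>Q. z - a n) * f2 z" for z
    unfolding f2(2) prod_Plus_fibre[OF A(1) UQ(2)] ..
  define BU BA where "BU z = (\<Prod>n\<in>U. hbl \<rho> (a n) z)" and "BA z = (\<Prod>n\<in>A. hbl \<rho> (p n) z)" for z
  define G where "G z = f2 z * BU z / (BA z * g2 z)" for z
  have hbl_hol: "hbl \<rho> w holomorphic_on ?D" if "Re w > 0" "norm w < \<rho>" for w
    unfolding hbl_def[abs_def] using hbl_nonzero[OF that]
    by (intro holomorphic_intros) (auto simp del: of_real_power)
  have BAnz: "BA z \<noteq> 0" if "z \<in> ?D" for z
    unfolding BA_def using A hbl_nonzero(4) that by auto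
  have holD: "G holomorphic_on ?D"
    unfolding G_def BU_def BA_def
    by (intro holomorphic_intros hbl_hol holomorphic_on_subset[OF f2(1)] holomorphic_on_subset[OF g2(1)])
      (use UP A g2nz BAnz in \<open>auto simp: BA_def\<close>)
  have nB: "(\<Prod>n\<in>A. norm ((z - p n) * hbl \<rho> (p n) z)) = norm (\<Prod>n\<in>A. z - p n) * norm (BA z)"
    "(\<Prod>n\<in>U. norm ((z - a n) * hbl \<rho> (a n) z)) = norm (\<Prod>n\<in>U. z - a n) * norm (BU z)" for z
    by (simp_all add: BA_def BU_def norm_mult prod.distrib prod_norm)
  have rel: "norm (f z) * (\<Prod>n\<in>U. norm ((z - a n) * hbl \<rho> (a n) z))
      = norm (g z) * (\<Prod>n\<in>A. norm ((z - p n) * hbl \<rho> (p n) z)) * norm (G z)" if "z \<in> ?D" for z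
    unfolding nB unfolding fAQ gUQ G_def norm_mult norm_divide using BAnz[OF that] g2nz[OF that] by simp
  have axis: "norm (G z) \<le> 1" if z: "Re z = 0" "norm z \<le> \<rho>" for z
  proof -
    \<comment> \<open>|f| <= |g| is divided by the common factor over Q. This is legitimate off
      finitely many points of the axis, and the result extends to them by continuity.\<close>
    define P where "P s = norm (f2 (axis s) * (\<Prod>n\<in>A. axis s - p n)) - norm (g2 (axis s) * (\<Prod>n\<in>U. axis s - a n))" for s :: real
    have zi: "z = axis (Im z)" using z by (simp add: complex_eq_iff)
    have cont: "continuous_on UNIV P"
    proof -
      have "continuous_on UNIV (\<lambda>s::real. axis s)" by (intro continuous_intros)
      then have "continuous_on UNIV (\<lambda>s::real. h (axis s))" if "h holomorphic_on UNIV" for h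
        using continuous_on_compose2[OF holomorphic_on_imp_continuous_on[OF that], of UNIV "\<lambda>s. axis s"]
        by simp
      then show ?thesis unfolding P_def using f2(1) g2(1) by (intro continuous_intros) auto
    qed
    have P0: "P s \<le> 0" if s: "s \<notin> (\<lambda>n. Im (a n)) ` Q" for s
    proof -
      have "axis s - a n \<noteq> 0" if "n \<in> Q" for n
        using s that by (auto simp: complex_eq_iff)
      then have q: "(\<Prod>n\<in>Q. axis s - a n) \<noteq> 0" using UQ by auto
      have "norm (f (axis s)) \<le> norm (g (axis s))" by (rule le)
      then have "norm (\<Prod>n\<in>Q. axis s - a n) * norm (f2 (axis s) * (\<Prod>n\<in>A. axis s - p n))
         \<le> norm (\<Prod>n\<in>Q. axis s - a n) * norm (g2 (axis s) * (\<Prod>n\<in>U. axis s - a n))"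
        unfolding fAQ gUQ norm_mult by (simp add: mult_ac)
      then have "norm (f2 (axis s) * (\<Prod>n\<in>A. axis s - p n)) \<le> norm (g2 (axis s) * (\<Prod>n\<in>U. axis s - a n))"
        using q by (subst (asm) mult_le_cancel_left_pos) auto
      then show ?thesis by (simp add: P_def)
    qed
    have "P (Im z) \<le> 0"
    proof -
      have "\<not> Im z islimpt ((\<lambda>n. Im (a n)) ` Q)" using UQ by (intro islimpt_finite) auto
      then have "\<forall>\<^sub>F s in at (Im z). s \<notin> (\<lambda>n. Im (a n)) ` Q" by (simp add: islimpt_iff_eventually)
      then have "\<forall>\<^sub>F s in at (Im z). P s \<le> 0" by eventually_elim (rule P0)
      moreover have "(P \<longlongrightarrow> P (Im z)) (at (Im z))"
        using cont by (metis continuous_on_eq_continuous_at isCont_def open_UNIV UNIV_I)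
      ultimately show ?thesis by (intro tendsto_upperbound[of P "P (Im z)" "at (Im z)"]) auto
    qed
    then have le2: "norm (f2 z * (\<Prod>n\<in>A. z - p n)) \<le> norm (g2 z * (\<Prod>n\<in>U. z - a n))"
      using zi by (simp add: P_def)
    have zD: "z \<in> ?D" using z by simp
    have "(\<Prod>n\<in>A. norm ((z - p n) * hbl \<rho> (p n) z)) = 1"
      using A(2) hbl_norm_axis z by (intro prod.neutral) auto
    moreover have "(\<Prod>n\<in>U. norm ((z - a n) * hbl \<rho> (a n) z)) = 1"
      using UP hbl_norm_axis z by (intro prod.neutral) auto
    ultimately have nA: "norm (\<Prod>n\<in>A. z - p n) * norm (BA z) = 1" and nU: "norm (\<Prod>n\<in>U. z - a n) * norm (BU z) = 1"
      using nB[of z] by simp_all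
    have "norm (f2 z) * norm (BU z) * (norm (\<Prod>n\<in>A. z - p n) * norm (BA z)) =
       (norm (f2 z) * norm (\<Prod>n\<in>A. z - p n)) * (norm (BU z) * norm (BA z))" by (simp add: mult_ac)
    also have "\<dots> \<le> (norm (g2 z) * norm (\<Prod>n\<in>U. z - a n)) * (norm (BU z) * norm (BA z))"
      using le2 by (intro mult_right_mono) (auto simp: norm_mult)
    also have "\<dots> = norm (g2 z) * norm (BA z) * (norm (\<Prod>n\<in>U. z - a n) * norm (BU z))" by (simp add: mult_ac)
    finally have "norm (f2 z) * norm (BU z) \<le> norm (g2 z) * norm (BA z)" unfolding nA nU by simp
    then show ?thesis unfolding G_def norm_divide norm_mult
      using BAnz[OF zD] g2nz[OF zD] by (subst divide_le_eq_1_pos) (auto simp: mult.commute)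
  qed
  have arcG: "norm (G z) \<le> exp (c * \<rho>)" if z: "Re z \<ge> 0" "norm z = \<rho>" for z
  proof -
    have zD: "z \<in> ?D" using z by simp
    have "(\<Prod>n\<in>A. norm ((z - p n) * hbl \<rho> (p n) z)) = 1"
      using A(2) hbl_norm_arc z by (intro prod.neutral) auto
    moreover have "(\<Prod>n\<in>U. norm ((z - a n) * hbl \<rho> (a n) z)) = 1"
      using UP hbl_norm_arc z by (intro prod.neutral) auto
    ultimately have "norm (f z) = norm (g z) * norm (G z)" using rel[OF zD] by simp
    then have "norm (g z) * norm (G z) \<le> norm (g z) * exp (c * \<rho>)" using arc[OF z(2)] by (simp add: mult.commute)
    then show ?thesis using nz[OF z(2)] by (subst (asm) mult_le_cancel_left_pos) auto
  qed
  have Gx: "norm (G (of_real x)) \<le> exp (2 * c * x)"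
    by (rule half_disc_maximum[OF \<rho> c _ _ axis arcG x])
      (auto intro: holomorphic_on_subset[OF holD] holomorphic_on_imp_continuous_on[OF holD])
  have "of_real x \<in> ?D" using x by simp
  from rel[OF this] show ?thesis using Gx by (auto intro!: mult_left_mono mult_nonneg_nonneg prod_nonneg)
qed

text \<open>The factor splits into the half-plane Blaschke factor (x - a) / (x + cnj a), whose
  negative log modulus \<beta>1 is 2 x Re (1 / a) to first order in x / |a|, and the reflected part
  (1 + v) / (1 - cnj v) with v = a x / \<rho>^2, which is a small correction.\<close>

lemma hbl_log_estimates:
  assumes a: "Re a > 0" "norm a < \<rho>" and x: "0 < x" "4 * x \<le> \<rho>" and ne: "of_real x \<noteq> a"
  defines "\<beta> \<equiv> - ln (norm ((of_real x - a) * hbl \<rho> a (of_real x)))"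
    and "\<beta>1 \<equiv> ln (norm (of_real x + cnj a) / norm (of_real x - a))"
  shows "\<bar>\<beta> - \<beta>1\<bar> \<le> 4 * x * norm a / \<rho>\<^sup>2" "\<beta>1 \<ge> 0"
    "4 * x \<le> norm a \<Longrightarrow> \<bar>\<beta>1 - 2 * x * Re (1 / a)\<bar> \<le> 4 * x\<^sup>2 / (norm a)\<^sup>2"
    "norm ((of_real x - a) * hbl \<rho> a (of_real x)) > 0"
proof -
  have \<rho>: "\<rho> > 0" using x by linarith
  have xr: "Re (of_real x) \<ge> 0" "norm (complex_of_real x) \<le> \<rho>" using x by auto
  note nz = hbl_nonzero[OF a xr]
  define v where "v = a * of_real (x / \<rho>\<^sup>2)"
  have nv: "norm v = x * norm a / \<rho>\<^sup>2" using x \<rho> by (simp add: v_def norm_mult norm_divide norm_power)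
  have "norm v \<le> 1 / 2"
  proof -
    have "x * norm a \<le> (\<rho> / 4) * \<rho>" using a x by (intro mult_mono) auto
    moreover have "0 \<le> x * norm a" using x by simp
    ultimately have "x * norm a \<le> 1 / 2 * \<rho>\<^sup>2" using \<rho> by (simp add: power2_eq_square)
    then show ?thesis unfolding nv using \<rho> by (simp add: pos_divide_le_eq)
  qed
  then have lv: "\<bar>ln (norm (1 + v))\<bar> \<le> 2 * norm v" "\<bar>ln (norm (1 - cnj v))\<bar> \<le> 2 * norm v"
    using ln_norm_one_plus(2)[of v] ln_norm_one_plus(2)[of "- cnj v"] by auto
  have \<rho>nz: "complex_of_real (\<rho>\<^sup>2) \<noteq> 0" using \<rho> by simp
  have e1: "of_real (\<rho>\<^sup>2) + a * of_real x = of_real (\<rho>\<^sup>2) * (1 + v)"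
    using \<rho> by (simp add: v_def field_simps)
  have e2: "of_real (\<rho>\<^sup>2) - cnj a * of_real x = of_real (\<rho>\<^sup>2) * (1 - cnj v)"
    using \<rho> by (simp add: v_def field_simps)
  have nz1: "1 + v \<noteq> 0" "1 - cnj v \<noteq> 0" using nz e1 e2 by (auto simp del: of_real_power)
  have xa: "norm (of_real x - a) > 0" "norm (of_real x + cnj a) > 0" using ne nz by auto
  have hb: "norm ((of_real x - a) * hbl \<rho> a (of_real x)) =
     norm (of_real x - a) / norm (of_real x + cnj a) * (norm (1 + v) / norm (1 - cnj v))"
    unfolding hbl_def e1 e2 norm_mult norm_divide using \<rho> by (simp add: norm_power)
  show pos: "norm ((of_real x - a) * hbl \<rho> a (of_real x)) > 0"
    unfolding hb using xa nz1 by (intro mult_pos_pos divide_pos_pos) auto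
  have "\<beta> = \<beta>1 - ln (norm (1 + v)) + ln (norm (1 - cnj v))"
    unfolding \<beta>_def \<beta>1_def hb using xa nz1 by (simp add: ln_mult ln_div)
  then show "\<bar>\<beta> - \<beta>1\<bar> \<le> 4 * x * norm a / \<rho>\<^sup>2" using lv nv by simp
  have "(norm (of_real x - a))\<^sup>2 \<le> (norm (of_real x + cnj a))\<^sup>2"
    unfolding cmod_power2 using a x by (simp add: power2_eq_square algebra_simps)
  then have "norm (of_real x - a) \<le> norm (of_real x + cnj a)" by (meson norm_ge_zero power2_le_imp_le)
  then show "\<beta>1 \<ge> 0" unfolding \<beta>1_def using xa by simp
  assume xa4: "4 * x \<le> norm a"
  define u where "u = of_real x / a"
  have a0: "a \<noteq> 0" using a by auto
  have nu: "norm u = x / norm a" using x by (simp add: u_def norm_divide)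
  have u: "norm u \<le> 1 / 2" unfolding nu using xa4 x a0 by (simp add: divide_simps)
  have f1: "of_real x + cnj a = cnj a * (1 + cnj u)" and f2: "of_real x - a = a * - (1 - u)"
    using a0 by (simp_all add: u_def field_simps)
  have "\<beta>1 = ln (norm (1 + cnj u)) - ln (norm (1 - u))"
  proof -
    have "norm (1 + cnj u) \<noteq> 0" "norm (1 - u) \<noteq> 0" using xa unfolding f1 f2 by (auto simp: norm_mult)
    then show ?thesis unfolding \<beta>1_def f1 f2 norm_mult norm_minus_cancel using a0 by (simp add: ln_div)
  qed
  moreover have "\<bar>ln (norm (1 + cnj u)) - Re u\<bar> \<le> 2 * (norm u)\<^sup>2"
    using ln_norm_one_plus(1)[of "cnj u"] u by simp
  moreover have "\<bar>ln (norm (1 - u)) + Re u\<bar> \<le> 2 * (norm u)\<^sup>2"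
    using ln_norm_one_plus(1)[of "- u"] u by simp
  moreover have "Re u = x * Re (1 / a)"
  proof -
    have "u = of_real x * (1 / a)" by (simp add: u_def)
    then show ?thesis by (simp only: Re_complex_of_real times_complex.simps Im_complex_of_real mult_zero_left diff_zero)
  qed
  ultimately have "\<bar>\<beta>1 - 2 * x * Re (1 / a)\<bar> \<le> 4 * (norm u)\<^sup>2" by linarith
  then show "\<bar>\<beta>1 - 2 * x * Re (1 / a)\<bar> \<le> 4 * x\<^sup>2 / (norm a)\<^sup>2" by (simp add: nu power_divide)
qed

text \<open>In the half-disc comparison at a good point x between r and 2 r all error terms are
  O(x), while points beyond 8 r >= 4 x enter with 2 x Re (1 / a); division by 2 x gives the claim.
  The factor 8 on the left-hand side keeps the expansion away from points near x.\<close>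

lemma carleman_comparison_step:
  assumes f: "f holomorphic_on UNIV" "f 0 \<noteq> 0" and g: "g holomorphic_on UNIV" "g 0 \<noteq> 0"
    and K: "K \<ge> 0" "\<And>z. norm (f z) \<le> exp (K * (1 + norm z))" "\<And>z. norm (g z) \<le> exp (K * (1 + norm z))"
    and le: "\<And>y::real. norm (f (axis y)) \<le> norm (g (axis y))"
    and b: "\<And>z. finite {n\<in>J. b n = z}" "\<And>z. vanishes f z (card {n\<in>J. b n = z})"
    and a: "\<And>z. finite {n\<in>I. a n = z}" "\<And>z. zero_count g z = enat (card {n\<in>I. a n = z})"
  obtains C where "C \<ge> 0" "\<And>r R. 1 \<le> r \<Longrightarrow> 8 * r \<le> R \<Longrightarrow>
    lsum J b R - lsum J b (8 * r) \<le> lsum I a R - lsum I a r + C"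
proof -
  have van: "vanishes g z m \<longleftrightarrow> m \<le> card {n\<in>I. a n = z}" for z m
    using vanishes_iff[OF g, of z m] a(2)[of z] by simp
  obtain If :: "nat set" and af where af0: "\<And>n. n \<in> If \<Longrightarrow> af n \<in> UNIV"
    "\<And>z. z \<in> UNIV \<Longrightarrow> finite {n\<in>If. af n = z} \<and> zero_count f z = enat (card {n\<in>If. af n = z})"
    using zero_family_exists[OF f, of UNIV] by blast
  then have af: "\<And>z. finite {n\<in>If. af n = z}" "\<And>z. zero_count f z = enat (card {n\<in>If. af n = z})" by auto
  have vaf: "vanishes f z (card {n\<in>If. af n = z})" for z using vanishes_iff[OF f] af(2) by simp
  have fdJ: "fin_dens J b" by (rule jensen_fin_dens_origin[OF f K(1,2) b])
  have fdI: "fin_dens I a" by (rule jensen_fin_dens_origin[OF g K(1,3) a(1)]) (simp add: van)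
  have fdf: "fin_dens If af" by (rule jensen_fin_dens_origin[OF f K(1,2) af(1) vaf])
  note finJ = fin_dens_near_finite[OF fdJ] and finI = fin_dens_near_finite[OF fdI] and finf = fin_dens_near_finite[OF fdf]
  obtain KJ where KJ: "KJ \<ge> 1" "\<And>t. t \<ge> 0 \<Longrightarrow> real (card (near J b t)) \<le> KJ * (1 + t)" using fin_densE[OF fdJ] by metis
  obtain KI where KI: "KI \<ge> 1" "\<And>t. t \<ge> 0 \<Longrightarrow> real (card (near I a t)) \<le> KI * (1 + t)" using fin_densE[OF fdI] by metis
  obtain Kf where Kf: "Kf \<ge> 1" "\<And>t. t \<ge> 0 \<Longrightarrow> real (card (near If af t)) \<le> Kf * (1 + t)" using fin_densE[OF fdf] by metis
  define k where "k = KJ + KI + Kf"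
  have k: "k \<ge> 1" using KJ KI Kf by (simp add: k_def)
  have up: "u * (1 + t) \<le> k * (1 + t)" if "t \<ge> 0" "u \<in> {KJ, KI, Kf}" for u t
    using that KJ KI Kf by (intro mult_right_mono) (auto simp: k_def)
  have cJ: "real (card (near J b t)) \<le> k * (1 + t)" and cI: "real (card (near I a t)) \<le> k * (1 + t)"
    and cf: "real (card (near If af t)) \<le> k * (1 + t)" if "t \<ge> 0" for t
    using KJ(2)[OF that] KI(2)[OF that] Kf(2)[OF that] up[OF that] by (meson insertCI order_trans)+
  define J1 where "J1 = {n\<in>J. norm (b n) \<ge> 1}"
  define I1 where "I1 = {n\<in>I. norm (a n) \<ge> 1}"
  have "fin_dens J1 b" "fin_dens I1 a" using fdJ fdI by (auto simp: J1_def I1_def intro: fin_dens_subset)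
  then obtain CJ CI where CJ: "CJ \<ge> 0" "\<And>F T. finite F \<Longrightarrow> F \<subseteq> J1 \<Longrightarrow> T > 0 \<Longrightarrow> (\<And>n. n \<in> F \<Longrightarrow> norm (b n) \<ge> T) \<Longrightarrow>
      (\<Sum>n\<in>F. 1 / (norm (b n))\<^sup>2) \<le> CJ / T"
    and CI: "CI \<ge> 0" "\<And>F T. finite F \<Longrightarrow> F \<subseteq> I1 \<Longrightarrow> T > 0 \<Longrightarrow> (\<And>n. n \<in> F \<Longrightarrow> norm (a n) \<ge> T) \<Longrightarrow>
      (\<Sum>n\<in>F. 1 / (norm (a n))\<^sup>2) \<le> CI / T"
    using fin_dens_tail_sum[of J1 b 1] fin_dens_tail_sum[of I1 a 1] unfolding J1_def I1_def
    by (smt (verit, del_insts) mem_Collect_eq)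
  obtain Cg where Cg: "Cg \<ge> 0" "\<And>R r (z::complex). R \<ge> 1 \<Longrightarrow> R \<le> r \<Longrightarrow> r \<le> 2 * R \<Longrightarrow> norm z = r \<Longrightarrow>
     (\<And>n. n \<in> near I a (4 * R) \<Longrightarrow> r \<noteq> norm (a n)) \<Longrightarrow>
     norm (g z) \<ge> exp (- Cg * R - (\<Sum>n\<in>near I a (4 * R). ln (10 * R / \<bar>r - norm (a n)\<bar>)))"
    by (rule minimum_modulus[OF g K(1,3) a]) blast
  obtain Cf where Cf: "Cf \<ge> 0" "\<And>R r (z::complex). R \<ge> 1 \<Longrightarrow> R \<le> r \<Longrightarrow> r \<le> 2 * R \<Longrightarrow> norm z = r \<Longrightarrow>
     (\<And>n. n \<in> near If af (4 * R) \<Longrightarrow> r \<noteq> norm (af n)) \<Longrightarrow>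
     norm (f z) \<ge> exp (- Cf * R - (\<Sum>n\<in>near If af (4 * R). ln (10 * R / \<bar>r - norm (af n)\<bar>)))"
    by (rule minimum_modulus[OF f K(1,2) af]) blast
  \<comment> \<open>162 = 18 * 9: the good radius loses 18 for each zero of g of modulus up to 8 R,
    and there are at most 9 k R of these.\<close>
  define c where "c = 2 * K + 2 * Cg + 162 * k + 1"
  have c: "c \<ge> 0" using K Cg k by (simp add: c_def)
  define C where "C = (CJ + 26 * k + CI + 506 * k + 2 * K + Cf + 2 * c) / 2"
  show ?thesis
  proof (rule that[of C])
    show "C \<ge> 0" using CJ CI k K Cf c by (simp add: C_def)
    fix r R :: real assume r: "1 \<le> r" and R: "8 * r \<le> R"
    \<comment> \<open>The same x must be good for the zeros of f, to bound |f x| from below, and for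
      the zeros of g near x, whose Blaschke factors may be small there.\<close>
    let ?F = "near If af (4 * r) <+> near I a (8 * r)"
    let ?t = "case_sum (\<lambda>n. norm (af n)) (\<lambda>n. norm (a n))"
    have finF: "finite ?F" using finf finI by simp
    obtain x where x: "r \<le> x" "x \<le> 2 * r" and xne: "\<And>j. j \<in> ?F \<Longrightarrow> x \<noteq> ?t j"
      and xsum: "(\<Sum>j\<in>?F. ln (10 * r / \<bar>x - ?t j\<bar>)) \<le> 18 * real (card ?F) + 1"
      using good_radius[OF finF, of r ?t] r by auto
    define Sf where "Sf = (\<Sum>n\<in>near If af (4 * r). ln (10 * r / \<bar>x - norm (af n)\<bar>))"
    define SI where "SI = (\<Sum>n\<in>near I a (8 * r). ln (10 * r / \<bar>x - norm (a n)\<bar>))"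
    have xnef: "x \<noteq> norm (af n)" if "n \<in> near If af (4 * r)" for n using xne[of "Inl n"] that by auto
    have xnea: "x \<noteq> norm (a n)" if "n \<in> near I a (8 * r)" for n using xne[of "Inr n"] that by auto
    have lnpos: "0 \<le> ln (10 * r / \<bar>x - u\<bar>)" if "x \<noteq> u" "0 \<le> u" "u \<le> 8 * r" for u
    proof -
      have "\<bar>x - u\<bar> \<le> 10 * r" using that x r by linarith
      then show ?thesis using that by simp
    qed
    have "Sf + SI = (\<Sum>j\<in>?F. ln (10 * r / \<bar>x - ?t j\<bar>))"
      unfolding Sf_def SI_def using finf finI by (simp add: sum.Plus comp_def)
    also note xsum
    also have "real (card ?F) = real (card (near If af (4 * r))) + real (card (near I a (8 * r)))"
      using finf finI by (simp add: card_Plus)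
    also have "18 * (real (card (near If af (4 * r))) + real (card (near I a (8 * r)))) + 1 \<le> 253 * k * r"
    proof -
      have "real (card (near If af (4 * r))) \<le> k * (1 + 4 * r)" "real (card (near I a (8 * r))) \<le> k * (1 + 8 * r)"
        using cf cI r by auto
      moreover have "k * (1 + 4 * r) \<le> k * (5 * r)" "k * (1 + 8 * r) \<le> k * (9 * r)"
        using r k by (auto intro!: mult_left_mono)
      moreover have "1 \<le> k * r" using r k mult_mono[of 1 k 1 r] by simp
      ultimately show ?thesis by (simp add: algebra_simps)
    qed
    finally have Ssum: "Sf + SI \<le> 253 * k * r" .
    have x0: "x > 0" "x \<ge> 1" using x r by auto
    have fx: "norm (f (of_real x)) \<ge> exp (- Cf * r - Sf)"
      unfolding Sf_def by (rule Cf(2)[OF r x]) (use x0 xnef in auto)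
    have R0: "R \<ge> 8" "R > 0" using r R by auto
    \<comment> \<open>On the arc it is |g| that has to be bounded below, so the radius is chosen
      good for the zeros of g.\<close>
    obtain \<rho> where \<rho>: "2 * R \<le> \<rho>" "\<rho> \<le> 2 * (2 * R)" and \<rho>ne: "\<And>n. n \<in> near I a (8 * R) \<Longrightarrow> \<rho> \<noteq> norm (a n)"
      and \<rho>sum: "(\<Sum>n\<in>near I a (8 * R). ln (10 * (2 * R) / \<bar>\<rho> - norm (a n)\<bar>)) \<le> 18 * real (card (near I a (8 * R))) + 1"
      using good_radius[OF finI, of "2 * R" "8 * R" "\<lambda>n. norm (a n)"] R0 by auto
    have \<rho>0: "\<rho> > 0" "\<rho> \<ge> 1" using \<rho> R0 by auto
    have gz: "norm (g z) \<ge> exp (- (2 * Cg * R + 18 * (k * (9 * R)) + 1))" if z: "norm z = \<rho>" for z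
    proof -
      have "18 * real (card (near I a (8 * R))) + 1 \<le> 18 * (k * (9 * R)) + 1"
      proof -
        have "real (card (near I a (8 * R))) \<le> k * (1 + 8 * R)" using cI R0 by auto
        also have "\<dots> \<le> k * (9 * R)" using k R0 by (intro mult_left_mono) auto
        finally show ?thesis by (simp add: mult_ac)
      qed
      then have "- (2 * Cg * R + 18 * (k * (9 * R)) + 1) \<le> - Cg * (2 * R) - (\<Sum>n\<in>near I a (8 * R). ln (10 * (2 * R) / \<bar>\<rho> - norm (a n)\<bar>))"
        using \<rho>sum by argo
      then have "exp (- (2 * Cg * R + 18 * (k * (9 * R)) + 1)) \<le> exp (- Cg * (2 * R) - (\<Sum>n\<in>near I a (8 * R). ln (10 * (2 * R) / \<bar>\<rho> - norm (a n)\<bar>)))"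
        by (simp only: exp_le_cancel_iff)
      also have "\<dots> \<le> norm (g z)"
        using Cg(2)[of "2 * R" \<rho> z] \<rho> R0 z \<rho>ne by auto
      finally show ?thesis .
    qed
    have gnz: "g z \<noteq> 0" if "norm z = \<rho>" for z using gz[OF that] exp_gt_zero by (metis norm_zero not_less)
    have arc: "norm (f z) \<le> exp (c * \<rho>) * norm (g z)" if z: "norm z = \<rho>" for z
    proof -
      have "K * (1 + \<rho>) + (2 * Cg * R + 18 * (k * (9 * R)) + 1) \<le> c * \<rho>"
      proof -
        have "K * (1 + \<rho>) \<le> K * (2 * \<rho>)" using K \<rho>0 by (intro mult_left_mono) auto
        moreover have "2 * Cg * R \<le> 2 * Cg * \<rho>" "162 * k * R \<le> 162 * k * \<rho>" using Cg k \<rho> R0 by (auto intro!: mult_left_mono)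
        ultimately show ?thesis using \<rho>0 by (simp add: c_def algebra_simps)
      qed
      then have "exp (K * (1 + \<rho>)) \<le> exp (c * \<rho> + - (2 * Cg * R + 18 * (k * (9 * R)) + 1))" by simp
      also have "\<dots> = exp (c * \<rho>) * exp (- (2 * Cg * R + 18 * (k * (9 * R)) + 1))" by (rule exp_add)
      also have "\<dots> \<le> exp (c * \<rho>) * norm (g z)" using gz[OF z] by (intro mult_left_mono) auto
      finally show ?thesis using K(2)[of z] z by simp
    qed
    define A where "A = {n\<in>J. Re (b n) > 0 \<and> norm (b n) < \<rho>}"
    define U where "U = {n\<in>I. Re (a n) > 0 \<and> norm (a n) < \<rho>}"
    have finA: "finite A" "A \<subseteq> near J b \<rho>" by (rule finite_subset[OF _ finJ[of \<rho>]]) (auto simp: A_def near_def)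
    have finU: "finite U" "U \<subseteq> near I a \<rho>" by (rule finite_subset[OF _ finI[of \<rho>]]) (auto simp: U_def near_def)
    have AP: "Re (b n) > 0" "norm (b n) < \<rho>" if "n \<in> A" for n using that by (auto simp: A_def)
    have UP: "Re (a n) > 0" "norm (a n) < \<rho>" if "n \<in> U" for n using that by (auto simp: U_def)
    have x4: "4 * x \<le> \<rho>" using x R \<rho> r by linarith
    define X where "X = complex_of_real x"
    have main: "norm (f X) * (\<Prod>n\<in>U. norm ((X - a n) * hbl \<rho> (a n) X))
       \<le> norm (g X) * (\<Prod>n\<in>A. norm ((X - b n) * hbl \<rho> (b n) X)) * exp (2 * c * x)"
      unfolding U_def X_def
    proof (rule half_disc_comparison[OF f g le finA(1) _ _ finI a(2) \<rho>0(1) gnz c arc])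
      show "0 < Re (b n) \<and> norm (b n) < \<rho>" if "n \<in> A" for n using AP[OF that] by simp
      show "vanishes f z (card {n \<in> A. b n = z})" for z
        by (rule vanishes_mono[OF b(2)[of z]], rule card_mono[OF b(1)]) (auto simp: A_def)
      show "0 < x" "x < \<rho>" using x0 x4 by auto
    qed
    have fX: "norm (f X) > 0" using fx exp_gt_zero[of "- Cf * r - Sf"] unfolding X_def by linarith
    have neA: "X \<noteq> b n" if "n \<in> A" for n
    proof
      assume "X = b n"
      have nJ: "n \<in> J" using that by (simp add: A_def)
      have "card {m\<in>J. b m = b n} \<noteq> 0" using b(1)[of "b n"] nJ by auto
      then have "vanishes f (b n) 1" by (intro vanishes_mono[OF b(2)[of "b n"]]) simp
      then have "f (b n) = 0" using vanishes_1_iff[OF f(1)] by simp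
      then show False using fX \<open>X = b n\<close> by simp
    qed
    have neU: "X \<noteq> a n" if "n \<in> U" for n
    proof
      assume "X = a n"
      then have "norm (a n) = x" using x0 by (metis X_def abs_of_pos norm_of_real)
      then have "n \<in> near I a (8 * r)" using that x r by (auto simp: near_def U_def)
      then show False using xnea \<open>norm (a n) = x\<close> by auto
    qed
    define \<beta>A where "\<beta>A n = - ln (norm ((X - b n) * hbl \<rho> (b n) X))" for n
    define \<beta>U where "\<beta>U n = - ln (norm ((X - a n) * hbl \<rho> (a n) X))" for n
    define \<gamma>A where "\<gamma>A n = ln (norm (X + cnj (b n)) / norm (X - b n))" for n
    define \<gamma>U where "\<gamma>U n = ln (norm (X + cnj (a n)) / norm (X - a n))" for n
    have estA: "\<bar>\<beta>A n - \<gamma>A n\<bar> \<le> 4 * x * norm (b n) / \<rho>\<^sup>2" "\<gamma>A n \<ge> 0"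
      "4 * x \<le> norm (b n) \<Longrightarrow> \<bar>\<gamma>A n - 2 * x * Re (1 / b n)\<bar> \<le> 4 * x\<^sup>2 / (norm (b n))\<^sup>2"
      "norm ((X - b n) * hbl \<rho> (b n) X) > 0" if "n \<in> A" for n
      using hbl_log_estimates[OF AP[OF that] x0(1) x4] neA[OF that] unfolding \<beta>A_def \<gamma>A_def X_def by blast+
    have estU: "\<bar>\<beta>U n - \<gamma>U n\<bar> \<le> 4 * x * norm (a n) / \<rho>\<^sup>2" "\<gamma>U n \<ge> 0"
      "4 * x \<le> norm (a n) \<Longrightarrow> \<bar>\<gamma>U n - 2 * x * Re (1 / a n)\<bar> \<le> 4 * x\<^sup>2 / (norm (a n))\<^sup>2"
      "norm ((X - a n) * hbl \<rho> (a n) X) > 0" if "n \<in> U" for n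
      using hbl_log_estimates[OF UP[OF that] x0(1) x4] neU[OF that] unfolding \<beta>U_def \<gamma>U_def X_def by blast+
    have pU: "(\<Prod>n\<in>U. norm ((X - a n) * hbl \<rho> (a n) X)) > 0" using estU(4) by (intro prod_pos) auto
    have pA: "(\<Prod>n\<in>A. norm ((X - b n) * hbl \<rho> (b n) X)) > 0" using estA(4) by (intro prod_pos) auto
    have gX: "norm (g X) > 0"
    proof (rule ccontr)
      assume "\<not> norm (g X) > 0"
      then have "norm (f X) * (\<Prod>n\<in>U. norm ((X - a n) * hbl \<rho> (a n) X)) \<le> 0" using main by simp
      then show False using fX pU by (simp add: mult_le_0_iff)
    qed
    have lnm: "ln (norm (f X)) - (\<Sum>n\<in>U. \<beta>U n) \<le> ln (norm (g X)) - (\<Sum>n\<in>A. \<beta>A n) + 2 * c * x"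
    proof -
      have "ln (norm (f X) * (\<Prod>n\<in>U. norm ((X - a n) * hbl \<rho> (a n) X)))
         \<le> ln (norm (g X) * (\<Prod>n\<in>A. norm ((X - b n) * hbl \<rho> (b n) X)) * exp (2 * c * x))"
        using main fX pU by (intro ln_mono mult_pos_pos) auto
      moreover have "ln (\<Prod>n\<in>U. norm ((X - a n) * hbl \<rho> (a n) X)) = - (\<Sum>n\<in>U. \<beta>U n)"
        using estU(4) finU by (subst ln_prod) (auto simp: \<beta>U_def sum_negf)
      moreover have "ln (\<Prod>n\<in>A. norm ((X - b n) * hbl \<rho> (b n) X)) = - (\<Sum>n\<in>A. \<beta>A n)"
        using estA(4) finA by (subst ln_prod) (auto simp: \<beta>A_def sum_negf)
      ultimately show ?thesis using fX gX pU pA by (simp add: ln_mult)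
    qed
    have lnf: "ln (norm (f X)) \<ge> - Cf * r - Sf"
    proof -
      have "ln (exp (- Cf * r - Sf)) \<le> ln (norm (f X))" using fx unfolding X_def by (intro ln_mono) auto
      then show ?thesis by simp
    qed
    have lng: "ln (norm (g X)) \<le> K * (1 + x)"
    proof -
      have "ln (norm (g X)) \<le> ln (exp (K * (1 + x)))" using K(3)[of X] gX x0 by (intro ln_mono) (auto simp: X_def)
      then show ?thesis by simp
    qed
    have err: "(\<Sum>n\<in>F. 4 * x * norm (p n) / \<rho>\<^sup>2) \<le> 8 * k * x"
      if "finite G" "F \<subseteq> G" "real (card G) \<le> k * (1 + \<rho>)" "\<And>n. n \<in> F \<Longrightarrow> norm (p n) < \<rho>" for F G :: "nat set" and p :: "nat \<Rightarrow> complex"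
    proof -
      have "(\<Sum>n\<in>F. 4 * x * norm (p n) / \<rho>\<^sup>2) \<le> (\<Sum>n\<in>F. 4 * x / \<rho>)"
      proof (rule sum_mono)
        fix n assume "n \<in> F"
        then have "4 * x * norm (p n) / \<rho>\<^sup>2 \<le> 4 * x * \<rho> / \<rho>\<^sup>2"
          using that(4)[of n] x0 by (intro divide_right_mono mult_left_mono) auto
        then show "4 * x * norm (p n) / \<rho>\<^sup>2 \<le> 4 * x / \<rho>" using \<rho>0 by (simp add: power2_eq_square)
      qed
      also have "\<dots> = real (card F) * (4 * x / \<rho>)" by simp
      also have "\<dots> \<le> (k * (1 + \<rho>)) * (4 * x / \<rho>)"
        using that(3) card_mono[OF that(1,2)] x0 \<rho>0 by (intro mult_right_mono) auto
      also have "\<dots> \<le> (k * (2 * \<rho>)) * (4 * x / \<rho>)"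
        using k x0 \<rho>0 by (intro mult_right_mono mult_left_mono) auto
      also have "\<dots> = 8 * k * x" using \<rho>0 by simp
      finally show ?thesis .
    qed
    have errA: "(\<Sum>n\<in>A. 4 * x * norm (b n) / \<rho>\<^sup>2) \<le> 8 * k * x"
      by (rule err[OF finJ finA(2)]) (use cJ \<rho>0 AP in auto)
    have errU: "(\<Sum>n\<in>U. 4 * x * norm (a n) / \<rho>\<^sup>2) \<le> 8 * k * x"
      by (rule err[OF finI finU(2)]) (use cI \<rho>0 UP in auto)
    have xx: "4 * x\<^sup>2 * (D / (8 * r)) \<le> D * x" if "D \<ge> 0" for D
    proof -
      have "4 * x\<^sup>2 * (D / (8 * r)) = D * x * (x / (2 * r))" by (simp add: power2_eq_square)
      also have "\<dots> \<le> D * x * 1" using that x x0 r by (intro mult_left_mono) auto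
      finally show ?thesis by simp
    qed
    \<comment> \<open>Of the points of A those of modulus between 8 r and R are expanded; the others
      contribute nonnegative terms and are dropped.\<close>
    define B where "B = {n\<in>near J b R - near J b (8 * r). Re (b n) > 0}"
    have BA: "B \<subseteq> A" using \<rho> R0 by (auto simp: B_def A_def near_def)
    have finB: "finite B" using BA finA finite_subset by blast
    have Bn: "norm (b n) \<ge> 8 * r" if "n \<in> B" for n using that by (auto simp: B_def near_def)
    have lJ: "lsum J b R - lsum J b (8 * r) = (\<Sum>n\<in>B. Re (1 / b n))"
    proof -
      have "lsum J b R - lsum J b (8 * r) = (\<Sum>n\<in>near J b R - near J b (8 * r). pos_recip (b n))"
        by (rule lsum_diff_eq[OF finJ R])
      also have "\<dots> = (\<Sum>n\<in>B. pos_recip (b n))"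
      proof (rule sum.mono_neutral_right)
        show "\<forall>n\<in>near J b R - near J b (8 * r) - B. pos_recip (b n) = 0"
          by (intro ballI pos_recip_eq_0) (auto simp: B_def)
      qed (use finJ in \<open>auto simp: B_def\<close>)
      also have "\<dots> = (\<Sum>n\<in>B. Re (1 / b n))"
        by (intro sum.cong refl pos_recip_pos) (auto simp: B_def)
      finally show ?thesis .
    qed
    have tailB: "(\<Sum>n\<in>B. 1 / (norm (b n))\<^sup>2) \<le> CJ / (8 * r)"
      by (rule CJ(2)[OF finB]) (use Bn r in \<open>force simp: J1_def B_def near_def\<close>)+
    have lowA: "(\<Sum>n\<in>A. \<beta>A n) \<ge> 2 * x * (lsum J b R - lsum J b (8 * r)) - CJ * x - 8 * k * x"
    proof -
      have "(\<Sum>n\<in>A. \<beta>A n) \<ge> (\<Sum>n\<in>A. \<gamma>A n - 4 * x * norm (b n) / \<rho>\<^sup>2)"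
        using estA(1) by (intro sum_mono) (auto simp: abs_le_iff, force)
      then have 1: "(\<Sum>n\<in>A. \<beta>A n) \<ge> (\<Sum>n\<in>A. \<gamma>A n) - 8 * k * x" using errA by (simp add: sum_subtractf)
      have "(\<Sum>n\<in>A. \<gamma>A n) \<ge> (\<Sum>n\<in>B. \<gamma>A n)" using finA BA estA(2) by (intro sum_mono2) auto
      moreover have "(\<Sum>n\<in>B. \<gamma>A n) \<ge> (\<Sum>n\<in>B. 2 * x * Re (1 / b n) - 4 * x\<^sup>2 * (1 / (norm (b n))\<^sup>2))"
      proof (rule sum_mono)
        fix n assume n: "n \<in> B"
        then have "4 * x \<le> norm (b n)" using Bn[OF n] x by linarith
        then show "2 * x * Re (1 / b n) - 4 * x\<^sup>2 * (1 / (norm (b n))\<^sup>2) \<le> \<gamma>A n"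
          using estA(3)[of n] n BA by (auto simp: abs_le_iff)
      qed
      moreover have "(\<Sum>n\<in>B. 2 * x * Re (1 / b n) - 4 * x\<^sup>2 * (1 / (norm (b n))\<^sup>2))
         = 2 * x * (\<Sum>n\<in>B. Re (1 / b n)) - 4 * x\<^sup>2 * (\<Sum>n\<in>B. 1 / (norm (b n))\<^sup>2)"
        by (simp only: sum_subtractf sum_distrib_left)
      moreover have "4 * x\<^sup>2 * (\<Sum>n\<in>B. 1 / (norm (b n))\<^sup>2) \<le> CJ * x"
        using mult_left_mono[OF tailB, of "4 * x\<^sup>2"] xx[OF CJ(1)] by simp
      ultimately show ?thesis using 1 unfolding lJ by linarith
    qed
    \<comment> \<open>All zeros of g have to be accounted for: those of modulus up to 8 r are
      bounded through the good choice of x, those beyond are expanded.\<close>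
    define U1 U2 where "U1 = {n\<in>U. norm (a n) \<le> 8 * r}" and "U2 = {n\<in>U. norm (a n) > 8 * r}"
    have finU12: "finite U1" "finite U2" using finU by (auto simp: U1_def U2_def)
    have sumU1: "(\<Sum>n\<in>U1. \<gamma>U n) \<le> SI"
    proof -
      have "(\<Sum>n\<in>U1. \<gamma>U n) \<le> (\<Sum>n\<in>U1. ln (10 * r / \<bar>x - norm (a n)\<bar>))"
      proof (rule sum_mono)
        fix n assume n: "n \<in> U1"
        then have nU: "n \<in> U" and n8: "norm (a n) \<le> 8 * r" by (auto simp: U1_def)
        have pos: "\<bar>x - norm (a n)\<bar> > 0" using xnea[of n] nU n8 by (auto simp: near_def U_def)
        have up: "norm (X + cnj (a n)) \<le> 10 * r"
          using norm_triangle_ineq[of X "cnj (a n)"] n8 x x0 by (simp add: X_def)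
        have lo: "\<bar>x - norm (a n)\<bar> \<le> norm (X - a n)"
          using norm_triangle_ineq3[of X "a n"] x0 by (simp add: X_def)
        have nz: "norm (X + cnj (a n)) > 0"
        proof -
          have "Re (X + cnj (a n)) > 0" using UP[OF nU] x0 by (simp add: X_def)
          then show ?thesis by (metis complex_Re_le_cmod less_le_trans)
        qed
        have "norm (X + cnj (a n)) / norm (X - a n) \<le> 10 * r / \<bar>x - norm (a n)\<bar>"
          using up lo pos r by (intro frac_le) auto
        then show "\<gamma>U n \<le> ln (10 * r / \<bar>x - norm (a n)\<bar>)"
          unfolding \<gamma>U_def using nz pos lo by (intro ln_mono divide_pos_pos) auto
      qed
      also have "\<dots> \<le> SI" unfolding SI_def
        by (intro sum_mono2 finI) (use xnea in \<open>auto intro!: lnpos simp: U1_def U_def near_def\<close>)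
      finally show ?thesis .
    qed
    have tailU: "(\<Sum>n\<in>U2. 1 / (norm (a n))\<^sup>2) \<le> CI / (8 * r)"
      by (rule CI(2)[OF finU12(2)]) (use r in \<open>force simp: I1_def U2_def U_def\<close>)+
    have lI: "(\<Sum>n\<in>U2. Re (1 / a n)) \<le> lsum I a \<rho> - lsum I a (8 * r)"
    proof -
      have "(\<Sum>n\<in>U2. Re (1 / a n)) = (\<Sum>n\<in>U2. pos_recip (a n))"
        by (intro sum.cong refl pos_recip_pos[symmetric]) (auto simp: U2_def U_def)
      also have "\<dots> \<le> (\<Sum>n\<in>near I a \<rho> - near I a (8 * r). pos_recip (a n))"
        by (intro sum_mono2 finite_Diff finI) (auto simp: U2_def U_def near_def pos_recip_bounds)
      also have "\<dots> = lsum I a \<rho> - lsum I a (8 * r)"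
        by (rule lsum_diff_eq[OF finI, symmetric]) (use \<rho> R r in linarith)
      finally show ?thesis .
    qed
    have sumU2: "(\<Sum>n\<in>U2. \<gamma>U n) \<le> 2 * x * (lsum I a \<rho> - lsum I a (8 * r)) + CI * x"
    proof -
      have "(\<Sum>n\<in>U2. \<gamma>U n) \<le> (\<Sum>n\<in>U2. 2 * x * Re (1 / a n) + 4 * x\<^sup>2 * (1 / (norm (a n))\<^sup>2))"
      proof (rule sum_mono)
        fix n assume n: "n \<in> U2"
        then have "4 * x \<le> norm (a n)" using x by (auto simp: U2_def)
        then show "\<gamma>U n \<le> 2 * x * Re (1 / a n) + 4 * x\<^sup>2 * (1 / (norm (a n))\<^sup>2)"
          using estU(3)[of n] n by (auto simp: abs_le_iff U2_def)
      qed
      also have "\<dots> = 2 * x * (\<Sum>n\<in>U2. Re (1 / a n)) + 4 * x\<^sup>2 * (\<Sum>n\<in>U2. 1 / (norm (a n))\<^sup>2)"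
        by (simp only: sum.distrib sum_distrib_left)
      also have "2 * x * (\<Sum>n\<in>U2. Re (1 / a n)) \<le> 2 * x * (lsum I a \<rho> - lsum I a (8 * r))"
        using lI x0 by (intro mult_left_mono) auto
      also have "4 * x\<^sup>2 * (\<Sum>n\<in>U2. 1 / (norm (a n))\<^sup>2) \<le> CI * x"
        using mult_left_mono[OF tailU, of "4 * x\<^sup>2"] xx[OF CI(1)] by simp
      finally show ?thesis by simp
    qed
    have upU: "(\<Sum>n\<in>U. \<beta>U n) \<le> SI + 2 * x * (lsum I a \<rho> - lsum I a (8 * r)) + CI * x + 8 * k * x"
    proof -
      have "(\<Sum>n\<in>U. \<beta>U n) \<le> (\<Sum>n\<in>U. \<gamma>U n + 4 * x * norm (a n) / \<rho>\<^sup>2)"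
        using estU(1) by (intro sum_mono) (auto simp: abs_le_iff, force)
      also have "\<dots> \<le> (\<Sum>n\<in>U. \<gamma>U n) + 8 * k * x" using errU by (simp add: sum.distrib)
      also have "(\<Sum>n\<in>U. \<gamma>U n) = (\<Sum>n\<in>U1. \<gamma>U n) + (\<Sum>n\<in>U2. \<gamma>U n)"
      proof -
        have "U = U1 \<union> U2" "U1 \<inter> U2 = {}" by (auto simp: U1_def U2_def)
        then show ?thesis using finU12 sum.union_disjoint[of U1 U2 \<gamma>U] by simp
      qed
      finally show ?thesis using sumU1 sumU2 by linarith
    qed
    \<comment> \<open>The sum runs up to \<rho> instead of R; since \<rho> <= 4 R the additional
      annulus holds O(R) points, each contributing at most 1 / R.\<close>
    have l\<rho>: "lsum I a \<rho> - lsum I a (8 * r) \<le> lsum I a R - lsum I a r + 5 * k"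
    proof -
      have "lsum I a \<rho> - lsum I a R \<le> real (card (near I a \<rho>)) / R"
        by (rule lsum_diff_le[OF finI]) (use R0 \<rho> in auto)
      also have "\<dots> \<le> k * (5 * R) / R"
      proof (rule divide_right_mono)
        have "real (card (near I a \<rho>)) \<le> k * (1 + \<rho>)" using cI \<rho>0 by auto
        also have "\<dots> \<le> k * (5 * R)" using k \<rho> R0 by (intro mult_left_mono) auto
        finally show "real (card (near I a \<rho>)) \<le> k * (5 * R)" .
      qed (use R0 in simp)
      also have "\<dots> = 5 * k" using R0 by simp
      finally have "lsum I a \<rho> - lsum I a R \<le> 5 * k" .
      moreover have "lsum I a r \<le> lsum I a (8 * r)" by (rule lsum_nonneg_mono[OF finI]) (use r in auto)
      ultimately show ?thesis by linarith
    qed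
    have l\<rho>x: "2 * x * (lsum I a \<rho> - lsum I a (8 * r)) \<le> 2 * x * (lsum I a R - lsum I a r + 5 * k)"
      using l\<rho> x0 by (intro mult_left_mono) auto
    have kr: "253 * k * r \<le> 253 * k * x" using k x by (intro mult_left_mono) auto
    have Cr: "Cf * r \<le> Cf * x" using Cf x by (intro mult_left_mono) auto
    have Kx: "K * (1 + x) \<le> K * (2 * x)" using K x0 by (intro mult_left_mono) auto
    have "2 * x * (lsum J b R - lsum J b (8 * r)) \<le> 2 * x * (lsum I a R - lsum I a r + C)"
    proof -
      have "2 * x * (lsum J b R - lsum J b (8 * r)) \<le> CJ * x + 8 * k * x + (\<Sum>n\<in>A. \<beta>A n)" using lowA by linarith
      also have "(\<Sum>n\<in>A. \<beta>A n) \<le> (\<Sum>n\<in>U. \<beta>U n) + K * (2 * x) + Cf * x + Sf + 2 * c * x"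
        using lnm lnf lng Cr Kx by (simp add: algebra_simps)
      also have "(\<Sum>n\<in>U. \<beta>U n) \<le> SI + 2 * x * (lsum I a R - lsum I a r + 5 * k) + CI * x + 8 * k * x"
        using upU l\<rho>x by linarith
      finally have "2 * x * (lsum J b R - lsum J b (8 * r)) \<le> CJ * x + 8 * k * x +
         (SI + 2 * x * (lsum I a R - lsum I a r + 5 * k) + CI * x + 8 * k * x + K * (2 * x) + Cf * x + Sf + 2 * c * x)" by simp
      also have "\<dots> \<le> 2 * x * (lsum I a R - lsum I a r) + (CJ + 26 * k + CI + 253 * k + 2 * K + Cf + 2 * c) * x"
        using Ssum kr by (simp add: algebra_simps)
      also have "\<dots> \<le> 2 * x * (lsum I a R - lsum I a r) + 2 * C * x"
        using k x0 by (simp add: C_def algebra_simps)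
      finally show ?thesis by (simp add: algebra_simps)
    qed
    then show "lsum J b R - lsum J b (8 * r) \<le> lsum I a R - lsum I a r + C"
      using x0 by (subst (asm) mult_le_cancel_left_pos) auto
  qed
qed

text \<open>The factor 8 is removed by the density of the points of J: between r and 8 r there are
  O(r) of them, each contributing at most 1 / r. Radii below 1 cost at most
  \<open>lsum J b 1\<close>.\<close>

lemma carleman_comparison_origin:
  assumes f: "f holomorphic_on UNIV" "f 0 \<noteq> 0" and g: "g holomorphic_on UNIV" "g 0 \<noteq> 0"
    and K: "K \<ge> 0" "\<And>z. norm (f z) \<le> exp (K * (1 + norm z))" "\<And>z. norm (g z) \<le> exp (K * (1 + norm z))"
    and le: "\<And>y::real. norm (f (axis y)) \<le> norm (g (axis y))"
    and b: "\<And>z. finite {n\<in>J. b n = z}" "\<And>z. vanishes f z (card {n\<in>J. b n = z})"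
    and a: "\<And>z. finite {n\<in>I. a n = z}" "\<And>z. zero_count g z = enat (card {n\<in>I. a n = z})"
  obtains C where "C \<ge> 0" "\<And>r R. 0 < r \<Longrightarrow> r < R \<Longrightarrow>
    lsum J b R - lsum J b r \<le> lsum I a R - lsum I a r + C"
proof -
  obtain C where C: "C \<ge> 0" "\<And>r R. 1 \<le> r \<Longrightarrow> 8 * r \<le> R \<Longrightarrow>
    lsum J b R - lsum J b (8 * r) \<le> lsum I a R - lsum I a r + C"
    by (rule carleman_comparison_step[OF assms]) blast
  have fdJ: "fin_dens J b" by (rule jensen_fin_dens_origin[OF f K(1,2) b])
  have fdI: "fin_dens I a"
    by (rule jensen_fin_dens_origin[OF g K(1,3) a(1)]) (use vanishes_iff[OF g] a(2) in simp)
  obtain k where k: "k \<ge> 1" "\<And>t. finite (near J b t)" "\<And>t. t \<ge> 0 \<Longrightarrow> real (card (near J b t)) \<le> k * (1 + t)"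
    using fin_densE[OF fdJ] by metis
  note monoI = lsum_nonneg_mono[OF fin_dens_near_finite[OF fdI]] and monoJ = lsum_nonneg_mono[OF k(2)]
  have short: "lsum J b R - lsum J b r \<le> 9 * k" if "1 \<le> r" "r \<le> R" "R \<le> 8 * r" for r R
  proof -
    have "lsum J b R - lsum J b r \<le> real (card (near J b R)) / r"
      by (rule lsum_diff_le[OF k(2)]) (use that in auto)
    also have "\<dots> \<le> k * (9 * r) / r"
    proof (rule divide_right_mono)
      have "real (card (near J b R)) \<le> k * (1 + R)" using k that by auto
      also have "\<dots> \<le> k * (9 * r)" using k that by (intro mult_left_mono) auto
      finally show "real (card (near J b R)) \<le> k * (9 * r)" .
    qed (use that in simp)
    finally show ?thesis using that by simp
  qed
  have ge1: "lsum J b R - lsum J b r \<le> lsum I a R - lsum I a r + (C + 9 * k)" if "1 \<le> r" "r \<le> R" for r R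
  proof (cases "R \<le> 8 * r")
    case True
    then show ?thesis using short[OF that True] monoI(2)[OF that(2)] C(1) by linarith
  next
    case False
    then show ?thesis using C(2)[of r R] short[of r "8 * r"] that by linarith
  qed
  show ?thesis
  proof (rule that[of "C + 9 * k + lsum J b 1"])
    show "C + 9 * k + lsum J b 1 \<ge> 0" using C k monoJ(1)[of 1 1] by simp
    fix r R :: real assume r: "0 < r" "r < R"
    have J0: "0 \<le> lsum J b r" "0 \<le> lsum J b 1" using monoJ(1)[of r r] monoJ(1)[of 1 1] by auto
    consider "1 \<le> r" | "r < 1" "1 \<le> R" | "R < 1" by linarith
    then show "lsum J b R - lsum J b r \<le> lsum I a R - lsum I a r + (C + 9 * k + lsum J b 1)"
    proof cases
      case 1
      then show ?thesis using ge1[of r R] r J0 by linarith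
    next
      case 2
      then show ?thesis using ge1[of 1 R] J0 monoI(2)[of r 1] by linarith
    next
      case 3
      then show ?thesis using monoJ(2)[of R 1] monoI(2)[of r R] r J0 C k by linarith
    qed
  qed
qed

lemma exists_axis_nonzero:
  assumes f: "f holomorphic_on UNIV" "f w0 \<noteq> 0"
  obtains y :: real where "f (axis y) \<noteq> 0"
proof (rule ccontr)
  assume "\<not> thesis"
  then have z: "f (axis y) = 0" for y :: real using that by blast
  obtain m q where q: "q holomorphic_on UNIV" "q 0 \<noteq> 0" "\<And>w. f w = (w - 0) ^ m * q w"
    using entire_factor_at[OF f, of 0] by blast
  have "isCont q 0" using holomorphic_on_imp_continuous_on[OF q(1)] continuous_on_eq_continuous_at by blast
  moreover have "((\<lambda>s::real. axis s) \<longlongrightarrow> 0) (at 0)" by (auto intro!: tendsto_eq_intros)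
  ultimately have "((\<lambda>s::real. q (axis s)) \<longlongrightarrow> q 0) (at 0)" by (rule isCont_tendsto_compose)
  moreover have "\<forall>\<^sub>F s::real in at 0. q (axis s) = 0"
    unfolding eventually_at using z by (intro exI[of _ 1]) (auto simp: q(3))
  then have "((\<lambda>s::real. q (axis s)) \<longlongrightarrow> 0) (at 0)" by (rule tendsto_eventually)
  ultimately show False using q(2) tendsto_unique[of "at (0::real)"] by (metis at_neq_bot)
qed

text \<open>A translation along the imaginary axis makes f nonzero at the origin, and by the
  inequality also g. It preserves the axis and changes logarithmic sums by O(1).\<close>

lemma carleman_comparison:
  assumes f: "f holomorphic_on UNIV" "f w0 \<noteq> 0" "exponential_type f"
    and g: "g holomorphic_on UNIV" "g w1 \<noteq> 0" "exponential_type g"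
    and le: "\<And>y::real. norm (f (axis y)) \<le> norm (g (axis y))"
    and b: "\<And>z. finite {n\<in>J. b n = z}" "\<And>z. vanishes f z (card {n\<in>J. b n = z})"
    and a: "\<And>z. finite {n\<in>I. a n = z}" "\<And>z. zero_count g z = enat (card {n\<in>I. a n = z})"
  obtains C where "C \<ge> 0" "\<And>r R. 0 < r \<Longrightarrow> r < R \<Longrightarrow>
    lsum J b R - lsum J b r \<le> lsum I a R - lsum I a r + C"
proof -
  obtain y0 :: real where y0: "f (axis y0) \<noteq> 0" using exists_axis_nonzero[OF f(1,2)] by blast
  define c where "c = axis y0"
  have fc: "f c \<noteq> 0" using y0 by (simp add: c_def)
  have gc: "g c \<noteq> 0" using le[of y0] y0 by (auto simp: c_def)
  obtain K1 where K1: "K1 \<ge> 0" "\<And>z. norm (f z) \<le> exp (K1 * (1 + norm z))"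
    using exponential_type_bound[OF f(1,3)] by blast
  obtain K2 where K2: "K2 \<ge> 0" "\<And>z. norm (g z) \<le> exp (K2 * (1 + norm z))"
    using exponential_type_bound[OF g(1,3)] by blast
  define K where "K = (K1 + K2) * (1 + norm c)"
  have bf: "norm (f z) \<le> exp ((K1 + K2) * (1 + norm z))" "norm (g z) \<le> exp ((K1 + K2) * (1 + norm z))" for z
  proof -
    have "K1 * (1 + norm z) \<le> (K1 + K2) * (1 + norm z)" "K2 * (1 + norm z) \<le> (K1 + K2) * (1 + norm z)"
      using K1 K2 by (auto intro!: mult_right_mono)
    then show "norm (f z) \<le> exp ((K1 + K2) * (1 + norm z))" "norm (g z) \<le> exp ((K1 + K2) * (1 + norm z))"
      using K1(2)[of z] K2(2)[of z] by (meson exp_le_cancel_iff order_trans)+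
  qed
  have van: "vanishes g z m \<longleftrightarrow> m \<le> card {n\<in>I. a n = z}" for z m
    using vanishes_iff[OF g(1,2), of z m] a(2)[of z] by simp
  have eq: "{n\<in>S. p n + - c = z} = {n\<in>S. p n = z + c}" for S z and p :: "nat \<Rightarrow> complex"
    by (auto simp: algebra_simps)
  obtain C1 where C1: "C1 \<ge> 0" "\<And>r R. 0 < r \<Longrightarrow> r < R \<Longrightarrow>
    lsum J (\<lambda>n. b n + - c) R - lsum J (\<lambda>n. b n + - c) r \<le> lsum I (\<lambda>n. a n + - c) R - lsum I (\<lambda>n. a n + - c) r + C1"
  proof (rule carleman_comparison_origin[where f = "\<lambda>z. f (z + c)" and g = "\<lambda>z. g (z + c)" and K = K
        and J = J and b = "\<lambda>n. b n + - c" and I = I and a = "\<lambda>n. a n + - c"])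
    show "(\<lambda>z. f (z + c)) holomorphic_on UNIV" "(\<lambda>z. g (z + c)) holomorphic_on UNIV"
      using f g by (auto intro: entire_shift)
    then have hg: "(\<lambda>z. g (z + c)) holomorphic_on UNIV" by simp
    show "f (0 + c) \<noteq> 0" "g (0 + c) \<noteq> 0" using fc gc by auto
    then have g0: "g (0 + c) \<noteq> 0" by simp
    show "0 \<le> K" using K1 K2 by (simp add: K_def)
    show "norm (f (z + c)) \<le> exp (K * (1 + norm z))" "norm (g (z + c)) \<le> exp (K * (1 + norm z))" for z
      unfolding K_def using K1 K2 bf by (auto intro!: exp_bound_shift)
    show "norm (f (axis y + c)) \<le> norm (g (axis y + c))" for y
      using le[of "y + y0"] by (simp add: c_def algebra_simps)
    show "finite {n \<in> J. b n + - c = z}" "finite {n \<in> I. a n + - c = z}" for z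
      unfolding eq using a b by auto
    show "vanishes (\<lambda>z. f (z + c)) z (card {n \<in> J. b n + - c = z})" for z
      unfolding eq by (rule vanishes_shift[OF b(2)])
    fix z
    have "vanishes (\<lambda>z. g (z + c)) z m \<longleftrightarrow> m \<le> card {n \<in> I. a n + - c = z}" for m
    proof
      assume "vanishes (\<lambda>z. g (z + c)) z m"
      then have "vanishes (\<lambda>w. g ((w + - c) + c)) (z + c) m"
        by (intro vanishes_shift[where g = "\<lambda>z. g (z + c)" and c = "- c"]) simp
      then show "m \<le> card {n \<in> I. a n + - c = z}" unfolding eq by (simp add: van)
    next
      assume "m \<le> card {n \<in> I. a n + - c = z}"
      then have "vanishes g (z + c) m" unfolding eq by (simp add: van)
      then show "vanishes (\<lambda>z. g (z + c)) z m" by (rule vanishes_shift)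
    qed
    then have *: "enat m \<le> zero_count (\<lambda>z. g (z + c)) z \<longleftrightarrow> m \<le> card {n \<in> I. a n + - c = z}" for m
      using vanishes_iff[OF hg g0] by simp
    show "zero_count (\<lambda>z. g (z + c)) z = enat (card {n \<in> I. a n + - c = z})"
    proof (cases "zero_count (\<lambda>z. g (z + c)) z")
      case (enat k)
      then show ?thesis using *[of k] *[of "card {n \<in> I. a n + - c = z}"] by simp
    next
      case infinity
      then show ?thesis using *[of "Suc (card {n \<in> I. a n + - c = z})"] by simp
    qed
  qed blast
  have fdJ: "fin_dens J b" by (rule jensen_fin_dens[OF f b])
  have fdI: "fin_dens I a" by (rule jensen_fin_dens[OF g a(1)]) (simp add: van)
  obtain C2 where C2: "C2 \<ge> 0" "\<And>t. \<bar>lsum J (\<lambda>n. b n + - c) t - lsum J b t\<bar> \<le> C2"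
    using lsum_shift[OF fdJ, of "- c"] by blast
  obtain C3 where C3: "C3 \<ge> 0" "\<And>t. \<bar>lsum I (\<lambda>n. a n + - c) t - lsum I a t\<bar> \<le> C3"
    using lsum_shift[OF fdI, of "- c"] by blast
  show ?thesis
  proof (rule that[of "C1 + 2 * C2 + 2 * C3"])
    show "C1 + 2 * C2 + 2 * C3 \<ge> 0" using C1 C2 C3 by simp
    fix r R :: real assume "0 < r" "r < R"
    from C1(2)[OF this] show "lsum J b R - lsum J b r \<le> lsum I a R - lsum I a r + (C1 + 2 * C2 + 2 * C3)"
      using C2(2)[of r] C2(2)[of R] C3(2)[of r] C3(2)[of R] by linarith
  qed
qed

section \<open>Poisson integrals\<close>

lemma poisson_kernel_integral:
  fixes p q :: real
  assumes p: "p > 0"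
  shows "integrable lborel (\<lambda>s. p / (p\<^sup>2 + (s - q)\<^sup>2))" "(LINT s|lborel. p / (p\<^sup>2 + (s - q)\<^sup>2)) = pi"
proof -
  let ?F = "\<lambda>s. arctan ((s - q) / p)"
  have pos: "p\<^sup>2 + (s - q)\<^sup>2 > 0" for s using p by (intro add_pos_nonneg) auto
  have F: "(?F has_real_derivative p / (p\<^sup>2 + (s - q)\<^sup>2)) (at s)" for s
  proof -
    have "1 + ((s - q) / p)\<^sup>2 = (p\<^sup>2 + (s - q)\<^sup>2) / p\<^sup>2" using p by (simp add: field_simps)
    then have "inverse (1 + ((s - q) / p)\<^sup>2) * (1 / p) = p / (p\<^sup>2 + (s - q)\<^sup>2)"
      using p pos[of s] by (simp add: power2_eq_square)
    moreover have "((\<lambda>s. (s - q) / p) has_real_derivative 1 / p) (at s)"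
      using p by (auto intro!: derivative_eq_intros)
    ultimately show ?thesis using DERIV_chain2[of arctan _ "\<lambda>s. (s - q) / p" s _ UNIV, OF DERIV_arctan] by metis
  qed
  have lim1: "(?F \<longlongrightarrow> pi / 2) at_top" and lim2: "(?F \<longlongrightarrow> - (pi / 2)) at_bot"
    using p by real_asymp+
  have 1: "-\<infinity> < (\<infinity>::ereal)" by simp
  note FTC = interval_integral_FTC_nonneg[OF 1, of ?F "\<lambda>s. p / (p\<^sup>2 + (s - q)\<^sup>2)" "- (pi / 2)" "pi / 2"]
  have c: "isCont (\<lambda>s. p / (p\<^sup>2 + (s - q)\<^sup>2)) s" for s
    using pos[of s] by (intro continuous_intros) auto
  have nn: "AE s in lborel. -\<infinity> < ereal s \<longrightarrow> ereal s < \<infinity> \<longrightarrow> 0 \<le> p / (p\<^sup>2 + (s - q)\<^sup>2)"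
    using p pos by (auto intro!: divide_nonneg_pos)
  have l1: "((?F \<circ> real_of_ereal) \<longlongrightarrow> - (pi / 2)) (at_right (-\<infinity>))" using lim2 by (simp add: ereal_tendsto_simps)
  have l2: "((?F \<circ> real_of_ereal) \<longlongrightarrow> pi / 2) (at_left \<infinity>)" using lim1 by (simp add: ereal_tendsto_simps)
  have "set_integrable lborel (einterval (-\<infinity>) \<infinity>) (\<lambda>s. p / (p\<^sup>2 + (s - q)\<^sup>2))"
    by (rule FTC(1)) (use F c nn l1 l2 in auto)
  then show "integrable lborel (\<lambda>s. p / (p\<^sup>2 + (s - q)\<^sup>2))"
    by (simp add: set_integrable_def einterval_def)
  have "(LBINT s=-\<infinity>..\<infinity>. p / (p\<^sup>2 + (s - q)\<^sup>2)) = pi / 2 - - (pi / 2)"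
    by (rule FTC(2)) (use F c nn l1 l2 in auto)
  then show "(LINT s|lborel. p / (p\<^sup>2 + (s - q)\<^sup>2)) = pi"
    by (simp add: interval_lebesgue_integral_def set_lebesgue_integral_def einterval_def)
qed

text \<open>-7/4 = 5/4 - 3: the growth of the density against the decay of the cubic kernel.\<close>

lemma integrable_powr_decay: "integrable lborel (\<lambda>s::real. (1 + \<bar>s\<bar>) powr (-7/4))"
proof -
  define f where "f s = indicator {0..} s * (1 + s) powr (-7/4)" for s :: real
  have "(\<integral>\<^sup>+s. ennreal ((1 + \<bar>s\<bar>) powr (-7/4)) * indicator {0..} s \<partial>lborel) = ennreal (0 - (- (4/3) * (1 + 0) powr (-3/4)))"
  proof (rule nn_integral_FTC_atLeast[where F = "\<lambda>s. - (4/3) * (1 + s) powr (-3/4)"])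
    fix s :: real assume s: "0 \<le> s"
    have "((\<lambda>s. - (4/3) * (1 + s) powr (-3/4)) has_real_derivative (1 + s) powr (-7/4)) (at s)"
      using s by (auto intro!: derivative_eq_intros)
    then show "((\<lambda>s. - (4/3) * (1 + s) powr (-3/4)) has_real_derivative (1 + \<bar>s\<bar>) powr (-7/4)) (at s)" using s by simp
  next
    show "((\<lambda>s::real. - (4/3) * (1 + s) powr (-3/4)) \<longlongrightarrow> 0) at_top" by real_asymp
  qed auto
  also have "\<dots> < \<infinity>" by simp
  also have "(\<lambda>s. ennreal ((1 + \<bar>s\<bar>) powr (-7/4)) * indicator {0..} s) = (\<lambda>s. ennreal (f s))"
    by (auto simp: f_def indicator_def)
  finally have fin: "(\<integral>\<^sup>+s. ennreal (f s) \<partial>lborel) < \<infinity>" .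
  have "f \<in> borel_measurable borel" unfolding f_def[abs_def] by measurable
  then have f: "integrable lborel f"
    using fin by (intro integrableI_nonneg) (auto simp: f_def)
  have f2: "integrable lborel (\<lambda>s. f (0 + (-1) * s))" by (rule lborel_integrable_real_affine[OF f]) simp
  show ?thesis
  proof (rule Bochner_Integration.integrable_bound[OF Bochner_Integration.integrable_add[OF f f2]])
    show "AE s in lborel. norm ((1 + \<bar>s\<bar>) powr (-7/4)) \<le> norm (f s + f (0 + (-1) * s))"
      by (auto simp: f_def indicator_def)
  qed simp
qed

lemma lborel_integral_limit:
  fixes f :: "real \<Rightarrow> complex"
  assumes f: "integrable lborel f" and p: "filterlim p at_bot sequentially" and q: "filterlim q at_top sequentially"
  shows "(\<lambda>n. LINT s:{p n..q n}|lborel. f s) \<longlonglongrightarrow> (LINT s|lborel. f s)"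
  unfolding set_lebesgue_integral_def
proof (rule integral_dominated_convergence[where w = "\<lambda>s. norm (f s)"])
  show "AE s in lborel. (\<lambda>n. indicat_real {p n..q n} s *\<^sub>R f s) \<longlonglongrightarrow> f s"
  proof (rule AE_I2)
    fix s
    have "\<forall>\<^sub>F n in sequentially. p n \<le> s" using p by (simp add: filterlim_at_bot)
    moreover have "\<forall>\<^sub>F n in sequentially. s \<le> q n" using q by (simp add: filterlim_at_top)
    ultimately have "\<forall>\<^sub>F n in sequentially. indicat_real {p n..q n} s *\<^sub>R f s = f s"
      by eventually_elim simp
    then show "(\<lambda>n. indicat_real {p n..q n} s *\<^sub>R f s) \<longlonglongrightarrow> f s" by (rule tendsto_eventually)
  qed
  show "AE s in lborel. norm (indicat_real {p n..q n} s *\<^sub>R f s) \<le> norm (f s)" for n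
    by (auto simp: indicator_def)
qed (use f in auto)

text \<open>A primitive H exists on the slightly larger half-plane, and the integral over [- S, S]
  is, up to a unimodular factor, its increment between the ends. The increment is estimated along
  two segments through the real point S, of length O(S), on which G is O(S^-2).\<close>

lemma half_plane_cauchy:
  assumes d: "d > 0" and G: "G holomorphic_on {w. Re w > - d}"
    and C: "\<And>w. Re w \<ge> 0 \<Longrightarrow> norm (G w) \<le> C / (1 + norm w)\<^sup>2"
  shows "integrable lborel (\<lambda>s. G (axis s))" "(LINT s|lborel. G (axis s)) = 0"
proof -
  let ?S = "{w. Re w > - d}"
  have C0: "C \<ge> 0" using C[of 0] norm_ge_zero[of "G 0"] by (simp del: norm_ge_zero)
  have S: "convex ?S" "open ?S" by (auto simp: convex_halfspace_Re_gt open_halfspace_Re_gt)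
  obtain H where H: "\<And>w. w \<in> ?S \<Longrightarrow> (H has_field_derivative G w) (at w within ?S)"
    using holomorphic_convex_primitive'[OF S G] by blast
  have H': "(H has_field_derivative G w) (at w)" if "w \<in> ?S" for w
    using H[OF that] unfolding at_within_open[OF that S(2)] .
  have cont: "continuous_on UNIV (\<lambda>s::real. G (axis s))"
  proof -
    have "continuous_on UNIV (\<lambda>s::real. axis s)" by (intro continuous_intros)
    moreover have "range (\<lambda>s::real. axis s) \<subseteq> ?S" using d by auto
    ultimately show ?thesis
      using continuous_on_compose2[OF holomorphic_on_imp_continuous_on[OF G], of UNIV "\<lambda>s. axis s"] by simp
  qed
  show int: "integrable lborel (\<lambda>s. G (axis s))"
  proof (rule Bochner_Integration.integrable_bound)
    show "integrable lborel (\<lambda>s. C * (1 / (1\<^sup>2 + (s - 0)\<^sup>2)))"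
      using poisson_kernel_integral(1)[of 1 0] by (intro integrable_mult_right) auto
    show "(\<lambda>s. G (axis s)) \<in> borel_measurable lborel"
      using borel_measurable_continuous_onI[OF cont] by simp
    show "AE s in lborel. norm (G (axis s)) \<le> norm (C * (1 / (1\<^sup>2 + (s - 0)\<^sup>2)))"
    proof (rule AE_I2)
      fix s :: real
      have "norm (G (axis s)) \<le> C / (1 + \<bar>s\<bar>)\<^sup>2" using C[of "axis s"] by (simp add: norm_mult)
      also have "\<dots> \<le> C / (1 + s\<^sup>2)"
        using C0 by (intro divide_left_mono mult_pos_pos) (auto simp: power2_eq_square algebra_simps intro: add_pos_nonneg)
      finally show "norm (G (axis s)) \<le> norm (C * (1 / (1\<^sup>2 + (s - 0)\<^sup>2)))" using C0 by simp
    qed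
  qed
  have Hbd: "norm (H (axis S) - H (- (axis S))) \<le> 16 * C / S" if S0: "S > 0" for S
  proof -
    have seg: "norm (H (of_real S) - H (axis (e * S))) \<le> 8 * C / S" if e: "e = 1 \<or> e = -1" for e :: real
    proof -
      let ?A = "closed_segment (axis (e * S)) (of_real S)"
      have inS: "Re w \<ge> 0 \<and> norm w \<ge> S / 2" if w: "w \<in> ?A" for w
      proof -
        obtain u where u: "0 \<le> u" "u \<le> 1" "w = (1 - u) *\<^sub>R (axis (e * S)) + u *\<^sub>R of_real S"
          using w by (auto simp: in_segment)
        have re: "Re w = u * S" and im: "Im w = (1 - u) * (e * S)" using u by simp_all
        have "norm w \<ge> \<bar>Re w\<bar>" "norm w \<ge> \<bar>Im w\<bar>" by (rule abs_Re_le_cmod abs_Im_le_cmod)+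
        moreover have "\<bar>Im w\<bar> = (1 - u) * S" unfolding im using e u S0 by (auto simp: abs_mult)
        ultimately have "2 * norm w \<ge> u * S + (1 - u) * S" using re u S0 by simp
        then have "S \<le> 2 * norm w" by (simp add: algebra_simps)
        moreover have "0 \<le> Re w" unfolding re using u(1) S0 by simp
        ultimately show ?thesis by simp
      qed
      have "norm (H (of_real S) - H (axis (e * S))) \<le> (4 * C / S\<^sup>2) * norm (of_real S - axis (e * S))"
      proof (rule field_differentiable_bound[of ?A])
        show "(H has_field_derivative G w) (at w within ?A)" if "w \<in> ?A" for w
          by (rule DERIV_subset[OF H']) (use inS[OF that] d in auto)
        show "norm (G w) \<le> 4 * C / S\<^sup>2" if "w \<in> ?A" for w
        proof -
          have "norm (G w) \<le> C / (1 + norm w)\<^sup>2" using C inS[OF that] by blast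
          also have "\<dots> \<le> C / (S / 2)\<^sup>2"
            using inS[OF that] S0 C0 by (intro divide_left_mono power_mono mult_pos_pos zero_less_power) auto
          finally show ?thesis by (simp add: power_divide mult.commute)
        qed
      qed auto
      also have "\<dots> \<le> (4 * C / S\<^sup>2) * (2 * S)"
      proof (rule mult_left_mono)
        show "norm (of_real S - axis (e * S)) \<le> 2 * S"
          using norm_triangle_ineq4[of "of_real S" "axis (e * S)"] e S0 by (auto simp: norm_mult)
      qed (use C0 in simp)
      also have "(4 * C / S\<^sup>2) * (2 * S) = 8 * C / S" using S0 by (simp add: power2_eq_square)
      finally show ?thesis .
    qed
    have "norm (H (axis S) - H (- (axis S))) \<le>
       norm (H (of_real S) - H (axis (1 * S))) + norm (H (of_real S) - H (axis ((-1) * S)))"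
      using norm_triangle_ineq4[of "H (of_real S) - H (axis ((-1) * S))" "H (of_real S) - H (axis (1 * S))"] by simp
    then show ?thesis using seg[of 1] seg[of "-1"] by simp
  qed
  have val: "(LINT s:{- real n..real n}|lborel. G (axis s)) = - \<i> * (H (axis (real n)) - H (- (axis (real n))))" for n
  proof -
    have der: "((\<lambda>s. - \<i> * H (axis s)) has_vector_derivative G (axis s)) (at s within A)" for s :: real and A
    proof -
      have "(H has_field_derivative G (axis s)) (at (axis s))" using d by (intro H') auto
      moreover have "((\<lambda>s. axis s) has_vector_derivative \<i>) (at s within A)"
        by (auto intro!: derivative_eq_intros simp: has_vector_derivative_def scaleR_conv_of_real)
      ultimately have "((H \<circ> (\<lambda>s. axis s)) has_vector_derivative (\<i> * G (axis s))) (at s within A)"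
        by (intro field_vector_diff_chain_within) (auto intro: has_field_derivative_at_within)
      then have "((\<lambda>s. - \<i> * H (axis s)) has_vector_derivative (- \<i> * (\<i> * G (axis s)))) (at s within A)"
        by (intro has_vector_derivative_mult_right) (simp add: o_def)
      then show ?thesis by simp
    qed
    have "integral\<^sup>L lborel (\<lambda>s. indicator {- real n..real n} s *\<^sub>R G (axis s)) =
       - \<i> * H (axis (real n)) - (- \<i> * H (axis (- real n)))"
      by (rule integral_FTC_Icc[OF _ der continuous_on_subset[OF cont]]) auto
    then show ?thesis by (simp add: set_lebesgue_integral_def algebra_simps)
  qed
  have lim: "(\<lambda>n. LINT s:{- real n..real n}|lborel. G (axis s)) \<longlonglongrightarrow> (LINT s|lborel. G (axis s))"
    by (rule lborel_integral_limit[OF int]) real_asymp+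
  have "(\<lambda>n. LINT s:{- real n..real n}|lborel. G (axis s)) \<longlonglongrightarrow> 0"
  proof (rule Lim_null_comparison)
    show "\<forall>\<^sub>F n in sequentially. norm (LINT s:{- real n..real n}|lborel. G (axis s)) \<le> 16 * C / real n"
      unfolding eventually_sequentially
    proof (intro exI[of _ 1] allI impI)
      fix n :: nat assume "1 \<le> n"
      then show "norm (LINT s:{- real n..real n}|lborel. G (axis s)) \<le> 16 * C / real n"
        unfolding val norm_mult using Hbd[of "real n"] by simp
    qed
    show "(\<lambda>n. 16 * C / real n) \<longlonglongrightarrow> 0" by real_asymp
  qed
  with lim show "(LINT s|lborel. G (axis s)) = 0" by (rule LIMSEQ_unique)
qed

lemma one_plus_norm_le:
  assumes "Re z > 0" "Re w \<ge> 0"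
  shows "1 + norm w \<le> ((1 + norm z) / Re z + 1) * norm (z + w)"
proof -
  have "Re z \<le> Re (z + w)" using assms by simp
  then have 1: "Re z \<le> norm (z + w)" using complex_Re_le_cmod[of "z + w"] by linarith
  have "norm w \<le> norm (z + w) + norm z" using norm_triangle_ineq4[of "z + w" z] by simp
  then have "1 + norm w \<le> (1 + norm z) + norm (z + w)" by simp
  also have "(1 + norm z) = (1 + norm z) / Re z * Re z" using assms by simp
  also have "\<dots> \<le> (1 + norm z) / Re z * norm (z + w)" using 1 assms by (intro mult_left_mono) auto
  finally show ?thesis by (simp add: algebra_simps)
qed

lemma inverse_decay:
  assumes "Re z > 0" "Re w \<ge> 0"
  defines "k \<equiv> (1 + norm z) / Re z + 1"
  shows "norm (1 / (z + w)) \<le> k / (1 + norm w)" "z + w \<noteq> 0" "k \<ge> 1"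
proof -
  show nz: "z + w \<noteq> 0" using assms by (auto simp: complex_eq_iff)
  show "k \<ge> 1" using assms by (simp add: k_def)
  have "1 + norm w \<le> k * norm (z + w)" unfolding k_def by (rule one_plus_norm_le) fact+
  moreover have "norm (z + w) > 0" "1 + norm w > 0" using nz by (auto intro: add_pos_nonneg)
  ultimately show "norm (1 / (z + w)) \<le> k / (1 + norm w)"
    by (simp add: norm_divide pos_le_divide_eq pos_divide_le_eq mult.commute)
qed

lemma inverse_decay_power:
  assumes "Re z > 0" "Re w \<ge> 0" "1 \<le> j" "j \<le> m"
  shows "norm (1 / (z + w) ^ m) \<le> ((1 + norm z) / Re z + 1) ^ m / (1 + norm w) ^ j"
proof -
  let ?k = "(1 + norm z) / Re z + 1"
  have "norm (1 / (z + w) ^ m) = norm (1 / (z + w)) ^ m" by (simp add: norm_divide norm_power power_divide)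
  also have "\<dots> \<le> (?k / (1 + norm w)) ^ m" by (intro power_mono inverse_decay(1) assms) auto
  also have "\<dots> = ?k ^ m / (1 + norm w) ^ m" by (simp add: power_divide)
  also have "\<dots> \<le> ?k ^ m / (1 + norm w) ^ j"
    using assms inverse_decay(3)[OF assms(1,2)] by (intro divide_left_mono power_increasing mult_pos_pos zero_less_power zero_le_power) (auto intro: add_pos_nonneg)
  finally show ?thesis .
qed

text \<open>The Poisson formula at a for (z + w)^-3, which is holomorphic for Re w > - Re z. Once
  the value at a is subtracted, the zero of the kernel's denominator at w = a cancels, and the rest
  integrates to 0 by Cauchy's theorem.\<close>

lemma poisson_formula_cube:
  fixes a z :: complex
  assumes a: "Re a > 0" and z: "Re z > 0"
  defines "f \<equiv> \<lambda>s::real. 1 / (z + axis s) ^ 3"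
  shows "integrable lborel f" "(LINT s|lborel. f s) = 0"
    "integrable lborel (\<lambda>s. f s * of_real (Re a / (norm (a - axis s))\<^sup>2))"
    "(LINT s|lborel. f s * of_real (Re a / (norm (a - axis s))\<^sup>2)) = pi / (z + a) ^ 3"
proof -
  define kz where "kz = (1 + norm z) / Re z + 1"
  define ka where "ka = (1 + norm (cnj a)) / Re (cnj a) + 1"
  have a': "Re (cnj a) > 0" using a by simp
  have k1: "kz \<ge> 1" "ka \<ge> 1" using z a by (auto simp: kz_def ka_def)
  have nz: "z + w \<noteq> 0" "cnj a + w \<noteq> 0" if "Re w > - min (Re z) (Re a)" for w
    using that by (auto simp: complex_eq_iff)
  have d: "min (Re z) (Re a) > 0" using a z by simp
  define q where "q = z + a"
  have q: "q \<noteq> 0" using a z by (auto simp: q_def complex_eq_iff)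
  have c1: "integrable lborel (\<lambda>s. (\<lambda>w. 1 / (z + w) ^ 3) (axis s))" "(LINT s|lborel. (\<lambda>w. 1 / (z + w) ^ 3) (axis s)) = 0"
  proof -
    have hol: "(\<lambda>w. 1 / (z + w) ^ 3) holomorphic_on {w. Re w > - min (Re z) (Re a)}"
      by (intro holomorphic_intros) (use nz in auto)
    have bd: "norm (1 / (z + w) ^ 3) \<le> kz ^ 3 / (1 + norm w)\<^sup>2" if "Re w \<ge> 0" for w
      unfolding kz_def by (rule inverse_decay_power[OF z that]) auto
    show "integrable lborel (\<lambda>s. (\<lambda>w. 1 / (z + w) ^ 3) (axis s))" "(LINT s|lborel. (\<lambda>w. 1 / (z + w) ^ 3) (axis s)) = 0"
      using half_plane_cauchy[OF d hol bd] by auto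
  qed
  then show "integrable lborel f" "(LINT s|lborel. f s) = 0" by (simp_all add: f_def)
  \<comment> \<open>The quotient of (z + w)^-3 - q^-3 by (a - w) (cnj a + w), which is the analytic
    form of |a - w|^2 on the axis. Its poles - z and - cnj a lie in the left half-plane.\<close>
  define G where "G w = (1 / (q * (z + w) ^ 3) + 1 / (q\<^sup>2 * (z + w)\<^sup>2) + 1 / (q ^ 3 * (z + w))) * (1 / (cnj a + w))" for w
  have G: "integrable lborel (\<lambda>s. G (axis s))" "(LINT s|lborel. G (axis s)) = 0"
  proof -
    have hol: "G holomorphic_on {w. Re w > - min (Re z) (Re a)}"
      unfolding G_def by (intro holomorphic_intros) (use nz q in auto)
    define C where "C = kz ^ 3 / norm q + kz\<^sup>2 / (norm q)\<^sup>2 + kz / norm q ^ 3"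
    have bd: "norm (G w) \<le> (C * ka) / (1 + norm w)\<^sup>2" if w: "Re w \<ge> 0" for w
    proof -
      have "norm (1 / (z + w) ^ m) \<le> kz ^ m / (1 + norm w)" if "1 \<le> m" for m
        using inverse_decay_power[OF z w, of 1 m] that by (simp add: kz_def)
      from this[of 3] this[of 2] this[of 1]
      have b: "norm (1 / (z + w) ^ 3) \<le> kz ^ 3 / (1 + norm w)" "norm (1 / (z + w)\<^sup>2) \<le> kz\<^sup>2 / (1 + norm w)" "norm (1 / (z + w)) \<le> kz / (1 + norm w)"
        by auto
      have "norm (1 / (q * (z + w) ^ 3) + 1 / (q\<^sup>2 * (z + w)\<^sup>2) + 1 / (q ^ 3 * (z + w)))
        \<le> norm (1 / (q * (z + w) ^ 3)) + norm (1 / (q\<^sup>2 * (z + w)\<^sup>2)) + norm (1 / (q ^ 3 * (z + w)))"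
        by (meson add_mono norm_triangle_le norm_triangle_ineq order_refl order_trans)
      also have "\<dots> = norm (1 / (z + w) ^ 3) / norm q + norm (1 / (z + w)\<^sup>2) / (norm q)\<^sup>2 + norm (1 / (z + w)) / norm q ^ 3"
        by (simp add: norm_divide norm_mult norm_power mult.commute)
      also have "\<dots> \<le> (kz ^ 3 / (1 + norm w)) / norm q + (kz\<^sup>2 / (1 + norm w)) / (norm q)\<^sup>2 + (kz / (1 + norm w)) / norm q ^ 3"
        by (intro add_mono divide_right_mono b) auto
      also have "\<dots> = C / (1 + norm w)" by (simp add: C_def add_divide_distrib mult.commute)
      finally have "norm (G w) \<le> (C / (1 + norm w)) * (ka / (1 + norm w))"
        unfolding G_def norm_mult[of _ "1 / (cnj a + w)"] using inverse_decay(1)[OF a' w] k1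
        by (intro mult_mono) (auto simp: ka_def C_def intro!: divide_nonneg_pos add_nonneg_nonneg add_pos_nonneg)
      then show ?thesis by (simp add: power2_eq_square)
    qed
    show "integrable lborel (\<lambda>s. G (axis s))" "(LINT s|lborel. G (axis s)) = 0"
      using half_plane_cauchy[OF d hol bd] by auto
  qed
  define P where "P s = Re a / (norm (a - axis s))\<^sup>2" for s :: real
  have Peq: "P s = Re a / ((Re a)\<^sup>2 + (s - Im a)\<^sup>2)" for s
    unfolding P_def cmod_power2 by (simp add: power2_commute)
  have P: "integrable lborel P" "(LINT s|lborel. P s) = pi"
    using poisson_kernel_integral[OF a, of "Im a"] unfolding Peq[abs_def] by auto
  have key: "f s * of_real (P s) = of_real (Re a) * G (axis s) + of_real (P s) * (1 / q ^ 3)" for s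
  proof -
    define w where "w = axis s"
    define u where "u = z + w"
    have w0: "Re w = 0" by (simp add: w_def)
    have nz': "u \<noteq> 0" "cnj a + w \<noteq> 0" using nz[of w] a z w0 by (auto simp: u_def)
    have cw: "cnj w = - w" by (simp add: w_def)
    have nza: "a - w \<noteq> 0" using a w0 by (auto simp: complex_eq_iff)
    have "of_real ((norm (a - w))\<^sup>2) = (a - w) * (cnj a + w)"
      using complex_norm_square[of "a - w"] cw by simp
    then have Pw: "of_real (P s) = of_real (Re a) / ((a - w) * (cnj a + w))"
      unfolding P_def w_def[symmetric] by simp
    have aw: "a - w = q - u" by (simp add: q_def u_def)
    have qu: "q - u \<noteq> 0" using nza aw by simp
    have tel: "1 / u ^ 3 - 1 / q ^ 3 = (q - u) * (1 / (q * u ^ 3) + 1 / (q\<^sup>2 * u\<^sup>2) + 1 / (q ^ 3 * u))"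
      using nz' q by (simp add: divide_simps) (simp add: power2_eq_square power3_eq_cube algebra_simps)
    have "f s * of_real (P s) - of_real (P s) * (1 / q ^ 3) = (1 / u ^ 3 - 1 / q ^ 3) * of_real (P s)"
      unfolding f_def w_def[symmetric] u_def[symmetric] by (simp add: algebra_simps)
    also have "\<dots> = of_real (Re a) * G w"
      unfolding tel Pw aw G_def u_def[symmetric] using qu nz' by simp
    finally show ?thesis unfolding w_def by (simp add: algebra_simps)
  qed
  have eq: "(\<lambda>s. f s * of_real (Re a / (norm (a - axis s))\<^sup>2)) = (\<lambda>s. of_real (Re a) * G (axis s) + of_real (P s) * (1 / q ^ 3))"
    using key by (simp add: P_def[abs_def])
  have Pc: "integrable lborel (\<lambda>s. complex_of_real (P s))" using P(1) by simp
  show "integrable lborel (\<lambda>s. f s * of_real (Re a / (norm (a - axis s))\<^sup>2))"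
    unfolding eq using G(1) Pc by (intro Bochner_Integration.integrable_add integrable_mult_right integrable_mult_left)
  have "(LINT s|lborel. of_real (Re a) * G (axis s) + of_real (P s) * (1 / q ^ 3)) =
     of_real (Re a) * (LINT s|lborel. G (axis s)) + (LINT s|lborel. complex_of_real (P s)) * (1 / q ^ 3)"
    using G(1) Pc by (subst Bochner_Integration.integral_add) (auto intro: integrable_mult_right integrable_mult_left)
  then show "(LINT s|lborel. f s * of_real (Re a / (norm (a - axis s))\<^sup>2)) = pi / (z + a) ^ 3"
    unfolding eq using G(2) P(2) by (simp add: q_def)
qed

text \<open>The exponent 5/4 bridges the regimes |a| >= 2 |w| and |a| < 2 |w|. It exceeds 1, so that
  the sum over a family of finite density converges, and it is below 2, so that the sum can be
  integrated against a cubic kernel.\<close>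

lemma LL1_term_bound:
  assumes "Re a \<ge> 1" "Re w \<ge> 0"
  shows "norm (1 / (w + a) - 1 / a) \<le> 2 * (1 + norm w) powr (5/4) * norm a powr (-5/4)"
proof -
  have na: "norm a \<ge> 1" using assms complex_Re_le_cmod[of a] by linarith
  have a0: "a \<noteq> 0" "w + a \<noteq> 0" using assms by (auto simp: complex_eq_iff)
  define v where "v = (1 + norm w) / norm a"
  have "1 + norm w > 0" by (simp add: add_pos_nonneg)
  then have v0: "v > 0" unfolding v_def using na by (intro divide_pos_pos) auto
  have "1 / (w + a) - 1 / a = - w / ((w + a) * a)" using a0 by (simp add: divide_simps)
  then have eq: "norm (1 / (w + a) - 1 / a) = norm w / norm a * (1 / norm (w + a))" by (simp add: norm_divide norm_mult)
  have wv: "norm w / norm a \<le> v" using na by (simp add: v_def divide_right_mono)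
  have vp: "v powr (5/4) = v * v powr (1/4)" using v0 by (simp add: powr_mult_base)
  have "norm w / norm a * (1 / norm (w + a)) \<le> v * (2 * v powr (1/4))"
  proof (cases "2 * norm w \<le> norm a")
    case True
    have "norm (w + a) \<ge> norm a / 2" by (rule norm_add_ge_half[of w "norm w"]) (use True in auto)
    then have "1 / norm (w + a) \<le> 1 / (norm a / 2)" using a0 na by (intro divide_left_mono mult_pos_pos) auto
    also have "\<dots> = 2 * (1 / norm a)" by simp
    also have "1 / norm a \<le> (1 / norm a) powr (1/4)"
    proof -
      have "1 / norm a \<le> 1" using na by (subst divide_le_eq_1_pos) auto
      then show ?thesis using powr_mono'[of "1/4" 1 "1 / norm a"] by simp
    qed
    also have "(1 / norm a) powr (1/4) \<le> v powr (1/4)" using na by (intro powr_mono2) (auto simp: v_def divide_right_mono)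
    finally show ?thesis using wv v0 by (intro mult_mono) auto
  next
    case False
    have "1 \<le> Re (w + a)" using assms by simp
    then have "norm (w + a) \<ge> 1" using complex_Re_le_cmod[of "w + a"] by linarith
    then have "1 / norm (w + a) \<le> 1" by (smt (verit) divide_le_eq_1)
    also have "1 \<le> 2 * v powr (1/4)"
    proof -
      have "1 / 2 \<le> v" using False na unfolding v_def by (subst pos_le_divide_eq) auto
      then have "(1/2) powr (1/4) \<le> v powr (1/4)" by (intro powr_mono2) auto
      moreover have "(1/2::real) powr 1 \<le> (1/2) powr (1/4)" by (intro powr_mono') auto
      ultimately show ?thesis by simp
    qed
    finally show ?thesis using wv v0 by (intro mult_mono) auto
  qed
  also have "\<dots> = 2 * v powr (5/4)" unfolding vp by simp
  also have "v powr (5/4) = (1 + norm w) powr (5/4) * norm a powr (-5/4)"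
    unfolding v_def using na by (simp add: powr_divide powr_minus_divide add_nonneg_nonneg)
  finally show ?thesis using eq by simp
qed

text \<open>Quadratic for small u and linear up to pi for large u; the exponent 5/4 lies between.
  The imaginary part is singled out because the real part of \<open>Ln (1 + u)\<close> is unbounded
  near u = -1.\<close>

lemma Im_Ln_bound:
  fixes u :: complex
  assumes "1 + u \<noteq> 0"
  shows "\<bar>Im (Ln (1 + u) - u)\<bar> \<le> 18 * norm u powr (5/4)"
proof (cases "norm u \<le> 1 / 2")
  case True
  have "\<bar>Im (Ln (1 + u) - u)\<bar> \<le> 2 * (norm u)\<^sup>2" using norm_Ln_minus_le[OF True] abs_Im_le_cmod order_trans by blast
  also have "(norm u)\<^sup>2 \<le> norm u powr (5/4)"
  proof (cases "u = 0")
    case False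
    have "norm u powr 2 \<le> norm u powr (5/4)" using True by (intro powr_mono') auto
    then show ?thesis using False by (simp add: powr_numeral)
  qed simp
  finally show ?thesis using powr_ge_zero[of "norm u" "5/4"] by linarith
next
  case False
  then have u: "norm u > 1 / 2" by simp
  have nz: "u \<noteq> 0" using u by auto
  have h: "(1/2::real) powr 1 \<le> norm u powr (1/4)"
  proof -
    have "(1/2::real) powr 1 \<le> (1/2) powr (1/4)" by (intro powr_mono') auto
    also have "\<dots> \<le> norm u powr (1/4)" using u by (intro powr_mono2) auto
    finally show ?thesis .
  qed
  have e: "norm u powr (5/4) = norm u * norm u powr (1/4)" using nz by (simp add: powr_mult_base)
  have 1: "norm u \<le> 2 * norm u powr (5/4)"
    unfolding e using mult_left_mono[OF h norm_ge_zero[of u]] by simp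
  have "\<bar>Im (Ln (1 + u))\<bar> \<le> pi"
  proof (cases "1 + u = 0")
    case False
    then show ?thesis using mpi_less_Im_Ln[OF False] Im_Ln_le_pi[OF False] by linarith
  qed (use assms in simp)
  also have "pi \<le> 4" using pi_less_4 by simp
  also have "4 \<le> 8 * norm u" using u by simp
  finally have "\<bar>Im (Ln (1 + u) - u)\<bar> \<le> 9 * norm u" using abs_Im_le_cmod[of u] by simp
  then show ?thesis using 1 by linarith
qed

section \<open>The density on the imaginary axis\<close>

text \<open>Absolute convergence makes the sum independent of the order, so truncation by modulus,
  which suits Abel summation, has the same limit as truncation by index.\<close>

lemma near_sum_limit:
  fixes u :: "nat \<Rightarrow> real"
  assumes fin: "\<And>t. finite (near I a t)" and s: "summable (\<lambda>n. if n \<in> I then norm (u n) else 0)"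
  shows "((\<lambda>T. \<Sum>n\<in>near I a T. u n) \<longlongrightarrow> (\<Sum>n. if n \<in> I then u n else 0)) at_top"
proof -
  let ?f = "\<lambda>n. if n \<in> I then u n else 0"
  have "(\<lambda>n. norm (?f n)) = (\<lambda>n. if n \<in> I then norm (u n) else 0)" by auto
  then have sn: "summable (\<lambda>n. norm (?f n))" using s by simp
  have "?f sums suminf ?f" by (rule summable_sums[OF summable_norm_cancel[OF sn]])
  with sn have "(?f has_sum suminf ?f) UNIV" by (rule norm_summable_imp_has_sum)
  moreover have "(u has_sum suminf ?f) I \<longleftrightarrow> (?f has_sum suminf ?f) UNIV"
    by (rule has_sum_cong_neutral) auto
  ultimately have "(u has_sum suminf ?f) I" by blast
  then have "(sum u \<longlongrightarrow> suminf ?f) (finite_subsets_at_top I)" by (simp add: has_sum_def)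
  moreover have "filterlim (near I a) (finite_subsets_at_top I) at_top"
    unfolding filterlim_finite_subsets_at_top
  proof (intro allI impI)
    fix X assume X: "finite X \<and> X \<subseteq> I"
    define T where "T = Max (insert 0 ((\<lambda>n. norm (a n)) ` X))"
    have "X \<subseteq> near I a t" if "t \<ge> T" for t
    proof
      fix n assume "n \<in> X"
      then have "norm (a n) \<le> T" unfolding T_def using X by (intro Max_ge) auto
      then show "n \<in> near I a t" using that \<open>n \<in> X\<close> X by (auto simp: near_def)
    qed
    then show "\<forall>\<^sub>F t in at_top. finite (near I a t) \<and> X \<subseteq> near I a t \<and> near I a t \<subseteq> I"
      unfolding eventually_at_top_linorder using fin by (intro exI[of _ T]) (auto simp: near_def)
  qed
  ultimately show ?thesis using filterlim_compose[of "sum u"] by (simp add: o_def)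
qed

lemma fam_cnj:
  assumes "fin_dens I a" "\<And>n. n \<in> I \<Longrightarrow> Re (a n) \<ge> 1"
  shows "fam I a" "fam I (cnj_fam a)" "fin_dens I (cnj_fam a)"
    "summable (\<lambda>n. if n \<in> I then norm (a n) powr (-5/4) else 0)"
proof -
  have n1: "norm (a n) \<ge> 1" if "n \<in> I" for n using assms(2)[OF that] complex_Re_le_cmod[of "a n"] by linarith
  show "fin_dens I (cnj_fam a)" by (rule fin_dens_norm[OF assms(1)]) simp
  then show "fam I (cnj_fam a)" by (rule fam_of_fin_dens[where c = 1]) (use n1 in auto)
  show "fam I a" by (rule fam_of_fin_dens[OF assms(1), where c = 1]) (use n1 in auto)
  show "summable (\<lambda>n. if n \<in> I then norm (a n) powr (-5/4) else 0)"
  proof -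
    have eq: "- (5 / 4) = (- 5 / 4 :: real)" by simp
    have "summable (\<lambda>n. if n \<in> I then norm (a n) powr (- (5 / 4)) else 0)"
      by (rule fin_dens_summable[OF assms(1), where c = 1]) (use n1 in auto)
    then show ?thesis unfolding eq .
  qed
qed

text \<open>The points are conjugated because |i s + cnj a| = |a - i s|: the real part of 1 / (i s +
  cnj a) is the Poisson kernel of a at i s. Up to the factor pi and the genus-one subtraction, the
  real part of \<open>LL1\<close> on the axis is therefore the density of the balayage, and the
  imaginary part of \<open>LL\<close> is its primitive.\<close>

lemma LL1_axis:
  assumes "fin_dens I a" "\<And>n. n \<in> I \<Longrightarrow> Re (a n) \<ge> 1"
  shows "continuous_on UNIV (\<lambda>s::real. Re (LL1 I (cnj_fam a) (axis s)))"
    "((\<lambda>s. Im (LL I (cnj_fam a) (axis s))) has_real_derivative Re (LL1 I (cnj_fam a) (axis s))) (at s)"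
    "(\<lambda>n. if n \<in> I then Re (1 / (axis s + cnj (a n)) - 1 / cnj (a n)) else 0) sums Re (LL1 I (cnj_fam a) (axis s))"
proof -
  have fam: "fam I (cnj_fam a)" by (rule fam_cnj(2)[OF assms])
  have Re: "\<And>n. n \<in> I \<Longrightarrow> Re (cnj (a n)) \<ge> 1" using assms by simp
  have z: "Re (axis s) > - 1" for s by simp
  note LLd = LL_deriv[OF fam zero_le_one Re z] and LL1d = LL1_deriv[OF fam zero_le_one Re z]
  show "continuous_on UNIV (\<lambda>s::real. Re (LL1 I (cnj_fam a) (axis s)))"
  proof (intro continuous_on_Re continuous_at_imp_continuous_on ballI)
    fix s :: real
    have "isCont (LL1 I (cnj_fam a)) (axis s)" using LL1d(2) by (rule DERIV_isCont)
    moreover have "isCont (\<lambda>s. axis s) s" by (intro continuous_intros)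
    ultimately show "isCont (\<lambda>s. LL1 I (cnj_fam a) (axis s)) s"
      by (rule isCont_o2[rotated])
  qed
  have "((\<lambda>s. axis s) has_vector_derivative \<i>) (at s)"
    by (auto intro!: derivative_eq_intros simp: has_vector_derivative_def scaleR_conv_of_real)
  then have "((LL I (cnj_fam a) \<circ> (\<lambda>s. axis s)) has_vector_derivative (\<i> * LL1 I (cnj_fam a) (axis s))) (at s)"
    using LLd(3) by (intro field_vector_diff_chain_at)
  then have "((\<lambda>s. Im (LL I (cnj_fam a) (axis s))) has_vector_derivative Im (\<i> * LL1 I (cnj_fam a) (axis s))) (at s)"
    unfolding o_def by (rule bounded_linear.has_vector_derivative[OF bounded_linear_Im])
  then show "((\<lambda>s. Im (LL I (cnj_fam a) (axis s))) has_real_derivative Re (LL1 I (cnj_fam a) (axis s))) (at s)"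
    by (simp add: has_real_derivative_iff_has_vector_derivative)
  have "(\<lambda>n. if n \<in> I then 1 / (axis s + cnj (a n)) - 1 / cnj (a n) else 0) sums LL1 I (cnj_fam a) (axis s)"
    unfolding LL1_def using LLd(2) by (rule summable_sums)
  then have "(\<lambda>n. Re (if n \<in> I then 1 / (axis s + cnj (a n)) - 1 / cnj (a n) else 0)) sums Re (LL1 I (cnj_fam a) (axis s))"
    by (simp add: sums_complex_iff)
  then show "(\<lambda>n. if n \<in> I then Re (1 / (axis s + cnj (a n)) - 1 / cnj (a n)) else 0) sums Re (LL1 I (cnj_fam a) (axis s))"
    by (rule sums_cong[THEN iffD1, rotated]) auto
qed

lemma axis_term_eq:
  assumes "Re a > 0"
  shows "Re (1 / (axis s + cnj a) - 1 / cnj a) = Re a / (norm (a - axis s))\<^sup>2 - Re (1 / a)"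
    "Re (1 / (axis s + cnj a) - 1 / cnj a) = pos_recip a * ((norm a)\<^sup>2 / (norm (a - axis s))\<^sup>2 - 1)"
proof -
  have "axis s + cnj a = cnj (a - axis s)" by simp
  then have n: "norm (axis s + cnj a) = norm (a - axis s)" by (metis complex_mod_cnj)
  show 1: "Re (1 / (axis s + cnj a) - 1 / cnj a) = Re a / (norm (a - axis s))\<^sup>2 - Re (1 / a)"
    unfolding minus_complex.simps Re_inverse_complex n by simp
  have "norm a > 0" using assms by auto
  then show "Re (1 / (axis s + cnj a) - 1 / cnj a) = pos_recip a * ((norm a)\<^sup>2 / (norm (a - axis s))\<^sup>2 - 1)"
    unfolding 1 using assms by (simp add: pos_recip_pos Re_inverse_complex algebra_simps)
qed

text \<open>For |s| >= 2 |b| the triangle inequality suffices; otherwise the distance of b from the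
  axis, at least \<eta> |b|, is already comparable with |b| + |s|.\<close>

lemma separated_norm_bound:
  assumes \<eta>: "0 < \<eta>" "\<eta> \<le> 1" and b: "Re b \<ge> \<eta> * norm b"
  shows "(norm (b - axis s))\<^sup>2 \<ge> \<eta>\<^sup>2 / 8 * ((norm b)\<^sup>2 + s\<^sup>2)"
proof (cases "\<bar>s\<bar> \<ge> 2 * norm b")
  case True
  have "\<bar>s\<bar> - norm b \<le> norm (b - axis s)"
    using norm_triangle_ineq2[of "axis s" b] by (simp add: norm_mult norm_minus_commute)
  then have "\<bar>s\<bar> / 2 \<le> norm (b - axis s)" using True by linarith
  then have 1: "(\<bar>s\<bar> / 2)\<^sup>2 \<le> (norm (b - axis s))\<^sup>2" by (intro power_mono) auto
  have "(norm b)\<^sup>2 \<le> (\<bar>s\<bar> / 2)\<^sup>2" using True by (intro power_mono) auto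
  then have 2: "(norm b)\<^sup>2 + s\<^sup>2 \<le> 5 / 4 * s\<^sup>2" by (simp add: power_divide)
  have "\<eta>\<^sup>2 \<le> 1" using \<eta> by (simp add: power_le_one)
  then have "\<eta>\<^sup>2 / 8 * ((norm b)\<^sup>2 + s\<^sup>2) \<le> 1 / 8 * (5 / 4 * s\<^sup>2)" using 2 by (intro mult_mono) auto
  also have "\<dots> \<le> (\<bar>s\<bar> / 2)\<^sup>2" by (simp add: power_divide)
  finally show ?thesis using 1 by linarith
next
  case False
  then have "\<bar>s\<bar>\<^sup>2 \<le> (2 * norm b)\<^sup>2" by (intro power_mono) auto
  then have 1: "(norm b)\<^sup>2 + s\<^sup>2 \<le> 5 * (norm b)\<^sup>2" by (simp add: power_mult_distrib)
  have "(\<eta> * norm b)\<^sup>2 \<le> (Re b)\<^sup>2" using b \<eta> by (intro power_mono) auto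
  also have "(Re b)\<^sup>2 \<le> (norm (b - axis s))\<^sup>2" by (simp add: cmod_power2)
  finally have 2: "\<eta>\<^sup>2 * (norm b)\<^sup>2 \<le> (norm (b - axis s))\<^sup>2" by (simp add: power_mult_distrib)
  have "\<eta>\<^sup>2 / 8 * ((norm b)\<^sup>2 + s\<^sup>2) \<le> \<eta>\<^sup>2 / 8 * (5 * (norm b)\<^sup>2)" using 1 by (intro mult_left_mono) auto
  also have "\<dots> \<le> \<eta>\<^sup>2 * (norm b)\<^sup>2" by simp
  finally show ?thesis using 2 by linarith
qed

text \<open>The density of the balayage of the poles minus that of the zeros is bounded below (after removal
  of a uniform density): the kernel is a monotone function of the modulus up to a bounded error,
  so that Abel summation reduces the estimate to the balance of the logarithmic sums.\<close>

lemma axis_density_lower_bound: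
  assumes fdI: "fin_dens I a" "\<And>n. n \<in> I \<Longrightarrow> Re (a n) \<ge> 1"
    and fdJ: "fin_dens J b" "\<And>n. n \<in> J \<Longrightarrow> Re (b n) \<ge> 1"
    and \<eta>: "0 < \<eta>" "\<eta> \<le> 1" "\<And>n. n \<in> J \<Longrightarrow> Re (b n) \<ge> \<eta> * norm (b n)"
    and bal: "\<And>t. lsum J b t - lsum I a t \<ge> - C0" and C0: "C0 \<ge> 0"
  obtains C where "\<And>s. Re (LL1 I (cnj_fam a) (axis s) - LL1 J (cnj_fam b) (axis s)) \<ge> - C"
proof -
  note finI = fin_dens_near_finite[OF fdI(1)] and finJ = fin_dens_near_finite[OF fdJ(1)]
  have n1: "norm w \<ge> 1" if "Re w \<ge> 1" for w using that complex_Re_le_cmod[of w] by linarith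
  obtain CJ where CJ: "CJ \<ge> 0" "\<And>F s. finite F \<Longrightarrow> F \<subseteq> J \<Longrightarrow> s > 0 \<Longrightarrow>
      (\<Sum>n\<in>F. s / ((norm (b n))\<^sup>2 + s\<^sup>2)) \<le> CJ"
    by (rule fin_dens_poisson_sum[OF fdJ(1), where c = 1]) (use fdJ(2) n1 in auto)
  define e where "e = 4 / (\<eta>\<^sup>2 / 8)"
  have e: "e > 0" using \<eta> by (simp add: e_def)
  define C where "C = C0 + e * CJ"
  show ?thesis
  proof (rule that[of C])
    fix s :: real
    define uI where "uI n = Re (1 / (axis s + cnj (a n)) - 1 / cnj (a n))" for n
    define uJ where "uJ n = Re (1 / (axis s + cnj (b n)) - 1 / cnj (b n))" for n
    \<comment> \<open>1 - |a|^2 / |a - i s|^2 with |a - i s| replaced by |a| + |s|: for fixed s this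
      depends on t = |a| alone, lies in [0, 1] and decreases in t, as Abel summation
      requires.\<close>
    define q where "q t = 1 - (t / (t + \<bar>s\<bar>))\<^sup>2" for t
    have fr: "0 \<le> t / (t + \<bar>s\<bar>)" "t / (t + \<bar>s\<bar>) \<le> 1" if "t \<ge> 1" for t using that by auto
    have q01: "0 \<le> q t \<and> q t \<le> 1" if "t \<ge> 1" for t
      using fr[OF that] by (simp add: q_def power_le_one)
    have qanti: "q t' \<le> q t" if "t \<ge> 1" "t \<le> t'" for t t'
    proof -
      have "u / (u + \<bar>s\<bar>) = 1 - \<bar>s\<bar> / (u + \<bar>s\<bar>)" if "u \<ge> 1" for u using that by (simp add: field_simps)
      moreover have "\<bar>s\<bar> / (t' + \<bar>s\<bar>) \<le> \<bar>s\<bar> / (t + \<bar>s\<bar>)"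
        using that by (intro divide_left_mono mult_pos_pos) auto
      ultimately have "t / (t + \<bar>s\<bar>) \<le> t' / (t' + \<bar>s\<bar>)" using that by simp
      then show ?thesis using fr[OF that(1)] unfolding q_def by (simp add: power_mono)
    qed
    \<comment> \<open>For the poles |a - i s| <= |a| + |s| gives the required direction without an
      error term.\<close>
    have lowI: "uI n \<ge> - pos_recip (a n) * q (norm (a n))" if n: "n \<in> I" for n
    proof -
      have na: "norm (a n) \<ge> 1" using n1 fdI(2)[OF n] by simp
      have Rp: "Re (a n) > 0" using fdI(2)[OF n] by linarith
      have nz: "norm (a n - axis s) > 0"
      proof -
        have "Re (a n - axis s) > 0" using Rp by simp
        then show ?thesis by (metis complex_Re_le_cmod less_le_trans)
      qed
      have "norm (a n - axis s) \<le> norm (a n) + \<bar>s\<bar>"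
        using norm_triangle_ineq4[of "a n" "axis s"] by (simp add: norm_mult)
      then have "norm (a n) / (norm (a n) + \<bar>s\<bar>) \<le> norm (a n) / norm (a n - axis s)"
        using nz na by (intro divide_left_mono mult_pos_pos) auto
      then have "(norm (a n) / (norm (a n) + \<bar>s\<bar>))\<^sup>2 \<le> (norm (a n) / norm (a n - axis s))\<^sup>2"
        using fr[OF na] by (intro power_mono) auto
      then have "- q (norm (a n)) \<le> (norm (a n))\<^sup>2 / (norm (a n - axis s))\<^sup>2 - 1"
        by (simp add: q_def power_divide)
      then have "pos_recip (a n) * (- q (norm (a n))) \<le> uI n"
        unfolding uI_def axis_term_eq(2)[OF Rp] by (intro mult_left_mono pos_recip_bounds)
      then show ?thesis by simp
    qed
    \<comment> \<open>For the zeros the replacement costs (|b| + |s|)^2 - |b - i s|^2 <= 4 |b| |s|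
      in the denominators; by separation this becomes a multiple of |s| / (|b|^2 + s^2), whose sum
      is bounded uniformly in s.\<close>
    have upJ: "uJ n \<le> - pos_recip (b n) * q (norm (b n)) + e * (\<bar>s\<bar> / ((norm (b n))\<^sup>2 + \<bar>s\<bar>\<^sup>2))" if n: "n \<in> J" for n
    proof -
      have nb: "norm (b n) \<ge> 1" using n1 fdJ(2)[OF n] by simp
      have Rp: "Re (b n) > 0" using fdJ(2)[OF n] by linarith
      define X where "X = (norm (b n - axis s))\<^sup>2"
      define Y where "Y = (norm (b n) + \<bar>s\<bar>)\<^sup>2"
      define W where "W = (norm (b n))\<^sup>2 + s\<^sup>2"
      have W: "W > 0" using nb by (auto simp: W_def intro!: add_pos_nonneg)
      have XW: "X \<ge> \<eta>\<^sup>2 / 8 * W" unfolding X_def W_def by (rule separated_norm_bound) (use \<eta> n in auto)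
      have \<eta>W: "\<eta>\<^sup>2 / 8 * W > 0" using \<eta> W by simp
      then have X0: "X > 0" using XW by linarith
      have YW: "Y \<ge> W" unfolding Y_def W_def by (simp add: power2_eq_square algebra_simps)
      have Y0: "Y > 0" using YW W by linarith
      have YX: "Y - X \<le> 4 * norm (b n) * \<bar>s\<bar>"
      proof -
        have "X = (norm (b n))\<^sup>2 + s\<^sup>2 - 2 * s * Im (b n)"
          unfolding X_def cmod_power2 by (simp add: power2_eq_square algebra_simps)
        moreover have "2 * s * Im (b n) \<le> 2 * (\<bar>s\<bar> * norm (b n))"
        proof -
          have "s * Im (b n) \<le> \<bar>s\<bar> * \<bar>Im (b n)\<bar>" by (metis abs_ge_self abs_mult)
          also have "\<dots> \<le> \<bar>s\<bar> * norm (b n)" by (intro mult_left_mono abs_Im_le_cmod) auto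
          finally show ?thesis by simp
        qed
        ultimately show ?thesis unfolding Y_def by (simp add: power2_eq_square algebra_simps)
      qed
      have "pos_recip (b n) * (norm (b n))\<^sup>2 = Re (b n)"
        using Rp nb by (simp add: pos_recip_pos Re_inverse_complex)
      then have le: "pos_recip (b n) * (norm (b n))\<^sup>2 \<le> norm (b n)" using complex_Re_le_cmod by simp
      have "pos_recip (b n) * (norm (b n))\<^sup>2 * (1 / X - 1 / Y) \<le> e * (\<bar>s\<bar> / W)"
      proof -
        have "1 / X - 1 / Y = (Y - X) / (X * Y)" using X0 Y0 by (simp add: field_simps)
        also have "\<dots> \<le> (4 * norm (b n) * \<bar>s\<bar>) / ((\<eta>\<^sup>2 / 8 * W) * W)"
          using YX XW YW \<eta>W W X0 Y0 by (intro frac_le mult_mono mult_nonneg_nonneg mult_pos_pos) auto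
        also have "\<dots> = e * norm (b n) * \<bar>s\<bar> / (W * W)" using \<eta> by (simp add: e_def)
        finally have 1: "1 / X - 1 / Y \<le> e * norm (b n) * \<bar>s\<bar> / (W * W)" .
        have "pos_recip (b n) * (norm (b n))\<^sup>2 * (1 / X - 1 / Y) \<le> pos_recip (b n) * (norm (b n))\<^sup>2 * (e * norm (b n) * \<bar>s\<bar> / (W * W))"
          using 1 by (intro mult_left_mono) (auto simp: pos_recip_bounds)
        also have "\<dots> \<le> norm (b n) * (e * norm (b n) * \<bar>s\<bar> / (W * W))"
          using le e W by (intro mult_right_mono) auto
        also have "\<dots> = (norm (b n))\<^sup>2 * (e * \<bar>s\<bar> / (W * W))" by (simp add: power2_eq_square)
        also have "\<dots> \<le> W * (e * \<bar>s\<bar> / (W * W))" using e W by (intro mult_right_mono) (auto simp: W_def)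
        also have "\<dots> = e * (\<bar>s\<bar> / W)" using W by simp
        finally show ?thesis .
      qed
      moreover have "uJ n = - pos_recip (b n) * q (norm (b n)) + pos_recip (b n) * (norm (b n))\<^sup>2 * (1 / X - 1 / Y)"
        unfolding uJ_def axis_term_eq(2)[OF Rp] q_def power_divide Y_def[symmetric] X_def[symmetric]
        by (simp add: algebra_simps)
      ultimately show ?thesis by (simp add: W_def)
    qed
    have ineq: "(\<Sum>n\<in>near I a T. uI n) - (\<Sum>n\<in>near J b T. uJ n) \<ge> - C" for T
    proof -
      let ?F = "near J b T <+> near I a T"
      let ?t = "case_sum (\<lambda>n. norm (b n)) (\<lambda>n. norm (a n))"
      let ?c = "case_sum (\<lambda>n. pos_recip (b n)) (\<lambda>n. - pos_recip (a n))"
      have t1: "?t j \<ge> 1" if "j \<in> ?F" for j using that n1 fdI(2) fdJ(2) by (auto simp: near_def)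
      have abel: "(\<Sum>j\<in>?F. ?c j * q (?t j)) \<ge> - C0 * 1"
      proof (rule abel_sum_lower_bound[where t = ?t])
        show "finite ?F" using finI finJ by simp
        fix U
        have "{j\<in>?F. ?t j \<le> U} = near J b (min T U) <+> near I a (min T U)"
          by (auto simp: near_def)
        then have "(\<Sum>j\<in>{j\<in>?F. ?t j \<le> U}. ?c j) = lsum J b (min T U) - lsum I a (min T U)"
          using finI finJ by (simp add: sum.Plus comp_def lsum_def sum_negf)
        then show "(\<Sum>j\<in>{j\<in>?F. ?t j \<le> U}. ?c j) \<ge> - C0" using bal by simp
      next
        show "0 \<le> q (?t j) \<and> q (?t j) \<le> 1" if "j \<in> ?F" for j using q01[OF t1[OF that]] .
        show "q (?t j) \<le> q (?t i)" if "i \<in> ?F" "j \<in> ?F" "?t i \<le> ?t j" for i j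
          using qanti[OF t1[OF that(1)] that(3)] .
      qed (use C0 in auto)
      have ab: "(\<Sum>j\<in>?F. ?c j * q (?t j)) = (\<Sum>n\<in>near J b T. pos_recip (b n) * q (norm (b n))) - (\<Sum>n\<in>near I a T. pos_recip (a n) * q (norm (a n)))"
        using finI finJ by (simp add: sum.Plus comp_def sum_negf)
      have sI: "(\<Sum>n\<in>near I a T. uI n) \<ge> (\<Sum>n\<in>near I a T. - pos_recip (a n) * q (norm (a n)))"
        by (intro sum_mono lowI) (auto simp: near_def)
      have sJ: "(\<Sum>n\<in>near J b T. uJ n) \<le> (\<Sum>n\<in>near J b T. - pos_recip (b n) * q (norm (b n)) + e * (\<bar>s\<bar> / ((norm (b n))\<^sup>2 + \<bar>s\<bar>\<^sup>2)))"
        by (intro sum_mono upJ) (auto simp: near_def)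
      have err: "(\<Sum>n\<in>near J b T. \<bar>s\<bar> / ((norm (b n))\<^sup>2 + \<bar>s\<bar>\<^sup>2)) \<le> CJ"
      proof (cases "s = 0")
        case False
        then show ?thesis by (intro CJ(2) finJ) (auto simp: near_def)
      qed (use CJ in simp)
      have "e * (\<Sum>n\<in>near J b T. \<bar>s\<bar> / ((norm (b n))\<^sup>2 + \<bar>s\<bar>\<^sup>2)) \<le> e * CJ" using err e by (intro mult_left_mono) auto
      then have sJ': "(\<Sum>n\<in>near J b T. uJ n) \<le> - (\<Sum>n\<in>near J b T. pos_recip (b n) * q (norm (b n))) + e * CJ"
        using sJ by (simp only: sum.distrib sum_negf sum_distrib_left[symmetric] mult_minus_left)
      have sI': "(\<Sum>n\<in>near I a T. uI n) \<ge> - (\<Sum>n\<in>near I a T. pos_recip (a n) * q (norm (a n)))"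
        using sI by (simp add: sum_negf)
      show ?thesis using abel sI' sJ' unfolding ab C_def by linarith
    qed
    have summ: "summable (\<lambda>n. if n \<in> S then norm (Re (1 / (axis s + cnj (p n)) - 1 / cnj (p n))) else 0)"
      if "fin_dens S p" "\<And>n. n \<in> S \<Longrightarrow> Re (p n) \<ge> 1" for S and p :: "nat \<Rightarrow> complex"
    proof (rule summable_comparison_test'[where N = 0])
      show "summable (\<lambda>n. 2 * (1 + norm (axis s)) powr (5/4) * (if n \<in> S then norm (p n) powr (-5/4) else 0))"
        by (intro summable_mult fam_cnj(4)[OF that])
      fix n
      show "norm (if n \<in> S then norm (Re (1 / (axis s + cnj (p n)) - 1 / cnj (p n))) else 0)
        \<le> 2 * (1 + norm (axis s)) powr (5/4) * (if n \<in> S then norm (p n) powr (-5/4) else 0)"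
      proof (cases "n \<in> S")
        case True
        have "\<bar>Re (1 / (axis s + cnj (p n)) - 1 / cnj (p n))\<bar> \<le> norm (1 / (axis s + cnj (p n)) - 1 / cnj (p n))"
          by (rule abs_Re_le_cmod)
        also have "\<dots> \<le> 2 * (1 + norm (axis s)) powr (5/4) * norm (cnj (p n)) powr (-5/4)"
          by (rule LL1_term_bound) (use that(2)[OF True] in auto)
        finally show ?thesis using True by simp
      qed simp
    qed
    have lI: "((\<lambda>T. \<Sum>n\<in>near I a T. uI n) \<longlongrightarrow> Re (LL1 I (cnj_fam a) (axis s))) at_top"
      using near_sum_limit[OF finI summ[OF fdI]] sums_unique[OF LL1_axis(3)[OF fdI, of s]] by (simp add: uI_def)
    have lJ: "((\<lambda>T. \<Sum>n\<in>near J b T. uJ n) \<longlongrightarrow> Re (LL1 J (cnj_fam b) (axis s))) at_top"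
      using near_sum_limit[OF finJ summ[OF fdJ]] sums_unique[OF LL1_axis(3)[OF fdJ, of s]] by (simp add: uJ_def)
    have "- C \<le> Re (LL1 I (cnj_fam a) (axis s)) - Re (LL1 J (cnj_fam b) (axis s))"
      by (rule tendsto_lowerbound[OF tendsto_diff[OF lI lJ]]) (use ineq in \<open>auto intro: always_eventually\<close>)
    then show "Re (LL1 I (cnj_fam a) (axis s) - LL1 J (cnj_fam b) (axis s)) \<ge> - C" by simp
  qed
qed

lemma Im_LL_axis_bound:
  assumes fd: "fin_dens I a" "\<And>n. n \<in> I \<Longrightarrow> Re (a n) \<ge> 1"
  obtains K where "K \<ge> 0" "\<And>s. \<bar>Im (LL I (cnj_fam a) (axis s))\<bar> \<le> K * \<bar>s\<bar> powr (5/4)"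
proof -
  let ?w = "\<lambda>n. if n \<in> I then norm (a n) powr (-5/4) else 0"
  have sw: "summable ?w" by (rule fam_cnj(4)[OF fd])
  show ?thesis
  proof (rule that[of "18 * suminf ?w"])
    show "18 * suminf ?w \<ge> 0" using suminf_nonneg[OF sw] by simp
    fix s :: real
    have fam: "fam I (cnj_fam a)" by (rule fam_cnj(2)[OF fd])
    have Re: "\<And>n. n \<in> I \<Longrightarrow> Re (cnj (a n)) \<ge> 1" using fd by simp
    have z: "Re (axis s) > - 1" by simp
    have "(\<lambda>n. LLt I (cnj_fam a) n (axis s)) sums LL I (cnj_fam a) (axis s)"
      unfolding LL_def by (intro summable_sums LL_deriv(1)[OF fam zero_le_one Re z])
    then have sm: "(\<lambda>n. Im (LLt I (cnj_fam a) n (axis s))) sums Im (LL I (cnj_fam a) (axis s))"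
      by (simp add: sums_complex_iff)
    have bd: "\<bar>Im (LLt I (cnj_fam a) n (axis s))\<bar> \<le> 18 * \<bar>s\<bar> powr (5/4) * ?w n" for n
    proof (cases "n \<in> I")
      case True
      have a0: "norm (a n) > 0" using fd(2)[OF True] by auto
      note nz = LL_aux_nz[OF fam zero_le_one Re True z]
      have "1 + axis s / cnj (a n) \<noteq> 0" using nz(2) by auto
      then have "\<bar>Im (LLt I (cnj_fam a) n (axis s))\<bar> \<le> 18 * norm (axis s / cnj (a n)) powr (5/4)"
        using Im_Ln_bound[of "axis s / cnj (a n)"] True by (simp add: LLt_def)
      also have "norm (axis s / cnj (a n)) powr (5/4) = \<bar>s\<bar> powr (5/4) * norm (a n) powr (-5/4)"
        using a0 by (simp add: norm_divide norm_mult powr_divide powr_minus_divide)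
      finally show ?thesis using True by simp
    qed (simp add: LLt_def)
    have s2: "summable (\<lambda>n. 18 * \<bar>s\<bar> powr (5/4) * ?w n)" by (intro summable_mult sw)
    have "\<bar>Im (LL I (cnj_fam a) (axis s))\<bar> = \<bar>\<Sum>n. Im (LLt I (cnj_fam a) n (axis s))\<bar>"
      using sums_unique[OF sm] by simp
    also have "\<dots> \<le> (\<Sum>n. 18 * \<bar>s\<bar> powr (5/4) * ?w n)"
      using norm_suminf_le[of "\<lambda>n. Im (LLt I (cnj_fam a) n (axis s))", OF _ s2] bd by auto
    also have "\<dots> = 18 * \<bar>s\<bar> powr (5/4) * suminf ?w" by (rule suminf_mult[OF sw])
    finally show "\<bar>Im (LL I (cnj_fam a) (axis s))\<bar> \<le> 18 * suminf ?w * \<bar>s\<bar> powr (5/4)" by (simp add: mult_ac)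
  qed
qed

text \<open>The Poisson formula term by term. The constants - Re (1 / a) of the genus-one
  subtraction disappear because the cubic kernel has integral 0, and pi / (z + a)^3 is pi / 2 times
  a term of \<open>LL3\<close>.\<close>

lemma LL1_axis_integral:
  assumes fd: "fin_dens I a" "\<And>n. n \<in> I \<Longrightarrow> Re (a n) \<ge> 1" and z: "Re z > 0"
  defines "f \<equiv> \<lambda>s::real. 1 / (z + axis s) ^ 3"
  shows "integrable lborel (\<lambda>s. f s * of_real (Re (LL1 I (cnj_fam a) (axis s))))"
    "(LINT s|lborel. f s * of_real (Re (LL1 I (cnj_fam a) (axis s)))) = pi * LL3 I a z / 2"
proof -
  define u where "u n s = (if n \<in> I then f s * of_real (Re (1 / (axis s + cnj (a n)) - 1 / cnj (a n))) else 0)" for n and s :: real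
  define k where "k = ((1 + norm z) / Re z + 1) ^ 3"
  have k0: "k \<ge> 0" using z by (simp add: k_def)
  have Rp: "Re (a n) > 0" if "n \<in> I" for n using fd(2)[OF that] by linarith
  have f0: "integrable lborel f" "(LINT s|lborel. f s) = 0" if "n \<in> I" for n
    using poisson_formula_cube(1,2)[OF Rp[OF that] z] by (simp_all add: f_def)
  have ueq: "u n = (\<lambda>s. f s * of_real (Re (a n) / (norm (a n - axis s))\<^sup>2) - f s * of_real (Re (1 / a n)))" if "n \<in> I" for n
    by (intro ext) (simp only: u_def that if_True axis_term_eq(1)[OF Rp[OF that]] of_real_diff right_diff_distrib)
  have uint: "integrable lborel (u n)" for n
  proof (cases "n \<in> I")
    case True
    have "integrable lborel (\<lambda>s. f s * of_real (Re (a n) / (norm (a n - axis s))\<^sup>2))"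
      unfolding f_def by (rule poisson_formula_cube(3)[OF Rp[OF True] z])
    moreover have "integrable lborel (\<lambda>s. f s * of_real (Re (1 / a n)))" using f0(1)[OF True] by (rule integrable_mult_left)
    ultimately show ?thesis unfolding ueq[OF True] by (rule Bochner_Integration.integrable_diff)
  qed (simp add: u_def[abs_def])
  have uval: "(LINT s|lborel. u n s) = (if n \<in> I then pi / (z + a n) ^ 3 else 0)" for n
  proof (cases "n \<in> I")
    case True
    have i1: "integrable lborel (\<lambda>s. f s * of_real (Re (a n) / (norm (a n - axis s))\<^sup>2))"
      unfolding f_def by (rule poisson_formula_cube(3)[OF Rp[OF True] z])
    have i2: "integrable lborel (\<lambda>s. f s * of_real (Re (1 / a n)))" using f0(1)[OF True] by (rule integrable_mult_left)
    have "(LINT s|lborel. u n s) = (LINT s|lborel. f s * of_real (Re (a n) / (norm (a n - axis s))\<^sup>2)) - (LINT s|lborel. f s * of_real (Re (1 / a n)))"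
      unfolding ueq[OF True] by (rule Bochner_Integration.integral_diff[OF i1 i2])
    also have "(LINT s|lborel. f s * of_real (Re (1 / a n))) = (LINT s|lborel. f s) * of_real (Re (1 / a n))"
      by (rule integral_mult_left_zero)
    also have "\<dots> = 0" using f0(2)[OF True] by simp
    also have "(LINT s|lborel. f s * of_real (Re (a n) / (norm (a n - axis s))\<^sup>2)) = pi / (z + a n) ^ 3"
      unfolding f_def by (rule poisson_formula_cube(4)[OF Rp[OF True] z])
    finally show ?thesis using True by simp
  qed (simp add: u_def)
  have ubd: "norm (u n s) \<le> (2 * k * (if n \<in> I then norm (a n) powr (-5/4) else 0)) * (1 + \<bar>s\<bar>) powr (-7/4)" for n s
  proof (cases "n \<in> I")
    case True
    have p: "1 + \<bar>s\<bar> > 0" by (simp add: add_pos_nonneg)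
    have "norm (f s) \<le> k / (1 + \<bar>s\<bar>) ^ 3"
      using inverse_decay_power[OF z, of "axis s" 3 3] by (simp add: f_def k_def norm_mult)
    also have "(1 + \<bar>s\<bar>) ^ 3 = (1 + \<bar>s\<bar>) powr 3" using p by (simp add: powr_numeral)
    finally have 1: "norm (f s) \<le> k * (1 + \<bar>s\<bar>) powr (-3)" using p by (simp add: powr_minus_divide)
    have 2: "\<bar>Re (1 / (axis s + cnj (a n)) - 1 / cnj (a n))\<bar> \<le> 2 * (1 + \<bar>s\<bar>) powr (5/4) * norm (a n) powr (-5/4)"
      using LL1_term_bound[of "cnj (a n)" "axis s"] fd(2)[OF True] abs_Re_le_cmod[of "1 / (axis s + cnj (a n)) - 1 / cnj (a n)"]
      by (simp add: norm_mult)
    have "norm (u n s) = norm (f s) * \<bar>Re (1 / (axis s + cnj (a n)) - 1 / cnj (a n))\<bar>"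
      using True by (simp add: u_def norm_mult del: minus_complex.simps)
    also have "\<dots> \<le> (k * (1 + \<bar>s\<bar>) powr (-3)) * (2 * (1 + \<bar>s\<bar>) powr (5/4) * norm (a n) powr (-5/4))"
      by (intro mult_mono 1 2) (use k0 in auto)
    also have "\<dots> = 2 * k * norm (a n) powr (-5/4) * ((1 + \<bar>s\<bar>) powr (-3) * (1 + \<bar>s\<bar>) powr (5/4))" by simp
    also have "(1 + \<bar>s\<bar>) powr (-3) * (1 + \<bar>s\<bar>) powr (5/4) = (1 + \<bar>s\<bar>) powr (-7/4)"
      by (simp add: powr_add[symmetric])
    finally show ?thesis using True by simp
  qed (simp add: u_def)
  have sw: "summable (\<lambda>n. if n \<in> I then norm (a n) powr (-5/4) else 0)" by (rule fam_cnj(4)[OF fd])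
  have s1: "AE s in lborel. summable (\<lambda>n. norm (u n s))"
  proof (rule AE_I2)
    fix s
    show "summable (\<lambda>n. norm (u n s))"
    proof (rule summable_comparison_test'[where N = 0, OF summable_mult2[OF summable_mult[OF sw]]])
      show "norm (norm (u n s)) \<le> (2 * k * (if n \<in> I then norm (a n) powr (-5/4) else 0)) * (1 + \<bar>s\<bar>) powr (-7/4)" for n
        unfolding real_norm_def abs_norm_cancel by (rule ubd)
    qed
  qed
  have s2: "summable (\<lambda>n. LINT s|lborel. norm (u n s))"
  proof (rule summable_comparison_test'[where N = 0, OF summable_mult2[OF summable_mult[OF sw]]])
    fix n :: nat
    have "(LINT s|lborel. norm (u n s)) \<le> (LINT s|lborel. (2 * k * (if n \<in> I then norm (a n) powr (-5/4) else 0)) * (1 + \<bar>s\<bar>) powr (-7/4))"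
      by (intro integral_mono integrable_norm uint integrable_mult_right integrable_powr_decay ubd)
    also have "\<dots> = (2 * k * (if n \<in> I then norm (a n) powr (-5/4) else 0)) * (LINT s|lborel. (1 + \<bar>s\<bar>) powr (-7/4))"
      by (rule integral_mult_right_zero)
    finally show "norm (LINT s|lborel. norm (u n s)) \<le> (2 * k * (if n \<in> I then norm (a n) powr (-5/4) else 0)) * (LINT s|lborel. (1 + \<bar>s\<bar>) powr (-7/4))"
      by simp
  qed
  have eq: "(\<lambda>s. f s * of_real (Re (LL1 I (cnj_fam a) (axis s)))) = (\<lambda>s. \<Sum>n. u n s)"
  proof
    fix s
    have "(\<lambda>n. f s * of_real (if n \<in> I then Re (1 / (axis s + cnj (a n)) - 1 / cnj (a n)) else 0)) sums (f s * of_real (Re (LL1 I (cnj_fam a) (axis s))))"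
      by (intro sums_mult sums_of_real LL1_axis(3)[OF fd])
    then have "(\<lambda>n. u n s) sums (f s * of_real (Re (LL1 I (cnj_fam a) (axis s))))"
      by (rule sums_cong[THEN iffD1, rotated]) (auto simp: u_def)
    then show "f s * of_real (Re (LL1 I (cnj_fam a) (axis s))) = (\<Sum>n. u n s)" by (rule sums_unique)
  qed
  show "integrable lborel (\<lambda>s. f s * of_real (Re (LL1 I (cnj_fam a) (axis s))))"
    unfolding eq by (rule integrable_suminf[OF uint s1 s2])
  have "(LINT s|lborel. (\<Sum>n. u n s)) = (\<Sum>n. if n \<in> I then pi / (z + a n) ^ 3 else 0)"
    using integral_suminf[OF uint s1 s2] by (simp add: uval)
  also have "\<dots> = (\<Sum>n. (pi / 2) * (if n \<in> I then 2 / (z + a n) ^ 3 else 0))"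
    by (intro suminf_cong) auto
  also have "\<dots> = (pi / 2) * LL3 I a z"
    unfolding LL3_def
  proof (rule suminf_mult)
    have "Re z > - 1" using z by simp
    then show "summable (\<lambda>n. if n \<in> I then 2 / (z + a n) ^ 3 else 0)"
      using LL2_deriv(1)[OF fam_cnj(1)[OF fd] zero_le_one fd(2)] by blast
  qed
  finally show "(LINT s|lborel. f s * of_real (Re (LL1 I (cnj_fam a) (axis s)))) = pi * LL3 I a z / 2"
    unfolding eq by simp
qed

section \<open>Discretizing the density\<close>

text \<open>Between S k and S (k + 1) the density N' has mass 1, so f (S k) minus the integral over
  this interval is a weighted mean of f (S k) - f and is bounded by the increment of V. The
  increments telescope.\<close>

lemma discrete_integral_estimate:
  fixes f :: "real \<Rightarrow> complex" and N N' V :: "real \<Rightarrow> real" and S :: "int \<Rightarrow> real"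
  assumes contf: "continuous_on UNIV f" and contN: "continuous_on UNIV N'"
    and N: "\<And>s. (N has_real_derivative N' s) (at s)" "\<And>s. N' s \<ge> 0"
    and V: "\<And>s t. s \<le> t \<Longrightarrow> norm (f s - f t) \<le> V t - V s"
    and S: "\<And>k. S k < S (k + 1)" "\<And>k. N (S (k + 1)) - N (S k) = 1"
  shows "norm ((\<Sum>k\<in>{m..<m + int n}. f (S k)) - integral {S m..S (m + int n)} (\<lambda>s. f s * of_real (N' s)))
      \<le> V (S (m + int n)) - V (S m)"
proof -
  let ?F = "\<lambda>s. f s * of_real (N' s)"
  have cF: "continuous_on A ?F" for A
    using contf contN by (intro continuous_intros continuous_on_of_real) (auto intro: continuous_on_subset)
  have iF: "?F integrable_on {p..q}" for p q by (rule integrable_continuous_interval[OF cF])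
  have step: "norm (f p - integral {p..q} ?F) \<le> V q - V p" if pq: "p < q" and N1: "N q - N p = 1" for p q
  proof -
    \<comment> \<open>Its derivative is (f p - f t) N' t, which the mean value inequality compares
      with (V q - V p) N' t.\<close>
    define H where "H t = f p * of_real (N t - N p) - integral {p..t} ?F" for t
    have Hd: "(H has_vector_derivative (f p - f t) * of_real (N' t)) (at t)" if t: "p < t" "t < q" for t
    proof -
      have "((\<lambda>t. integral {p..t} ?F) has_vector_derivative ?F t) (at t within {p..q})"
        by (rule integral_has_vector_derivative[OF cF]) (use t in auto)
      then have 1: "((\<lambda>t. integral {p..t} ?F) has_vector_derivative ?F t) (at t)"
        using at_within_Icc_at[OF t] by simp
      have "((\<lambda>t. N t - N p) has_real_derivative N' t) (at t)"
        using DERIV_diff[OF N(1)[of t] DERIV_const[of "N p"]] unfolding diff_zero .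
      then have "((\<lambda>t. f p * of_real (N t - N p)) has_vector_derivative f p * of_real (N' t)) (at t)"
        by (intro has_vector_derivative_mult_right has_vector_derivative_of_real)
      from has_vector_derivative_diff[OF this 1] show ?thesis unfolding H_def[abs_def] left_diff_distrib .
    qed
    have contH: "continuous_on {p..q} H"
    proof -
      have "continuous_on UNIV N" using N(1) by (intro continuous_at_imp_continuous_on ballI DERIV_isCont)
      then have "continuous_on {p..q} N" by (rule continuous_on_subset) simp
      then show ?thesis unfolding H_def[abs_def] by (intro continuous_intros indefinite_integral_continuous_1 iF)
    qed
    have contG: "continuous_on {p..q} (\<lambda>t. (V q - V p) * N t)"
    proof -
      have "continuous_on UNIV N" using N(1) by (intro continuous_at_imp_continuous_on ballI DERIV_isCont)
      then have "continuous_on {p..q} N" by (rule continuous_on_subset) simp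
      then show ?thesis by (intro continuous_intros)
    qed
    have "norm (H q - H p) \<le> (V q - V p) * N q - (V q - V p) * N p"
    proof (rule differentiable_bound_general[OF pq contH contG Hd])
      fix t assume t: "p < t" "t < q"
      have "(N has_vector_derivative N' t) (at t)" using N(1) by (simp add: has_real_derivative_iff_has_vector_derivative)
      then show "((\<lambda>t. (V q - V p) * N t) has_vector_derivative (V q - V p) * N' t) (at t)"
        by (rule has_vector_derivative_mult_right)
      have "0 \<le> norm (f t - f q)" by simp
      then have "V q - V t \<ge> 0" using V[of t q] t by linarith
      then have "norm (f p - f t) \<le> V q - V p" using V[of p t] t by linarith
      then show "norm ((f p - f t) * of_real (N' t)) \<le> (V q - V p) * N' t"
        using N(2)[of t] by (simp add: norm_mult mult_right_mono)
    qed
    also have "(V q - V p) * N q - (V q - V p) * N p = (V q - V p) * (N q - N p)" by (simp add: algebra_simps)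
    finally have "norm (H q - H p) \<le> V q - V p" using N1 by simp
    moreover have "H q - H p = f p - integral {p..q} ?F" using N1 by (simp add: H_def)
    ultimately show ?thesis by simp
  qed
  show ?thesis
  proof (induction n)
    case 0
    show ?case by simp
  next
    case (Suc n)
    have mono: "S m \<le> S (m + int n)" for n
    proof (induction n)
      case (Suc n)
      then show ?case using S(1)[of "m + int n"] by (simp add: add_ac)
    qed simp
    have e: "m + int (Suc n) = m + int n + 1" by simp
    have "{m..<m + int (Suc n)} = insert (m + int n) {m..<m + int n}" by auto
    then have s: "(\<Sum>k\<in>{m..<m + int (Suc n)}. f (S k)) = f (S (m + int n)) + (\<Sum>k\<in>{m..<m + int n}. f (S k))" by simp
    have i: "integral {S m..S (m + int (Suc n))} ?F = integral {S m..S (m + int n)} ?F + integral {S (m + int n)..S (m + int (Suc n))} ?F"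
      using Henstock_Kurzweil_Integration.integral_combine[OF mono[of n] _ iF, of "S (m + int (Suc n))"]
        S(1)[of "m + int n"] unfolding e by simp
    have "norm (f (S (m + int n)) - integral {S (m + int n)..S (m + int (Suc n))} ?F) \<le> V (S (m + int (Suc n))) - V (S (m + int n))"
      unfolding e by (rule step) (use S in auto)
    then show ?case using Suc.IH unfolding s i
      using norm_triangle_ineq[of "(\<Sum>k\<in>{m..<m + int n}. f (S k)) - integral {S m..S (m + int n)} ?F"
        "f (S (m + int n)) - integral {S (m + int n)..S (m + int (Suc n))} ?F"]
      by (simp add: algebra_simps)
  qed
qed

text \<open>|f' s| = 3 / |z + i s|^4 is at most 3 / ((Re z)^2 |z + i s|^2), since Re z <= |z + i s|.
  V is the antiderivative of this majorant, an arctangent, whose range has length pi.\<close>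

lemma cube_variation:
  fixes z :: complex
  assumes x: "Re z > 0"
  defines "f \<equiv> \<lambda>s::real. 1 / (z + axis s) ^ 3"
    and "V \<equiv> \<lambda>s. 3 / (Re z) ^ 3 * arctan ((s + Im z) / Re z)"
  shows "continuous_on UNIV f" "s \<le> t \<Longrightarrow> norm (f s - f t) \<le> V t - V s" "V t - V s \<le> 3 * pi / (Re z) ^ 3"
proof -
  have nz: "z + axis s \<noteq> 0" for s using x by (auto simp: complex_eq_iff)
  show cf: "continuous_on UNIV f" unfolding f_def by (intro continuous_intros) (simp add: nz)
  show "V t - V s \<le> 3 * pi / (Re z) ^ 3"
  proof -
    have "arctan ((t + Im z) / Re z) - arctan ((s + Im z) / Re z) \<le> pi"
      using arctan_bounded[of "(t + Im z) / Re z"] arctan_bounded[of "(s + Im z) / Re z"] by linarith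
    then have "3 / (Re z) ^ 3 * (arctan ((t + Im z) / Re z) - arctan ((s + Im z) / Re z)) \<le> 3 / (Re z) ^ 3 * pi"
      using x by (intro mult_left_mono) auto
    then show ?thesis by (simp add: V_def right_diff_distrib)
  qed
  have fd: "(f has_vector_derivative (- 3 * \<i> / (z + axis s) ^ 4)) (at s)" for s
  proof -
    have "((\<lambda>w. 1 / (z + w) ^ 3) has_field_derivative (- 3 / (z + axis s) ^ 4)) (at (axis s))"
    proof -
      have e: "- (3 * y\<^sup>2) / (y ^ 3 * y ^ 3) = - 3 / y ^ 4" if "y \<noteq> 0" for y :: complex
        using that by (simp add: power2_eq_square power3_eq_cube eval_nat_numeral)
      have "((\<lambda>w. 1 / (z + w) ^ 3) has_field_derivative (- (3 * (z + axis s)\<^sup>2) / ((z + axis s) ^ 3 * (z + axis s) ^ 3))) (at (axis s))"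
        using nz[of s] by (auto intro!: derivative_eq_intros)
      then show ?thesis unfolding e[OF nz] .
    qed
    moreover have "((\<lambda>s. axis s) has_vector_derivative \<i>) (at s)"
      by (auto intro!: derivative_eq_intros simp: has_vector_derivative_def scaleR_conv_of_real)
    ultimately have "((\<lambda>w. 1 / (z + w) ^ 3) \<circ> (\<lambda>s. axis s) has_vector_derivative \<i> * (- 3 / (z + axis s) ^ 4)) (at s)"
      by (rule field_vector_diff_chain_at[rotated])
    then show ?thesis by (simp add: f_def o_def mult.commute)
  qed
  have pos: "(Re z)\<^sup>2 + (s + Im z)\<^sup>2 > 0" for s using x by (intro add_pos_nonneg) auto
  have Vd: "(V has_real_derivative 3 / ((Re z)\<^sup>2 * ((Re z)\<^sup>2 + (s + Im z)\<^sup>2))) (at s)" for s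
  proof -
    have "1 + ((s + Im z) / Re z)\<^sup>2 = ((Re z)\<^sup>2 + (s + Im z)\<^sup>2) / (Re z)\<^sup>2" using x by (simp add: field_simps)
    then have e: "3 / (Re z) ^ 3 * (inverse (1 + ((s + Im z) / Re z)\<^sup>2) * (1 / Re z)) = 3 / ((Re z)\<^sup>2 * ((Re z)\<^sup>2 + (s + Im z)\<^sup>2))"
      using x by (simp add: power2_eq_square power3_eq_cube)
    have "((\<lambda>s. (s + Im z) / Re z) has_real_derivative 1 / Re z) (at s)"
      using x by (auto intro!: derivative_eq_intros)
    then have "((\<lambda>s. arctan ((s + Im z) / Re z)) has_real_derivative (inverse (1 + ((s + Im z) / Re z)\<^sup>2) * (1 / Re z))) (at s)"
      by (rule DERIV_chain2[OF DERIV_arctan])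
    then show ?thesis unfolding V_def e[symmetric] by (rule DERIV_cmult)
  qed
  assume "s \<le> t"
  then consider "s = t" | "s < t" by linarith
  then show "norm (f s - f t) \<le> V t - V s"
  proof cases
    case 2
    have "norm (f t - f s) \<le> V t - V s"
    proof (rule differentiable_bound_general[OF 2 _ _ fd])
      show "continuous_on {s..t} f" using cf by (rule continuous_on_subset) simp
      show "continuous_on {s..t} V" using Vd by (intro continuous_at_imp_continuous_on ballI DERIV_isCont)
      fix u
      show "(V has_vector_derivative 3 / ((Re z)\<^sup>2 * ((Re z)\<^sup>2 + (u + Im z)\<^sup>2))) (at u)"
        using Vd by (simp add: has_real_derivative_iff_has_vector_derivative)
      have n: "(norm (z + axis u))\<^sup>2 = (Re z)\<^sup>2 + (u + Im z)\<^sup>2" by (simp add: cmod_power2 add.commute)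
      have "norm (- 3 * \<i> / (z + axis u) ^ 4) = 3 / (norm (z + axis u)) ^ 4"
        by (simp add: norm_divide norm_mult norm_power)
      also have "(norm (z + axis u)) ^ 4 = ((norm (z + axis u))\<^sup>2)\<^sup>2" by simp
      also have "\<dots> = ((Re z)\<^sup>2 + (u + Im z)\<^sup>2) * ((Re z)\<^sup>2 + (u + Im z)\<^sup>2)" unfolding n by (simp add: power2_eq_square)
      also have "3 / \<dots> \<le> 3 / ((Re z)\<^sup>2 * ((Re z)\<^sup>2 + (u + Im z)\<^sup>2))"
        using x pos[of u] by (intro divide_left_mono mult_right_mono mult_pos_pos) auto
      finally show "norm (- 3 * \<i> / (z + axis u) ^ 4) \<le> 3 / ((Re z)\<^sup>2 * ((Re z)\<^sup>2 + (u + Im z)\<^sup>2))" .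
    qed
    then show ?thesis by (simp add: norm_minus_commute)
  qed simp
qed

lemma int_decode_double: "int_decode (2 * k) = int k" "int_decode (Suc (2 * k)) = - int k - 1"
  by (simp_all add: int_decode_def sum_decode_def)

text \<open>The enumeration 0, -1, 1, -2, 2, ... has filled the block from - K to K - 1 after 2 K
  steps.\<close>

lemma sum_int_decode: "(\<Sum>n<2 * K. g (int_decode n)) = (\<Sum>k\<in>{- int K..<- int K + int (2 * K)}. g k)"
  for g :: "int \<Rightarrow> 'a::comm_monoid_add"
proof (induction K)
  case (Suc K)
  have "{- int (Suc K)..<- int (Suc K) + int (2 * Suc K)} = insert (int K) (insert (- int K - 1) {- int K..<- int K + int (2 * K)})"
    by auto
  then have "(\<Sum>k\<in>{- int (Suc K)..<- int (Suc K) + int (2 * Suc K)}. g k) = g (int K) + (g (- int K - 1) + (\<Sum>k\<in>{- int K..<- int K + int (2 * K)}. g k))"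
    by simp
  also have "\<dots> = (\<Sum>n<2 * Suc K. g (int_decode n))"
    using Suc.IH by (simp add: int_decode_double add_ac)
  finally show ?case by simp
qed simp

lemma int_decode_lower: "\<bar>real_of_int (int_decode n) + 1 / 2\<bar> \<ge> (real n + 1) / 4"
proof (cases "even n")
  case True
  then obtain k where "n = 2 * k" by blast
  then show ?thesis by (simp add: int_decode_double)
next
  case False
  then obtain k where "n = Suc (2 * k)" using oddE by (metis Suc_eq_plus1)
  then show ?thesis by (simp add: int_decode_double)
qed

text \<open>The zeros on the imaginary axis discretize the density: each of them carries one unit of the
  phase \<open>N\<close>, so that their cubic sums differ from the Poisson integral of the density by at most the
  total variation of the kernel.\<close>

lemma axis_zeros_exist:
  assumes fdI: "fin_dens I a" "\<And>n. n \<in> I \<Longrightarrow> Re (a n) \<ge> 1"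
    and fdJ: "fin_dens J b" "\<And>n. n \<in> J \<Longrightarrow> Re (b n) \<ge> 1"
    and \<eta>: "0 < \<eta>" "\<eta> \<le> 1" "\<And>n. n \<in> J \<Longrightarrow> Re (b n) \<ge> \<eta> * norm (b n)"
    and bal: "\<And>t. lsum J b t - lsum I a t \<ge> - C0" and C0: "C0 \<ge> 0"
  obtains S :: "nat \<Rightarrow> real" where "\<And>n. S n \<noteq> 0" "fam UNIV (\<lambda>n. axis (S n))"
    "summable (\<lambda>n. \<bar>S n\<bar> powr (-3/2))"
    "\<And>z. Re z > 0 \<Longrightarrow> norm (LL3 UNIV (\<lambda>n. axis (S n)) z + LL3 J b z - LL3 I a z) \<le> 6 * pi / (Re z) ^ 3"
proof -
  obtain C1 where C1: "\<And>s. Re (LL1 I (cnj_fam a) (axis s) - LL1 J (cnj_fam b) (axis s)) \<ge> - C1"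
    by (rule axis_density_lower_bound[OF fdI fdJ \<eta> bal C0]) auto
  obtain KI where KI: "KI \<ge> 0" "\<And>s. \<bar>Im (LL I (cnj_fam a) (axis s))\<bar> \<le> KI * \<bar>s\<bar> powr (5/4)"
    using Im_LL_axis_bound[OF fdI] by blast
  obtain KJ where KJ: "KJ \<ge> 0" "\<And>s. \<bar>Im (LL J (cnj_fam b) (axis s))\<bar> \<le> KJ * \<bar>s\<bar> powr (5/4)"
    using Im_LL_axis_bound[OF fdJ] by blast
  \<comment> \<open>The multiple of Lebesgue measure that is added; it makes the density N' at least
    1.\<close>
  define c where "c = 1 + \<bar>C1\<bar> / pi"
  have c1: "c \<ge> 1" by (simp add: c_def)
  define rI where "rI s = Re (LL1 I (cnj_fam a) (axis s))" for s
  define rJ where "rJ s = Re (LL1 J (cnj_fam b) (axis s))" for s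
  define N where "N s = c * s + (Im (LL I (cnj_fam a) (axis s)) - Im (LL J (cnj_fam b) (axis s))) / pi" for s
  define N' where "N' s = c + (rI s - rJ s) / pi" for s
  have contI: "continuous_on UNIV rI" unfolding rI_def[abs_def] by (rule LL1_axis(1)[OF fdI])
  have contJ: "continuous_on UNIV rJ" unfolding rJ_def[abs_def] by (rule LL1_axis(1)[OF fdJ])
  have cN': "continuous_on UNIV N'" unfolding N'_def[abs_def] by (intro continuous_intros contI contJ) simp
  have dN: "(N has_real_derivative N' s) (at s)" for s
  proof -
    have "((\<lambda>s. (Im (LL I (cnj_fam a) (axis s)) - Im (LL J (cnj_fam b) (axis s))) / pi) has_real_derivative (rI s - rJ s) / pi) (at s)"
      unfolding rI_def rJ_def by (intro DERIV_cdivide DERIV_diff LL1_axis(2) fdI fdJ)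
    moreover have "((\<lambda>s. c * s) has_real_derivative c) (at s)" by (auto intro!: derivative_eq_intros)
    ultimately show ?thesis unfolding N_def[abs_def] N'_def by (rule DERIV_add[rotated])
  qed
  have N'1: "N' s \<ge> 1" for s
  proof -
    have "rI s - rJ s \<ge> - \<bar>C1\<bar>" using C1[of s] by (simp add: rI_def rJ_def)
    then have "(rI s - rJ s) / pi \<ge> - \<bar>C1\<bar> / pi" by (intro divide_right_mono) auto
    then show ?thesis by (simp add: N'_def c_def)
  qed
  have Nmono: "N t - N s \<ge> t - s" if "s \<le> t" for s t
  proof -
    have "(\<lambda>s. N s - s) s \<le> (\<lambda>s. N s - s) t"
    proof (rule DERIV_nonneg_imp_nondecreasing[OF that])
      fix x
      have "((\<lambda>s. N s - s) has_real_derivative N' x - 1) (at x)" by (intro DERIV_diff dN DERIV_ident)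
      then show "\<exists>y. ((\<lambda>s. N s - s) has_real_derivative y) (at x) \<and> 0 \<le> y" using N'1[of x] by auto
    qed
    then show ?thesis by simp
  qed
  define K where "K = c + KI + KJ"
  have K1: "K \<ge> 1" using c1 KI KJ by (simp add: K_def)
  have Nbd: "\<bar>N s\<bar> \<le> K * (\<bar>s\<bar> + \<bar>s\<bar> powr (5/4))" for s
  proof -
    let ?d = "Im (LL I (cnj_fam a) (axis s)) - Im (LL J (cnj_fam b) (axis s))"
    have "\<bar>?d / pi\<bar> \<le> \<bar>?d\<bar> / 1" unfolding abs_divide using pi_gt3 by (intro frac_le) auto
    also have "\<dots> \<le> (KI + KJ) * \<bar>s\<bar> powr (5/4)"
      using KI(2)[of s] KJ(2)[of s] by (simp add: distrib_right)
    also have "\<dots> \<le> K * \<bar>s\<bar> powr (5/4)" using c1 by (intro mult_right_mono) (auto simp: K_def)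
    finally have 1: "\<bar>?d / pi\<bar> \<le> K * \<bar>s\<bar> powr (5/4)" .
    have "\<bar>c * s\<bar> = c * \<bar>s\<bar>" using c1 by (simp add: abs_mult)
    also have "\<dots> \<le> K * \<bar>s\<bar>" using KI KJ by (intro mult_right_mono) (auto simp: K_def)
    finally have "\<bar>c * s\<bar> \<le> K * \<bar>s\<bar>" .
    then show ?thesis using 1 unfolding N_def distrib_left by linarith
  qed
  have N0: "N 0 = 0" using Nbd[of 0] by simp
  have contN: "isCont N s" for s by (rule DERIV_isCont[OF dN])
  have surj: "\<exists>s. N s = v" for v
  proof -
    have 1: "N \<bar>v\<bar> \<ge> v" "N (- \<bar>v\<bar>) \<le> v" using Nmono[of 0 "\<bar>v\<bar>"] Nmono[of "- \<bar>v\<bar>" 0] N0 by auto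
    have "\<exists>s\<ge>- \<bar>v\<bar>. s \<le> \<bar>v\<bar> \<and> N s = v" by (rule IVT) (use 1 contN in auto)
    then show ?thesis by blast
  qed
  \<comment> \<open>The points where N takes half-integer values: consecutive ones enclose mass 1,
    and since N 0 = 0 none of them is 0.\<close>
  define S where "S k = (SOME s. N s = of_int k + 1 / 2)" for k :: int
  have NS: "N (S k) = of_int k + 1 / 2" for k unfolding S_def by (rule someI_ex) (rule surj)
  have Sge: "S k \<ge> t" if "of_int k + 1 / 2 \<ge> N t" for k t
  proof (rule ccontr)
    assume "\<not> ?thesis"
    then show False using Nmono[of "S k" t] that NS[of k] by linarith
  qed
  have Sle: "S k \<le> t" if "of_int k + 1 / 2 \<le> N t" for k t
  proof (rule ccontr)
    assume "\<not> ?thesis"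
    then show False using Nmono[of t "S k"] that NS[of k] by linarith
  qed
  have Smono: "S k < S (k + 1)" for k
  proof (rule ccontr)
    assume "\<not> ?thesis"
    then show False using Nmono[of "S (k + 1)" "S k"] NS[of k] NS[of "k + 1"] by simp
  qed
  \<comment> \<open>For |s| <= 1 one has |N s| <= 2 K |s|, while |N| >= 1/2 at every S k; this keeps
    the points at distance at least 1 / (4 K) from 0.\<close>
  define e where "e = 1 / (4 * K)"
  have e: "0 < e" "e \<le> 1 / 4" using K1 by (auto simp: e_def field_simps)
  have Se: "\<bar>S k\<bar> \<ge> e" for k
  proof (rule ccontr)
    assume as: "\<not> ?thesis"
    then have l1: "\<bar>S k\<bar> \<le> 1" using e by linarith
    have "\<bar>real_of_int k + 1 / 2\<bar> \<ge> 1 / 2" by (cases "k \<ge> 0") auto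
    then have "1 / 2 \<le> K * (\<bar>S k\<bar> + \<bar>S k\<bar> powr (5/4))" using Nbd[of "S k"] NS[of k] by simp
    also have "\<bar>S k\<bar> powr (5/4) \<le> \<bar>S k\<bar> powr 1" using l1 by (intro powr_mono') auto
    then have "K * (\<bar>S k\<bar> + \<bar>S k\<bar> powr (5/4)) \<le> K * (2 * \<bar>S k\<bar>)" using K1 by (intro mult_left_mono) auto
    also have "\<dots> < K * (2 * e)" using as K1 by (intro mult_strict_left_mono) auto
    also have "\<dots> = 1 / 2" using K1 by (simp add: e_def)
    finally show False by simp
  qed
  define K2 where "K2 = 4 * K * (e powr (-1/4) + 1)"
  have K2: "K2 > 0" using K1 by (auto simp: K2_def intro!: mult_pos_pos add_nonneg_pos)
  have Slow: "\<bar>S (int_decode n)\<bar> powr (5/4) \<ge> (real n + 1) / K2" for n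
  proof -
    let ?s = "\<bar>S (int_decode n)\<bar>"
    have s0: "?s > 0" using Se[of "int_decode n"] e by linarith
    have "?s = ?s powr (-1/4) * ?s powr (5/4)" using s0 by (simp add: powr_add[symmetric])
    also have "\<dots> \<le> e powr (-1/4) * ?s powr (5/4)" using Se[of "int_decode n"] e by (intro mult_right_mono powr_mono2') auto
    finally have "?s + ?s powr (5/4) \<le> (e powr (-1/4) + 1) * ?s powr (5/4)" by (simp add: distrib_right)
    then have "K * (?s + ?s powr (5/4)) \<le> K * ((e powr (-1/4) + 1) * ?s powr (5/4))" using K1 by (intro mult_left_mono) auto
    moreover have "(real n + 1) / 4 \<le> K * (?s + ?s powr (5/4))"
      using int_decode_lower[of n] Nbd[of "S (int_decode n)"] NS[of "int_decode n"] by simp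
    ultimately have "real n + 1 \<le> K2 * ?s powr (5/4)" by (simp add: K2_def)
    then show ?thesis using K2 by (simp add: pos_divide_le_eq mult.commute)
  qed
  define T where "T n = S (int_decode n)" for n
  let ?Sf = "\<lambda>n. axis (T n)"
  have Te: "\<bar>T n\<bar> \<ge> e" for n by (simp add: T_def Se)
  \<comment> \<open>Since N grows at most with order 5/4, |T n| is at least of order n^(4/5), and
    the exponent (4/5) (3/2) = 6/5 exceeds 1.\<close>
  have Tsum: "summable (\<lambda>n. \<bar>T n\<bar> powr (-3/2))"
  proof (rule summable_comparison_test'[where N = 0])
    have "summable (\<lambda>n. of_nat (Suc n) powr (-6/5) :: real)" by (subst summable_Suc_iff) (simp add: summable_real_powr_iff)
    then show "summable (\<lambda>n. K2 powr (6/5) * (of_nat (Suc n) powr (-6/5) :: real))" by (rule summable_mult)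
    fix n
    have "\<bar>T n\<bar> powr (-3/2) = (\<bar>T n\<bar> powr (5/4)) powr (-6/5)" by (simp add: powr_powr)
    also have "\<dots> \<le> ((real n + 1) / K2) powr (-6/5)"
      using Slow[of n] K2 by (intro powr_mono2') (auto simp: T_def)
    also have "\<dots> = K2 powr (6/5) * (of_nat (Suc n) powr (-6/5))"
      using K2 by (simp add: powr_divide powr_minus_divide add.commute)
    finally show "norm (\<bar>T n\<bar> powr (-3/2)) \<le> K2 powr (6/5) * (of_nat (Suc n) powr (-6/5))" by simp
  qed
  have fam: "fam UNIV ?Sf"
    by (rule fam_of_powr[where c = e and p = "3/2"]) (use e Te Tsum in \<open>auto simp: norm_mult\<close>)
  show thesis
  proof (rule that[OF _ fam Tsum])
    show "T n \<noteq> 0" for n using Te[of n] e by auto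
    fix z :: complex assume z: "Re z > 0"
    define f where "f s = 1 / (z + axis s) ^ 3" for s :: real
    define V where "V s = 3 / (Re z) ^ 3 * arctan ((s + Im z) / Re z)" for s
    note cv = cube_variation[OF z, folded f_def V_def]
    let ?F = "\<lambda>s. f s * of_real (N' s)"
    have iI: "integrable lborel (\<lambda>s. f s * of_real (rI s))" "(LINT s|lborel. f s * of_real (rI s)) = pi * LL3 I a z / 2"
      using LL1_axis_integral[OF fdI z] by (simp_all add: f_def rI_def)
    have iJ: "integrable lborel (\<lambda>s. f s * of_real (rJ s))" "(LINT s|lborel. f s * of_real (rJ s)) = pi * LL3 J b z / 2"
      using LL1_axis_integral[OF fdJ z] by (simp_all add: f_def rJ_def)
    \<comment> \<open>The kernel has integral 0, so the uniform density c leaves no trace in the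
      integral of \<open>?F\<close>.\<close>
    have i0: "integrable lborel f" "(LINT s|lborel. f s) = 0"
      using poisson_formula_cube(1,2)[of 1 z] z by (simp_all add: f_def[abs_def])
    have eqF: "?F = (\<lambda>s. f s * of_real c + (f s * of_real (rI s) - f s * of_real (rJ s)) / of_real pi)"
      by (simp add: N'_def[abs_def] algebra_simps add_divide_distrib diff_divide_distrib)
    have k1: "integrable lborel (\<lambda>s. f s * of_real c)" by (rule integrable_mult_left[OF i0(1)])
    have k2: "integrable lborel (\<lambda>s. f s * of_real (rI s) - f s * of_real (rJ s))"
      by (rule Bochner_Integration.integrable_diff[OF iI(1) iJ(1)])
    have k3: "integrable lborel (\<lambda>s. (f s * of_real (rI s) - f s * of_real (rJ s)) / of_real pi)"
      by (rule integrable_divide[OF k2])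
    have iF: "integrable lborel ?F" unfolding eqF by (rule Bochner_Integration.integrable_add[OF k1 k3])
    have "(LINT s|lborel. ?F s) = (LINT s|lborel. f s * of_real c) + (LINT s|lborel. (f s * of_real (rI s) - f s * of_real (rJ s)) / of_real pi)"
      unfolding eqF by (rule Bochner_Integration.integral_add[OF k1 k3])
    also have "(LINT s|lborel. f s * of_real c) = 0" using i0(2) by simp
    also have "(LINT s|lborel. (f s * of_real (rI s) - f s * of_real (rJ s)) / of_real pi) = (LINT s|lborel. f s * of_real (rI s) - f s * of_real (rJ s)) / of_real pi"
      by (rule integral_divide_zero)
    also have "(LINT s|lborel. f s * of_real (rI s) - f s * of_real (rJ s)) = pi * LL3 I a z / 2 - pi * LL3 J b z / 2"
      using Bochner_Integration.integral_diff[OF iI(1) iJ(1)] iI(2) iJ(2) by simp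
    finally have LF: "(LINT s|lborel. ?F s) = (LL3 I a z - LL3 J b z) / 2"
      by (simp add: diff_divide_distrib)
    have contF: "continuous_on A ?F" for A
      using cv(1) cN' by (intro continuous_intros continuous_on_of_real) (auto intro: continuous_on_subset)
    have top: "filterlim (\<lambda>n. S (int n)) at_top sequentially"
      unfolding filterlim_at_top
    proof
      fix t
      obtain n0 where "real n0 \<ge> N t" using real_arch_simple by blast
      then show "\<forall>\<^sub>F n in sequentially. t \<le> S (int n)"
        unfolding eventually_sequentially by (intro exI[of _ n0] allI impI Sge) simp
    qed
    have bot: "filterlim (\<lambda>n. S (- int n)) at_bot sequentially"
      unfolding filterlim_at_bot
    proof
      fix t
      obtain n0 where "real n0 \<ge> 1 - N t" using real_arch_simple by blast
      then show "\<forall>\<^sub>F n in sequentially. S (- int n) \<le> t"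
        unfolding eventually_sequentially by (intro exI[of _ n0] allI impI Sle) simp
    qed
    have lim1: "(\<lambda>n. LINT s:{S (- int n)..S (int n)}|lborel. ?F s) \<longlonglongrightarrow> (LL3 I a z - LL3 J b z) / 2"
      using lborel_integral_limit[OF iF bot top] unfolding LF .
    have sm: "(\<lambda>n. 2 * f (T n)) sums LL3 UNIV ?Sf z"
    proof -
      have "summable (\<lambda>n. if n \<in> UNIV then 2 / (z + ?Sf n) ^ 3 else 0)"
        by (rule LL2_deriv(1)[OF fam order_refl]) (use z in auto)
      then have "(\<lambda>n. if n \<in> UNIV then 2 / (z + ?Sf n) ^ 3 else 0) sums LL3 UNIV ?Sf z"
        unfolding LL3_def by (rule summable_sums)
      then show ?thesis by (simp add: f_def)
    qed
    \<comment> \<open>The even partial sums are those that correspond to blocks of consecutive k.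
      Convergence of the whole series is known, so passing to this subsequence is enough.\<close>
    have "(\<lambda>K. \<Sum>n<2 * K. 2 * f (T n)) \<longlonglongrightarrow> LL3 UNIV ?Sf z"
    proof -
      have "strict_mono (\<lambda>K::nat. 2 * K)" by (rule strict_monoI) simp
      then show ?thesis using LIMSEQ_subseq_LIMSEQ[OF sm[unfolded sums_def]] by (auto simp: o_def)
    qed
    then have lim2: "(\<lambda>K. 2 * (\<Sum>n<2 * K. f (T n))) \<longlonglongrightarrow> LL3 UNIV ?Sf z" by (simp add: sum_distrib_left)
    have lim: "(\<lambda>K. 2 * (\<Sum>n<2 * K. f (T n)) - 2 * (LINT s:{S (- int K)..S (int K)}|lborel. ?F s))
        \<longlonglongrightarrow> LL3 UNIV ?Sf z - 2 * ((LL3 I a z - LL3 J b z) / 2)"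
      by (intro tendsto_diff lim2 tendsto_mult_left lim1)
    have bound: "norm (2 * (\<Sum>n<2 * K. f (T n)) - 2 * (LINT s:{S (- int K)..S (int K)}|lborel. ?F s)) \<le> 6 * pi / (Re z) ^ 3" for K
    proof -
      have st: "(\<Sum>n<2 * K. f (T n)) = (\<Sum>k\<in>{- int K..<- int K + int (2 * K)}. f (S k))"
        unfolding T_def by (rule sum_int_decode)
      have ek: "- int K + int (2 * K) = int K" by simp
      have si: "set_integrable lborel {S (- int K)..S (int K)} ?F"
        by (rule borel_integrable_atLeastAtMost') (rule contF)
      have "norm ((\<Sum>k\<in>{- int K..<- int K + int (2 * K)}. f (S k)) - integral {S (- int K)..S (- int K + int (2 * K))} ?F)
          \<le> V (S (- int K + int (2 * K))) - V (S (- int K))"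
      proof (rule discrete_integral_estimate[OF cv(1) cN' dN])
        show "N' s \<ge> 0" for s using N'1[of s] by linarith
        show "norm (f s - f t) \<le> V t - V s" if "s \<le> t" for s t by (rule cv(2)[OF that])
        show "N (S (k + 1)) - N (S k) = 1" for k using NS[of k] NS[of "k + 1"] by simp
      qed (rule Smono)
      also have "\<dots> \<le> 3 * pi / (Re z) ^ 3" by (rule cv(3))
      finally have "norm ((\<Sum>n<2 * K. f (T n)) - (LINT s:{S (- int K)..S (int K)}|lborel. ?F s)) \<le> 3 * pi / (Re z) ^ 3"
        unfolding st ek set_borel_integral_eq_integral(2)[OF si] .
      then have "2 * norm ((\<Sum>n<2 * K. f (T n)) - (LINT s:{S (- int K)..S (int K)}|lborel. ?F s)) \<le> 6 * pi / (Re z) ^ 3" by simp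
      moreover have "norm (2 * (\<Sum>n<2 * K. f (T n)) - 2 * (LINT s:{S (- int K)..S (int K)}|lborel. ?F s))
        = 2 * norm ((\<Sum>n<2 * K. f (T n)) - (LINT s:{S (- int K)..S (int K)}|lborel. ?F s))"
        unfolding right_diff_distrib[symmetric] norm_mult by simp
      ultimately show ?thesis by simp
    qed
    have "norm (LL3 UNIV ?Sf z - 2 * ((LL3 I a z - LL3 J b z) / 2)) \<le> 6 * pi / (Re z) ^ 3"
      by (rule Lim_norm_ubound[OF _ lim]) (use bound in auto)
    moreover have "LL3 UNIV ?Sf z - 2 * ((LL3 I a z - LL3 J b z) / 2) = LL3 UNIV ?Sf z + LL3 J b z - LL3 I a z" by (simp add: field_simps)
    ultimately show "norm (LL3 UNIV ?Sf z + LL3 J b z - LL3 I a z) \<le> 6 * pi / (Re z) ^ 3" by (simp only:)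
  qed
qed

section \<open>Integration of the logarithm\<close>

lemma ray_increment_bound:
  fixes F F' :: "complex \<Rightarrow> complex"
  assumes F: "\<And>z. Re z > 0 \<Longrightarrow> (F has_field_derivative F' z) (at z)"
    and G: "\<And>t. t > 0 \<Longrightarrow> (G has_real_derivative g t) (at t)"
    and bd: "\<And>z. Re z > 0 \<Longrightarrow> norm (F' z) \<le> g (Re z)"
    and x: "0 < x" "x \<le> X"
  shows "norm (F (Complex X y) - F (Complex x y)) \<le> G X - G x"
proof (cases "x = X")
  case False
  then have lt: "x < X" using x by simp
  have d: "((\<lambda>t. F (Complex t y)) has_vector_derivative F' (Complex t y)) (at t)" if "t > 0" for t
  proof -
    have e: "(\<lambda>t. Complex t y) = (\<lambda>t. of_real t + Complex 0 y)" by (auto simp: complex_eq_iff)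
    have "((\<lambda>t. Complex t y) has_vector_derivative 1) (at t)"
      unfolding e by (auto intro!: derivative_eq_intros simp: has_vector_derivative_def scaleR_conv_of_real)
    then have "(F \<circ> (\<lambda>t. Complex t y) has_vector_derivative 1 * F' (Complex t y)) (at t)"
      by (rule field_vector_diff_chain_at) (use F that in auto)
    then show ?thesis by (simp add: o_def)
  qed
  show ?thesis
  proof (rule differentiable_bound_general[OF lt])
    show "continuous_on {x..X} (\<lambda>t. F (Complex t y))"
    proof (intro continuous_at_imp_continuous_on ballI)
      fix t assume "t \<in> {x..X}"
      then show "isCont (\<lambda>t. F (Complex t y)) t" using x by (intro has_vector_derivative_continuous[OF d]) auto
    qed
    show "continuous_on {x..X} G"
    proof (intro continuous_at_imp_continuous_on ballI)
      fix t assume "t \<in> {x..X}"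
      then show "isCont G t" using x by (intro DERIV_isCont[OF G]) auto
    qed
    fix t assume t: "x < t" "t < X"
    then have t0: "t > 0" using x by linarith
    show "((\<lambda>t. F (Complex t y)) has_vector_derivative F' (Complex t y)) (at t)" by (rule d[OF t0])
    show "(G has_vector_derivative g t) (at t)" using G[OF t0] by (simp add: has_real_derivative_iff_has_vector_derivative)
    show "norm (F' (Complex t y)) \<le> g t" using bd[of "Complex t y"] t0 by simp
  qed
qed simp

lemma vertical_increment_bound:
  fixes F F' :: "complex \<Rightarrow> complex"
  assumes F: "\<And>z. Re z > 0 \<Longrightarrow> (F has_field_derivative F' z) (at z)"
    and bd: "\<And>z. Re z > 0 \<Longrightarrow> norm (F' z) \<le> g (Re z)" and x: "0 < x"
  shows "norm (F (Complex x y) - F (of_real x)) \<le> g x * \<bar>y\<bar>"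
proof -
  have "norm (F (Complex x y) - F (of_real x)) \<le> g x * norm (Complex x y - of_real x)"
  proof (rule field_differentiable_bound[where S = "{z. Re z = x}" and f' = F'])
    show "convex {z. Re z = x}"
    proof -
      have "{z. Re z = x} = {z. Re z \<le> x} \<inter> {z. Re z \<ge> x}" by auto
      then show ?thesis using convex_halfspace_Re_le convex_halfspace_Re_ge by (auto intro: convex_Int)
    qed
    show "(F has_field_derivative F' z) (at z within {z. Re z = x})" if "z \<in> {z. Re z = x}" for z
      by (rule has_field_derivative_at_within[OF F]) (use that x in auto)
    show "norm (F' z) \<le> g x" if "z \<in> {z. Re z = x}" for z using bd[of z] that x by auto
  qed auto
  moreover have "norm (Complex x y - of_real x) = \<bar>y\<bar>"
  proof -
    have "Complex x y - of_real x = axis y" by (simp add: complex_eq_iff)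
    then show ?thesis by (simp add: norm_mult)
  qed
  ultimately show ?thesis by simp
qed

text \<open>F is integrated from infinity along the horizontal ray through z. A limit along the
  integers on the real axis is enough, since at real part n the vertical displacement by Im z costs
  O(1 / n).\<close>

lemma ray_limit_bound:
  fixes F F' :: "complex \<Rightarrow> complex" and p :: nat
  assumes F: "\<And>z. Re z > 0 \<Longrightarrow> (F has_field_derivative F' z) (at z)"
    and bd: "\<And>z. Re z > 0 \<Longrightarrow> norm (F' z) \<le> c / (Re z) ^ (p + 1)" and p: "p \<ge> 1" and c: "c \<ge> 0"
    and lim: "(\<lambda>n. F (of_nat n)) \<longlonglongrightarrow> L" and z: "Re z > 0"
  shows "norm (F z - L) \<le> (c / p) / (Re z) ^ p"
proof -
  define x y where "x = Re z" and "y = Im z"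
  have zxy: "z = Complex x y" by (simp add: x_def y_def)
  have x: "x > 0" using z by (simp add: x_def)
  define G where "G t = - (c / p) / t ^ p" for t :: real
  have G: "(G has_real_derivative c / t ^ (p + 1)) (at t)" if t: "t > 0" for t
  proof -
    have "t ^ (p - Suc 0) / (t ^ p * t ^ p) = 1 / t ^ (p + 1)"
    proof -
      have "t ^ p = t ^ (p - Suc 0) * t" using p by (metis One_nat_def Suc_pred' le_simps(3) power_Suc2)
      then show ?thesis using t by simp
    qed
    then have "c * (t ^ (p - Suc 0) / (t ^ p * t ^ p)) = c * (1 / t ^ (p + 1))" by (rule arg_cong)
    then have e: "- (c / p) * (- (real p * t ^ (p - Suc 0)) / (t ^ p * t ^ p)) = c / t ^ (p + 1)" using p by simp
    have "((\<lambda>t. 1 / t ^ p) has_real_derivative - (real p * t ^ (p - Suc 0)) / (t ^ p * t ^ p)) (at t)"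
      using t by (auto intro!: derivative_eq_intros)
    from DERIV_cmult[OF this, of "- (c / p)"] show ?thesis unfolding e G_def[abs_def] by simp
  qed
  have est: "norm (F (of_nat n) - F z) \<le> (c / p) / x ^ p + c * \<bar>y\<bar> * (1 / real n)" if n: "real n \<ge> x" "n \<ge> 1" for n
  proof -
    have n0: "real n > 0" using n by simp
    have "norm (F (Complex (real n) y) - F (Complex x y)) \<le> G (real n) - G x"
      by (rule ray_increment_bound[OF F G bd x n(1)]) auto
    also have "\<dots> \<le> (c / p) / x ^ p" using c by (simp add: G_def)
    finally have 1: "norm (F (Complex (real n) y) - F z) \<le> (c / p) / x ^ p" by (simp add: zxy)
    have "norm (F (Complex (real n) y) - F (of_real (real n))) \<le> c / (real n) ^ (p + 1) * \<bar>y\<bar>"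
      by (rule vertical_increment_bound[OF F bd n0]) auto
    also have "c / (real n) ^ (p + 1) \<le> c / (real n)" 
    proof -
      have "real n ^ 1 \<le> real n ^ (p + 1)" using n(2) by (intro power_increasing) auto
      then show ?thesis using n0 c by (intro divide_left_mono) auto
    qed
    then have "c / (real n) ^ (p + 1) * \<bar>y\<bar> \<le> c / (real n) * \<bar>y\<bar>" by (rule mult_right_mono) simp
    finally have 2: "norm (F (Complex (real n) y) - F (of_nat n)) \<le> c * \<bar>y\<bar> * (1 / real n)" by simp
    have "norm (F (of_nat n) - F z) \<le> norm (F (of_nat n) - F (Complex (real n) y)) + norm (F (Complex (real n) y) - F z)"
      using norm_triangle_ineq[of "F (of_nat n) - F (Complex (real n) y)" "F (Complex (real n) y) - F z"] by simp
    then show ?thesis using 1 2 by (simp add: norm_minus_commute)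
  qed
  have l1: "(\<lambda>n. norm (F (of_nat n) - F z)) \<longlonglongrightarrow> norm (L - F z)" by (intro tendsto_intros lim)
  have l2: "(\<lambda>n. (c / p) / x ^ p + c * \<bar>y\<bar> * (1 / real n)) \<longlonglongrightarrow> (c / p) / x ^ p + c * \<bar>y\<bar> * 0"
    by (intro tendsto_intros lim_1_over_n)
  have "norm (L - F z) \<le> (c / p) / x ^ p + c * \<bar>y\<bar> * 0"
  proof (rule LIMSEQ_le[OF l1 l2])
    obtain n0 where "real n0 \<ge> x" using real_arch_simple by blast
    then show "\<exists>N. \<forall>n\<ge>N. norm (F (of_nat n) - F z) \<le> (c / p) / x ^ p + c * \<bar>y\<bar> * (1 / real n)"
      by (intro exI[of _ "max 1 n0"] allI impI est) auto
  qed
  then show ?thesis by (simp add: x_def norm_minus_commute)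
qed

text \<open>Integrate three times, each time from infinity as long as the integrand permits.\<close>

lemma linear_up_to_log:
  fixes M M1 M2 M3 :: "complex \<Rightarrow> complex"
  assumes d0: "\<And>z. Re z > 0 \<Longrightarrow> (M has_field_derivative M1 z) (at z)"
    and d1: "\<And>z. Re z > 0 \<Longrightarrow> (M1 has_field_derivative M2 z) (at z)"
    and d2: "\<And>z. Re z > 0 \<Longrightarrow> (M2 has_field_derivative M3 z) (at z)"
    and b3: "\<And>z. Re z > 0 \<Longrightarrow> norm (M3 z) \<le> D / (Re z) ^ 3" and D: "D \<ge> 0"
    and lim: "(\<lambda>n. M2 (of_nat n)) \<longlonglongrightarrow> 0"
  obtains \<kappa> C where "\<And>z. Re z \<ge> 1 \<Longrightarrow> norm (M z - \<kappa> * z) \<le> C + D * ln (1 + norm z)" 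
proof -
  have b2: "norm (M2 z) \<le> (D / 2) / (Re z)\<^sup>2" if "Re z > 0" for z
  proof -
    have "norm (M2 z - 0) \<le> (D / real 2) / (Re z) ^ 2"
      by (rule ray_limit_bound[OF d2 _ _ D lim that]) (use b3 in \<open>auto simp: eval_nat_numeral\<close>)
    then show ?thesis by simp
  qed
  have D2: "D / 2 \<ge> 0" using D by simp
  have G1: "((\<lambda>t. - (D / 2) / t) has_real_derivative (D / 2) / t\<^sup>2) (at t)" if "t > 0" for t
    using that by (auto intro!: derivative_eq_intros simp: power2_eq_square)
  \<comment> \<open>The decay of \<open>M2\<close> makes \<open>M1\<close> convergent at infinity,
    to a limit \<kappa> that nothing forces to vanish; it becomes the slope of the linear
    term.\<close>
  have cauchy: "norm (M1 (of_nat m) - M1 (of_nat n)) \<le> (D / 2) * (1 / real n)" if "1 \<le> n" "n \<le> m" for m n :: nat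
  proof -
    have "norm (M1 (Complex (real m) 0) - M1 (Complex (real n) 0)) \<le> - (D / 2) / real m - (- (D / 2) / real n)"
      by (rule ray_increment_bound[OF d1 G1 b2]) (use that in auto)
    also have "\<dots> \<le> (D / 2) * (1 / real n)" using D by simp
    finally show ?thesis by (simp add: complex_of_real_def[symmetric])
  qed
  have "Cauchy (\<lambda>n. M1 (of_nat n))"
  proof (rule CauchyI)
    fix e :: real assume e: "e > 0"
    have "(\<lambda>n. (D / 2) * (1 / real n)) \<longlonglongrightarrow> (D / 2) * 0" by (intro tendsto_intros lim_1_over_n)
    then have "\<forall>\<^sub>F n in sequentially. (D / 2) * (1 / real n) < e" by (rule order_tendstoD) (use e in simp)
    then obtain N where N: "\<And>n. n \<ge> N \<Longrightarrow> (D / 2) * (1 / real n) < e" by (auto simp: eventually_sequentially)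
    show "\<exists>M. \<forall>m\<ge>M. \<forall>n\<ge>M. norm (M1 (of_nat m) - M1 (of_nat n)) < e"
    proof (intro exI[of _ "max 1 N"] allI impI)
      fix m n assume mn: "max 1 N \<le> m" "max 1 N \<le> n"
      show "norm (M1 (of_nat m) - M1 (of_nat n)) < e"
      proof (cases "n \<le> m")
        case True
        then show ?thesis using cauchy[of n m] N[of n] mn by auto
      next
        case False
        then show ?thesis using cauchy[of m n] N[of m] mn by (auto simp: norm_minus_commute)
      qed
    qed
  qed
  then obtain \<kappa> where \<kappa>: "(\<lambda>n. M1 (of_nat n)) \<longlonglongrightarrow> \<kappa>" using Cauchy_convergent convergent_def by blast
  have b1: "norm (M1 z - \<kappa>) \<le> (D / 2) / Re z" if "Re z > 0" for z
  proof -
    have "norm (M1 z - \<kappa>) \<le> (D / 2 / real 1) / (Re z) ^ 1"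
      by (rule ray_limit_bound[OF d1 _ _ D2 \<kappa> that]) (use b2 in \<open>auto simp: power2_eq_square\<close>)
    then show ?thesis by simp
  qed
  define H where "H z = M z - \<kappa> * z" for z
  have dH: "(H has_field_derivative M1 z - \<kappa>) (at z)" if "Re z > 0" for z
    unfolding H_def[abs_def] using d0[OF that] by (auto intro!: derivative_eq_intros)
  have Gl: "((\<lambda>t. (D / 2) * ln t) has_real_derivative (D / 2) / t) (at t)" if "t > 0" for t
    using that by (auto intro!: derivative_eq_intros)
  show ?thesis
  proof (rule that[of \<kappa> "norm (H 1) + D"])
    fix z :: complex assume z: "Re z \<ge> 1"
    \<comment> \<open>The path from 1 to z runs along the real axis to X, then vertically, then back
      horizontally. Since X >= |Im z| the vertical piece costs a constant, and each horizontal piece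
      costs at most (D / 2) ln X.\<close>
    define X where "X = max (Re z) \<bar>Im z\<bar>"
    have X: "X \<ge> 1" "Re z \<le> X" "\<bar>Im z\<bar> \<le> X" using z by (auto simp: X_def)
    have "X \<le> norm z" unfolding X_def using abs_Re_le_cmod[of z] abs_Im_le_cmod[of z] by auto
    then have lnX: "ln X \<le> ln (1 + norm z)" using X by (intro ln_mono) auto
    have 1: "norm (H (Complex X 0) - H (Complex 1 0)) \<le> (D / 2) * ln X - (D / 2) * ln 1"
      by (rule ray_increment_bound[OF dH Gl b1]) (use X in auto)
    have 2: "norm (H (Complex X (Im z)) - H (Complex (Re z) (Im z))) \<le> (D / 2) * ln X - (D / 2) * ln (Re z)"
      by (rule ray_increment_bound[OF dH Gl b1]) (use X z in auto)
    have 3: "norm (H (Complex X (Im z)) - H (of_real X)) \<le> (D / 2) / X * \<bar>Im z\<bar>"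
      by (rule vertical_increment_bound[OF dH b1]) (use X in auto)
    have "(D / 2) / X * \<bar>Im z\<bar> \<le> (D / 2) / X * X" using X D by (intro mult_left_mono) auto
    also have "\<dots> = D / 2" using X by simp
    finally have 3: "norm (H (Complex X (Im z)) - H (of_real X)) \<le> D" using 3 D by linarith
    have 4: "(D / 2) * ln (Re z) \<ge> 0" using D z by simp
    have e: "Complex 1 0 = 1" "Complex X 0 = of_real X" "Complex (Re z) (Im z) = z" by (simp_all add: complex_eq_iff)
    have "H z = H 1 + (H (of_real X) - H 1) + (H (Complex X (Im z)) - H (of_real X)) - (H (Complex X (Im z)) - H z)" by simp
    then have "norm (H z) \<le> norm (H 1) + norm (H (of_real X) - H 1) + norm (H (Complex X (Im z)) - H (of_real X)) + norm (H (Complex X (Im z)) - H z)"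
      by (smt (verit) norm_triangle_ineq norm_triangle_ineq4)
    also have "\<dots> \<le> norm (H 1) + D + D * ln X" using 1 2 3 4 unfolding e by simp
    also have "\<dots> \<le> norm (H 1) + D + D * ln (1 + norm z)" using D lnX by (intro add_left_mono mult_left_mono) auto
    finally show "norm (M z - \<kappa> * z) \<le> norm (H 1) + D + D * ln (1 + norm z)" by (simp add: H_def)
  qed
qed

text \<open>For a in the closed right half-plane |m + a| dominates both m and |a|, hence |m + a|^2
  >= m^(1/2) |a|^(3/2). Summability with exponent 3/2 thus leaves the factor m^(-1/2).\<close>

lemma LL2_tendsto_0:
  assumes s: "summable (\<lambda>n. if n \<in> I then norm (a n) powr (-3/2) else 0)"
    and Re: "\<And>n. n \<in> I \<Longrightarrow> Re (a n) \<ge> 0" and nz: "\<And>n. n \<in> I \<Longrightarrow> a n \<noteq> 0"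
  shows "(\<lambda>m. LL2 I a (of_nat m)) \<longlonglongrightarrow> 0"
proof (rule tendsto_norm_zero_cancel, rule tendsto_sandwich)
  let ?w = "\<lambda>n. if n \<in> I then norm (a n) powr (-3/2) else 0"
  show "\<forall>\<^sub>F m in sequentially. 0 \<le> norm (LL2 I a (of_nat m))" by simp
  show "\<forall>\<^sub>F m in sequentially. norm (LL2 I a (of_nat m)) \<le> real m powr (-1/2) * suminf ?w"
    unfolding eventually_sequentially
  proof (intro exI[of _ 1] allI impI)
    fix m :: nat assume m: "m \<ge> 1"
    have bd: "norm (if n \<in> I then - 1 / (of_nat m + a n)^2 else 0) \<le> real m powr (-1/2) * ?w n" for n
    proof (cases "n \<in> I")
      case True
      have a0: "norm (a n) > 0" using nz[OF True] by simp
      let ?N = "norm (of_nat m + a n)"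
      have "(real m)\<^sup>2 + (norm (a n))\<^sup>2 \<le> ?N\<^sup>2"
        using Re[OF True] unfolding cmod_power2 by (simp add: power2_eq_square algebra_simps)
      then have "(real m)\<^sup>2 \<le> ?N\<^sup>2" "(norm (a n))\<^sup>2 \<le> ?N\<^sup>2"
        by (smt (verit) zero_le_power2)+
      then have N: "real m \<le> ?N" "norm (a n) \<le> ?N" by (auto intro: power2_le_imp_le)
      have "real m powr (1/2) * norm (a n) powr (3/2) \<le> ?N powr (1/2) * ?N powr (3/2)"
        using N by (intro mult_mono powr_mono2) auto
      also have "\<dots> = ?N\<^sup>2" using a0 N by (simp add: powr_add[symmetric] powr_numeral)
      finally have "1 / ?N\<^sup>2 \<le> 1 / (real m powr (1/2) * norm (a n) powr (3/2))"
        using a0 m N by (intro divide_left_mono mult_pos_pos) auto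
      also have "\<dots> = real m powr (-1/2) * norm (a n) powr (-3/2)" by (simp add: powr_minus_divide)
      finally show ?thesis using True by (simp add: norm_divide norm_power)
    qed simp
    have "norm (LL2 I a (of_nat m)) \<le> (\<Sum>n. real m powr (-1/2) * ?w n)"
      unfolding LL2_def by (rule norm_suminf_le[OF bd summable_mult[OF s]])
    then show "norm (LL2 I a (of_nat m)) \<le> real m powr (-1/2) * suminf ?w"
      using suminf_mult[OF s] by simp
  qed
  have "(\<lambda>m. real m powr (-1/2)) \<longlonglongrightarrow> 0" by real_asymp
  then show "(\<lambda>m. real m powr (-1/2) * suminf ?w) \<longlonglongrightarrow> 0" by (rule tendsto_mult_left_zero)
qed simp

section \<open>The multiplier\<close>

lemma near_subset: "near I a t \<subseteq> I"
  by (auto simp: near_def)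

text \<open>When every point has modulus at least 2 |z|, each genus-one factor is the exponential of
  a quantity of size O(|z / a|^2), so the product is controlled from above and below.\<close>

lemma PP_tail_bound:
  assumes fam: "fam I a" and big: "\<And>n. n \<in> I \<Longrightarrow> norm (a n) \<ge> 2 * norm z"
    and B: "\<And>F. finite F \<Longrightarrow> F \<subseteq> I \<Longrightarrow> (\<Sum>n\<in>F. 1 / (norm (a n))\<^sup>2) \<le> B"
  shows "norm (PP I a z) \<le> exp (2 * (norm z)\<^sup>2 * B)" "norm (PP I a z) \<ge> exp (- (2 * (norm z)\<^sup>2 * B))"
proof -
  let ?v = "\<lambda>n. if n \<in> I then 1 / (norm (a n))\<^sup>2 else 0"
  have fac: "exp (- (2 * (norm z)\<^sup>2 * ?v n)) \<le> norm (pfac I a n z) \<and> norm (pfac I a n z) \<le> exp (2 * (norm z)\<^sup>2 * ?v n)" for n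
  proof (cases "n \<in> I")
    case True
    then have a0: "norm (a n) > 0" using fam by (auto simp: fam_def)
    define u where "u = - (z / a n)"
    have u: "norm u \<le> 1 / 2" using big[OF True] a0 by (simp add: u_def norm_divide pos_divide_le_eq)
    have nz: "1 + u \<noteq> 0"
    proof
      assume "1 + u = 0"
      then have "u = - 1" by (simp add: add_eq_0_iff)
      then show False using u by simp
    qed
    have "\<bar>Re (Ln (1 + u) - u)\<bar> \<le> 2 * (norm u)\<^sup>2"
      using norm_Ln_minus_le[OF u] abs_Re_le_cmod order_trans by blast
    also have "2 * (norm u)\<^sup>2 = 2 * (norm z)\<^sup>2 * ?v n" using True by (simp add: u_def norm_divide power_divide)
    finally have "\<bar>Re (Ln (1 + u) - u)\<bar> \<le> 2 * (norm z)\<^sup>2 * ?v n" .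
    moreover have "exp (Ln (1 + u) - u) = (1 + u) * exp (- u)"
      using nz by (simp add: exp_diff exp_minus divide_inverse)
    then have "pfac I a n z = exp (Ln (1 + u) - u)" using True by (simp add: pfac_def u_def)
    ultimately show ?thesis by (simp add: norm_exp_eq_Re abs_le_iff)
  qed (simp add: pfac_def)
  have sB: "(\<Sum>n<N. ?v n) \<le> B" for N
  proof -
    have "(\<Sum>n<N. ?v n) = (\<Sum>n\<in>{..<N} \<inter> I. 1 / (norm (a n))\<^sup>2)"
      by (rule sum.inter_restrict[symmetric]) simp
    also have "\<dots> \<le> B" by (rule B) auto
    finally show ?thesis .
  qed
  have es: "2 * (norm z)\<^sup>2 * (\<Sum>n<N. ?v n) \<le> 2 * (norm z)\<^sup>2 * B" for N
    by (intro mult_left_mono sB) auto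
  have up: "norm (\<Prod>n<N. pfac I a n z) \<le> exp (2 * (norm z)\<^sup>2 * B)" for N
  proof -
    have "norm (\<Prod>n<N. pfac I a n z) \<le> (\<Prod>n<N. exp (2 * (norm z)\<^sup>2 * ?v n))"
      unfolding prod_norm[symmetric] by (rule prod_mono) (use fac in auto)
    also have "\<dots> = exp (2 * (norm z)\<^sup>2 * (\<Sum>n<N. ?v n))" by (simp only: exp_sum[OF finite_lessThan] sum_distrib_left)
    also have "\<dots> \<le> exp (2 * (norm z)\<^sup>2 * B)" using es by simp
    finally show ?thesis .
  qed
  have lo: "norm (\<Prod>n<N. pfac I a n z) \<ge> exp (- (2 * (norm z)\<^sup>2 * B))" for N
  proof -
    have "exp (- (2 * (norm z)\<^sup>2 * B)) \<le> exp (- (2 * (norm z)\<^sup>2 * (\<Sum>n<N. ?v n)))" using es by simp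
    also have "\<dots> = (\<Prod>n<N. exp (- (2 * (norm z)\<^sup>2 * ?v n)))"
      by (simp only: exp_sum[OF finite_lessThan, symmetric] sum_distrib_left sum_negf)
    also have "\<dots> \<le> norm (\<Prod>n<N. pfac I a n z)"
      unfolding prod_norm[symmetric] by (rule prod_mono) (use fac in auto)
    finally show ?thesis .
  qed
  have lim: "(\<lambda>N. norm (\<Prod>n<N. pfac I a n z)) \<longlonglongrightarrow> norm (PP I a z)" by (intro tendsto_norm PP_LIMSEQ fam)
  show "norm (PP I a z) \<le> exp (2 * (norm z)\<^sup>2 * B)" by (rule LIMSEQ_le_const2[OF lim]) (use up in auto)
  show "norm (PP I a z) \<ge> exp (- (2 * (norm z)\<^sup>2 * B))" by (rule LIMSEQ_le_const[OF lim]) (use lo in auto)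
qed

lemma fin_dens_powr_summable:
  assumes "fin_dens I a" "\<And>n. n \<in> I \<Longrightarrow> Re (a n) \<ge> 1"
  shows "summable (\<lambda>n. if n \<in> I then norm (a n) powr (-3/2) else 0)"
proof -
  have eq: "- (3 / 2) = (- 3 / 2 :: real)" by simp
  have "summable (\<lambda>n. if n \<in> I then norm (a n) powr (- (3 / 2)) else 0)"
  proof (rule fin_dens_summable[OF assms(1), where c = 1])
    show "norm (a n) \<ge> 1" if "n \<in> I" for n
      using assms(2)[OF that] complex_Re_le_cmod[of "a n"] by linarith
  qed auto
  then show ?thesis unfolding eq .
qed

text \<open>At - z the logarithm of the product over the axis points and J, divided by that over I,
  is linear up to D ln (1 + |z|). So this quotient is exponential up to the power m >= D of 1 + |z|.
  Dropping m + d axis points divides by as many factors comparable with 1 + |z| on Re z <= -1, which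
  leaves a spare decay of order d.\<close>

lemma axis_multiplier_decay:
  assumes fdI: "fin_dens I a" "\<And>n. n \<in> I \<Longrightarrow> Re (a n) \<ge> 1"
    and fdJ: "fin_dens J b" "\<And>n. n \<in> J \<Longrightarrow> Re (b n) \<ge> 1"
    and \<eta>: "0 < \<eta>" "\<eta> \<le> 1" "\<And>n. n \<in> J \<Longrightarrow> Re (b n) \<ge> \<eta> * norm (b n)"
    and bal: "\<And>t. lsum J b t - lsum I a t \<ge> - C0" and C0: "C0 \<ge> 0"
  obtains \<kappa> T K and S :: "nat \<Rightarrow> real" where "fam UNIV (\<lambda>n. axis (S n))" "K \<ge> 0"
    "\<And>z. Re z \<le> -1 \<Longrightarrow> norm (PP J b z * (exp (\<kappa> * z) * PP T (\<lambda>n. axis (S n)) z)) * (1 + norm z) ^ d \<le> K * norm (PP I a z)"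
proof -
  obtain S :: "nat \<Rightarrow> real" where S: "\<And>n. S n \<noteq> 0" "fam UNIV (\<lambda>n. axis (S n))"
    "summable (\<lambda>n. \<bar>S n\<bar> powr (-3/2))"
    "\<And>z. Re z > 0 \<Longrightarrow> norm (LL3 UNIV (\<lambda>n. axis (S n)) z + LL3 J b z - LL3 I a z) \<le> 6 * pi / (Re z) ^ 3"
    using axis_zeros_exist[OF fdI fdJ \<eta> bal C0] by metis
  let ?S = "\<lambda>n. axis (S n)"
  have famI: "fam I a" and famJ: "fam J b" using fam_cnj(1)[OF fdI] fam_cnj(1)[OF fdJ] by blast+
  have RI: "\<And>n. n \<in> I \<Longrightarrow> Re (a n) \<ge> 0" and RJ: "\<And>n. n \<in> J \<Longrightarrow> Re (b n) \<ge> 0" and RS: "\<And>n. n \<in> UNIV \<Longrightarrow> Re (?S n) \<ge> 0"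
    using fdI(2) fdJ(2) by force+
  have m0: "Re z > - 0" if "Re z > 0" for z using that by simp
  note dS = LL_deriv(3)[OF S(2) order_refl RS m0] LL1_deriv(2)[OF S(2) order_refl RS m0] LL2_deriv(2)[OF S(2) order_refl RS m0]
  note dJ = LL_deriv(3)[OF famJ order_refl RJ m0] LL1_deriv(2)[OF famJ order_refl RJ m0] LL2_deriv(2)[OF famJ order_refl RJ m0]
  note dI = LL_deriv(3)[OF famI order_refl RI m0] LL1_deriv(2)[OF famI order_refl RI m0] LL2_deriv(2)[OF famI order_refl RI m0]
  define D where "D = 6 * pi"
  define M where "M z = LL UNIV ?S z + LL J b z - LL I a z" for z
  have D: "D \<ge> 0" by (simp add: D_def)
  obtain \<kappa>0 C where C: "\<And>z. Re z \<ge> 1 \<Longrightarrow> norm (M z - \<kappa>0 * z) \<le> C + D * ln (1 + norm z)"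
  proof (rule linear_up_to_log[of M "\<lambda>z. LL1 UNIV ?S z + LL1 J b z - LL1 I a z"
        "\<lambda>z. LL2 UNIV ?S z + LL2 J b z - LL2 I a z" "\<lambda>z. LL3 UNIV ?S z + LL3 J b z - LL3 I a z" D])
    fix z :: complex assume z: "Re z > 0"
    show "(M has_field_derivative LL1 UNIV ?S z + LL1 J b z - LL1 I a z) (at z)"
      unfolding M_def[abs_def] by (intro DERIV_add DERIV_diff dS dJ dI z)
    show "((\<lambda>z. LL1 UNIV ?S z + LL1 J b z - LL1 I a z) has_field_derivative LL2 UNIV ?S z + LL2 J b z - LL2 I a z) (at z)"
      by (intro DERIV_add DERIV_diff dS dJ dI z)
    show "((\<lambda>z. LL2 UNIV ?S z + LL2 J b z - LL2 I a z) has_field_derivative LL3 UNIV ?S z + LL3 J b z - LL3 I a z) (at z)"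
      by (intro DERIV_add DERIV_diff dS dJ dI z)
    show "norm (LL3 UNIV ?S z + LL3 J b z - LL3 I a z) \<le> D / (Re z) ^ 3" unfolding D_def by (rule S(4)[OF z])
  next
    have "(\<lambda>n. LL2 UNIV ?S (of_nat n) + LL2 J b (of_nat n) - LL2 I a (of_nat n)) \<longlonglongrightarrow> 0 + 0 - 0"
    proof (intro tendsto_add tendsto_diff LL2_tendsto_0)
      show "summable (\<lambda>n. if n \<in> UNIV then norm (?S n) powr (-3/2) else 0)" using S(3) by (simp add: norm_mult)
      show "?S n \<noteq> 0" for n using S(1) by simp
      show "b n \<noteq> 0" if "n \<in> J" for n using famJ that by (simp add: fam_def)
      show "a n \<noteq> 0" if "n \<in> I" for n using famI that by (simp add: fam_def)
    qed (use RI RJ fin_dens_powr_summable[OF fdI] fin_dens_powr_summable[OF fdJ] in auto)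
    then show "(\<lambda>n. LL2 UNIV ?S (of_nat n) + LL2 J b (of_nat n) - LL2 I a (of_nat n)) \<longlonglongrightarrow> 0" by simp
  qed (use D in auto)
  define m where "m = nat \<lceil>D\<rceil>"
  have mD: "D \<le> real m" unfolding m_def by (rule real_nat_ceiling_ge)
  define F where "F = {..<m + d}"
  have F: "finite F" "F \<subseteq> UNIV" "card F = m + d" by (auto simp: F_def)
  \<comment> \<open>The exponential parts of the dropped genus-one factors are kept and collected in
    the linear exponent; what is dropped are the polynomial parts 1 - z / (i s).\<close>
  define \<kappa> where "\<kappa> = \<kappa>0 + (\<Sum>n\<in>F. 1 / ?S n)"
  define Q where "Q = (\<Prod>n\<in>F. (2 + \<bar>S n\<bar>) * \<bar>S n\<bar>)"
  have Q: "Q > 0" unfolding Q_def by (intro prod_pos) (use S(1) in \<open>auto intro!: mult_pos_pos add_pos_nonneg\<close>)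
  show ?thesis
  proof (rule that[OF S(2)])
    show "Q * exp C \<ge> 0" using Q by simp
    fix z :: complex assume z: "Re z \<le> - 1"
    define h where "h = exp (\<kappa> * z) * PP (UNIV - F) ?S z"
    define q where "q = (\<Prod>n\<in>F. 1 - z / ?S n)"
    have z': "Re (- z) > - 0" "Re (- z) \<ge> 1" using z by auto
    have split: "exp (\<kappa>0 * z) * PP UNIV ?S z = q * h"
    proof -
      have "exp (\<kappa> * z) = exp (\<kappa>0 * z) * (\<Prod>n\<in>F. exp (z / ?S n))"
        using F(1) by (simp add: \<kappa>_def distrib_right exp_add sum_distrib_right exp_sum)
      moreover have "PP UNIV ?S z = (\<Prod>n\<in>F. (1 - z / ?S n) * exp (z / ?S n)) * PP (UNIV - F) ?S z"
        by (rule PP_split[OF S(2) F(1,2)])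
      ultimately show ?thesis unfolding q_def h_def prod.distrib by (simp only: mult_ac)
    qed
    have "exp (M (- z)) * PP I a z = PP UNIV ?S z * PP J b z"
    proof -
      have "exp (LL UNIV ?S (- z)) = PP UNIV ?S z" "exp (LL J b (- z)) = PP J b z" "exp (LL I a (- z)) = PP I a z"
        using exp_LL[OF S(2) order_refl RS z'(1)] exp_LL[OF famJ order_refl RJ z'(1)] exp_LL[OF famI order_refl RI z'(1)] by simp_all
      moreover have "exp (LL I a (- z)) \<noteq> 0" by simp
      ultimately show ?thesis by (simp add: M_def exp_add exp_diff)
    qed
    then have "exp (M (- z) - \<kappa>0 * (- z)) * PP I a z = PP J b z * (q * h)"
      unfolding split[symmetric] by (simp add: exp_add exp_diff exp_minus field_simps)
    then have "norm q * norm (PP J b z * h) = norm (exp (M (- z) - \<kappa>0 * (- z))) * norm (PP I a z)"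
      by (metis (no_types, lifting) mult.left_commute norm_mult)
    also have "norm (exp (M (- z) - \<kappa>0 * (- z))) \<le> exp (norm (M (- z) - \<kappa>0 * (- z)))" by (rule norm_exp)
    also have "\<dots> \<le> exp (C + D * ln (1 + norm z))" using C[OF z'(2)] by simp
    also have "D * ln (1 + norm z) \<le> real m * ln (1 + norm z)" using mD by (intro mult_right_mono) auto
    then have "exp (C + D * ln (1 + norm z)) \<le> exp C * exp (real m * ln (1 + norm z))" by (simp add: exp_add[symmetric])
    also have "exp (real m * ln (1 + norm z)) = (1 + norm z) ^ m"
      by (simp add: exp_of_nat_mult add_pos_nonneg)
    finally have up: "norm q * norm (PP J b z * h) \<le> exp C * (1 + norm z) ^ m * norm (PP I a z)"
      by (simp add: mult_right_mono)
    have "(1 + norm z) ^ (m + d) = (\<Prod>n\<in>F. 1 + norm z)" using F(3) by simp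
    also have "\<dots> \<le> (\<Prod>n\<in>F. ((2 + \<bar>S n\<bar>) * \<bar>S n\<bar>) * norm (1 - z / ?S n))"
    proof (rule prod_mono, intro conjI)
      fix n
      have nS: "norm (?S n) = \<bar>S n\<bar>" by (simp add: norm_mult)
      \<comment> \<open>Being at distance at least 1 from each axis point lets 1 + |z| be absorbed
        into a multiple of |z - i s|.\<close>
      have "1 \<le> \<bar>Re (z - ?S n)\<bar>" using z by simp
      then have 1: "1 \<le> norm (z - ?S n)" using abs_Re_le_cmod order_trans by blast
      have "norm z \<le> norm (z - ?S n) + \<bar>S n\<bar>" using norm_triangle_sub[of z "?S n"] nS by simp
      also have "\<bar>S n\<bar> \<le> \<bar>S n\<bar> * norm (z - ?S n)" using mult_left_mono[OF 1, of "\<bar>S n\<bar>"] by simp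
      finally have "1 + norm z \<le> (2 + \<bar>S n\<bar>) * norm (z - ?S n)" using 1 by (simp add: distrib_right)
      also have "norm (z - ?S n) = \<bar>S n\<bar> * norm (1 - z / ?S n)"
      proof -
        have "z - ?S n = - (?S n * (1 - z / ?S n))" using S(1)[of n] by (simp add: right_diff_distrib)
        then show ?thesis by (simp add: norm_mult)
      qed
      finally show "1 + norm z \<le> ((2 + \<bar>S n\<bar>) * \<bar>S n\<bar>) * norm (1 - z / ?S n)" by (simp add: mult.assoc)
    qed simp
    also have "\<dots> = Q * norm q" unfolding Q_def q_def prod_norm[symmetric] prod.distrib ..
    finally have "(1 + norm z) ^ (m + d) * norm (PP J b z * h) \<le> Q * norm q * norm (PP J b z * h)" by (rule mult_right_mono) simp
    also have "\<dots> = Q * (norm q * norm (PP J b z * h))" by simp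
    also have "\<dots> \<le> Q * (exp C * (1 + norm z) ^ m * norm (PP I a z))" using up Q by (intro mult_left_mono) auto
    finally have "(1 + norm z) ^ m * (norm (PP J b z * h) * (1 + norm z) ^ d) \<le> (1 + norm z) ^ m * (Q * exp C * norm (PP I a z))"
      by (simp add: power_add mult_ac)
    moreover have "(1 + norm z) ^ m > 0" by (intro zero_less_power) (simp add: add_pos_nonneg)
    ultimately have "norm (PP J b z * h) * (1 + norm z) ^ d \<le> Q * exp C * norm (PP I a z)" by (rule mult_left_le_imp_le)
    then show "norm (PP J b z * (exp (\<kappa> * z) * PP (UNIV - F) ?S z)) * (1 + norm z) ^ d \<le> Q * exp C * norm (PP I a z)"
      by (simp only: h_def)
  qed
qed

text \<open>Growth in the rest of the plane is controlled by comparing \<open>z\<close> with the point \<open>z'\<close> on the far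
  side of the axis and with the same imaginary part: the moduli of the individual factors are then
  comparable, and the exponential factors contribute the balanced logarithmic sums.\<close>

lemma axis_multiplier_growth:
  assumes fdI: "fin_dens I a" "\<And>n. n \<in> I \<Longrightarrow> Re (a n) \<ge> 1"
    and fdJ: "fin_dens J b" "\<And>n. n \<in> J \<Longrightarrow> Re (b n) \<ge> 1"
    and bal: "\<And>t. lsum J b t - lsum I a t \<le> C0" and C0: "C0 \<ge> 0"
    and S: "fam UNIV (\<lambda>n. axis (S n))" and K: "K \<ge> 0"
    and dec: "\<And>z. Re z \<le> -1 \<Longrightarrow> norm (PP J b z * (exp (\<kappa> * z) * PP T (\<lambda>n. axis (S n)) z)) \<le> K * norm (PP I a z)"
  obtains C where "C \<ge> 0" "\<And>z. (\<And>n. n \<in> I \<Longrightarrow> z \<noteq> a n) \<Longrightarrow>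
    norm (PP J b z * (exp (\<kappa> * z) * PP T (\<lambda>n. axis (S n)) z)) \<le>
      exp (C * (1 + norm z)) * (\<Prod>n\<in>near I a (2 * (1 + norm z)). 4 * (1 + norm z) / norm (z - a n)) * norm (PP I a z)"
proof -
  let ?S = "\<lambda>n. axis (S n)"
  have n1: "norm w \<ge> 1" if "Re w \<ge> 1" for w using that complex_Re_le_cmod[of w] by linarith
  have famI: "fam I a" and famJ: "fam J b" using fam_cnj(1)[OF fdI] fam_cnj(1)[OF fdJ] by blast+
  have famT: "fam T ?S" using S by (rule fam_subset) simp
  obtain CI where CI: "CI \<ge> 0" "\<And>F T. finite F \<Longrightarrow> F \<subseteq> I \<Longrightarrow> T > 0 \<Longrightarrow> (\<And>n. n \<in> F \<Longrightarrow> norm (a n) \<ge> T) \<Longrightarrow>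
      (\<Sum>n\<in>F. 1 / (norm (a n))\<^sup>2) \<le> CI / T"
    by (rule fin_dens_tail_sum[OF fdI(1), where c = 1]) (use fdI(2) n1 in auto)
  obtain CJ where CJ: "CJ \<ge> 0" "\<And>F T. finite F \<Longrightarrow> F \<subseteq> J \<Longrightarrow> T > 0 \<Longrightarrow> (\<And>n. n \<in> F \<Longrightarrow> norm (b n) \<ge> T) \<Longrightarrow>
      (\<Sum>n\<in>F. 1 / (norm (b n))\<^sup>2) \<le> CJ / T"
    by (rule fin_dens_tail_sum[OF fdJ(1), where c = 1]) (use fdJ(2) n1 in auto)
  note finI = fin_dens_near_finite[OF fdI(1)] and finJ = fin_dens_near_finite[OF fdJ(1)]
  have tail: "exp (- (c * m)) \<le> norm (PP (X - near X p (2 * m)) p w) \<and> norm (PP (X - near X p (2 * m)) p w) \<le> exp (c * m)"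
    if X: "fam X p" and c: "c \<ge> 0" "\<And>F T. finite F \<Longrightarrow> F \<subseteq> X \<Longrightarrow> T > 0 \<Longrightarrow> (\<And>n. n \<in> F \<Longrightarrow> norm (p n) \<ge> T) \<Longrightarrow>
      (\<Sum>n\<in>F. 1 / (norm (p n))\<^sup>2) \<le> c / T" and m: "m > 0" "norm w \<le> m" for X and p :: "nat \<Rightarrow> complex" and c m w
  proof -
    let ?Y = "X - near X p (2 * m)"
    have f: "fam ?Y p" using X by (rule fam_subset) auto
    have big: "norm (p n) \<ge> 2 * m" if "n \<in> ?Y" for n using that by (auto simp: near_def)
    have b: "(\<Sum>n\<in>F. 1 / (norm (p n))\<^sup>2) \<le> c / (2 * m)" if "finite F" "F \<subseteq> ?Y" for F
      by (rule c(2)) (use that m big in auto)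
    have "2 * (norm w)\<^sup>2 * (c / (2 * m)) \<le> 2 * m\<^sup>2 * (c / (2 * m))"
      using m c by (intro mult_right_mono mult_left_mono power_mono) auto
    also have "\<dots> = c * m" using m by (simp add: power2_eq_square)
    finally have le: "2 * (norm w)\<^sup>2 * (c / (2 * m)) \<le> c * m" .
    have big': "norm (p n) \<ge> 2 * norm w" if "n \<in> ?Y" for n using big[OF that] m by linarith
    note PP_tail_bound[OF f big' b]
    moreover have "exp (- (c * m)) \<le> exp (- (2 * (norm w)\<^sup>2 * (c / (2 * m))))" using le by simp
    moreover have "exp (2 * (norm w)\<^sup>2 * (c / (2 * m))) \<le> exp (c * m)" using le by simp
    ultimately show ?thesis by linarith
  qed
  define C where "C = 2 * C0 + 2 * CJ + 2 * CI + 2 * norm \<kappa> + K"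
  show ?thesis
  proof (rule that[of C])
    show C: "C \<ge> 0" using C0 CJ CI K by (simp add: C_def)
    fix z assume za: "\<And>n. n \<in> I \<Longrightarrow> z \<noteq> a n"
    define m where "m = 1 + norm z"
    define PQ where "PQ = (\<Prod>n\<in>near I a (2 * m). 4 * m / norm (z - a n))"
    have m: "m \<ge> 1" "m > 0" by (simp_all add: m_def add_pos_nonneg)
    have K1: "K \<le> exp (K * m)"
    proof -
      have "K \<le> K * m" using K m mult_left_mono[of 1 m K] by simp
      also have "\<dots> \<le> exp (K * m)" using exp_ge_add_one_self[of "K * m"] by linarith
      finally show ?thesis .
    qed
    have goal: "norm (PP J b z * (exp (\<kappa> * z) * PP T ?S z)) \<le> exp (C * m) * PQ * norm (PP I a z)"
    proof (cases "Re z \<le> - 1")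
      case True
      have "PQ \<ge> 1" unfolding PQ_def
      proof (rule prod_ge_1)
        fix n assume n: "n \<in> near I a (2 * m)"
        have "norm (z - a n) \<le> norm z + norm (a n)" by (rule norm_triangle_ineq4)
        then have "norm (z - a n) \<le> 4 * m" using n m by (auto simp: near_def m_def)
        moreover have "norm (z - a n) > 0" using za n by (auto simp: near_def)
        ultimately show "1 \<le> 4 * m / norm (z - a n)" by simp
      qed
      moreover have "exp (K * m) \<le> exp (C * m)" using m C0 CJ CI by (auto simp: C_def intro!: mult_right_mono)
      moreover from calculation have "K \<le> exp (C * m)" using K1 by linarith
      ultimately have "K * 1 \<le> exp (C * m) * PQ" using K by (intro mult_mono) auto
      then have "K * norm (PP I a z) \<le> exp (C * m) * PQ * norm (PP I a z)" by (intro mult_right_mono) auto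
      then show ?thesis using dec[OF True] by linarith
    next
      case False
      \<comment> \<open>The point z' has real part - max (Re z) 1. It satisfies Re z' <= -1, where
        the decay estimate holds, has modulus at most m, and is at least as far as z from every
        point of the closed right half-plane.\<close>
      define x1 where "x1 = max (Re z) 1"
      define z' where "z' = Complex (- x1) (Im z)"
      define \<delta> where "\<delta> = Re z + x1"
      have zz: "z = z' + of_real \<delta>" by (simp add: z'_def \<delta>_def complex_eq_iff)
      have \<delta>0: "\<delta> \<ge> 0" using False by (simp add: \<delta>_def x1_def)
      have x1: "x1 \<le> m" using complex_Re_le_cmod[of z] m by (auto simp: x1_def m_def)
      have \<delta>m: "\<delta> \<le> 2 * m" using x1 complex_Re_le_cmod[of z] by (simp add: \<delta>_def m_def)
      have z'1: "Re z' \<le> - 1" by (simp add: z'_def x1_def)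
      have z'm: "norm z' \<le> m"
      proof (cases "Re z \<ge> 1")
        case True
        then have "norm z' = norm z" by (simp add: z'_def x1_def cmod_def)
        then show ?thesis by (simp add: m_def)
      next
        case False
        then have "norm z' \<le> 1 + \<bar>Im z\<bar>" using cmod_le[of z'] by (simp add: z'_def x1_def)
        then show ?thesis using abs_Im_le_cmod[of z] by (simp add: m_def)
      qed
      have zm: "norm z \<le> m" by (simp add: m_def)
      have ex: "norm (exp (z / w)) = exp (\<delta> * Re (1 / w)) * norm (exp (z' / w))" for w
      proof -
        have "Re (z / w) = \<delta> * Re (1 / w) + Re (z' / w)" unfolding zz add_divide_distrib by (simp add: Re_inverse_complex Re_divide cmod_power2)
        then show ?thesis by (simp only: norm_exp_eq_Re exp_add)
      qed
      have dist: "norm (z - w) \<le> norm (z' - w)" if "Re w \<ge> 0" for w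
      proof -
        have "\<bar>Re (z - w)\<bar> \<le> \<bar>Re (z' - w)\<bar>" using that False by (auto simp: z'_def x1_def)
        then have "(Re (z - w))\<^sup>2 \<le> (Re (z' - w))\<^sup>2" by (simp add: abs_le_square_iff)
        then show ?thesis by (simp add: cmod_def z'_def)
      qed
      have one: "norm (1 - u / w) = norm (u - w) / norm w" if "w \<noteq> 0" for u w :: complex
      proof -
        have "1 - u / w = - ((u - w) / w)" using that by (simp add: diff_divide_distrib)
        then show ?thesis by (simp add: norm_divide)
      qed
      have nJ: "norm (\<Prod>n\<in>near J b (2 * m). (1 - z / b n) * exp (z / b n)) \<le>
        exp (\<delta> * lsum J b (2 * m)) * norm (\<Prod>n\<in>near J b (2 * m). (1 - z' / b n) * exp (z' / b n))"
      proof -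
        have "norm (\<Prod>n\<in>near J b (2 * m). (1 - z / b n) * exp (z / b n))
          \<le> (\<Prod>n\<in>near J b (2 * m). exp (\<delta> * pos_recip (b n)) * norm ((1 - z' / b n) * exp (z' / b n)))"
          unfolding prod_norm[symmetric]
        proof (rule prod_mono, intro conjI norm_ge_zero)
          fix n assume "n \<in> near J b (2 * m)"
          then have n: "n \<in> J" by (simp add: near_def)
          have Rb: "Re (b n) \<ge> 0" using fdJ(2)[OF n] by linarith
          have b0: "b n \<noteq> 0" using famJ n by (simp add: fam_def)
          have "norm (1 - z / b n) \<le> norm (1 - z' / b n)"
            unfolding one[OF b0] using dist[OF Rb] by (simp add: divide_right_mono)
          then have "norm (1 - z / b n) * (exp (\<delta> * Re (1 / b n)) * norm (exp (z' / b n))) \<le> norm (1 - z' / b n) * (exp (\<delta> * Re (1 / b n)) * norm (exp (z' / b n)))"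
            by (rule mult_right_mono) simp
          then show "norm ((1 - z / b n) * exp (z / b n)) \<le> exp (\<delta> * pos_recip (b n)) * norm ((1 - z' / b n) * exp (z' / b n))"
            unfolding norm_mult ex pos_recip_pos[OF Rb] by (simp only: mult_ac)
        qed
        also have "\<dots> = exp (\<delta> * lsum J b (2 * m)) * norm (\<Prod>n\<in>near J b (2 * m). (1 - z' / b n) * exp (z' / b n))"
          unfolding prod.distrib lsum_def sum_distrib_left exp_sum[OF finJ] prod_norm[symmetric] norm_mult ..
        finally show ?thesis .
      qed
      \<comment> \<open>For the denominators the comparison goes the wrong way, as z may be close to
        a point of I. The loss is recorded in \<open>PQ\<close> and gets bounded later, on circles
        of good radius.\<close>
      have nI: "norm (\<Prod>n\<in>near I a (2 * m). (1 - z' / a n) * exp (z' / a n)) \<le>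
        exp (- \<delta> * lsum I a (2 * m)) * PQ * norm (\<Prod>n\<in>near I a (2 * m). (1 - z / a n) * exp (z / a n))"
      proof -
        have "norm (\<Prod>n\<in>near I a (2 * m). (1 - z' / a n) * exp (z' / a n))
          \<le> (\<Prod>n\<in>near I a (2 * m). exp (- \<delta> * pos_recip (a n)) * (4 * m / norm (z - a n)) * norm ((1 - z / a n) * exp (z / a n)))"
          unfolding prod_norm[symmetric]
        proof (rule prod_mono, intro conjI norm_ge_zero)
          fix n assume nn: "n \<in> near I a (2 * m)"
          then have n: "n \<in> I" by (simp add: near_def)
          have Ra: "Re (a n) \<ge> 0" using fdI(2)[OF n] by linarith
          have a0: "a n \<noteq> 0" using famI n by (simp add: fam_def)
          have nz: "norm (z - a n) > 0" using za[OF n] by simp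
          have "norm (z' - a n) \<le> norm z' + norm (a n)" by (rule norm_triangle_ineq4)
          then have le: "norm (z' - a n) \<le> 4 * m" using nn z'm m by (simp add: near_def)
          have "norm (1 - z' / a n) \<le> (4 * m / norm (z - a n)) * norm (1 - z / a n)"
            unfolding one[OF a0] using nz le by (simp add: divide_right_mono)
          moreover have "norm (exp (z' / a n)) = exp (- \<delta> * pos_recip (a n)) * norm (exp (z / a n))"
            unfolding ex pos_recip_pos[OF Ra] by (simp add: mult.assoc[symmetric] exp_add[symmetric])
          ultimately have "norm (1 - z' / a n) * norm (exp (z' / a n)) \<le> ((4 * m / norm (z - a n)) * norm (1 - z / a n)) * (exp (- \<delta> * pos_recip (a n)) * norm (exp (z / a n)))"
            by (metis mult_right_mono norm_ge_zero)
          then show "norm ((1 - z' / a n) * exp (z' / a n)) \<le> exp (- \<delta> * pos_recip (a n)) * (4 * m / norm (z - a n)) * norm ((1 - z / a n) * exp (z / a n))"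
            unfolding norm_mult by (simp only: mult_ac)
        qed
        also have "\<dots> = exp (- \<delta> * lsum I a (2 * m)) * PQ * norm (\<Prod>n\<in>near I a (2 * m). (1 - z / a n) * exp (z / a n))"
          unfolding prod.distrib lsum_def sum_distrib_left exp_sum[OF finI] PQ_def prod_norm[symmetric] norm_mult ..
        finally show ?thesis .
      qed
      have tJ: "norm (PP (J - near J b (2 * m)) b z) \<le> exp (2 * CJ * m) * norm (PP (J - near J b (2 * m)) b z')"
      proof -
        have "norm (PP (J - near J b (2 * m)) b z) \<le> exp (CJ * m)" by (rule tail[OF famJ CJ m(2) zm, THEN conjunct2])
        also have "\<dots> = exp (2 * CJ * m) * exp (- (CJ * m))" by (simp add: exp_add[symmetric])
        also have "\<dots> \<le> exp (2 * CJ * m) * norm (PP (J - near J b (2 * m)) b z')"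
          by (rule mult_left_mono[OF tail[OF famJ CJ m(2) z'm, THEN conjunct1]]) (blast | rule exp_ge_zero)+
        finally show ?thesis .
      qed
      have tI: "norm (PP (I - near I a (2 * m)) a z') \<le> exp (2 * CI * m) * norm (PP (I - near I a (2 * m)) a z)"
      proof -
        have "norm (PP (I - near I a (2 * m)) a z') \<le> exp (CI * m)" by (rule tail[OF famI CI m(2) z'm, THEN conjunct2])
        also have "\<dots> = exp (2 * CI * m) * exp (- (CI * m))" by (simp add: exp_add[symmetric])
        also have "\<dots> \<le> exp (2 * CI * m) * norm (PP (I - near I a (2 * m)) a z)"
          by (rule mult_left_mono[OF tail[OF famI CI m(2) zm, THEN conjunct1]]) (blast | rule exp_ge_zero)+
        finally show ?thesis .
      qed
      have ek: "norm (exp (\<kappa> * z)) \<le> exp (2 * norm \<kappa> * m) * norm (exp (\<kappa> * z'))"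
      proof -
        have "Re (\<kappa> * z) \<le> norm \<kappa> * m" 
          using complex_Re_le_cmod[of "\<kappa> * z"] mult_left_mono[OF zm, of "norm \<kappa>"] by (simp add: norm_mult)
        moreover have "- Re (\<kappa> * z') \<le> norm \<kappa> * m"
          using abs_Re_le_cmod[of "\<kappa> * z'"] mult_left_mono[OF z'm, of "norm \<kappa>"] by (simp add: norm_mult)
        ultimately have "Re (\<kappa> * z) \<le> 2 * norm \<kappa> * m + Re (\<kappa> * z')" by linarith
        then show ?thesis by (simp only: norm_exp_eq_Re exp_add[symmetric] exp_le_cancel_iff)
      qed
      have pT: "norm (PP T ?S z) \<le> norm (PP T ?S z')"
      proof (rule LIMSEQ_le[OF tendsto_norm[OF PP_LIMSEQ[OF famT]] tendsto_norm[OF PP_LIMSEQ[OF famT]]])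
        have "norm (pfac T ?S n z) \<le> norm (pfac T ?S n z')" for n
        proof (cases "n \<in> T")
          case True
          then have S0: "?S n \<noteq> 0" using famT by (simp add: fam_def)
          have "norm (1 - z / ?S n) \<le> norm (1 - z' / ?S n)"
            unfolding one[OF S0] using dist[of "?S n"] by (simp add: divide_right_mono)
          moreover have "norm (exp (z / ?S n)) = norm (exp (z' / ?S n))"
            unfolding ex by (simp add: Re_divide)
          ultimately show ?thesis using True unfolding pfac_def norm_mult by (simp add: norm_mult mult_right_mono)
        qed (simp add: pfac_def)
        then show "\<exists>N. \<forall>n\<ge>N. norm (\<Prod>n<n. pfac T ?S n z) \<le> norm (\<Prod>n<n. pfac T ?S n z')"
          unfolding prod_norm[symmetric] by (intro exI[of _ 0] allI impI prod_mono) auto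
      qed
      define e1 where "e1 = exp (\<delta> * lsum J b (2 * m)) * exp (2 * CJ * m) * exp (2 * norm \<kappa> * m)"
      have "norm (PP J b z * (exp (\<kappa> * z) * PP T ?S z)) =
        (norm (\<Prod>n\<in>near J b (2 * m). (1 - z / b n) * exp (z / b n)) * norm (PP (J - near J b (2 * m)) b z)) * (norm (exp (\<kappa> * z)) * norm (PP T ?S z))"
        unfolding PP_split[OF famJ finJ[of "2 * m"], of z, OF near_subset] norm_mult ..
      also have "\<dots> \<le> ((exp (\<delta> * lsum J b (2 * m)) * norm (\<Prod>n\<in>near J b (2 * m). (1 - z' / b n) * exp (z' / b n))) *
          (exp (2 * CJ * m) * norm (PP (J - near J b (2 * m)) b z'))) * ((exp (2 * norm \<kappa> * m) * norm (exp (\<kappa> * z'))) * norm (PP T ?S z'))"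
        by (intro mult_mono nJ tJ ek pT) auto
      also have "\<dots> = e1 * norm (PP J b z' * (exp (\<kappa> * z') * PP T ?S z'))"
        unfolding PP_split[OF famJ finJ[of "2 * m"], of z', OF near_subset] norm_mult e1_def by (simp only: mult_ac)
      also have "\<dots> \<le> e1 * (K * norm (PP I a z'))" by (intro mult_left_mono dec z'1) (simp add: e1_def)
      also have "norm (PP I a z') = norm (\<Prod>n\<in>near I a (2 * m). (1 - z' / a n) * exp (z' / a n)) * norm (PP (I - near I a (2 * m)) a z')"
        unfolding PP_split[OF famI finI[of "2 * m"], of z', OF near_subset] norm_mult ..
      also have "e1 * (K * \<dots>) \<le> e1 * (exp (K * m) * ((exp (- \<delta> * lsum I a (2 * m)) * PQ * norm (\<Prod>n\<in>near I a (2 * m). (1 - z / a n) * exp (z / a n))) *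
          (exp (2 * CI * m) * norm (PP (I - near I a (2 * m)) a z))))"
        using K by (intro mult_left_mono mult_mono nI tI K1 mult_nonneg_nonneg) (auto simp: e1_def PQ_def intro!: prod_nonneg divide_nonneg_nonneg, use m in linarith)
      also have "\<dots> = (e1 * exp (K * m) * exp (- \<delta> * lsum I a (2 * m)) * exp (2 * CI * m)) * PQ * norm (PP I a z)"
        unfolding PP_split[OF famI finI[of "2 * m"], of z, OF near_subset] norm_mult by (simp only: mult_ac)
      also have "e1 * exp (K * m) * exp (- \<delta> * lsum I a (2 * m)) * exp (2 * CI * m) =
          exp (\<delta> * (lsum J b (2 * m) - lsum I a (2 * m)) + (2 * CJ * m + 2 * norm \<kappa> * m + K * m + 2 * CI * m))"
        unfolding e1_def exp_add[symmetric] by (simp add: algebra_simps)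
      also have "\<dots> * PQ * norm (PP I a z) \<le> exp (C * m) * PQ * norm (PP I a z)"
      proof (intro mult_right_mono)
        \<comment> \<open>Each logarithmic sum alone may grow like ln m, which multiplied by
          \<delta> would destroy exponential type; the difference is bounded.\<close>
        have "\<delta> * (lsum J b (2 * m) - lsum I a (2 * m)) \<le> \<delta> * C0" using bal \<delta>0 by (intro mult_left_mono) auto
        also have "\<dots> \<le> 2 * m * C0" using \<delta>m C0 by (intro mult_right_mono) auto
        finally show "exp (\<delta> * (lsum J b (2 * m) - lsum I a (2 * m)) + (2 * CJ * m + 2 * norm \<kappa> * m + K * m + 2 * CI * m)) \<le> exp (C * m)"
          by (simp add: C_def algebra_simps)
        show "PQ \<ge> 0" unfolding PQ_def using m by (intro prod_nonneg divide_nonneg_nonneg) auto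
      qed simp
      finally show ?thesis .
    qed
    then show "norm (PP J b z * (exp (\<kappa> * z) * PP T ?S z)) \<le>
      exp (C * (1 + norm z)) * (\<Prod>n\<in>near I a (2 * (1 + norm z)). 4 * (1 + norm z) / norm (z - a n)) * norm (PP I a z)"
      unfolding PQ_def m_def .
  qed
qed

lemma axis_multiplier:
  assumes fdI: "fin_dens I a" "\<And>n. n \<in> I \<Longrightarrow> Re (a n) \<ge> 1"
    and fdJ: "fin_dens J b" "\<And>n. n \<in> J \<Longrightarrow> Re (b n) \<ge> 1"
    and \<eta>: "0 < \<eta>" "\<eta> \<le> 1" "\<And>n. n \<in> J \<Longrightarrow> Re (b n) \<ge> \<eta> * norm (b n)"
    and bal: "\<And>t. \<bar>lsum J b t - lsum I a t\<bar> \<le> C0"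
  obtains h K C where "h holomorphic_on UNIV" "h 0 \<noteq> 0" "K \<ge> 0" "C \<ge> 0"
    "\<And>z. Re z \<le> -1 \<Longrightarrow> norm (PP J b z * h z) * (1 + norm z) ^ d \<le> K * norm (PP I a z)"
    "\<And>z. (\<And>n. n \<in> I \<Longrightarrow> z \<noteq> a n) \<Longrightarrow> norm (PP J b z * h z) \<le>
      exp (C * (1 + norm z)) * (\<Prod>n\<in>near I a (2 * (1 + norm z)). 4 * (1 + norm z) / norm (z - a n)) * norm (PP I a z)"
proof -
  have C0: "C0 \<ge> 0" using bal[of 0] by linarith
  have bal1: "lsum J b t - lsum I a t \<ge> - C0" and bal2: "lsum J b t - lsum I a t \<le> C0" for t
    using bal[of t] by linarith+
  obtain \<kappa> T K and S :: "nat \<Rightarrow> real" where S: "fam UNIV (\<lambda>n. axis (S n))" "K \<ge> 0"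
    "\<And>z. Re z \<le> -1 \<Longrightarrow> norm (PP J b z * (exp (\<kappa> * z) * PP T (\<lambda>n. axis (S n)) z)) * (1 + norm z) ^ d \<le> K * norm (PP I a z)"
    using axis_multiplier_decay[OF fdI fdJ \<eta> bal1 C0, where d = d] by metis
  define h where "h z = exp (\<kappa> * z) * PP T (\<lambda>n. axis (S n)) z" for z
  have famT: "fam T (\<lambda>n. axis (S n))" using S(1) by (rule fam_subset) simp
  have dec: "norm (PP J b z * (exp (\<kappa> * z) * PP T (\<lambda>n. axis (S n)) z)) \<le> K * norm (PP I a z)" if "Re z \<le> -1" for z
  proof -
    have "(1 + norm z) ^ d \<ge> 1" by (rule one_le_power) simp
    then have "norm (PP J b z * (exp (\<kappa> * z) * PP T (\<lambda>n. axis (S n)) z)) * 1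
      \<le> norm (PP J b z * (exp (\<kappa> * z) * PP T (\<lambda>n. axis (S n)) z)) * (1 + norm z) ^ d" by (intro mult_left_mono) auto
    then show ?thesis using S(3)[OF that] by linarith
  qed
  obtain C where C: "C \<ge> 0" "\<And>z. (\<And>n. n \<in> I \<Longrightarrow> z \<noteq> a n) \<Longrightarrow>
    norm (PP J b z * (exp (\<kappa> * z) * PP T (\<lambda>n. axis (S n)) z)) \<le>
      exp (C * (1 + norm z)) * (\<Prod>n\<in>near I a (2 * (1 + norm z)). 4 * (1 + norm z) / norm (z - a n)) * norm (PP I a z)"
    using axis_multiplier_growth[OF fdI fdJ bal2 C0 S(1,2) dec] by metis
  show ?thesis
  proof (rule that[of h K C])
    show "h holomorphic_on UNIV" unfolding h_def[abs_def] by (intro holomorphic_intros PP_holomorphic[OF famT])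
    show "h 0 \<noteq> 0" unfolding h_def using PP_nonzero_somewhere[OF famT] by simp
  qed (use S C in \<open>auto simp: h_def\<close>)
qed

section \<open>Zero counts, mirror images and distributions\<close>

lemma entire_product_nonzero:
  assumes f: "f holomorphic_on UNIV" "f w0 \<noteq> 0" and g: "g holomorphic_on UNIV" "g w1 \<noteq> 0"
  obtains w where "f w * g w \<noteq> 0"
proof -
  obtain m q where q: "q holomorphic_on UNIV" "q w0 \<noteq> 0" "\<And>w. g w = (w - w0) ^ m * q w"
    using entire_factor_at[OF g, of w0] by blast
  have "isCont f w0" "isCont q w0"
    using f(1) q(1) holomorphic_on_imp_continuous_on continuous_on_eq_continuous_at by blast+
  then have "\<forall>\<^sub>F w in at w0. f w \<noteq> 0" "\<forall>\<^sub>F w in at w0. q w \<noteq> 0"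
    using f(2) q(2) by (auto simp: isCont_def intro: tendsto_imp_eventually_ne)
  moreover have "\<forall>\<^sub>F w in at w0. w \<noteq> w0" by (simp add: eventually_at_filter)
  ultimately have "\<forall>\<^sub>F w in at w0. f w * g w \<noteq> 0" by eventually_elim (simp add: q(3))
  then show ?thesis using that eventually_happens[of _ "at w0"] by auto
qed

lemma zero_count_mult:
  assumes f: "f holomorphic_on UNIV" "f w0 \<noteq> 0" and g: "g holomorphic_on UNIV" "g w1 \<noteq> 0"
  shows "zero_count (\<lambda>w. f w * g w) z = zero_count f z + zero_count g z"
proof -
  obtain m p where p: "p holomorphic_on UNIV" "p z \<noteq> 0" "\<And>w. f w = (w - z) ^ m * p w"
    using entire_factor_at[OF f, of z] by blast
  obtain k q where q: "q holomorphic_on UNIV" "q z \<noteq> 0" "\<And>w. g w = (w - z) ^ k * q w"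
    using entire_factor_at[OF g, of z] by blast
  have "zero_count (\<lambda>w. f w * g w) z = enat (m + k)"
    by (rule zero_count_factor[of "\<lambda>w. p w * q w"]) (use p q in \<open>auto intro!: holomorphic_intros simp: power_add\<close>)
  then show ?thesis using zero_count_factor[OF p] zero_count_factor[OF q] by simp
qed

lemma entire_affine:
  assumes "f holomorphic_on UNIV"
  shows "(\<lambda>w. f (c * w + e)) holomorphic_on UNIV"
  by (rule holomorphic_on_compose_gen[of "\<lambda>w. c * w + e" UNIV f UNIV, unfolded o_def])
    (auto intro!: holomorphic_intros assms)

lemma zero_count_affine:
  assumes f: "f holomorphic_on UNIV" "f w0 \<noteq> 0" and c: "c \<noteq> 0"
  shows "zero_count (\<lambda>w. f (c * w + e)) z = zero_count f (c * z + e)"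
proof -
  obtain m p where p: "p holomorphic_on UNIV" "p (c * z + e) \<noteq> 0" "\<And>w. f w = (w - (c * z + e)) ^ m * p w"
    using entire_factor_at[OF f, of "c * z + e"] by blast
  have "zero_count (\<lambda>w. f (c * w + e)) z = enat m"
  proof (rule zero_count_factor[of "\<lambda>w. c ^ m * p (c * w + e)"])
    show "(\<lambda>w. c ^ m * p (c * w + e)) holomorphic_on UNIV" by (intro holomorphic_intros entire_affine p)
    fix w
    have "c * w + e - (c * z + e) = (w - z) * c" by (simp add: algebra_simps)
    then show "f (c * w + e) = (w - z) ^ m * (c ^ m * p (c * w + e))" unfolding p(3) by (simp add: power_mult_distrib)
  qed (use p c in simp)
  then show ?thesis using zero_count_factor[OF p] by simp
qed

text \<open>Reflection in the imaginary axis: the modulus on the axis is preserved, and the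
  half-planes with their zeros are exchanged.\<close>

definition mirror :: "(complex \<Rightarrow> complex) \<Rightarrow> complex \<Rightarrow> complex" where
  "mirror f z = cnj (f (- cnj z))"

lemma mirror_holomorphic:
  assumes "f holomorphic_on UNIV"
  shows "mirror f holomorphic_on UNIV"
proof -
  define g where "g = cnj \<circ> f \<circ> cnj"
  have "g field_differentiable at z" for z
    unfolding g_def using assms by (intro field_differentiable_cnj_cnj holomorphic_on_imp_differentiable_at[of _ UNIV]) auto
  then have "g holomorphic_on UNIV" by (auto simp: holomorphic_on_def intro: field_differentiable_at_within)
  then have "(\<lambda>w. g ((-1) * w + 0)) holomorphic_on UNIV" by (rule entire_affine)
  moreover have "(\<lambda>w. g ((-1) * w + 0)) = mirror f" by (auto simp: g_def mirror_def)
  ultimately show ?thesis by simp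
qed

lemma mirror_axis: "norm (mirror f (axis y)) = norm (f (axis y))"
  by (simp add: mirror_def)

lemma mirror_exponential_type:
  assumes "f holomorphic_on UNIV" "exponential_type f"
  shows "exponential_type (mirror f)"
proof -
  obtain K where K: "K \<ge> 0" "\<And>z. norm (f z) \<le> exp (K * (1 + norm z))"
    using exponential_type_bound[OF assms] by blast
  show ?thesis
  proof (rule exponential_typeI[OF _ K(1)])
    show "norm (mirror f z) \<le> exp (K * (1 + norm z))" for z
      using K(2)[of "- cnj z"] by (simp add: mirror_def)
  qed
qed

lemma mirror_zero_count:
  assumes f: "f holomorphic_on UNIV" "f w0 \<noteq> 0"
  shows "zero_count (mirror f) z = zero_count f (- cnj z)"
proof -
  obtain m p where p: "p holomorphic_on UNIV" "p (- cnj z) \<noteq> 0" "\<And>w. f w = (w - (- cnj z)) ^ m * p w"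
    using entire_factor_at[OF f, of "- cnj z"] by blast
  have "zero_count (mirror f) z = enat m"
  proof (rule zero_count_factor[of "\<lambda>w. (-1) ^ m * mirror p w"])
    show "(\<lambda>w. (-1) ^ m * mirror p w) holomorphic_on UNIV" by (intro holomorphic_intros mirror_holomorphic p)
    show "(-1) ^ m * mirror p z \<noteq> 0" using p(2) by (simp add: mirror_def)
    fix w
    have "cnj (- cnj w - - cnj z) = (w - z) * (-1)" by simp
    then have "mirror f w = ((w - z) * (-1)) ^ m * mirror p w"
      unfolding mirror_def p(3) complex_cnj_mult complex_cnj_power by (simp only:)
    then show "mirror f w = (w - z) ^ m * ((-1) ^ m * mirror p w)" by (simp only: power_mult_distrib mult.assoc)
  qed
  then show ?thesis using zero_count_factor[OF p] by simp
qed

lemma mirror_nonzero: "f w0 \<noteq> 0 \<Longrightarrow> mirror f (- cnj w0) \<noteq> 0"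
  by (simp add: mirror_def)

lemma mirror_fibre: "{n\<in>I. - cnj (a n) = z} = {n\<in>I. a n = - cnj z}"
proof -
  have "- cnj u = z \<longleftrightarrow> u = - cnj z" for u by (metis complex_cnj_cnj complex_cnj_minus minus_minus)
  then show ?thesis by auto
qed

lemma lsum_mirror: "lsum I (\<lambda>n. - cnj (a n)) t = lsum I (\<lambda>n. - a n) t"
  by (simp add: lsum_def near_def pos_recip_def Re_inverse_complex)

lemma fin_dens_fibre:
  assumes "fin_dens I a"
  shows "finite {n\<in>I. a n = z}"
  by (rule finite_subset[OF _ fin_dens_near_finite[OF assms, of "norm z"]]) (auto simp: near_def)

section \<open>Hypotheses and function classes in terms of indexed families\<close>

lemma I1_iff:
  assumes fd: "fin_dens (index_set Z) (point Z)"
  shows "f \<in> I1 Z \<longleftrightarrow> f holomorphic_on UNIV \<and> (\<exists>w. f w \<noteq> 0) \<and> exponential_type f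
    \<and> (\<forall>z. vanishes f z (card {n\<in>index_set Z. point Z n = z}))"
proof -
  have "count_dist Z z = enat (card {n\<in>index_set Z. point Z n = z})" for z
    using fin_dens_fibre[OF fd] by (simp add: count_dist_def ext_card_def)
  then show ?thesis unfolding I1_def by (auto simp: vanishes_iff)
qed

lemma asymp_separated_imagE:
  assumes "asymp_separated_imag Z"
  obtains \<eta> j0 where "0 < \<eta>" "\<eta> \<le> 1" "\<And>j. j \<in> index_set Z \<Longrightarrow> j \<ge> j0 \<Longrightarrow> \<bar>Re (point Z j)\<bar> \<ge> \<eta> * norm (point Z j)"
proof -
  obtain y where y: "0 < ereal y" "ereal y < Liminf (inf sequentially (principal (index_set Z)))
       (\<lambda>j. ereal (\<bar>Re (point Z j)\<bar> / norm (point Z j)))"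
    using assms unfolding asymp_separated_imag_def using ereal_dense2 by blast
  have "\<forall>\<^sub>F j in inf sequentially (principal (index_set Z)). ereal y < ereal (\<bar>Re (point Z j)\<bar> / norm (point Z j))"
    using less_LiminfD[OF y(2)] .
  then obtain j0 where j0: "\<And>j. j \<ge> j0 \<Longrightarrow> j \<in> index_set Z \<Longrightarrow> y < \<bar>Re (point Z j)\<bar> / norm (point Z j)"
    by (auto simp: eventually_inf_principal eventually_sequentially)
  show ?thesis
  proof (rule that[of "min y 1" j0])
    show "0 < min y 1" "min y 1 \<le> 1" using y by auto
    fix j assume j: "j \<in> index_set Z" "j \<ge> j0"
    \<comment> \<open>A point 0 has the quotient 0 / 0 = 0, which is not above y; so the late points
      are nonzero.\<close>
    have pos: "norm (point Z j) > 0" using j0[OF j(2,1)] y by (cases "point Z j = 0") auto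
    have "min y 1 * norm (point Z j) \<le> y * norm (point Z j)" by (intro mult_right_mono) auto
    also have "\<dots> \<le> \<bar>Re (point Z j)\<bar>" using j0[OF j(2,1)] pos by (simp add: pos_less_divide_eq)
    finally show "\<bar>Re (point Z j)\<bar> \<ge> min y 1 * norm (point Z j)" .
  qed
qed

lemma pos_recip_neq_0D: "pos_recip z \<noteq> 0 \<Longrightarrow> Re z > 0"
  by (metis not_less pos_recip_eq_0)

lemma l_rh_eq_lsum:
  assumes "fin_dens (index_set Z) (point Z)"
  shows "l_rh Z r = lsum (index_set Z) (point Z) r"
  unfolding l_rh_def lsum_def
proof (rule sum.mono_neutral_cong_left)
  show "finite (near (index_set Z) (point Z) r)" by (rule fin_dens_near_finite[OF assms])
qed (auto simp: near_def right_half_plane_def pos_recip_pos dest: pos_recip_neq_0D)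

lemma l_lh_eq_lsum:
  assumes "fin_dens (index_set Z) (point Z)"
  shows "l_lh Z r = lsum (index_set Z) (\<lambda>n. - point Z n) r"
  unfolding l_lh_def lsum_def
proof (rule sum.mono_neutral_cong_left)
  have "near (index_set Z) (\<lambda>n. - point Z n) r = near (index_set Z) (point Z) r" by (simp add: near_def)
  then show "finite (near (index_set Z) (\<lambda>n. - point Z n) r)" using fin_dens_near_finite[OF assms] by simp
  fix j assume "j \<in> {k \<in> index_set Z. 0 < norm (point Z k) \<and> norm (point Z k) \<le> r \<and> point Z k \<in> left_half_plane}"
  then have "pos_recip (- point Z j) = Re (1 / - point Z j)" by (intro pos_recip_pos) (auto simp: left_half_plane_def)
  then show "- Re (1 / point Z j) = pos_recip (- point Z j)" by simp
qed (auto simp: near_def left_half_plane_def dest: pos_recip_neq_0D)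

text \<open>By the maximum principle a bound on one circle outside the disc of radius R controls f
  in that disc. The circle can therefore be chosen away from the zeros of denominators.\<close>

lemma exponential_type_on_circles:
  assumes f: "f holomorphic_on UNIV" and C: "C \<ge> 0"
    and bd: "\<And>R. R \<ge> 1 \<Longrightarrow> \<exists>r\<ge>R. \<forall>z. norm z = r \<longrightarrow> norm (f z) \<le> exp (C * R)"
  shows "exponential_type f"
proof (rule exponential_typeI[OF _ C])
  fix z :: complex
  obtain r where r: "r \<ge> 1 + norm z" "\<And>z'. norm z' = r \<Longrightarrow> norm (f z') \<le> exp (C * (1 + norm z))"
    using bd[of "1 + norm z"] by auto
  show "norm (f z) \<le> exp (C * (1 + norm z))"
  proof (rule maximum_modulus_frontier[where S = "cball 0 r" and f = f])
    show "f holomorphic_on interior (cball 0 r)" using f by (rule holomorphic_on_subset) simp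
    show "continuous_on (closure (cball 0 r)) f"
      using holomorphic_on_imp_continuous_on[OF f] by (rule continuous_on_subset) simp
    show "norm (f w) \<le> exp (C * (1 + norm z))" if "w \<in> frontier (cball 0 r)" for w
    proof -
      have "r > 0" using r(1) norm_ge_zero[of z] by linarith
      then have "norm w = r" using that by simp
      then show ?thesis by (rule r(2))
    qed
  qed (use r in auto)
qed

lemma fam_of_fin_dens_nonzero:
  assumes fd: "fin_dens I a" and nz: "\<And>n. n \<in> I \<Longrightarrow> a n \<noteq> 0"
  obtains c where "c > 0" "\<And>n. n \<in> I \<Longrightarrow> norm (a n) \<ge> c" "fam I a"
proof -
  define X where "X = insert 1 ((\<lambda>n. norm (a n)) ` near I a 1)"
  define c where "c = Min X"
  have X: "finite X" "X \<noteq> {}" using fin_dens_near_finite[OF fd] by (auto simp: X_def)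
  have c: "c > 0" unfolding c_def using X nz by (subst Min_gr_iff) (auto simp: X_def near_def)
  have c2: "norm (a n) \<ge> c" if "n \<in> I" for n
  proof (cases "norm (a n) \<le> 1")
    case True
    then show ?thesis unfolding c_def using X that by (intro Min_le) (auto simp: X_def near_def)
  next
    case False
    have "c \<le> 1" unfolding c_def using X by (intro Min_le) (auto simp: X_def)
    then show ?thesis using False by linarith
  qed
  show ?thesis using that[OF c c2 fam_of_fin_dens[OF fd c c2]] .
qed

text \<open>The derivative of the left side in r is twice the Poisson sum at r, hence at most 2 C,
  and both sides vanish at r = 0.\<close>

lemma sum_ln_quadratic_bound:
  fixes F :: "nat set"
  assumes F: "finite F" and C: "\<And>s. s > 0 \<Longrightarrow> (\<Sum>n\<in>F. s / ((b n)\<^sup>2 + s\<^sup>2)) \<le> C"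
    and b: "\<And>n. n \<in> F \<Longrightarrow> b n > (0::real)" and r: "r \<ge> 0"
  shows "(\<Sum>n\<in>F. ln (1 + r\<^sup>2 / (b n)\<^sup>2)) \<le> 2 * C * r"
proof -
  define \<phi> where "\<phi> s = 2 * C * s - (\<Sum>n\<in>F. ln (1 + s\<^sup>2 / (b n)\<^sup>2))" for s :: real
  have d: "(\<phi> has_real_derivative 2 * C - (\<Sum>n\<in>F. 2 * (s / ((b n)\<^sup>2 + s\<^sup>2)))) (at s)" for s
    unfolding \<phi>_def[abs_def]
  proof (intro DERIV_diff DERIV_sum)
    show "((\<lambda>s. 2 * C * s) has_real_derivative 2 * C) (at s)" by (auto intro!: derivative_eq_intros)
    fix n assume n: "n \<in> F"
    have b0: "b n > 0" using b[OF n] .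
    have pos: "1 + s\<^sup>2 / (b n)\<^sup>2 > 0" by (simp add: add_pos_nonneg)
    have e: "1 / (1 + s\<^sup>2 / (b n)\<^sup>2) * (2 * s / (b n)\<^sup>2) = 2 * (s / ((b n)\<^sup>2 + s\<^sup>2))"
    proof -
      have "1 + s\<^sup>2 / (b n)\<^sup>2 = ((b n)\<^sup>2 + s\<^sup>2) / (b n)\<^sup>2" using b0 by (simp add: add_divide_distrib)
      then show ?thesis using b0 by simp
    qed
    have "((\<lambda>s. s\<^sup>2) has_real_derivative 2 * s) (at s)" by (auto intro!: derivative_eq_intros)
    from DERIV_add[OF DERIV_const DERIV_cdivide[OF this]]
    have "((\<lambda>s. 1 + s\<^sup>2 / (b n)\<^sup>2) has_real_derivative 2 * s / (b n)\<^sup>2) (at s)" by simp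
    from DERIV_chain2[OF DERIV_ln_divide[OF pos] this]
    have "((\<lambda>s. ln (1 + s\<^sup>2 / (b n)\<^sup>2)) has_real_derivative 1 / (1 + s\<^sup>2 / (b n)\<^sup>2) * (2 * s / (b n)\<^sup>2)) (at s)" .
    then show "((\<lambda>s. ln (1 + s\<^sup>2 / (b n)\<^sup>2)) has_real_derivative 2 * (s / ((b n)\<^sup>2 + s\<^sup>2))) (at s)" unfolding e .
  qed
  have "\<phi> 0 \<le> \<phi> r"
  proof (rule DERIV_nonneg_imp_increasing_open[OF r])
    fix s assume "0 < s" "s < r"
    then have "(\<Sum>n\<in>F. 2 * (s / ((b n)\<^sup>2 + s\<^sup>2))) \<le> 2 * C" unfolding sum_distrib_left[symmetric] using C[of s] by simp
    then show "\<exists>y. (\<phi> has_real_derivative y) (at s) \<and> 0 \<le> y" using d[of s] by force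
  next
    show "continuous_on {0..r} \<phi>" using d by (intro continuous_at_imp_continuous_on ballI DERIV_isCont)
  qed
  then show ?thesis by (simp add: \<phi>_def)
qed

text \<open>The factors at z and - z multiply to 1 - (z / a)^2: the exponentials cancel, and finite
  density alone gives exponential type.\<close>

lemma symmetric_product_exponential_type:
  assumes fd: "fin_dens I a" and nz: "\<And>n. n \<in> I \<Longrightarrow> a n \<noteq> 0"
  shows "exponential_type (\<lambda>z. PP I a z * PP I a (- z))"
proof -
  obtain c where c: "c > 0" "\<And>n. n \<in> I \<Longrightarrow> norm (a n) \<ge> c" "fam I a"
    using fam_of_fin_dens_nonzero[OF fd nz] by blast
  obtain C where C: "C \<ge> 0" "\<And>F s. finite F \<Longrightarrow> F \<subseteq> I \<Longrightarrow> s > 0 \<Longrightarrow>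
      (\<Sum>n\<in>F. s / ((norm (a n))\<^sup>2 + s\<^sup>2)) \<le> C" using fin_dens_poisson_sum[OF fd c(1,2)] by metis
  have bd: "norm (PP I a z * PP I a (- z)) \<le> exp (2 * C * norm z)" for z
  proof (rule LIMSEQ_le_const2[OF tendsto_norm[OF tendsto_mult[OF PP_LIMSEQ[OF c(3), of z] PP_LIMSEQ[OF c(3), of "- z"]]]])
    have "norm ((\<Prod>n<N. pfac I a n z) * (\<Prod>n<N. pfac I a n (- z))) \<le> exp (2 * C * norm z)" for N
    proof -
      let ?F = "{..<N} \<inter> I"
      have "norm ((\<Prod>n<N. pfac I a n z) * (\<Prod>n<N. pfac I a n (- z))) = (\<Prod>n<N. norm (pfac I a n z * pfac I a n (- z)))"
        unfolding prod.distrib[symmetric] prod_norm[symmetric] ..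
      also have "\<dots> \<le> (\<Prod>n<N. if n \<in> I then exp (ln (1 + (norm z)\<^sup>2 / (norm (a n))\<^sup>2)) else 1)"
      proof (rule prod_mono, intro conjI norm_ge_zero)
        fix n
        show "norm (pfac I a n z * pfac I a n (- z)) \<le> (if n \<in> I then exp (ln (1 + (norm z)\<^sup>2 / (norm (a n))\<^sup>2)) else 1)"
        proof (cases "n \<in> I")
          case True
          have "pfac I a n z * pfac I a n (- z) = ((1 - z / a n) * (1 + z / a n)) * (exp (z / a n) * exp (- (z / a n)))"
            using True by (simp add: pfac_def)
          also have "\<dots> = 1 - (z / a n)\<^sup>2" by (simp add: exp_add[symmetric] power2_eq_square algebra_simps)
          finally have "norm (pfac I a n z * pfac I a n (- z)) \<le> 1 + norm ((z / a n)\<^sup>2)"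
            using norm_triangle_ineq4[of 1 "(z / a n)\<^sup>2"] by simp
          moreover have "norm ((z / a n)\<^sup>2) = (norm z)\<^sup>2 / (norm (a n))\<^sup>2" by (simp add: norm_power norm_divide power_divide)
          moreover have "1 + (norm z)\<^sup>2 / (norm (a n))\<^sup>2 > 0" by (simp add: add_pos_nonneg)
          ultimately show ?thesis using True by simp
        qed (simp add: pfac_def)
      qed
      also have "\<dots> = (\<Prod>n\<in>?F. exp (ln (1 + (norm z)\<^sup>2 / (norm (a n))\<^sup>2)))" by (rule prod.inter_restrict[symmetric]) simp
      also have "\<dots> = exp (\<Sum>n\<in>?F. ln (1 + (norm z)\<^sup>2 / (norm (a n))\<^sup>2))" by (rule exp_sum[symmetric]) simp
      also have "\<dots> \<le> exp (2 * C * norm z)"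
        unfolding exp_le_cancel_iff by (rule sum_ln_quadratic_bound) (use C nz in auto)
      finally show ?thesis .
    qed
    then show "\<exists>N. \<forall>n\<ge>N. norm ((\<Prod>n<n. pfac I a n z) * (\<Prod>n<n. pfac I a n (- z))) \<le> exp (2 * C * norm z)" by blast
  qed
  show ?thesis
  proof (rule exponential_typeI)
    fix z :: complex
    have "exp (2 * C * norm z) \<le> exp ((2 * C) * (1 + norm z))" using C(1) by (simp add: algebra_simps)
    then show "norm (PP I a z * PP I a (- z)) \<le> exp ((2 * C) * (1 + norm z))" using bd[of z] by linarith
  qed (use C in simp)
qed

text \<open>The symmetric product adds to the prescribed zeros only their negatives, which lie in
  the left half-plane.\<close>

lemma exists_function_with_right_zeros:
  assumes fd: "fin_dens I a" and Re: "\<And>n. n \<in> I \<Longrightarrow> Re (a n) > 0"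
  obtains g where "g holomorphic_on UNIV" "g 0 \<noteq> 0" "exponential_type g"
    "\<And>z. Re z > 0 \<Longrightarrow> zero_count g z = enat (card {n\<in>I. a n = z})"
proof -
  have nz: "a n \<noteq> 0" if "n \<in> I" for n using Re[OF that] by auto
  have fam: "fam I a" using fam_of_fin_dens_nonzero[OF fd nz] by blast
  have h1: "PP I a holomorphic_on UNIV" "PP I a 0 \<noteq> 0" using PP_holomorphic[OF fam] PP_nonzero_somewhere[OF fam] by blast+
  have h2: "(\<lambda>z. PP I a (- z)) holomorphic_on UNIV" using entire_affine[OF h1(1), of "-1" 0] by simp
  show ?thesis
  proof (rule that[of "\<lambda>z. PP I a z * PP I a (- z)"])
    show "(\<lambda>z. PP I a z * PP I a (- z)) holomorphic_on UNIV" by (intro holomorphic_intros h1 h2)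
    show "PP I a 0 * PP I a (- 0) \<noteq> 0" using h1 by simp
    show "exponential_type (\<lambda>z. PP I a z * PP I a (- z))" by (rule symmetric_product_exponential_type[OF fd nz])
    fix z :: complex assume z: "Re z > 0"
    have "PP I a (- z) \<noteq> 0" unfolding PP_eq_0_iff[OF fam] using Re z by force
    then have "zero_count (\<lambda>z. PP I a (- z)) z = 0" by (simp add: zero_count_def)
    moreover have "PP I a (- 0) \<noteq> 0" using h1 by simp
    ultimately show "zero_count (\<lambda>z. PP I a z * PP I a (- z)) z = enat (card {n\<in>I. a n = z})"
      using zero_count_mult[OF h1 h2, of 0 z] PP_zero_count[OF fam, of z] by simp
  qed
qed

section \<open>The two half-planes\<close>

text \<open>A point of the right half-plane with real part below 2 contributes at most 2 / |v|^2,
  and these bounds are summable outside the unit disc.\<close>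

lemma lsum_strip_bounded:
  assumes fd: "fin_dens I v"
  obtains C where "C \<ge> 0" "\<And>t. \<bar>lsum I v t - lsum {n\<in>I. Re (v n) \<ge> 2} v t\<bar> \<le> C"
proof -
  note fin = fin_dens_near_finite[OF fd]
  let ?I1 = "{n\<in>I. Re (v n) \<ge> 2}" and ?I2 = "{n\<in>I. norm (v n) \<ge> 1}"
  have fd2: "fin_dens ?I2 v" using fd by (rule fin_dens_subset) auto
  obtain C where C: "C \<ge> 0" "\<And>F T. finite F \<Longrightarrow> F \<subseteq> ?I2 \<Longrightarrow> T > 0 \<Longrightarrow> (\<And>n. n \<in> F \<Longrightarrow> norm (v n) \<ge> T) \<Longrightarrow>
      (\<Sum>n\<in>F. 1 / (norm (v n))\<^sup>2) \<le> C / T"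
    by (rule fin_dens_tail_sum[OF fd2, where c = 1]) auto
  show ?thesis
  proof (rule that[of "lsum I v 1 + 2 * C"])
    show "lsum I v 1 + 2 * C \<ge> 0" using lsum_nonneg_mono(1)[of I v 1, OF fin order_refl] C(1) by simp
    fix t
    define D where "D = near I v t - near ?I1 v t"
    have sub: "near ?I1 v t \<subseteq> near I v t" by (auto simp: near_def)
    have finD: "finite D" using fin by (simp add: D_def)
    have eq: "lsum I v t - lsum ?I1 v t = (\<Sum>n\<in>D. pos_recip (v n))"
      unfolding lsum_def D_def by (rule sum_diff[OF fin sub, symmetric])
    have nn: "(\<Sum>n\<in>D. pos_recip (v n)) \<ge> 0" by (intro sum_nonneg pos_recip_bounds)
    have "(\<Sum>n\<in>D. pos_recip (v n)) \<le> (\<Sum>n\<in>D. (if norm (v n) \<le> 1 then pos_recip (v n) else 0) + 2 * (if norm (v n) \<le> 1 then 0 else 1 / (norm (v n))\<^sup>2))"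
    proof (rule sum_mono)
      fix n assume n: "n \<in> D"
      show "pos_recip (v n) \<le> (if norm (v n) \<le> 1 then pos_recip (v n) else 0) + 2 * (if norm (v n) \<le> 1 then 0 else 1 / (norm (v n))\<^sup>2)"
      proof (cases "norm (v n) \<le> 1 \<or> Re (v n) \<le> 0")
        case True
        then show ?thesis by (auto simp: pos_recip_eq_0)
      next
        case False
        have "Re (v n) \<le> 2" using n by (auto simp: D_def near_def)
        then have "pos_recip (v n) \<le> 2 / (norm (v n))\<^sup>2"
          using False by (simp add: pos_recip_pos Re_inverse_complex divide_right_mono)
        then show ?thesis using False by simp
      qed
    qed
    also have "\<dots> = (\<Sum>n\<in>D. if norm (v n) \<le> 1 then pos_recip (v n) else 0) + 2 * (\<Sum>n\<in>D. if norm (v n) \<le> 1 then 0 else 1 / (norm (v n))\<^sup>2)"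
      by (simp only: sum.distrib sum_distrib_left)
    also have "(\<Sum>n\<in>D. if norm (v n) \<le> 1 then pos_recip (v n) else 0) = (\<Sum>n\<in>{n\<in>D. norm (v n) \<le> 1}. pos_recip (v n))"
      using finD by (simp add: sum.inter_filter)
    also have "\<dots> \<le> lsum I v 1" unfolding lsum_def
      by (rule sum_mono2[OF fin]) (auto simp: D_def near_def pos_recip_bounds)
    also have "(\<Sum>n\<in>D. if norm (v n) \<le> 1 then 0 else 1 / (norm (v n))\<^sup>2) = (\<Sum>n\<in>{n\<in>D. \<not> norm (v n) \<le> 1}. 1 / (norm (v n))\<^sup>2)"
    proof -
      have "(\<Sum>n\<in>{n\<in>D. \<not> norm (v n) \<le> 1}. 1 / (norm (v n))\<^sup>2) = (\<Sum>n\<in>D. if \<not> norm (v n) \<le> 1 then 1 / (norm (v n))\<^sup>2 else 0)"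
        by (rule sum.inter_filter[OF finD])
      also have "\<dots> = (\<Sum>n\<in>D. if norm (v n) \<le> 1 then 0 else 1 / (norm (v n))\<^sup>2)" by (intro sum.cong) auto
      finally show ?thesis by simp
    qed
    also have "\<dots> \<le> C / 1"
    proof (rule C(2))
      show "finite {n\<in>D. \<not> norm (v n) \<le> 1}" by (rule finite_subset[OF _ finD]) auto
    qed (auto simp: D_def near_def)
    finally show "\<bar>lsum I v t - lsum ?I1 v t\<bar> \<le> lsum I v 1 + 2 * C" using nn unfolding eq by simp
  qed
qed

lemma lsum_diff_subset:
  assumes fin: "\<And>t. finite (near J b t)" and sub: "J1 \<subseteq> J" and r: "r \<le> R"
  shows "lsum J1 b R - lsum J1 b r \<le> lsum J b R - lsum J b r"
proof -
  have "near J1 b t \<subseteq> near J b t" for t using sub by (auto simp: near_def)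
  then have fin1: "finite (near J1 b t)" for t using fin finite_subset by blast
  show ?thesis unfolding lsum_diff_eq[OF fin r] lsum_diff_eq[OF fin1 r]
    using fin sub by (intro sum_mono2) (auto simp: near_def pos_recip_bounds)
qed

text \<open>Translation by 1 carries points of real part at least 2 to real part at least 1 and the
  imaginary axis to the line Re w = -1, where the multiplier is small. Omitting the points of real
  part below 2 and translating change the sums by O(1), so the balance survives for the greedy
  choice.\<close>

lemma half_plane_multiplier:
  fixes v z :: "nat \<Rightarrow> complex"
  assumes fdI: "fin_dens I v" and fdJ: "fin_dens J z" and J1: "J1 \<subseteq> J" "\<And>n. n \<in> J1 \<Longrightarrow> Re (z n) \<ge> 2"
    and \<eta>: "0 < \<eta>" "\<eta> \<le> 1" "\<And>n. n \<in> J1 \<Longrightarrow> Re (z n) \<ge> \<eta> * norm (z n)"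
    and bal: "\<And>r R. 0 < r \<Longrightarrow> r < R \<Longrightarrow> lsum J z R - lsum J z r \<le> lsum I v R - lsum I v r + C0"
  obtains A h K C where "A \<subseteq> {n\<in>I. Re (v n) \<ge> 2}" "fam A (\<lambda>n. v n - 1)" "fam J1 (\<lambda>n. z n - 1)"
    "h holomorphic_on UNIV" "h 0 \<noteq> 0" "K \<ge> 0" "C \<ge> 0"
    "\<And>w. Re w \<le> -1 \<Longrightarrow> norm (PP J1 (\<lambda>n. z n - 1) w * h w) * (1 + norm w) ^ d \<le> K * norm (PP A (\<lambda>n. v n - 1) w)"
    "\<And>w. (\<And>n. n \<in> A \<Longrightarrow> w \<noteq> v n - 1) \<Longrightarrow> norm (PP J1 (\<lambda>n. z n - 1) w * h w) \<le>
      exp (C * (1 + norm w)) * (\<Prod>n\<in>near A (\<lambda>n. v n - 1) (2 * (1 + norm w)). 4 * (1 + norm w) / norm (w - (v n - 1))) * norm (PP A (\<lambda>n. v n - 1) w)"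
proof -
  define I1 where "I1 = {n\<in>I. Re (v n) \<ge> 2}"
  have fdI1: "fin_dens I1 v" using fdI by (rule fin_dens_subset) (auto simp: I1_def)
  have fdJ1: "fin_dens J1 z" using fdJ J1(1) by (rule fin_dens_subset)
  have s: "(\<lambda>n. u n - 1) = (\<lambda>n. u n + -1)" for u :: "nat \<Rightarrow> complex" by simp
  have fdI1': "fin_dens I1 (\<lambda>n. v n - 1)" unfolding s by (rule fin_dens_shift[OF fdI1])
  have fdJ1': "fin_dens J1 (\<lambda>n. z n - 1)" unfolding s by (rule fin_dens_shift[OF fdJ1])
  obtain c1 where c1: "c1 \<ge> 0" "\<And>t. \<bar>lsum I v t - lsum I1 v t\<bar> \<le> c1"
    unfolding I1_def using lsum_strip_bounded[OF fdI] by metis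
  obtain c2 where c2: "c2 \<ge> 0" "\<And>t. \<bar>lsum I1 (\<lambda>n. v n - 1) t - lsum I1 v t\<bar> \<le> c2"
    unfolding s using lsum_shift[OF fdI1] by metis
  obtain c3 where c3: "c3 \<ge> 0" "\<And>t. \<bar>lsum J1 (\<lambda>n. z n - 1) t - lsum J1 z t\<bar> \<le> c3"
    unfolding s using lsum_shift[OF fdJ1] by metis
  define c where "c = \<bar>C0\<bar> + 2 * c1 + 2 * c2 + 2 * c3"
  have Re1: "\<And>n. n \<in> I1 \<Longrightarrow> Re (v n - 1) \<ge> 1" "\<And>n. n \<in> J1 \<Longrightarrow> Re (z n - 1) \<ge> 1"
    using J1(2) by (force simp: I1_def)+
  have n1: "norm w \<ge> 1" if "Re w \<ge> 1" for w using that complex_Re_le_cmod[of w] by linarith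
  obtain A where A: "A \<subseteq> I1" "\<And>t. \<bar>lsum J1 (\<lambda>n. z n - 1) t - lsum A (\<lambda>n. v n - 1) t\<bar> \<le> c + 1"
  proof (rule greedy_subfamily[of I1 "\<lambda>n. v n - 1" J1 "\<lambda>n. z n - 1" c])
    show "finite (near I1 (\<lambda>n. v n - 1) t)" for t by (rule fin_dens_near_finite[OF fdI1'])
    show "finite (near J1 (\<lambda>n. z n - 1) t)" for t by (rule fin_dens_near_finite[OF fdJ1'])
    show "norm (v n - 1) \<ge> 1" if "n \<in> I1" for n by (rule n1[OF Re1(1)[OF that]])
    show "norm (z n - 1) \<ge> 1" if "n \<in> J1" for n by (rule n1[OF Re1(2)[OF that]])
    show "c \<ge> 0" using c1(1) c2(1) c3(1) by (simp add: c_def)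
    fix r R :: real assume rR: "0 < r" "r < R"
    have "lsum J1 z R - lsum J1 z r \<le> lsum J z R - lsum J z r"
      by (rule lsum_diff_subset[OF fin_dens_near_finite[OF fdJ] J1(1)]) (use rR in simp)
    then show "lsum J1 (\<lambda>n. z n - 1) R - lsum J1 (\<lambda>n. z n - 1) r \<le> lsum I1 (\<lambda>n. v n - 1) R - lsum I1 (\<lambda>n. v n - 1) r + c"
      using bal[OF rR] c1(2)[of r] c1(2)[of R] c2(2)[of r] c2(2)[of R] c3(2)[of r] c3(2)[of R]
      unfolding c_def by linarith
  qed blast
  have fdA: "fin_dens A (\<lambda>n. v n - 1)" using fdI1' A(1) by (rule fin_dens_subset)
  have ReA: "\<And>n. n \<in> A \<Longrightarrow> Re (v n - 1) \<ge> 1" using A(1) Re1(1) by blast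
  \<comment> \<open>Separation survives the translation with \<eta> / 4, because x + 1 <= 4 (x - 1)
    for x >= 2.\<close>
  have sep: "Re (z n - 1) \<ge> (\<eta> / 4) * norm (z n - 1)" if n: "n \<in> J1" for n
  proof -
    have "norm (z n - 1) \<le> norm (z n) + 1" using norm_triangle_ineq4[of "z n" 1] by simp
    then have "\<eta> * norm (z n - 1) \<le> \<eta> * (norm (z n) + 1)" using \<eta> by (intro mult_left_mono) auto
    also have "\<dots> \<le> Re (z n) + 1" using \<eta>(2) \<eta>(3)[OF n] by (simp add: distrib_left)
    also have "\<dots> \<le> 4 * Re (z n - 1)" using J1(2)[OF n] by simp
    finally show ?thesis by simp
  qed
  have \<eta>4: "0 < \<eta> / 4" "\<eta> / 4 \<le> 1" using \<eta> by auto
  obtain h K C where h: "h holomorphic_on UNIV" "h 0 \<noteq> 0" "K \<ge> 0" "C \<ge> 0"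
    "\<And>w. Re w \<le> -1 \<Longrightarrow> norm (PP J1 (\<lambda>n. z n - 1) w * h w) * (1 + norm w) ^ d \<le> K * norm (PP A (\<lambda>n. v n - 1) w)"
    "\<And>w. (\<And>n. n \<in> A \<Longrightarrow> w \<noteq> v n - 1) \<Longrightarrow> norm (PP J1 (\<lambda>n. z n - 1) w * h w) \<le>
      exp (C * (1 + norm w)) * (\<Prod>n\<in>near A (\<lambda>n. v n - 1) (2 * (1 + norm w)). 4 * (1 + norm w) / norm (w - (v n - 1))) * norm (PP A (\<lambda>n. v n - 1) w)"
    by (rule axis_multiplier[OF fdA ReA fdJ1' Re1(2) \<eta>4 sep A(2), where d = d]) blast+
  show ?thesis
    by (rule that[OF A(1)[unfolded I1_def] fam_cnj(1)[OF fdA ReA] fam_cnj(1)[OF fdJ1' Re1(2)] h])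
qed

lemma prod_norm_le_power:
  fixes z :: "nat \<Rightarrow> complex"
  assumes "finite F"
  shows "norm (\<Prod>n\<in>F. w - z n) \<le> (\<Prod>n\<in>F. 1 + norm (z n)) * (1 + norm w) ^ card F"
proof -
  have "norm (\<Prod>n\<in>F. w - z n) \<le> (\<Prod>n\<in>F. (1 + norm (z n)) * (1 + norm w))"
    unfolding prod_norm[symmetric]
  proof (rule prod_mono, intro conjI norm_ge_zero)
    fix n
    have "norm (w - z n) \<le> norm w + norm (z n)" by (rule norm_triangle_ineq4)
    also have "\<dots> \<le> (1 + norm (z n)) * (1 + norm w)" by (simp add: algebra_simps)
    finally show "norm (w - z n) \<le> (1 + norm (z n)) * (1 + norm w)" .
  qed
  then show ?thesis by (simp add: prod.distrib)
qed

text \<open>The radius is good for the original points v, while the products involve a = v - 1 with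
  u = w - 1 in one half-plane and a = - v - 1 with u = - w - 1 in the other. The quantification over
  a and u lets one circle serve both. From r <= 2 R come 1 + |u| <= 4 R, |v| <= 9 R and the factor
  16 R.\<close>

lemma circle_product_bound:
  fixes v :: "nat \<Rightarrow> complex"
  assumes fd: "fin_dens I v"
  obtains K where "K \<ge> 0" "\<And>R. R \<ge> 1 \<Longrightarrow> \<exists>r. R \<le> r \<and> r \<le> 2 * R \<and> (\<forall>n\<in>I. norm (v n) \<noteq> r) \<and>
    (\<forall>A w a u. A \<subseteq> I \<longrightarrow> norm w = r \<longrightarrow> norm u \<le> r + 1 \<longrightarrow> (\<forall>n\<in>A. norm (v n) \<le> norm (a n) + 1 \<and> norm (u - a n) = norm (w - v n)) \<longrightarrow>
      (\<Prod>n\<in>near A a (2 * (1 + norm u)). 4 * (1 + norm u) / norm (u - a n)) \<le> exp (K * R))"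
proof -
  obtain K where K: "K \<ge> 1" "\<And>t. finite (near I v t)" "\<And>t. t \<ge> 0 \<Longrightarrow> real (card (near I v t)) \<le> K * (1 + t)"
    using fin_densE[OF fd] by blast
  show ?thesis
  proof (rule that[of "191 * K"])
    show "191 * K \<ge> 0" using K by simp
    fix R :: real assume R: "R \<ge> 1"
    let ?F = "near I v (9 * R)"
    have R0: "R > 0" using R by simp
    obtain r where r: "R \<le> r" "r \<le> 2 * R" "\<And>n. n \<in> ?F \<Longrightarrow> r \<noteq> norm (v n)"
      "(\<Sum>n\<in>?F. ln (10 * R / \<bar>r - norm (v n)\<bar>)) \<le> 18 * real (card ?F) + 1"
      using good_radius[OF K(2) R0, of "9 * R" "\<lambda>n. norm (v n)"] by metis
    define X where "X = (\<Prod>n\<in>?F. 16 * R / \<bar>r - norm (v n)\<bar>)"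
    have pos: "\<bar>r - norm (v n)\<bar> > 0" if "n \<in> ?F" for n using r(3)[OF that] by simp
    have ne: "norm (v n) \<noteq> r" if "n \<in> I" for n
      using r(2) r(3)[of n] that R by (auto simp: near_def)
    have "X = exp (\<Sum>n\<in>?F. ln (16 * R / \<bar>r - norm (v n)\<bar>))"
    proof -
      have "X = (\<Prod>n\<in>?F. exp (ln (16 * R / \<bar>r - norm (v n)\<bar>)))"
        unfolding X_def by (intro prod.cong refl exp_ln[symmetric] divide_pos_pos pos) (use R in auto)
      then show ?thesis using exp_sum[OF K(2)] by metis
    qed
    also have "(\<Sum>n\<in>?F. ln (16 * R / \<bar>r - norm (v n)\<bar>)) \<le> (\<Sum>n\<in>?F. ln (10 * R / \<bar>r - norm (v n)\<bar>) + 1)"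
    proof (rule sum_mono)
      fix n assume n: "n \<in> ?F"
      have e: "16 * R / \<bar>r - norm (v n)\<bar> = (10 * R / \<bar>r - norm (v n)\<bar>) * (8 / 5)" by simp
      have "ln (16 * R / \<bar>r - norm (v n)\<bar>) = ln (10 * R / \<bar>r - norm (v n)\<bar>) + ln (8 / 5)"
        unfolding e using R pos[OF n] by (intro ln_mult_pos divide_pos_pos) auto
      moreover have "ln (8 / 5 :: real) \<le> 8 / 5 - 1" by (rule ln_le_minus_one) simp
      ultimately show "ln (16 * R / \<bar>r - norm (v n)\<bar>) \<le> ln (10 * R / \<bar>r - norm (v n)\<bar>) + 1" by linarith
    qed
    also have "\<dots> = (\<Sum>n\<in>?F. ln (10 * R / \<bar>r - norm (v n)\<bar>)) + real (card ?F)" by (simp add: sum.distrib)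
    also have "\<dots> \<le> 19 * real (card ?F) + 1" using r(4) by linarith
    also have "\<dots> \<le> 19 * (K * (10 * R)) + 1"
    proof -
      have "K * (1 + 9 * R) \<le> K * (10 * R)" using K(1) R by (intro mult_left_mono) auto
      then show ?thesis using K(3)[of "9 * R"] R by linarith
    qed
    also have "\<dots> \<le> 191 * K * R"
    proof -
      have "1 * 1 \<le> K * R" using K(1) R by (intro mult_mono) auto
      then show ?thesis by simp
    qed
    finally have X: "X \<le> exp (191 * K * R)" by simp
    show "\<exists>r. R \<le> r \<and> r \<le> 2 * R \<and> (\<forall>n\<in>I. norm (v n) \<noteq> r) \<and>
      (\<forall>A w a u. A \<subseteq> I \<longrightarrow> norm w = r \<longrightarrow> norm u \<le> r + 1 \<longrightarrow> (\<forall>n\<in>A. norm (v n) \<le> norm (a n) + 1 \<and> norm (u - a n) = norm (w - v n)) \<longrightarrow>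
        (\<Prod>n\<in>near A a (2 * (1 + norm u)). 4 * (1 + norm u) / norm (u - a n)) \<le> exp (191 * K * R))"
    proof (intro exI[of _ r] conjI ballI allI impI r(1,2) ne)
      fix A w u and a :: "nat \<Rightarrow> complex"
      assume A: "A \<subseteq> I" and w: "norm w = r" and u: "norm u \<le> r + 1"
        and a: "\<forall>n\<in>A. norm (v n) \<le> norm (a n) + 1 \<and> norm (u - a n) = norm (w - v n)"
      let ?G = "near A a (2 * (1 + norm u))"
      have uR: "1 + norm u \<le> 4 * R" using u r(2) R by linarith
      have G: "?G \<subseteq> ?F"
      proof
        fix n assume "n \<in> ?G"
        then have n: "n \<in> A" "norm (a n) \<le> 2 * (1 + norm u)" by (auto simp: near_def)
        have "norm (v n) \<le> norm (a n) + 1" using a n(1) by blast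
        then show "n \<in> ?F" using n uR R A by (auto simp: near_def)
      qed
      have "(\<Prod>n\<in>?G. 4 * (1 + norm u) / norm (u - a n)) \<le> (\<Prod>n\<in>?G. 16 * R / \<bar>r - norm (v n)\<bar>)"
      proof (rule prod_mono, intro conjI)
        fix n assume n: "n \<in> ?G"
        then have e: "norm (u - a n) = norm (w - v n)" using a by (auto simp: near_def)
        have le: "\<bar>r - norm (v n)\<bar> \<le> norm (u - a n)" unfolding e w[symmetric] by (rule norm_triangle_ineq3)
        show "4 * (1 + norm u) / norm (u - a n) \<ge> 0" by (intro divide_nonneg_nonneg) (auto intro: add_nonneg_nonneg)
        have "n \<in> ?F" using n G by blast
        note p = pos[OF this]
        have "4 * (1 + norm u) / norm (u - a n) \<le> 16 * R / norm (u - a n)" using uR by (intro divide_right_mono) auto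
        also have "\<dots> \<le> 16 * R / \<bar>r - norm (v n)\<bar>" using le p R by (intro divide_left_mono mult_pos_pos) auto
        finally show "4 * (1 + norm u) / norm (u - a n) \<le> 16 * R / \<bar>r - norm (v n)\<bar>" .
      qed
      also have "\<dots> \<le> X" unfolding X_def
      proof (rule prod_mono2[OF K(2) G])
        fix n assume "n \<in> ?F - ?G"
        then have n: "n \<in> ?F" by blast
        have "norm (v n) \<le> 9 * R" using n by (simp add: near_def)
        then have "\<bar>r - norm (v n)\<bar> \<le> 16 * R" using r(1,2) R norm_ge_zero[of "v n"] by linarith
        then show "1 \<le> 16 * R / \<bar>r - norm (v n)\<bar>" using pos[OF n] by simp
      qed (use R in auto)
      also note X
      finally show "(\<Prod>n\<in>?G. 4 * (1 + norm u) / norm (u - a n)) \<le> exp (191 * K * R)" .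
    qed
  qed
qed

section \<open>Construction of the dominated function\<close>

text \<open>Here g = P1 P2 q, where P1 and P2 vanish on the subfamilies of zeros chosen in the two
  half-planes. The function f is q times the replacements Q1 H1 and Q2 H2, a polynomial T for the
  points of J left over, and a normalizing constant.\<close>

lemma dominated_function_exists:
  fixes v z :: "nat \<Rightarrow> complex"
  assumes fdJ: "fin_dens J z"
    and \<eta>: "0 < \<eta>" "\<eta> \<le> 1" "\<And>j. j \<in> J \<Longrightarrow> j \<ge> j0 \<Longrightarrow> \<bar>Re (z j)\<bar> \<ge> \<eta> * norm (z j)"
    and g: "g holomorphic_on UNIV" "g w0 \<noteq> 0" "exponential_type g"
    and v: "\<And>w. finite {n\<in>I. v n = w}" "\<And>w. zero_count g w = enat (card {n\<in>I. v n = w})"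
    and bal1: "\<And>r R. 0 < r \<Longrightarrow> r < R \<Longrightarrow> lsum J z R - lsum J z r \<le> lsum I v R - lsum I v r + C0"
    and bal2: "\<And>r R. 0 < r \<Longrightarrow> r < R \<Longrightarrow> lsum J (\<lambda>n. - z n) R - lsum J (\<lambda>n. - z n) r \<le> lsum I (\<lambda>n. - v n) R - lsum I (\<lambda>n. - v n) r + C0"
  obtains f w1 where "f holomorphic_on UNIV" "f w1 \<noteq> 0" "exponential_type f"
    "\<And>w. vanishes f w (card {n\<in>J. z n = w})" "\<And>y::real. norm (f (axis y)) \<le> norm (g (axis y))"
proof -
  have fdI: "fin_dens I v"
    by (rule jensen_fin_dens[OF g v(1)]) (use vanishes_iff[OF g(1,2)] v(2) in simp)
  have fdI': "fin_dens I (\<lambda>n. - v n)" by (rule fin_dens_norm[OF fdI]) simp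
  have fdJ': "fin_dens J (\<lambda>n. - z n)" by (rule fin_dens_norm[OF fdJ]) simp
  define J1 where "J1 = {n\<in>J. Re (z n) \<ge> 2 \<and> Re (z n) \<ge> \<eta> * norm (z n)}"
  define J2 where "J2 = {n\<in>J. Re (- z n) \<ge> 2 \<and> Re (- z n) \<ge> \<eta> * norm (- z n)}"
  \<comment> \<open>Points of J with index at least j0 that miss both J1 and J2 have |Re z| < 2, and
    then modulus at most 2 / \<eta> by separation. So finitely many are left over, and they become
    the zeros of the polynomial T of degree d.\<close>
  define J3 where "J3 = J - J1 - J2"
  have J3: "finite J3"
  proof (rule finite_subset)
    show "J3 \<subseteq> {..<j0} \<union> near J z (2 / \<eta>)"
    proof
      fix n assume n: "n \<in> J3"
      show "n \<in> {..<j0} \<union> near J z (2 / \<eta>)"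
      proof (cases "n < j0")
        case False
        then have s: "\<bar>Re (z n)\<bar> \<ge> \<eta> * norm (z n)" using \<eta>(3)[of n] n by (auto simp: J3_def)
        then have "\<bar>Re (z n)\<bar> < 2" using n by (auto simp: J3_def J1_def J2_def abs_if split: if_splits)
        then have "\<eta> * norm (z n) \<le> 2" using s by linarith
        then have "norm (z n) \<le> 2 / \<eta>" using \<eta>(1) by (simp add: pos_le_divide_eq mult.commute)
        then show ?thesis using n by (auto simp: J3_def near_def)
      qed simp
    qed
    show "finite ({..<j0} \<union> near J z (2 / \<eta>))" using fin_dens_near_finite[OF fdJ] by simp
  qed
  define d where "d = card J3"
  have J1: "J1 \<subseteq> J" "\<And>n. n \<in> J1 \<Longrightarrow> Re (z n) \<ge> 2" "\<And>n. n \<in> J1 \<Longrightarrow> Re (z n) \<ge> \<eta> * norm (z n)" by (auto simp: J1_def)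
  have J2: "J2 \<subseteq> J" "\<And>n. n \<in> J2 \<Longrightarrow> Re (- z n) \<ge> 2" "\<And>n. n \<in> J2 \<Longrightarrow> Re (- z n) \<ge> \<eta> * norm (- z n)" by (auto simp: J2_def)
  define a1 where "a1 n = v n - 1" for n
  define b1 where "b1 n = z n - 1" for n
  define a2 where "a2 n = - v n - 1" for n
  define b2 where "b2 n = - z n - 1" for n
  obtain A1 h1 K1 C1 where A1: "A1 \<subseteq> {n\<in>I. Re (v n) \<ge> 2}" "fam A1 a1" "fam J1 b1"
    and h1: "h1 holomorphic_on UNIV" "h1 0 \<noteq> 0" and K1: "K1 \<ge> 0" "C1 \<ge> 0"
    "\<And>w. Re w \<le> -1 \<Longrightarrow> norm (PP J1 b1 w * h1 w) * (1 + norm w) ^ d \<le> K1 * norm (PP A1 a1 w)"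
    "\<And>w. (\<And>n. n \<in> A1 \<Longrightarrow> w \<noteq> a1 n) \<Longrightarrow> norm (PP J1 b1 w * h1 w) \<le>
      exp (C1 * (1 + norm w)) * (\<Prod>n\<in>near A1 a1 (2 * (1 + norm w)). 4 * (1 + norm w) / norm (w - a1 n)) * norm (PP A1 a1 w)"
    unfolding a1_def[abs_def] b1_def[abs_def]
    by (rule half_plane_multiplier[OF fdI fdJ J1(1,2) \<eta>(1,2) J1(3) bal1, where d = d]) blast+
  \<comment> \<open>The left half-plane is treated through - v and - z. The polynomial T is paid for
    by the first multiplier, hence the exponent 0 here.\<close>
  obtain A2 h2 K2 C2 where A2: "A2 \<subseteq> {n\<in>I. Re (- v n) \<ge> 2}" "fam A2 a2" "fam J2 b2"
    and h2: "h2 holomorphic_on UNIV" "h2 0 \<noteq> 0" and K2: "K2 \<ge> 0" "C2 \<ge> 0"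
    "\<And>w. Re w \<le> -1 \<Longrightarrow> norm (PP J2 b2 w * h2 w) * (1 + norm w) ^ 0 \<le> K2 * norm (PP A2 a2 w)"
    "\<And>w. (\<And>n. n \<in> A2 \<Longrightarrow> w \<noteq> a2 n) \<Longrightarrow> norm (PP J2 b2 w * h2 w) \<le>
      exp (C2 * (1 + norm w)) * (\<Prod>n\<in>near A2 a2 (2 * (1 + norm w)). 4 * (1 + norm w) / norm (w - a2 n)) * norm (PP A2 a2 w)"
    unfolding a2_def[abs_def] b2_def[abs_def]
    by (rule half_plane_multiplier[OF fdI' fdJ' J2(1,2) \<eta>(1,2) J2(3) bal2, where d = 0]) blast+
  define P1 where "P1 w = PP A1 a1 (1 * w + (-1))" for w
  define P2 where "P2 w = PP A2 a2 ((-1) * w + (-1))" for w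
  define Q1 where "Q1 w = PP J1 b1 (1 * w + (-1))" for w
  define Q2 where "Q2 w = PP J2 b2 ((-1) * w + (-1))" for w
  define H1 where "H1 w = h1 (1 * w + (-1))" for w
  define H2 where "H2 w = h2 ((-1) * w + (-1))" for w
  define T where "T w = (\<Prod>n\<in>J3. w - z n)" for w
  note PPs = PP_holomorphic[OF A1(2)] PP_holomorphic[OF A2(2)] PP_holomorphic[OF A1(3)] PP_holomorphic[OF A2(3)]
  have hol: "P1 holomorphic_on UNIV" "P2 holomorphic_on UNIV" "Q1 holomorphic_on UNIV" "Q2 holomorphic_on UNIV"
    "H1 holomorphic_on UNIV" "H2 holomorphic_on UNIV" "T holomorphic_on UNIV"
    unfolding P1_def[abs_def] P2_def[abs_def] Q1_def[abs_def] Q2_def[abs_def] H1_def[abs_def] H2_def[abs_def] T_def[abs_def]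
    by (rule entire_affine[OF PPs(1)], rule entire_affine[OF PPs(2)], rule entire_affine[OF PPs(3)], rule entire_affine[OF PPs(4)],
      rule entire_affine[OF h1(1)], rule entire_affine[OF h2(1)], intro holomorphic_intros)
  note PPn = PP_nonzero_somewhere[OF A1(2)] PP_nonzero_somewhere[OF A2(2)] PP_nonzero_somewhere[OF A1(3)] PP_nonzero_somewhere[OF A2(3)]
  have nz: "P1 1 \<noteq> 0" "P2 (-1) \<noteq> 0" "Q1 1 \<noteq> 0" "Q2 (-1) \<noteq> 0" "H1 1 \<noteq> 0" "H2 (-1) \<noteq> 0"
    using PPn h1(2) h2(2) by (simp_all add: P1_def P2_def Q1_def Q2_def H1_def H2_def)
  have zc: "zero_count P1 w = enat (card {n\<in>A1. v n = w})" "zero_count P2 w = enat (card {n\<in>A2. v n = w})"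
    "zero_count Q1 w = enat (card {n\<in>J1. z n = w})" "zero_count Q2 w = enat (card {n\<in>J2. z n = w})" for w
  proof -
    have e1: "{n\<in>X. u n - 1 = 1 * w + (-1)} = {n\<in>X. u n = w}" for X and u :: "nat \<Rightarrow> complex" by auto
    have e2: "{n\<in>X. - u n - 1 = (-1) * w + (-1)} = {n\<in>X. u n = w}" for X and u :: "nat \<Rightarrow> complex" by auto
    show "zero_count P1 w = enat (card {n\<in>A1. v n = w})"
      unfolding P1_def[abs_def] zero_count_affine[OF PPs(1) PPn(1) one_neq_zero] PP_zero_count[OF A1(2)] a1_def e1 ..
    show "zero_count Q1 w = enat (card {n\<in>J1. z n = w})"
      unfolding Q1_def[abs_def] zero_count_affine[OF PPs(3) PPn(3) one_neq_zero] PP_zero_count[OF A1(3)] b1_def e1 ..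
    have m1: "(-1 :: complex) \<noteq> 0" by simp
    show "zero_count P2 w = enat (card {n\<in>A2. v n = w})"
      unfolding P2_def[abs_def] zero_count_affine[OF PPs(2) PPn(2) m1] PP_zero_count[OF A2(2)] a2_def e2 ..
    show "zero_count Q2 w = enat (card {n\<in>J2. z n = w})"
      unfolding Q2_def[abs_def] zero_count_affine[OF PPs(4) PPn(4) m1] PP_zero_count[OF A2(3)] b2_def e2 ..
  qed
  have holP: "(\<lambda>w. P1 w * P2 w) holomorphic_on UNIV" by (intro holomorphic_intros hol)
  obtain wP where wP: "P1 wP * P2 wP \<noteq> 0" using entire_product_nonzero[OF hol(1) nz(1) hol(2) nz(2)] by blast
  have disj: "A1 \<inter> A2 = {}" using A1(1) A2(1) by force
  have "zero_count (\<lambda>w. P1 w * P2 w) w \<le> zero_count g w" for w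
  proof -
    have fin: "finite {n\<in>I. v n = w}" by (rule v(1))
    have "card {n\<in>A1. v n = w} + card {n\<in>A2. v n = w} = card ({n\<in>A1. v n = w} \<union> {n\<in>A2. v n = w})"
    proof (rule card_Un_disjoint[symmetric])
      show "finite {n\<in>A1. v n = w}" "finite {n\<in>A2. v n = w}" by (rule finite_subset[OF _ fin], use A1(1) A2(1) in auto)+
    qed (use disj in auto)
    also have "\<dots> \<le> card {n\<in>I. v n = w}" by (rule card_mono[OF fin]) (use A1(1) A2(1) in auto)
    finally show ?thesis unfolding zero_count_mult[OF hol(1) nz(1) hol(2) nz(2)] zc v(2) by simp
  qed
  then have "vanishes g w m" if "vanishes (\<lambda>w. P1 w * P2 w) w m" for w m
    using that vanishes_iff[OF holP wP] vanishes_iff[OF g(1,2)] order_trans by blast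
  then obtain q where q: "q holomorphic_on UNIV" "\<And>w. g w = (P1 w * P2 w) * q w"
    using entire_divide[OF g(1) holP wP] by metis
  have qnz: "q w0 \<noteq> 0" using q(2)[of w0] g(2) by auto
  define B where "B = (\<Prod>n\<in>J3. 1 + norm (z n))"
  have B: "B \<ge> 0" unfolding B_def by (intro prod_nonneg) (auto intro: add_nonneg_nonneg)
  have Tbd: "norm (T w) \<le> B * (1 + norm w) ^ d" for w
    unfolding T_def B_def d_def by (rule prod_norm_le_power[OF J3])
  \<comment> \<open>Turns the bound by B K1 K2 |g| on the axis into |f| <= |g|; the summand 1 covers
    the case that this constant is 0.\<close>
  define e where "e = 1 / (1 + B * K1 * K2)"
  have BK: "B * K1 * K2 \<ge> 0" using B K1(1) K2(1) by simp
  have e: "e > 0" "e \<le> 1" "e * (B * K1 * K2) \<le> 1" using BK by (auto simp: e_def)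
  define f where "f w = (T w * Q1 w * Q2 w) * (of_real e * (H1 w * H2 w * q w))" for w
  have fn: "norm (f w) = e * norm (T w) * norm (Q1 w * H1 w) * norm (Q2 w * H2 w) * norm (q w)" for w
    using e(1) by (simp add: f_def norm_mult)
  have holQ: "(\<lambda>w. T w * Q1 w) holomorphic_on UNIV" "(\<lambda>w. T w * Q1 w * Q2 w) holomorphic_on UNIV"
    "(\<lambda>w. H1 w * H2 w) holomorphic_on UNIV" "(\<lambda>w. H1 w * H2 w * q w) holomorphic_on UNIV"
    "(\<lambda>w. of_real e * (H1 w * H2 w * q w)) holomorphic_on UNIV"
    by (intro holomorphic_intros hol q)+
  have holf: "f holomorphic_on UNIV" unfolding f_def[abs_def] by (intro holomorphic_on_mult holQ)
  obtain wf where wf: "f wf \<noteq> 0"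
  proof -
    have "infinite (UNIV :: complex set)" using infinite_UNIV_char_0 by blast
    then obtain w1 where "w1 \<notin> z ` J3" using J3 by (metis UNIV_eq_I finite_imageI)
    then have "T w1 \<noteq> 0" using J3 by (auto simp: T_def)
    then obtain w2 where "T w2 * Q1 w2 \<noteq> 0" using entire_product_nonzero[OF hol(7) _ hol(3) nz(3)] by blast
    then obtain w3 where w3: "T w3 * Q1 w3 * Q2 w3 \<noteq> 0" using entire_product_nonzero[OF holQ(1) _ hol(4) nz(4)] by blast
    obtain w4 where "H1 w4 * H2 w4 \<noteq> 0" using entire_product_nonzero[OF hol(5) nz(5) hol(6) nz(6)] by blast
    then obtain w5 where "H1 w5 * H2 w5 * q w5 \<noteq> 0" using entire_product_nonzero[OF holQ(3) _ q(1) qnz] by blast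
    then have "of_real e * (H1 w5 * H2 w5 * q w5) \<noteq> 0" using e(1) by simp
    then show ?thesis using that entire_product_nonzero[OF holQ(2) w3 holQ(5)] unfolding f_def by blast
  qed
  have van: "vanishes f w (card {n\<in>J. z n = w})" for w
  proof -
    have fin: "finite {n\<in>J. z n = w}" by (rule fin_dens_fibre[OF fdJ])
    have f3: "finite {n\<in>X. z n = w}" if "X \<subseteq> J" for X by (rule finite_subset[OF _ fin]) (use that in auto)
    have J3J: "J3 \<subseteq> J" by (auto simp: J3_def)
    have dj: "J1 \<inter> J2 = {}" using J1(2) J2(2) by force
    have "{n\<in>J. z n = w} = {n\<in>J3. z n = w} \<union> {n\<in>J1. z n = w} \<union> {n\<in>J2. z n = w}" using J1(1) J2(1) by (auto simp: J3_def)
    also have "card \<dots> = card ({n\<in>J3. z n = w} \<union> {n\<in>J1. z n = w}) + card {n\<in>J2. z n = w}"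
      using f3[OF J3J] f3[OF J1(1)] f3[OF J2(1)] dj by (intro card_Un_disjoint) (auto simp: J3_def)
    also have "card ({n\<in>J3. z n = w} \<union> {n\<in>J1. z n = w}) = card {n\<in>J3. z n = w} + card {n\<in>J1. z n = w}"
      using f3[OF J3J] f3[OF J1(1)] by (intro card_Un_disjoint) (auto simp: J3_def)
    finally have c: "card {n\<in>J. z n = w} = card {n\<in>J3. z n = w} + card {n\<in>J1. z n = w} + card {n\<in>J2. z n = w} + 0" by simp
    have v3: "vanishes T w (card {n\<in>J3. z n = w})" unfolding T_def[abs_def] using vanishes_prod_iff[OF J3] by blast
    have v1: "vanishes Q1 w (card {n\<in>J1. z n = w})" using vanishes_iff[OF hol(3) nz(3)] zc(3) by simp
    have v2: "vanishes Q2 w (card {n\<in>J2. z n = w})" using vanishes_iff[OF hol(4) nz(4)] zc(4) by simp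
    show ?thesis unfolding c f_def[abs_def]
      by (intro vanishes_mult v1 v2 v3 vanishes_0[OF holQ(5)])
  qed
  have axis: "norm (f (axis y)) \<le> norm (g (axis y))" for y :: real
  proof -
    let ?w = "axis y"
    let ?u = "1 * ?w + (-1)"
    have 1: "norm (Q1 ?w * H1 ?w) * (1 + norm ?u) ^ d \<le> K1 * norm (P1 ?w)"
      unfolding Q1_def H1_def P1_def by (rule K1(3)) simp
    have 2: "norm (Q2 ?w * H2 ?w) \<le> K2 * norm (P2 ?w)"
      using K2(3)[of "(-1) * ?w + (-1)"] unfolding Q2_def H2_def P2_def by simp
    have "norm ?w \<le> norm ?u" using abs_Im_le_cmod[of ?u] by (simp add: norm_mult)
    then have "(1 + norm ?w) ^ d \<le> (1 + norm ?u) ^ d" by (intro power_mono) auto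
    then have "B * (1 + norm ?w) ^ d \<le> B * (1 + norm ?u) ^ d" using B by (rule mult_left_mono)
    then have 3: "norm (T ?w) \<le> B * (1 + norm ?u) ^ d" using Tbd[of ?w] by linarith
    have "norm (T ?w) * norm (Q1 ?w * H1 ?w) \<le> (B * (1 + norm ?u) ^ d) * norm (Q1 ?w * H1 ?w)"
      by (rule mult_right_mono[OF 3]) simp
    also have "\<dots> = B * (norm (Q1 ?w * H1 ?w) * (1 + norm ?u) ^ d)" by (simp only: mult_ac)
    also have "\<dots> \<le> B * (K1 * norm (P1 ?w))" by (rule mult_left_mono[OF 1 B])
    finally have 4: "norm (T ?w) * norm (Q1 ?w * H1 ?w) \<le> B * (K1 * norm (P1 ?w))" .
    have "norm (f ?w) = e * (norm (T ?w) * norm (Q1 ?w * H1 ?w)) * norm (Q2 ?w * H2 ?w) * norm (q ?w)"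
      unfolding fn by (simp only: mult_ac)
    also have "\<dots> \<le> e * (B * (K1 * norm (P1 ?w))) * (K2 * norm (P2 ?w)) * norm (q ?w)"
      using e(1) B K1(1) K2(1) by (intro mult_mono 2 4 order_refl mult_nonneg_nonneg) auto
    also have "\<dots> = (e * (B * K1 * K2)) * norm (g ?w)" unfolding q(2) norm_mult by (simp only: mult_ac)
    also have "\<dots> \<le> 1 * norm (g ?w)" by (rule mult_right_mono[OF e(3)]) simp
    finally show ?thesis by simp
  qed
  have expf: "exponential_type f"
  proof -
    obtain Kg where Kg: "Kg \<ge> 0" "\<And>w. norm (g w) \<le> exp (Kg * (1 + norm w))"
      using exponential_type_bound[OF g(1,3)] by blast
    obtain K where K: "K \<ge> 0" "\<And>R. R \<ge> 1 \<Longrightarrow> \<exists>r. R \<le> r \<and> r \<le> 2 * R \<and> (\<forall>n\<in>I. norm (v n) \<noteq> r) \<and>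
    (\<forall>A w a u. A \<subseteq> I \<longrightarrow> norm w = r \<longrightarrow> norm u \<le> r + 1 \<longrightarrow> (\<forall>n\<in>A. norm (v n) \<le> norm (a n) + 1 \<and> norm (u - a n) = norm (w - v n)) \<longrightarrow>
      (\<Prod>n\<in>near A a (2 * (1 + norm u)). 4 * (1 + norm u) / norm (u - a n)) \<le> exp (K * R))"
      using circle_product_bound[OF fdI] by metis
    define C where "C = B + 2 * real d + 4 * C1 + 4 * C2 + 2 * K + 3 * Kg"
    show ?thesis
    proof (rule exponential_type_on_circles[OF holf])
      show "C \<ge> 0" using B K1(2) K2(2) K(1) Kg(1) by (simp add: C_def)
      fix R :: real assume R: "R \<ge> 1"
      \<comment> \<open>The circle is good relative to all zeros of g, so it suits both half-planes
        and misses the points at which the growth estimates say nothing.\<close>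
      obtain r where r: "R \<le> r" "r \<le> 2 * R" "\<And>n. n \<in> I \<Longrightarrow> norm (v n) \<noteq> r" and
        pr: "\<And>A w a u. A \<subseteq> I \<Longrightarrow> norm w = r \<Longrightarrow> norm u \<le> r + 1 \<Longrightarrow> (\<And>n. n \<in> A \<Longrightarrow> norm (v n) \<le> norm (a n) + 1 \<and> norm (u - a n) = norm (w - v n)) \<Longrightarrow>
      (\<Prod>n\<in>near A a (2 * (1 + norm u)). 4 * (1 + norm u) / norm (u - a n)) \<le> exp (K * R)"
        using K(2)[OF R] by metis
      show "\<exists>r\<ge>R. \<forall>w. norm w = r \<longrightarrow> norm (f w) \<le> exp (C * R)"
      proof (intro exI[of _ r] conjI allI impI r(1))
        fix w :: complex assume w: "norm w = r"
        have A1I: "A1 \<subseteq> I" and A2I: "A2 \<subseteq> I" using A1(1) A2(1) by auto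
        define u1 where "u1 = 1 * w + (-1)"
        define u2 where "u2 = (-1) * w + (-1)"
        have u1: "norm u1 \<le> r + 1" using norm_triangle_ineq4[of w 1] w by (simp add: u1_def)
        have u2: "norm u2 \<le> r + 1" using norm_triangle_ineq4[of "- w" 1] w by (simp add: u2_def)
        have d1: "u1 - a1 n = w - v n" for n by (simp add: u1_def a1_def)
        have d2: "u2 - a2 n = - (w - v n)" for n by (simp add: u2_def a2_def)
        have v1: "norm (v n) \<le> norm (a1 n) + 1" for n using norm_triangle_ineq[of "a1 n" 1] by (simp add: a1_def)
        have v2: "norm (v n) \<le> norm (a2 n) + 1" for n using norm_triangle_ineq[of "a2 n" 1] by (simp add: a2_def)
        have p1: "(\<Prod>n\<in>near A1 a1 (2 * (1 + norm u1)). 4 * (1 + norm u1) / norm (u1 - a1 n)) \<le> exp (K * R)"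
          by (rule pr[OF A1I w u1]) (simp add: d1 v1)
        have p2: "(\<Prod>n\<in>near A2 a2 (2 * (1 + norm u2)). 4 * (1 + norm u2) / norm (u2 - a2 n)) \<le> exp (K * R)"
          by (rule pr[OF A2I w u2]) (simp add: d2 v2 norm_minus_commute)
        have ne: "w \<noteq> v n" if "n \<in> I" for n using r(3)[OF that] w by auto
        have E: "exp (c * (1 + norm u)) \<le> exp (4 * c * R)" if "c \<ge> 0" "norm u \<le> r + 1" for c and u :: complex
        proof -
          have "1 + norm u \<le> 4 * R" using that(2) r(2) R by linarith
          then have "c * (1 + norm u) \<le> c * (4 * R)" using that(1) by (rule mult_left_mono)
          then show ?thesis by simp
        qed
        have b1: "norm (Q1 w * H1 w) \<le> exp (4 * C1 * R) * exp (K * R) * norm (P1 w)"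
        proof -
          have "u1 \<noteq> a1 n" if "n \<in> A1" for n using ne[of n] d1[of n] that A1I by auto
          then have "norm (PP J1 b1 u1 * h1 u1) \<le> exp (C1 * (1 + norm u1)) * (\<Prod>n\<in>near A1 a1 (2 * (1 + norm u1)). 4 * (1 + norm u1) / norm (u1 - a1 n)) * norm (PP A1 a1 u1)"
            by (rule K1(4))
          also have "\<dots> \<le> exp (4 * C1 * R) * exp (K * R) * norm (PP A1 a1 u1)"
            by (intro mult_mono p1 E K1(2) u1 order_refl mult_nonneg_nonneg prod_nonneg divide_nonneg_nonneg) (auto intro: add_nonneg_nonneg)
          finally show ?thesis unfolding Q1_def H1_def P1_def u1_def .
        qed
        have b2: "norm (Q2 w * H2 w) \<le> exp (4 * C2 * R) * exp (K * R) * norm (P2 w)"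
        proof -
          have "u2 \<noteq> a2 n" if "n \<in> A2" for n using ne[of n] d2[of n] that A2I by auto
          then have "norm (PP J2 b2 u2 * h2 u2) \<le> exp (C2 * (1 + norm u2)) * (\<Prod>n\<in>near A2 a2 (2 * (1 + norm u2)). 4 * (1 + norm u2) / norm (u2 - a2 n)) * norm (PP A2 a2 u2)"
            by (rule K2(4))
          also have "\<dots> \<le> exp (4 * C2 * R) * exp (K * R) * norm (PP A2 a2 u2)"
            by (intro mult_mono p2 E K2(2) u2 order_refl mult_nonneg_nonneg prod_nonneg divide_nonneg_nonneg) (auto intro: add_nonneg_nonneg)
          finally show ?thesis unfolding Q2_def H2_def P2_def u2_def .
        qed
        have b3: "norm (T w) \<le> exp (B * R) * exp (2 * real d * R)"
        proof -
          have "B \<le> B * R" using mult_left_mono[OF R B] by simp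
          also have "\<dots> \<le> exp (B * R)" using exp_ge_add_one_self[of "B * R"] by linarith
          finally have "B \<le> exp (B * R)" .
          moreover have "(1 + norm w) ^ d \<le> exp (2 * real d * R)"
          proof -
            have "(1 + norm w) ^ d \<le> exp r ^ d" using exp_ge_add_one_self[of r] w by (intro power_mono) auto
            also have "\<dots> = exp (real d * r)" by (simp add: exp_of_nat_mult)
            also have "\<dots> \<le> exp (2 * real d * R)" using mult_left_mono[OF r(2), of "real d"] by simp
            finally show ?thesis .
          qed
          ultimately have "B * (1 + norm w) ^ d \<le> exp (B * R) * exp (2 * real d * R)" using B by (intro mult_mono) auto
          then show ?thesis using Tbd[of w] by linarith
        qed
        have b4: "norm (g w) \<le> exp (3 * Kg * R)"
        proof -
          have "Kg * (1 + norm w) \<le> Kg * (3 * R)" using w r(2) R Kg(1) by (intro mult_left_mono) auto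
          then have "exp (Kg * (1 + norm w)) \<le> exp (3 * Kg * R)" by simp
          then show ?thesis using Kg(2)[of w] by linarith
        qed
        have "norm (f w) \<le> 1 * (exp (B * R) * exp (2 * real d * R)) * (exp (4 * C1 * R) * exp (K * R) * norm (P1 w)) * (exp (4 * C2 * R) * exp (K * R) * norm (P2 w)) * norm (q w)"
          unfolding fn using e(1,2) by (intro mult_mono b1 b2 b3 order_refl mult_nonneg_nonneg) auto
        also have "\<dots> = (exp (B * R) * exp (2 * real d * R) * exp (4 * C1 * R) * exp (K * R) * exp (4 * C2 * R) * exp (K * R)) * norm (g w)"
          unfolding q(2) norm_mult by (simp only: mult_ac mult_1_left)
        also have "\<dots> \<le> (exp (B * R) * exp (2 * real d * R) * exp (4 * C1 * R) * exp (K * R) * exp (4 * C2 * R) * exp (K * R)) * exp (3 * Kg * R)"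
          by (rule mult_left_mono[OF b4]) simp
        also have "\<dots> = exp (C * R)" unfolding exp_add[symmetric] C_def by (simp add: algebra_simps)
        finally show "norm (f w) \<le> exp (C * R)" .
      qed
    qed
  qed
  show ?thesis by (rule that[OF holf wf expf van axis])
qed

text \<open>Reflecting f compares its zeros in the left half-plane with those of g in the right one;
  reflecting g does the converse; neither changes a modulus on the axis. For f = g the last
  comparison says that zeros in the right half-plane force zeros of at least the same logarithmic
  size, up to O(1), in the left one.\<close>

lemma carleman_comparison_both:
  assumes f: "f holomorphic_on UNIV" "f w0 \<noteq> 0" "exponential_type f"
    and g: "g holomorphic_on UNIV" "g w1 \<noteq> 0" "exponential_type g"
    and le: "\<And>y::real. norm (f (axis y)) \<le> norm (g (axis y))"
    and b: "\<And>z. finite {n\<in>J. b n = z}" "\<And>z. vanishes f z (card {n\<in>J. b n = z})"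
    and a: "\<And>z. finite {n\<in>I. a n = z}" "\<And>z. zero_count g z = enat (card {n\<in>I. a n = z})"
  obtains C where "C \<ge> 0"
    "\<And>r R. 0 < r \<Longrightarrow> r < R \<Longrightarrow> lsum J b R - lsum J b r \<le> lsum I a R - lsum I a r + C"
    "\<And>r R. 0 < r \<Longrightarrow> r < R \<Longrightarrow> lsum J (\<lambda>n. - b n) R - lsum J (\<lambda>n. - b n) r \<le> lsum I a R - lsum I a r + C"
    "\<And>r R. 0 < r \<Longrightarrow> r < R \<Longrightarrow> lsum J b R - lsum J b r \<le> lsum I (\<lambda>n. - a n) R - lsum I (\<lambda>n. - a n) r + C"
proof -
  note mf = mirror_holomorphic[OF f(1)] mirror_nonzero[of f, OF f(2)] mirror_exponential_type[OF f(1,3)]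
  note mg = mirror_holomorphic[OF g(1)] mirror_nonzero[of g, OF g(2)] mirror_exponential_type[OF g(1,3)]
  have le1: "norm (mirror f (axis y)) \<le> norm (g (axis y))" for y :: real
    unfolding mirror_axis by (rule le)
  have le2: "norm (f (axis y)) \<le> norm (mirror g (axis y))" for y :: real
    unfolding mirror_axis by (rule le)
  have b': "finite {n\<in>J. - cnj (b n) = z}" "vanishes (mirror f) z (card {n\<in>J. - cnj (b n) = z})" for z
  proof -
    show "finite {n\<in>J. - cnj (b n) = z}" unfolding mirror_fibre by (rule b(1))
    show "vanishes (mirror f) z (card {n\<in>J. - cnj (b n) = z})"
      unfolding mirror_fibre vanishes_iff[OF mf(1,2)] mirror_zero_count[OF f(1,2)]
      using b(2)[of "- cnj z"] unfolding vanishes_iff[OF f(1,2)] .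
  qed
  have a': "finite {n\<in>I. - cnj (a n) = z}" "zero_count (mirror g) z = enat (card {n\<in>I. - cnj (a n) = z})" for z
    unfolding mirror_fibre mirror_zero_count[OF g(1,2)] by (rule a)+
  obtain C1 where C1: "C1 \<ge> 0" "\<And>r R. 0 < r \<Longrightarrow> r < R \<Longrightarrow> lsum J b R - lsum J b r \<le> lsum I a R - lsum I a r + C1"
    by (rule carleman_comparison[OF f g le b a]) blast
  obtain C2 where C2: "C2 \<ge> 0" "\<And>r R. 0 < r \<Longrightarrow> r < R \<Longrightarrow> lsum J (\<lambda>n. - cnj (b n)) R - lsum J (\<lambda>n. - cnj (b n)) r \<le> lsum I a R - lsum I a r + C2"
    by (rule carleman_comparison[OF mf g le1 b' a]) blast
  obtain C3 where C3: "C3 \<ge> 0" "\<And>r R. 0 < r \<Longrightarrow> r < R \<Longrightarrow> lsum J b R - lsum J b r \<le> lsum I (\<lambda>n. - cnj (a n)) R - lsum I (\<lambda>n. - cnj (a n)) r + C3"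
    by (rule carleman_comparison[OF f mg le2 b a']) blast
  show ?thesis
  proof (rule that[of "C1 + C2 + C3"])
    show "C1 + C2 + C3 \<ge> 0" using C1 C2 C3 by simp
    fix r R :: real assume rR: "0 < r" "r < R"
    show "lsum J b R - lsum J b r \<le> lsum I a R - lsum I a r + (C1 + C2 + C3)"
      using C1(2)[OF rR] C2(1) C3(1) by linarith
    show "lsum J (\<lambda>n. - b n) R - lsum J (\<lambda>n. - b n) r \<le> lsum I a R - lsum I a r + (C1 + C2 + C3)"
      using C2(2)[OF rR] C1(1) C3(1) unfolding lsum_mirror by linarith
    show "lsum J b R - lsum J b r \<le> lsum I (\<lambda>n. - a n) R - lsum I (\<lambda>n. - a n) r + (C1 + C2 + C3)"
      using C3(2)[OF rR] C1(1) C2(1) unfolding lsum_mirror by linarith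
  qed
qed

theorem mainTheorem1:
  fixes Z W :: distribution
  assumes "points_in W right_half_plane"
    and "finite_upper_density Z" and "finite_upper_density W"
    and "asymp_separated_imag Z" and "asymp_separated_imag W"
  shows
    "let I = (\<forall>g \<in> I1 W. \<exists>f \<in> I1 Z.
                \<forall>y::real. norm (f (\<i> * of_real y)) \<le> norm (g (\<i> * of_real y)));
         II = (\<exists>f \<in> I1 Z. \<exists>g \<in> I1 W.
                (\<forall>z. restrict_count (zero_count g) right_half_plane z = count_dist W z)
                \<and> (\<forall>y::real. norm (f (\<i> * of_real y)) \<le> norm (g (\<i> * of_real y))));
         III = (\<exists>C::real. C \<ge> 0 \<and>
                 (\<forall>r R. 0 < r \<and> r < R \<longrightarrow> l_char Z r R \<le> l_char W r R + C))
     in (I \<longleftrightarrow> II) \<and> (II \<longleftrightarrow> III)"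
proof -
  let ?J = "index_set Z" and ?z = "point Z" and ?M = "index_set W" and ?w = "point W"
  have fdZ: "fin_dens ?J ?z" and fdW: "fin_dens ?M ?w"
    using assms(2,3) by (auto intro: finite_upper_density_imp_fin_dens)
  have ReW: "Re (?w n) > 0" if "n \<in> ?M" for n
    using assms(1) that by (auto simp: points_in_def right_half_plane_def)
  have cW: "count_dist W z = enat (card {n\<in>?M. ?w n = z})" for z
    using fin_dens_fibre[OF fdW] by (simp add: count_dist_def ext_card_def)
  \<comment> \<open>W has no points in the left half-plane, so the maximum in \<open>l_char\<close>
    is the sum for the right one.\<close>
  have lW: "l_char W r R = lsum ?M ?w R - lsum ?M ?w r" if "r < R" for r R
  proof -
    have "lsum ?M (\<lambda>n. - ?w n) t = 0" for t
      unfolding lsum_def using ReW by (intro sum.neutral) (auto simp: near_def pos_recip_eq_0 less_imp_le)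
    moreover have "lsum ?M ?w r \<le> lsum ?M ?w R" by (rule lsum_nonneg_mono(2)) (use that fin_dens_near_finite[OF fdW] in auto)
    ultimately show ?thesis by (simp add: l_char_def l_rh_eq_lsum[OF fdW] l_lh_eq_lsum[OF fdW])
  qed
  have lZ: "l_char Z r R = max (lsum ?J (\<lambda>n. - ?z n) R - lsum ?J (\<lambda>n. - ?z n) r) (lsum ?J ?z R - lsum ?J ?z r)" for r R
    by (simp add: l_char_def l_rh_eq_lsum[OF fdZ] l_lh_eq_lsum[OF fdZ])
  define I where "I \<longleftrightarrow> (\<forall>g \<in> I1 W. \<exists>f \<in> I1 Z. \<forall>y::real. norm (f (axis y)) \<le> norm (g (axis y)))"
  define II where "II \<longleftrightarrow> (\<exists>f \<in> I1 Z. \<exists>g \<in> I1 W. (\<forall>z. restrict_count (zero_count g) right_half_plane z = count_dist W z)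
                \<and> (\<forall>y::real. norm (f (axis y)) \<le> norm (g (axis y))))"
  define III where "III \<longleftrightarrow> (\<exists>C::real. C \<ge> 0 \<and> (\<forall>r R. 0 < r \<and> r < R \<longrightarrow> l_char Z r R \<le> l_char W r R + C))"
  have "II" if "I"
  proof -
    \<comment> \<open>A function whose zeros in the right half-plane are exactly W; the f that
      statement I supplies for it serves in II.\<close>
    obtain g where g: "g holomorphic_on UNIV" "g 0 \<noteq> 0" "exponential_type g"
      "\<And>z. Re z > 0 \<Longrightarrow> zero_count g z = enat (card {n\<in>?M. ?w n = z})"
      using exists_function_with_right_zeros[OF fdW ReW] by metis
    have r: "restrict_count (zero_count g) right_half_plane z = count_dist W z" for z
    proof (cases "Re z > 0")
      case True
      then show ?thesis using g(4)[OF True] by (simp add: restrict_count_def right_half_plane_def cW)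
    next
      case False
      then have "{n\<in>?M. ?w n = z} = {}" using ReW by auto
      then have "card {n\<in>?M. ?w n = z} = 0" by (simp only: card.empty)
      then show ?thesis using False unfolding cW by (simp add: restrict_count_def right_half_plane_def zero_enat_def)
    qed
    have "count_dist W z \<le> zero_count g z" for z
      unfolding r[symmetric] by (simp add: restrict_count_def)
    then have gI: "g \<in> I1 W" using g by (auto simp: I1_def)
    then obtain f where "f \<in> I1 Z" "\<forall>y::real. norm (f (axis y)) \<le> norm (g (axis y))"
      using \<open>I\<close> unfolding I_def by blast
    then show ?thesis unfolding II_def using gI r by blast
  qed
  moreover have "III" if "II"
  proof -
    obtain f g where fI: "f \<in> I1 Z" and gI: "g \<in> I1 W"
      and r: "\<And>z. restrict_count (zero_count g) right_half_plane z = count_dist W z"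
      and le: "\<And>y::real. norm (f (axis y)) \<le> norm (g (axis y))"
      using \<open>II\<close> unfolding II_def by blast
    obtain w0 where f: "f holomorphic_on UNIV" "f w0 \<noteq> 0" "exponential_type f"
      "\<And>z. vanishes f z (card {n\<in>?J. ?z n = z})" using fI unfolding I1_iff[OF fdZ] by blast
    obtain w1 where g: "g holomorphic_on UNIV" "g w1 \<noteq> 0" "exponential_type g" using gI unfolding I1_iff[OF fdW] by blast
    obtain X :: "nat set" and a where a: "\<And>z. finite {n\<in>X. a n = z}" "\<And>z. zero_count g z = enat (card {n\<in>X. a n = z})"
      using zero_family_exists[OF g(1,2), of UNIV] by (metis UNIV_I)
    have fdX: "fin_dens X a" by (rule jensen_fin_dens[OF g a(1)]) (use vanishes_iff[OF g(1,2)] a(2) in simp)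
    \<comment> \<open>\<open>lsum\<close> sees only the open right half-plane, and there the zeros
      of g are W.\<close>
    have eq: "lsum X a t = lsum ?M ?w t" for t
    proof (rule lsum_cong_count)
      show "finite (near X a t)" "finite (near ?M ?w t)" for t
        by (rule fin_dens_near_finite[OF fdX], rule fin_dens_near_finite[OF fdW])
      fix z :: complex assume "Re z > 0"
      then have "zero_count g z = count_dist W z" using r[of z] by (simp add: restrict_count_def right_half_plane_def)
      then show "card {n\<in>X. a n = z} = card {n\<in>?M. ?w n = z}" unfolding a(2) cW by simp
    qed
    obtain C where C: "C \<ge> 0"
      "\<And>r R. 0 < r \<Longrightarrow> r < R \<Longrightarrow> lsum ?J ?z R - lsum ?J ?z r \<le> lsum X a R - lsum X a r + C"
      "\<And>r R. 0 < r \<Longrightarrow> r < R \<Longrightarrow> lsum ?J (\<lambda>n. - ?z n) R - lsum ?J (\<lambda>n. - ?z n) r \<le> lsum X a R - lsum X a r + C"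
      by (rule carleman_comparison_both[OF f(1-3) g le fin_dens_fibre[OF fdZ] f(4) a]) blast
    have "l_char Z r R \<le> l_char W r R + C" if "0 < r" "r < R" for r R
      using C(2,3)[OF that] unfolding lZ lW[OF that(2)] eq by simp
    then show ?thesis unfolding III_def using C(1) by blast
  qed
  moreover have "I" if "III"
    unfolding I_def
  proof
    fix g assume gI: "g \<in> I1 W"
    obtain C where C: "C \<ge> 0" "\<And>r R. 0 < r \<Longrightarrow> r < R \<Longrightarrow> l_char Z r R \<le> l_char W r R + C"
      using \<open>III\<close> unfolding III_def by blast
    obtain w0 where g: "g holomorphic_on UNIV" "g w0 \<noteq> 0" "exponential_type g"
      "\<And>z. vanishes g z (card {n\<in>?M. ?w n = z})" using gI unfolding I1_iff[OF fdW] by blast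
    obtain X :: "nat set" and v where v: "\<And>z. finite {n\<in>X. v n = z}" "\<And>z. zero_count g z = enat (card {n\<in>X. v n = z})"
      using zero_family_exists[OF g(1,2), of UNIV] by (metis UNIV_I)
    \<comment> \<open>g is compared with itself, with W as the smaller family: the zeros of g in the
      left half-plane dominate W too, which serves the points of Z there.\<close>
    obtain C' where C': "C' \<ge> 0"
      "\<And>r R. 0 < r \<Longrightarrow> r < R \<Longrightarrow> lsum ?M ?w R - lsum ?M ?w r \<le> lsum X v R - lsum X v r + C'"
      "\<And>r R. 0 < r \<Longrightarrow> r < R \<Longrightarrow> lsum ?M ?w R - lsum ?M ?w r \<le> lsum X (\<lambda>n. - v n) R - lsum X (\<lambda>n. - v n) r + C'"
      by (rule carleman_comparison_both[OF g(1-3) g(1-3) order_refl fin_dens_fibre[OF fdW] g(4) v]) blast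
    obtain \<eta> j0 where \<eta>: "0 < \<eta>" "\<eta> \<le> 1" "\<And>j. j \<in> ?J \<Longrightarrow> j \<ge> j0 \<Longrightarrow> \<bar>Re (?z j)\<bar> \<ge> \<eta> * norm (?z j)"
      using asymp_separated_imagE[OF assms(4)] by blast
    have b1: "lsum ?J ?z R - lsum ?J ?z r \<le> lsum X v R - lsum X v r + (C + C')" if "0 < r" "r < R" for r R
      using C(2)[OF that] C'(2)[OF that] unfolding lZ lW[OF that(2)] by simp
    have b2: "lsum ?J (\<lambda>n. - ?z n) R - lsum ?J (\<lambda>n. - ?z n) r \<le> lsum X (\<lambda>n. - v n) R - lsum X (\<lambda>n. - v n) r + (C + C')"
      if "0 < r" "r < R" for r R
      using C(2)[OF that] C'(3)[OF that] unfolding lZ lW[OF that(2)] by simp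
    obtain f w1 where f: "f holomorphic_on UNIV" "f w1 \<noteq> 0" "exponential_type f"
      "\<And>w. vanishes f w (card {n\<in>?J. ?z n = w})" "\<And>y::real. norm (f (axis y)) \<le> norm (g (axis y))"
      by (rule dominated_function_exists[OF fdZ \<eta> g(1-3) v b1 b2]) blast+
    have "f \<in> I1 Z" unfolding I1_iff[OF fdZ] using f(1-4) by blast
    then show "\<exists>f \<in> I1 Z. \<forall>y::real. norm (f (axis y)) \<le> norm (g (axis y))" using f(5) by blast
  qed
  ultimately show ?thesis unfolding Let_def I_def[symmetric] II_def[symmetric] III_def[symmetric] by blast
qed

end
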